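(* Let $n\ge 1$ and let $p \in \mathbb{Z}[x_1^{\pm 1},\dots,x_n^{\pm 1}]$ be a Laurent polynomial whose Newton polytope $\Phi$ is an $n$-dimensional smooth lattice polytope with normal fan $\Sigma$, and such that the $\Phi$-homogenization $\widetilde p\in\mathbb{Z}[ z_\rho\mid\rho\in\Sigma(1)]$ of $p$ satisfies (Pos1) and (Pos2). The following statements are equivalent: (i) $\widetilde p$ satisfies (Pos3). (ii) $\widetilde p = \beta_A$ for some irreducible square matrix $A$ over $\mathbb{Z}_+[ z_\rho\mid\rho\in\Sigma(1)]$. (iii) $\widetilde p = \beta_A$ for some aperiodic square matrix $A$ over $\mathbb{Z}_+[ z_\rho\mid\rho\in\Sigma(1)]$.
   Context: Let $M=\mathbb{Z}^n$, $N=\mathrm{Hom}_{\mathbb{Z}}(M,\mathbb{Z})$, $M_{\mathbb{R}}=M\otimes_{\mathbb{Z}}\mathbb{R}\cong\mathbb{R}^n$, $N_{\mathbb{R}}=N\otimes_{\mathbb{Z}}\mathbb{R}$, with natural pairing $\langle\ ,\ \rangle$. Write $p=\sum_{m\in M}c_m x^m$. The Newton polytope of $p$ is the convex hull $\Phi$ in $M_{\mathbb{R}}$ of $\{m\in M\mid c_m\ne 0\}$. An $n$-dimensional lattice polytope $\Phi$ is smooth if for each vertex $v$ of $\Phi$ the set $\{w_{E,v}-v\}$, with $E$ running over the edges of $\Phi$ containing $v$ and $w_{E,v}$ the lattice point of $E\setminus\{v\}$ adjacent to $v$, is a $\mathbb{Z}$-basis of $M$. For each facet $F$ of $\Phi$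 let $u_F\in N$ be the minimal (primitive) inward-pointing normal and $a_F\in\mathbb{Z}$ the number such that the supporting hyperplane of $F$ is $\{m\in M_{\mathbb{R}}\mid\langle m,u_F\rangle=-a_F\}$. For each face $Q$ of $\Phi$ let $\sigma_Q\subset N_{\mathbb{R}}$ be the cone spanned by the $u_F$ with $F\supset Q$ a facet. The normal fan is $\Sigma=\{\sigma_Q\mid Q\text{ a face of }\Phi\}$; $\Sigma(i)$ is the set of its $i$-dimensional cones, and for $\sigma\in\Sigma$, $\sigma(1)\subset\Sigma(1)$ is the set of rays of $\sigma$. For $\rho\in\Sigma(1)$, the ray spanned by $u_F$ for a facet $F$, put $u_\rho=u_F$, $a_\rho=a_F$. The $\Phi$-homogenization of $p$ is $\widetilde p(z)=\sum_{m\in\Phi\cap M}c_m\prod_{\rho\in\Sigma(1)}z_\rho^{\langle m,u_\rho\rangle+a_\rho}$. $\mathbb{R}_+=\{x\in\mathbb{R}\mid x\ge 0\}$, $U(1)=\{e^{i\theta}\mid\theta\in\mathbb{R}\}$, $\mathbb{C}^*=\mathbb{C}\setminus\{0\}$; a superscript $\Sigma(1)$ denotes the Cartesian product of copies indexed by $\Sigma(1)$; $\cdot$ is the coordinatewise product. $Z(\Sigma)=\{z\in\mathbb{C}^{\Sigma(1)}\mid\prod_{\rho\in\Sigma(1)\setminus\sigma(1)}z_\rho=0\ \text{for all }\sigma\in\Sigma(n)\}$. $G=\{(t_\rho)\in(\mathbb{C}^* )^{\Sigma(1)}\mid\prod_{\rho\in\Sigma(1)}t_\rho^{\langle m,u_\rho\rangle}=1\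 \text{for all }m\in M\}$. For $\sigma\in\Sigma(n)$, $e^{(\sigma)}_\rho=1$ if $\rho\in\Sigma(1)\setminus\sigma(1)$ and $e^{(\sigma)}_\rho=0$ if $\rho\in\sigma(1)$. $F_{\rho}(\mathbb{R}_+^{\Sigma(1)})=\{x\in\mathbb{R}_+^{\Sigma(1)}\mid x_{\rho}=0\}$. (Pos1): $\widetilde p(e^{(\sigma)})>0$ for all $\sigma\in\Sigma(n)$. (Pos2): for all $\rho\in\Sigma(1)$, $\frac{\partial\widetilde p}{\partial x_\rho}(x)>0$ for all $x\in F_\rho(\mathbb{R}_+^{\Sigma(1)})\setminus Z(\Sigma)$. (Pos3): $|\widetilde p(z)|<\widetilde p((|z_\rho|)_{\rho\in\Sigma(1)})$ for all $z\in\mathbb{C}^{\Sigma(1)}\setminus\big(Z(\Sigma)\cup(G\cap U(1)^{\Sigma(1)})\cdot\mathbb{R}_+^{\Sigma(1)}\big)$. $\mathbb{Z}_+=\{k\in\mathbb{Z}\mid k\ge 0\}$, and $\mathbb{Z}_+[z_\rho\mid\rho\in\Sigma(1)]$ is the semiring of polynomials with coefficients in $\mathbb{Z}_+$. A square matrix $A$ over this semiring is irreducible if for each pair of indices $(i,j)$ there is $k\ge 1$ such that the $(i,j)$ entry of $A^k$ is a non-zero polynomial; it is aperiodic if there is $k\ge 1$ such that all entries of $A^k$ are non-zero polynomials. The spectral radius function $\beta_A$ of $A$ is the function on the open positive orthant $\{x\in\mathbb{R}^{\Sigma(1)}\mid x_\rho>0\ \forall\rho\}$ assigning to $x$ the spectral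 radius of the nonnegative real matrix $A(x)$; $\widetilde p=\beta_A$ means equality of functions on this open orthant. *)

theory Defs
  imports
    "HOL-Analysis.Analysis"
    "HOL-Library.Poly_Mapping"
    "Jordan_Normal_Form.Spectral_Radius"
begin

no_notation Matrix.vec_index (infixl \<open>$\<close> 100)
no_notation Matrix.scalar_prod (infix \<open>\<bullet>\<close> 70)

section \<open>Lattices\<close>

text \<open>\<open>M\<close> is \<open>int ^ 'n\<close>, and \<open>N\<close> is identified with \<open>int ^ 'n\<close> by means of the dual basis, so that
  the pairing is the standard one; \<open>M\<^sub>\<real>\<close> and \<open>N\<^sub>\<real>\<close> are both \<open>real ^ 'n\<close> with pairing the inner
  product. A free index type \<open>'n :: finite\<close> accounts for all dimensions \<open>n \<ge> 1\<close>.\<close>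

definition real_vec :: "int ^ 'n \<Rightarrow> real ^ 'n" where
  "real_vec m = (\<chi> i. real_of_int (m $ i))"

definition lattice_pairing :: "int ^ 'n \<Rightarrow> int ^ 'n \<Rightarrow> int" where
  "lattice_pairing m u = (\<Sum>i\<in>UNIV. m $ i * u $ i)"

definition primitive_vec :: "int ^ 'n \<Rightarrow> bool" where
  "primitive_vec u \<longleftrightarrow> (GCD i. u $ i) = 1"

global_interpretation int_lattice: Modules.module "(*s) :: int \<Rightarrow> int ^ 'n \<Rightarrow> int ^ 'n"
  by unfold_locales (simp_all add: vec_eq_iff algebra_simps)

definition lattice_basis :: "(int ^ 'n) set \<Rightarrow> bool" where
  "lattice_basis B \<longleftrightarrow> \<not> int_lattice.dependent B \<and> int_lattice.span B = UNIV"

section \<open>Lattice polytopes and their normal fans\<close>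

definition lattice_polytope :: "(real ^ 'n) set \<Rightarrow> bool" where
  "lattice_polytope \<Phi> \<longleftrightarrow> (\<exists>S. finite S \<and> \<Phi> = convex hull (real_vec ` S))"

definition edge_vectors :: "(real ^ 'n) set \<Rightarrow> int ^ 'n \<Rightarrow> (int ^ 'n) set" where
  "edge_vectors \<Phi> v = {w - v | w E. E edge_of \<Phi> \<and> real_vec v \<in> E \<and> real_vec w \<in> E \<and> w \<noteq> v \<and>
     open_segment (real_vec v) (real_vec w) \<inter> range real_vec = {}}"

text \<open>Only integral \<open>v\<close> need be considered, as vertices of lattice polytopes are lattice points.\<close>

definition smooth_lattice_polytope :: "(real ^ 'n) set \<Rightarrow> bool" where
  "smooth_lattice_polytope \<Phi> \<longleftrightarrow> lattice_polytope \<Phi> \<and> aff_dim \<Phi> = int CARD('n) \<and>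
     (\<forall>v. real_vec v extreme_point_of \<Phi> \<longrightarrow> lattice_basis (edge_vectors \<Phi> v))"

definition facet_normal :: "(real ^ 'n) set \<Rightarrow> (real ^ 'n) set \<Rightarrow> int ^ 'n" where
  "facet_normal \<Phi> F = (THE u. primitive_vec u \<and>
     (\<exists>b. \<Phi> \<subseteq> {x. x \<bullet> real_vec u \<ge> b} \<and> F = \<Phi> \<inter> {x. x \<bullet> real_vec u = b}))"

definition facet_offset :: "(real ^ 'n) set \<Rightarrow> (real ^ 'n) set \<Rightarrow> int" where
  "facet_offset \<Phi> F =
     (THE a. affine hull F = {x. x \<bullet> real_vec (facet_normal \<Phi> F) = - real_of_int a})"

definition normal_cone :: "(real ^ 'n) set \<Rightarrow> (real ^ 'n) set \<Rightarrow> (real ^ 'n) set" where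
  "normal_cone \<Phi> Q =
     convex_cone hull {real_vec (facet_normal \<Phi> F) | F. F facet_of \<Phi> \<and> Q \<subseteq> F}"

text \<open>\<^const>\<open>face_of\<close> admits the empty face, which does not contribute a cone to the normal fan.\<close>

definition normal_fan :: "(real ^ 'n) set \<Rightarrow> (real ^ 'n) set set" where
  "normal_fan \<Phi> = {normal_cone \<Phi> Q | Q. Q face_of \<Phi> \<and> Q \<noteq> {}}"

definition fan_cones :: "(real ^ 'n) set \<Rightarrow> nat \<Rightarrow> (real ^ 'n) set set" where
  "fan_cones \<Phi> i = {\<sigma> \<in> normal_fan \<Phi>. dim \<sigma> = i}"

abbreviation rays :: "(real ^ 'n) set \<Rightarrow> (real ^ 'n) set set" where
  "rays \<Phi> \<equiv> fan_cones \<Phi> 1"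

abbreviation maximal_cones :: "(real ^ 'n) set \<Rightarrow> (real ^ 'n) set set" where
  "maximal_cones \<Phi> \<equiv> fan_cones \<Phi> CARD('n)"

definition cone_rays :: "(real ^ 'n) set \<Rightarrow> (real ^ 'n) set \<Rightarrow> (real ^ 'n) set set" where
  "cone_rays \<Phi> \<sigma> = {\<rho> \<in> rays \<Phi>. \<rho> face_of \<sigma>}"

definition ray_facet :: "(real ^ 'n) set \<Rightarrow> (real ^ 'n) set \<Rightarrow> (real ^ 'n) set" where
  "ray_facet \<Phi> \<rho> =
     (THE F. F facet_of \<Phi> \<and> \<rho> = convex_cone hull {real_vec (facet_normal \<Phi> F)})"

definition ray_normal :: "(real ^ 'n) set \<Rightarrow> (real ^ 'n) set \<Rightarrow> int ^ 'n" where
  "ray_normal \<Phi> \<rho> = facet_normal \<Phi> (ray_facet \<Phi> \<rho>)"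

definition ray_offset :: "(real ^ 'n) set \<Rightarrow> (real ^ 'n) set \<Rightarrow> int" where
  "ray_offset \<Phi> \<rho> = facet_offset \<Phi> (ray_facet \<Phi> \<rho>)"

section \<open>Polynomials\<close>

text \<open>Polynomials in variables of type \<open>'v\<close> map exponent vectors to coefficients. Laurent
  polynomials are elements of the group ring of \<open>M\<close>, that is, of type \<open>(int ^ 'n) \<Rightarrow>\<^sub>0 int\<close>.\<close>

type_synonym ('v, 'a) multipoly = "('v \<Rightarrow>\<^sub>0 nat) \<Rightarrow>\<^sub>0 'a"

definition polys_over :: "'v set \<Rightarrow> ('v, 'a::zero) multipoly set" where
  "polys_over V = {q. \<forall>\<alpha>\<in>Poly_Mapping.keys q. Poly_Mapping.keys \<alpha> \<subseteq> V}"

text \<open>The function \<open>h\<close> is the coercion of coefficients, \<^const>\<open>of_int\<close> or \<^const>\<open>of_nat\<close> below.\<close>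

definition poly_value :: "('a::zero \<Rightarrow> 'b::comm_semiring_1) \<Rightarrow> ('v, 'a) multipoly \<Rightarrow> ('v \<Rightarrow> 'b) \<Rightarrow> 'b" where
  "poly_value h q z = (\<Sum>\<alpha>\<in>Poly_Mapping.keys q. h (Poly_Mapping.lookup q \<alpha>) *
     (\<Prod>v\<in>Poly_Mapping.keys \<alpha>. z v ^ Poly_Mapping.lookup \<alpha> v))"

definition newton_polytope :: "((int ^ 'n) \<Rightarrow>\<^sub>0 int) \<Rightarrow> (real ^ 'n) set" where
  "newton_polytope p = convex hull (real_vec ` Poly_Mapping.keys p)"

text \<open>The exponents \<open>\<langle>m, u\<^sub>\<rho>\<rangle> + a\<^sub>\<rho>\<close> are nonnegative for \<open>m \<in> \<Phi>\<close>, so \<^const>\<open>nat\<close> does not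
  truncate.\<close>

definition homogenization ::
    "(real ^ 'n) set \<Rightarrow> ((int ^ 'n) \<Rightarrow>\<^sub>0 int) \<Rightarrow> ((real ^ 'n) set, int) multipoly" where
  "homogenization \<Phi> p = (\<Sum>m | real_vec m \<in> \<Phi>. Poly_Mapping.single
     (\<Sum>\<rho>\<in>rays \<Phi>. Poly_Mapping.single \<rho> (nat (lattice_pairing m (ray_normal \<Phi> \<rho>) + ray_offset \<Phi> \<rho>)))
     (Poly_Mapping.lookup p m))"

section \<open>Positivity conditions\<close>

text \<open>The Cartesian power \<open>X\<^bsup>\<Sigma>(1)\<^esup>\<close> is \<open>rays \<Phi> \<rightarrow>\<^sub>E X\<close>, a set of functions that are
  \<^const>\<open>undefined\<close> outside \<open>rays \<Phi>\<close>.\<close>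

definition complex_point :: "'v set \<Rightarrow> ('v \<Rightarrow> real) \<Rightarrow> 'v \<Rightarrow> complex" where
  "complex_point V x = (\<lambda>v\<in>V. complex_of_real (x v))"

definition unit_circle :: "complex set" where
  "unit_circle = {exp (\<i> * complex_of_real \<theta>) | \<theta>. True}"

definition irrelevant_set :: "(real ^ 'n) set \<Rightarrow> ((real ^ 'n) set \<Rightarrow> complex) set" where
  "irrelevant_set \<Phi> = {z \<in> rays \<Phi> \<rightarrow>\<^sub>E UNIV.
     \<forall>\<sigma>\<in>maximal_cones \<Phi>. (\<Prod>\<rho>\<in>rays \<Phi> - cone_rays \<Phi> \<sigma>. z \<rho>) = 0}"

definition cox_group :: "(real ^ 'n) set \<Rightarrow> ((real ^ 'n) set \<Rightarrow> complex) set" where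
  "cox_group \<Phi> = {t \<in> rays \<Phi> \<rightarrow>\<^sub>E (UNIV - {0}).
     \<forall>m. (\<Prod>\<rho>\<in>rays \<Phi>. t \<rho> powi lattice_pairing m (ray_normal \<Phi> \<rho>)) = 1}"

definition cone_point :: "(real ^ 'n) set \<Rightarrow> (real ^ 'n) set \<Rightarrow> (real ^ 'n) set \<Rightarrow> real" where
  "cone_point \<Phi> \<sigma> = (\<lambda>\<rho>\<in>rays \<Phi>. if \<rho> \<in> cone_rays \<Phi> \<sigma> then 0 else 1)"

definition orthant_face :: "(real ^ 'n) set \<Rightarrow> (real ^ 'n) set \<Rightarrow> ((real ^ 'n) set \<Rightarrow> real) set" where
  "orthant_face \<Phi> \<rho> = {x \<in> rays \<Phi> \<rightarrow>\<^sub>E {0..}. x \<rho> = 0}"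

definition twisted_orthant :: "(real ^ 'n) set \<Rightarrow> ((real ^ 'n) set \<Rightarrow> complex) set" where
  "twisted_orthant \<Phi> = {\<lambda>\<rho>\<in>rays \<Phi>. t \<rho> * complex_of_real (x \<rho>) | t x.
     t \<in> cox_group \<Phi> \<inter> (rays \<Phi> \<rightarrow>\<^sub>E unit_circle) \<and> x \<in> rays \<Phi> \<rightarrow>\<^sub>E {0..}}"

definition Pos1 :: "(real ^ 'n) set \<Rightarrow> ((real ^ 'n) set, int) multipoly \<Rightarrow> bool" where
  "Pos1 \<Phi> q \<longleftrightarrow> (\<forall>\<sigma>\<in>maximal_cones \<Phi>. poly_value of_int q (cone_point \<Phi> \<sigma>) > 0)"

definition Pos2 :: "(real ^ 'n) set \<Rightarrow> ((real ^ 'n) set, int) multipoly \<Rightarrow> bool" where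
  "Pos2 \<Phi> q \<longleftrightarrow> (\<forall>\<rho>\<in>rays \<Phi>. \<forall>x\<in>orthant_face \<Phi> \<rho>.
     complex_point (rays \<Phi>) x \<notin> irrelevant_set \<Phi> \<longrightarrow>
     deriv (\<lambda>s. poly_value of_int q (x(\<rho> := s))) (x \<rho>) > 0)"

definition Pos3 :: "(real ^ 'n) set \<Rightarrow> ((real ^ 'n) set, int) multipoly \<Rightarrow> bool" where
  "Pos3 \<Phi> q \<longleftrightarrow> (\<forall>z\<in>(rays \<Phi> \<rightarrow>\<^sub>E UNIV) - (irrelevant_set \<Phi> \<union> twisted_orthant \<Phi>).
     cmod (poly_value of_int q z) < poly_value of_int q (\<lambda>\<rho>\<in>rays \<Phi>. cmod (z \<rho>)))"

section \<open>Matrices of polynomials\<close>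

text \<open>The semiring \<open>\<int>\<^sub>+[z\<^sub>v | v \<in> V]\<close> is \<open>polys_over V\<close> with coefficients in \<^typ>\<open>nat\<close>. Matrices of
  size zero are excluded: their spectrum is empty.\<close>

definition square_matrix_over :: "'v set \<Rightarrow> ('v, nat) multipoly mat \<Rightarrow> bool" where
  "square_matrix_over V A \<longleftrightarrow>
     dim_row A > 0 \<and> square_mat A \<and> elements_mat A \<subseteq> polys_over V"

definition irreducible_matrix :: "('v, nat) multipoly mat \<Rightarrow> bool" where
  "irreducible_matrix A \<longleftrightarrow>
     (\<forall>i<dim_row A. \<forall>j<dim_row A. \<exists>k\<ge>1. (A ^\<^sub>m k) $$ (i, j) \<noteq> 0)"

definition aperiodic_matrix :: "('v, nat) multipoly mat \<Rightarrow> bool" where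
  "aperiodic_matrix A \<longleftrightarrow>
     (\<exists>k\<ge>1. \<forall>i<dim_row A. \<forall>j<dim_row A. (A ^\<^sub>m k) $$ (i, j) \<noteq> 0)"

definition spectral_radius_fun :: "('v, nat) multipoly mat \<Rightarrow> ('v \<Rightarrow> real) \<Rightarrow> real" where
  "spectral_radius_fun A x =
     spectral_radius (map_mat (\<lambda>q. complex_of_real (poly_value of_nat q x)) A)"

definition is_spectral_radius_fun ::
    "'v set \<Rightarrow> ('v, int) multipoly \<Rightarrow> ('v, nat) multipoly mat \<Rightarrow> bool" where
  "is_spectral_radius_fun V q A \<longleftrightarrow>
     (\<forall>x\<in>V \<rightarrow>\<^sub>E {0<..}. poly_value of_int q x = spectral_radius_fun A x)"

end

theory Submission
  imports Defs "HOL-Probability.Probability"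
begin

text \<open>In the affine chart of a vertex, \<open>p~\<close> is a real polynomial, and the phases of its terms at a
  point \<open>x \<ge> 0\<close> define the characteristic function of a signed probability on exponents; (Pos3) bounds
  it strictly below 1 away from the trivial phase. Every coefficient of \<open>p~ ^ k\<close> is a Fourier
  integral. Maximizing \<open>x\<^sup>\<beta> / p~(x) ^ k\<close> over the nonnegative part of the toric variety, which is
  covered by the unit boxes of the vertex charts, yields a saddle point for each exponent \<open>\<beta>\<close>, and a
  local limit theorem (Gaussian in the directions where the exponent is large, Poissonian where it
  stays bounded) shows that all coefficients of \<open>p~ ^ k\<close> are positive for large \<open>k\<close>. A companion matrix
  built from \<open>p~ ^ k\<close> is then aperiodic and has spectral radius \<open>p~\<close>.

  Conversely, let \<open>p~\<close> be the spectral radius of an irreducible matrix \<open>A\<close> and \<open>|p~(z)| = p~(|z|)\<close>.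
  Perron-Frobenius theory on the stratum of \<open>z\<close> aligns the phases \<open>t\<close> of the entries of \<open>A\<close>, so that
  \<open>p~(t y) = \<lambda> p~(y)\<close> for all \<open>y\<close> in the stratum. By (Pos1) and (Pos2) the polynomial contains the
  monomials of each vertex and of its neighbours on the edges, and comparing their phases puts \<open>z\<close> into
  the twisted orthant.\<close>

text \<open>Since coefficients may be negative, probabilistic arguments enter only through (Pos3),
  which supplies |chi| \<le> 1 and, less obviously, the positivity of variances. The obstacle is
  uniformity: exponents of \<open>p~ ^ k\<close> may lie on or near any face of the dilated
  polytope, where coordinates of the saddle point tend to 0 and the Gaussian variance degenerates.
  (Pos2) says that it degenerates only linearly in these coordinates. This gives one bound, 1 -
  |chi|^2 \<ge> C * sum of x_i (1 - cos theta_i), on the whole unit box of a chart, and it dominates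
  the Gaussian and the Poissonian limits alike. A threshold for k that serves all exponents is then
  found by contradiction along subsequences. In the converse, the spectral radius is prescribed only
  on the open orthant, whereas (Pos3) concerns complex points with vanishing coordinates, where the
  matrix may become reducible. The hypothesis is therefore turned into the vanishing of a
  determinant, a polynomial identity that survives restriction to a stratum.\<close>

section \<open>Characteristic functions of signed weights\<close>

text \<open>Let d be the order of the first nonvanishing moment, so that the transform is 1 + A z^d
  up to higher order. On short rays z = r e^(i phi) the hypothesis \<open>le\<close> forces A (cos
  (d phi) - (cos phi)^d) \<le> 0, and suitable angles leave only d = 2 with A > 0. For signed
  weights the sign of the second moment is not automatic.\<close>

lemma exp_sum_second_moment_pos:
  fixes w lam :: "'b \<Rightarrow> real"
  assumes w1: "(\<Sum>a\<in>S. w a) = 1" and m1: "(\<Sum>a\<in>S. w a * lam a) = 0"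
    and le: "\<And>z::complex. cmod (\<Sum>a\<in>S. of_real (w a) * exp (z * of_real (lam a))) \<le> (\<Sum>a\<in>S. w a * exp (Re z * lam a))"
    and ne: "cmod (\<Sum>a\<in>S. of_real (w a) * exp (\<i> * of_real \<tau> * of_real (lam a))) < 1"
  shows "(\<Sum>a\<in>S. w a * (lam a)^2) > 0"
proof -
  define M where "M d = (\<Sum>a\<in>S. w a * lam a ^ d)" for d
  define g where "g z = (\<Sum>a\<in>S. of_real (w a) * exp (z * of_real (lam a)))" for z :: complex
  have g_series: "(\<lambda>n. of_real (M n) * z ^ n /\<^sub>R fact n) sums g z" for z
  proof -
    have "(\<lambda>n. \<Sum>a\<in>S. of_real (w a) * ((z * of_real (lam a)) ^ n /\<^sub>R fact n)) sums g z"
      unfolding g_def by (intro sums_sum sums_mult exp_converges)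
    then show ?thesis
      by (simp add: M_def sum_distrib_right sum_distrib_left scaleR_sum_right power_mult_distrib mult_ac)
  qed
  \<comment> \<open>If all higher moments vanished, the transform \<open>g\<close> would be
    constantly 1, against \<open>ne\<close>.\<close>
  have ex: "\<exists>d\<ge>1. M d \<noteq> 0"
  proof (rule ccontr)
    assume "\<not> ?thesis"
    then have "M n = (if n = 0 then 1 else 0)" for n
      by (cases n) (auto simp: M_def w1)
    then have "(\<lambda>n. of_real (M n) * z ^ n /\<^sub>R fact n) = (\<lambda>n. if n = 0 then 1 else 0)" for z :: complex
      by (auto simp: fun_eq_iff)
    then have "(\<lambda>n. if n = 0 then 1 else 0) sums g z" for z
      using g_series[of z] by metis
    moreover have "(\<lambda>n. if n = 0 then 1 else (0::complex)) sums 1"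
      using sums_single[of 0 "\<lambda>_. 1::complex"] by (simp add: if_distrib cong: if_cong)
    ultimately have "g (\<i> * of_real \<tau>) = 1" using sums_unique2 by blast
    with ne show False by (simp add: g_def)
  qed
  define d where "d = (LEAST d. d \<ge> 1 \<and> M d \<noteq> 0)"
  have d: "d \<ge> 1" "M d \<noteq> 0" using LeastI_ex[OF ex[unfolded Bex_def]] ex unfolding d_def
    by (metis (mono_tags, lifting) LeastI_ex)+
  have dl: "M j = 0" if "1 \<le> j" "j < d" for j
    using that not_less_Least[of j "\<lambda>d. d \<ge> 1 \<and> M d \<noteq> 0"] unfolding d_def by blast
  have d2: "d \<ge> 2" using d m1 by (cases "d = 1") (auto simp: M_def)
  define A where "A = M d / fact d"
  define C where "C = (\<Sum>a\<in>S. \<bar>w a\<bar> * (exp \<bar>lam a\<bar> * \<bar>lam a\<bar> ^ Suc d / fact d))"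
  have C0: "C \<ge> 0" unfolding C_def by (intro sum_nonneg) auto
  have rem: "cmod (g z - (1 + of_real A * z ^ d)) \<le> C * cmod z ^ Suc d" if z: "cmod z \<le> 1" for z
  proof -
    have "(\<Sum>a\<in>S. of_real (w a) * (\<Sum>i\<le>d. (z * of_real (lam a)) ^ i / fact i)) = (\<Sum>i\<le>d. of_real (M i) * z ^ i / fact i)"
      by (simp add: M_def sum_distrib_left sum_distrib_right sum_divide_distrib power_mult_distrib mult_ac sum.swap[of _ S])
    also have "\<dots> = (\<Sum>i\<in>{0,d}. of_real (M i) * z ^ i / fact i)"
      by (rule sum.mono_neutral_right) (auto simp: dl Suc_le_eq)
    also have "\<dots> = 1 + of_real A * z ^ d" using d by (simp add: A_def M_def w1 del: of_real_sum)
    finally have eq: "1 + of_real A * z ^ d = (\<Sum>a\<in>S. of_real (w a) * (\<Sum>i\<le>d. (z * of_real (lam a)) ^ i / fact i))" ..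
    have "g z - (1 + of_real A * z ^ d) = (\<Sum>a\<in>S. of_real (w a) * (exp (z * of_real (lam a)) - (\<Sum>i\<le>d. (z * of_real (lam a)) ^ i / fact i)))"
      unfolding eq g_def by (simp add: sum_subtractf right_diff_distrib)
    also have "cmod \<dots> \<le> (\<Sum>a\<in>S. \<bar>w a\<bar> * (exp \<bar>lam a\<bar> * \<bar>lam a\<bar> ^ Suc d / fact d * cmod z ^ Suc d))"
    proof (intro sum_norm_le)
      fix a assume "a \<in> S"
      have "cmod (exp (z * of_real (lam a)) - (\<Sum>i\<le>d. (z * of_real (lam a)) ^ i / fact i))
        \<le> exp \<bar>Re (z * of_real (lam a))\<bar> * cmod (z * of_real (lam a)) ^ Suc d / fact d"
        by (rule Taylor_exp)
      also have "\<dots> \<le> exp \<bar>lam a\<bar> * cmod (z * of_real (lam a)) ^ Suc d / fact d"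
      proof -
        have "\<bar>Re z\<bar> \<le> 1" using abs_Re_le_cmod[of z] z by linarith
        then have "\<bar>Re (z * of_real (lam a))\<bar> \<le> \<bar>lam a\<bar>"
          by (simp add: abs_mult mult_left_le_one_le)
        then show ?thesis by (intro divide_right_mono mult_right_mono) auto
      qed
      also have "\<dots> = exp \<bar>lam a\<bar> * \<bar>lam a\<bar> ^ Suc d / fact d * cmod z ^ Suc d"
        by (simp add: norm_mult power_mult_distrib)
      finally show "cmod (of_real (w a) * (exp (z * of_real (lam a)) - (\<Sum>i\<le>d. (z * of_real (lam a)) ^ i / fact i)))
         \<le> \<bar>w a\<bar> * (exp \<bar>lam a\<bar> * \<bar>lam a\<bar> ^ Suc d / fact d * cmod z ^ Suc d)"
        unfolding norm_mult norm_of_real by (rule mult_left_mono) simp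
    qed
    also have "\<dots> = C * cmod z ^ Suc d" unfolding C_def sum_distrib_right by (intro sum.cong) (simp_all add: mult_ac)
    finally show ?thesis .
  qed
  \<comment> \<open>Re (g z) \<le> |g z| is compared with the value of \<open>g\<close> at Re z;
    after division by r^d the remainders are of order r.\<close>
  have key: "A * (cos (real d * \<phi>) - cos \<phi> ^ d) \<le> 0" for \<phi> :: real
  proof -
    have bd: "A * (cos (real d * \<phi>) - cos \<phi> ^ d) \<le> 2 * C * r" if r: "0 < r" "r \<le> 1" for r
    proof -
      define z where "z = rcis r \<phi>"
      have cz: "cmod z = r" and rz: "Re z = r * cos \<phi>" using r by (auto simp: z_def)
      have zd: "Re (z ^ d) = r ^ d * cos (real d * \<phi>)" by (simp add: z_def DeMoivre2)
      have "1 + A * Re (z ^ d) - Re (g z) \<le> C * r ^ Suc d"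
        using order_trans[OF complex_Re_le_cmod rem[of z]] abs_Re_le_cmod[of "g z - (1 + of_real A * z ^ d)"] rem[of z] cz r
        by simp
      moreover have "Re (g z) \<le> cmod (g z)" by (rule complex_Re_le_cmod)
      moreover have "cmod (g z) \<le> (\<Sum>a\<in>S. w a * exp (Re z * lam a))" unfolding g_def by (rule le)
      moreover have "complex_of_real (\<Sum>a\<in>S. w a * exp (Re z * lam a)) = g (of_real (Re z))"
        by (simp add: g_def exp_of_real flip: of_real_mult)
      then have "(\<Sum>a\<in>S. w a * exp (Re z * lam a)) = Re (g (of_real (Re z)))" by (metis Re_complex_of_real)
      moreover have "Re (g (of_real (Re z))) - (1 + A * Re z ^ d) \<le> C * r ^ Suc d"
      proof -
        have a1: "\<bar>Re z\<bar> \<le> r" using abs_Re_le_cmod[of z] cz by simp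
        have "Re (g (of_real (Re z))) - (1 + A * Re z ^ d) = Re (g (of_real (Re z)) - (1 + of_real A * of_real (Re z) ^ d))"
          by (simp flip: of_real_power)
        also have "\<dots> \<le> cmod (g (of_real (Re z)) - (1 + of_real A * of_real (Re z) ^ d))" by (rule complex_Re_le_cmod)
        also have "\<dots> \<le> C * cmod (of_real (Re z)) ^ Suc d" using a1 r by (intro rem) auto
        also have "\<dots> \<le> C * r ^ Suc d" using a1 C0 by (intro mult_left_mono power_mono) auto
        finally show ?thesis .
      qed
      ultimately have "A * (r ^ d * cos (real d * \<phi>)) - A * (r * cos \<phi>) ^ d \<le> 2 * (C * r ^ Suc d)"
        unfolding zd rz by linarith
      then have "r ^ d * (A * (cos (real d * \<phi>) - cos \<phi> ^ d)) \<le> r ^ d * (2 * C * r)"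
        by (simp add: algebra_simps power_mult_distrib)
      then show ?thesis using r by simp
    qed
    show ?thesis
    proof (rule field_le_epsilon)
      fix \<epsilon> :: real assume e: "\<epsilon> > 0"
      define r where "r = min 1 (\<epsilon> / (2 * C + 1))"
      have "A * (cos (real d * \<phi>) - cos \<phi> ^ d) \<le> 2 * C * r" using e C0 by (intro bd) (auto simp: r_def)
      also have "\<dots> \<le> 2 * C * (\<epsilon> / (2 * C + 1))" using C0 by (intro mult_left_mono) (auto simp: r_def)
      also have "\<dots> \<le> \<epsilon>" using e C0 by (simp add: field_simps)
      finally show "A * (cos (real d * \<phi>) - cos \<phi> ^ d) \<le> 0 + \<epsilon>" by simp
    qed
  qed
  have A0: "A \<noteq> 0" using d by (simp add: A_def)
  \<comment> \<open>At the angle pi / d, cos (d phi) = -1, while cos phi \<ge> 0 because d \<ge>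
    2.\<close>
  have Age: "A \<ge> 0"
  proof -
    have "0 \<le> cos (pi / d)"
    proof (rule cos_ge_zero)
      show "pi / d \<le> pi / 2" using d2 by (intro divide_left_mono) auto
      have "0 \<le> pi / d" by simp
      then show "- (pi / 2) \<le> pi / d" using pi_gt_zero by linarith
    qed
    then have "0 \<le> cos (pi / d) ^ d" by simp
    moreover have "A * (-1 - cos (pi / d) ^ d) \<le> 0" using key[of "pi / d"] d by simp
    ultimately show ?thesis by (smt (verit) mult_pos_neg mult_neg_neg mult_less_0_iff)
  qed
  \<comment> \<open>At the angle 2 pi / d, cos (d phi) = 1, while |cos phi| < 1 as soon as d \<ge>
    3; for d = 2 the angle is pi and nothing follows.\<close>
  have "d = 2"
  proof (rule ccontr)
    assume "d \<noteq> 2"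
    then have d3: "d \<ge> 3" using d2 by simp
    have "\<bar>cos (2 * pi / d)\<bar> < 1"
    proof -
      have p: "0 < 2 * pi / d" "2 * pi / d < pi" using d3 by (auto simp: field_simps)
      have "cos (2 * pi / d) < cos 0" using p by (intro cos_monotone_0_pi) auto
      moreover have "cos pi < cos (2 * pi / d)" using p by (intro cos_monotone_0_pi) auto
      ultimately show ?thesis by simp
    qed
    then have "\<bar>cos (2 * pi / d)\<bar> ^ d < 1" using d by (simp add: power_less_one_iff)
    then have "cos (2 * pi / d) ^ d < 1" by (metis abs_ge_self order_le_less_trans power_abs)
    moreover have "A * (1 - cos (2 * pi / d) ^ d) \<le> 0" using key[of "2 * pi / d"] d by simp
    ultimately show False using A0 Age by (smt (verit) mult_pos_pos)
  qed
  then show ?thesis using A0 Age d by (simp add: A_def M_def)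
qed

text \<open>\<open>I\<close> indexes the coordinates of an affine chart and \<open>S\<close> the
  terms of the polynomial; the term \<open>a\<close> has coefficient \<open>c a\<close>, of either
  sign, and exponents \<open>e a\<close>.\<close>

locale pos_chart =
  fixes I :: "'i set" and S :: "'b set" and c :: "'b \<Rightarrow> real" and e :: "'b \<Rightarrow> 'i \<Rightarrow> nat"
  assumes finI: "finite I" and finS: "finite S"
begin

text \<open>The weights \<open>wt x\<close> have sum 1 but may be negative; \<open>chi x\<close> is their characteristic function.\<close>

definition mon :: "'b \<Rightarrow> ('i \<Rightarrow> real) \<Rightarrow> real" where "mon a x = (\<Prod>i\<in>I. x i ^ e a i)"
definition pr :: "('i \<Rightarrow> real) \<Rightarrow> real" where "pr x = (\<Sum>a\<in>S. c a * mon a x)"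
definition wt :: "('i \<Rightarrow> real) \<Rightarrow> 'b \<Rightarrow> real" where "wt x a = c a * mon a x / pr x"
definition ph :: "'b \<Rightarrow> ('i \<Rightarrow> real) \<Rightarrow> real" where "ph a \<theta> = (\<Sum>i\<in>I. real (e a i) * \<theta> i)"
definition chi :: "('i \<Rightarrow> real) \<Rightarrow> ('i \<Rightarrow> real) \<Rightarrow> complex" where
  "chi x \<theta> = (\<Sum>a\<in>S. of_real (wt x a) * cis (ph a \<theta>))"
definition nonneg :: "('i \<Rightarrow> real) \<Rightarrow> bool" where "nonneg x \<longleftrightarrow> (\<forall>i\<in>I. 0 \<le> x i)"

end

text \<open>The positivity conditions as seen in one chart. \<open>chi_strict\<close> looks only at
  phases of coordinates that do not vanish; the sum in \<open>deriv_pos\<close> is the partial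
  derivative of \<open>pr\<close> at \<open>x i = 0\<close>, where only terms of exponent 1
  survive.\<close>

locale strict_chart = pos_chart +
  assumes pr_pos: "nonneg x \<Longrightarrow> pr x > 0"
    and chi_strict: "nonneg x \<Longrightarrow> i \<in> I \<Longrightarrow> x i > 0 \<Longrightarrow> cos (\<theta> i) \<noteq> 1 \<Longrightarrow> cmod (chi x \<theta>) < 1"
    and deriv_pos: "nonneg x \<Longrightarrow> i \<in> I \<Longrightarrow> x i = 0 \<Longrightarrow>
      (\<Sum>a | a \<in> S \<and> e a i = 1. c a * (\<Prod>j\<in>I - {i}. x j ^ e a j)) > 0"
begin

lemma sum_wt: "nonneg x \<Longrightarrow> (\<Sum>a\<in>S. wt x a) = 1"
  using pr_pos[of x] by (simp add: wt_def pr_def flip: sum_divide_distrib)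

text \<open>If no positive coordinate carries a nontrivial phase, every term of nonzero weight has
  phase 1, and \<open>chi\<close> is the sum of the weights.\<close>

lemma chi_le_1: "nonneg x \<Longrightarrow> cmod (chi x \<theta>) \<le> 1"
proof (cases "\<exists>i\<in>I. x i > 0 \<and> cos (\<theta> i) \<noteq> 1")
  case True
  then show "nonneg x \<Longrightarrow> ?thesis" using chi_strict[of x _ \<theta>] by fastforce
next
  case False
  assume x: "nonneg x"
  have "chi x \<theta> = (\<Sum>a\<in>S. of_real (wt x a))"
    unfolding chi_def
  proof (intro sum.cong refl)
    fix a assume "a \<in> S"
    show "of_real (wt x a) * cis (ph a \<theta>) = of_real (wt x a)"
    proof (cases "wt x a = 0")
      case F: False
      have "cis (real (e a i) * \<theta> i) = 1" if i: "i \<in> I" for i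
      proof (cases "x i > 0")
        case True
        then have "cos (\<theta> i) = 1" using False i by blast
        then have "cis (\<theta> i) = 1" using sin_squared_eq[of "\<theta> i"] by (simp add: complex_eq_iff)
        then show ?thesis by (metis Complex.DeMoivre power_one)
      next
        case f: False
        then have "x i = 0" using x i by (auto simp: nonneg_def less_le)
        then have "e a i = 0" using F i finI by (auto simp: wt_def mon_def prod_zero_iff)
        then show ?thesis by simp
      qed
      moreover have "cis (ph a \<theta>) = (\<Prod>i\<in>I. cis (real (e a i) * \<theta> i))"
        by (simp add: ph_def cis_conv_exp exp_sum finI sum_distrib_left)
      ultimately show ?thesis by simp
    qed simp
  qed
  then show ?thesis using sum_wt[OF x] by (simp flip: of_real_sum)
qed

text \<open>Exponential tilting: multiplying the weights by exp (z * phase) with complex z moves the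
  point \<open>x\<close> by the factors exp (Re z * \<eta>) and adds the phase Im z * \<eta>. So
  \<open>chi_le_1\<close> at the tilted points is the hypothesis of
  \<open>exp_sum_second_moment_pos\<close> for the centred phases.\<close>

lemma var_pos:
  assumes x: "nonneg x" and i: "i \<in> I" "x i > 0" "\<eta> i \<noteq> 0"
  shows "(\<Sum>a\<in>S. wt x a * (ph a \<eta>)\<^sup>2) - (\<Sum>a\<in>S. wt x a * ph a \<eta>)\<^sup>2 > 0"
proof -
  define M where "M = (\<Sum>a\<in>S. wt x a * ph a \<eta>)"
  have chi_shift: "cmod (\<Sum>a\<in>S. of_real (wt x a) * exp (z * of_real (ph a \<eta> - M)))
     = cmod (chi (\<lambda>i. x i * exp (Re z * \<eta> i)) (\<lambda>i. Im z * \<eta> i)) * (\<Sum>a\<in>S. wt x a * exp (Re z * (ph a \<eta> - M)))"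
    and ge0: "(\<Sum>a\<in>S. wt x a * exp (Re z * (ph a \<eta> - M))) > 0" for z
  proof -
    define y where "y = (\<lambda>i. x i * exp (Re z * \<eta> i))"
    have ny: "nonneg y" using x by (auto simp: nonneg_def y_def)
    have mon: "mon a y = mon a x * exp (Re z * ph a \<eta>)" for a
      by (simp add: mon_def y_def power_mult_distrib prod.distrib ph_def sum_distrib_left exp_sum finI mult_ac flip: exp_of_nat_mult)
    have wt: "wt y a * (pr y / pr x) = wt x a * exp (Re z * ph a \<eta>)" for a
      using pr_pos[OF ny] pr_pos[OF x] by (simp add: wt_def mon field_simps)
    have ph2: "ph a (\<lambda>i. Im z * \<eta> i) = Im z * ph a \<eta>" for a
      by (simp add: ph_def sum_distrib_left mult_ac)
    have ex: "exp (z * of_real (ph a \<eta> - M)) = of_real (exp (Re z * ph a \<eta>)) * cis (Im z * ph a \<eta>) * exp (- z * of_real M)" for a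
      by (simp add: exp_eq_polar[of "z * of_real _"] exp_minus right_diff_distrib exp_diff field_simps)
    have "(\<Sum>a\<in>S. of_real (wt x a) * exp (z * of_real (ph a \<eta> - M)))
      = (\<Sum>a\<in>S. of_real (wt x a * exp (Re z * ph a \<eta>)) * cis (Im z * ph a \<eta>)) * exp (- z * of_real M)"
      unfolding ex sum_distrib_right by (intro sum.cong) (simp_all add: mult_ac)
    also have "\<dots> = chi y (\<lambda>i. Im z * \<eta> i) * of_real (pr y / pr x) * exp (- z * of_real M)"
      unfolding chi_def wt[symmetric] ph2 sum_distrib_right sum_distrib_left
      by (intro sum.cong) (simp_all add: mult_ac)
    finally have 1: "cmod (\<Sum>a\<in>S. of_real (wt x a) * exp (z * of_real (ph a \<eta> - M))) = cmod (chi y (\<lambda>i. Im z * \<eta> i)) * ((pr y / pr x) * exp (- Re z * M))"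
      using pr_pos[OF ny] pr_pos[OF x] by (simp add: norm_mult norm_divide)
    have "(\<Sum>a\<in>S. wt x a * exp (Re z * (ph a \<eta> - M))) = (\<Sum>a\<in>S. wt x a * exp (Re z * ph a \<eta>)) * exp (- Re z * M)"
      unfolding sum_distrib_right by (intro sum.cong) (simp_all add: right_diff_distrib exp_diff exp_minus field_simps)
    also have "\<dots> = (pr y / pr x) * exp (- Re z * M)"
      unfolding wt[symmetric] unfolding sum_distrib_right[symmetric] sum_wt[OF ny] by simp
    finally have 2: "(\<Sum>a\<in>S. wt x a * exp (Re z * (ph a \<eta> - M))) = (pr y / pr x) * exp (- Re z * M)" .
    show "cmod (\<Sum>a\<in>S. of_real (wt x a) * exp (z * of_real (ph a \<eta> - M)))
     = cmod (chi (\<lambda>i. x i * exp (Re z * \<eta> i)) (\<lambda>i. Im z * \<eta> i)) * (\<Sum>a\<in>S. wt x a * exp (Re z * (ph a \<eta> - M)))"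
      unfolding 1 2 y_def ..
    show "(\<Sum>a\<in>S. wt x a * exp (Re z * (ph a \<eta> - M))) > 0"
      unfolding 2 using pr_pos[OF ny] pr_pos[OF x] by simp
  qed
  have "(\<Sum>a\<in>S. wt x a * (ph a \<eta> - M)\<^sup>2) > 0"
  proof (rule exp_sum_second_moment_pos[where \<tau> = "1 / \<eta> i"])
    show "(\<Sum>a\<in>S. wt x a) = 1" by (rule sum_wt[OF x])
    show "(\<Sum>a\<in>S. wt x a * (ph a \<eta> - M)) = 0"
      using sum_wt[OF x] by (simp add: right_diff_distrib sum_subtractf M_def flip: sum_distrib_right)
    show "cmod (\<Sum>a\<in>S. of_real (wt x a) * exp (z * of_real (ph a \<eta> - M))) \<le> (\<Sum>a\<in>S. wt x a * exp (Re z * (ph a \<eta> - M)))" for z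
    proof -
      have "nonneg (\<lambda>i. x i * exp (Re z * \<eta> i))" using x by (auto simp: nonneg_def)
      then show ?thesis unfolding chi_shift using ge0[of z] chi_le_1 by (intro mult_left_le_one_le) auto
    qed
    \<comment> \<open>Scaling \<open>\<eta>\<close> by \<open>1 / \<eta> i\<close> makes the angle
      of the coordinate \<open>i\<close> equal to 1, a nontrivial phase.\<close>
    have "cos 1 < cos (0::real)" using pi_gt3 by (intro cos_monotone_0_pi) auto
    then have "cmod (chi (\<lambda>i. x i) (\<lambda>j. (1 / \<eta> i) * \<eta> j)) < 1"
      using i by (intro chi_strict[OF x i(1,2)]) auto
    then show "cmod (\<Sum>a\<in>S. of_real (wt x a) * exp (\<i> * of_real (1 / \<eta> i) * of_real (ph a \<eta> - M))) < 1"
      unfolding chi_shift using sum_wt[OF x] by simp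
  qed
  also have "(\<Sum>a\<in>S. wt x a * (ph a \<eta> - M)\<^sup>2) = (\<Sum>a\<in>S. wt x a * (ph a \<eta>)\<^sup>2 - 2 * M * (wt x a * ph a \<eta>) + M\<^sup>2 * wt x a)"
    by (intro sum.cong) (simp_all add: power2_eq_square algebra_simps)
  also have "\<dots> = (\<Sum>a\<in>S. wt x a * (ph a \<eta>)\<^sup>2) - 2 * M * M + M\<^sup>2"
    using sum_wt[OF x] by (simp add: sum.distrib sum_subtractf M_def flip: sum_distrib_left)
  finally show ?thesis by (simp add: M_def power2_eq_square)
qed

end

section \<open>Uniform decay of the characteristic function on the unit box\<close>

lemma finite_conv_subseq:
  fixes f :: "nat \<Rightarrow> 'i \<Rightarrow> 'a::heine_borel"
  assumes "finite I" "\<And>i. i \<in> I \<Longrightarrow> bounded (range (\<lambda>n. f n i))"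
  shows "\<exists>r. \<exists>l. strict_mono (r :: nat \<Rightarrow> nat) \<and> (\<forall>i\<in>I. (\<lambda>n. f (r n) i) \<longlonglongrightarrow> l i)"
  using assms
proof (induction I)
  case empty
  show ?case by (auto intro: strict_mono_id[unfolded id_def])
next
  case (insert i I)
  then obtain r l where r: "strict_mono (r :: nat \<Rightarrow> nat)" "\<forall>i\<in>I. (\<lambda>n. f (r n) i) \<longlonglongrightarrow> l i" by auto
  have "bounded (range (\<lambda>n. f (r n) i))" using insert.prems[of i] by (auto intro: bounded_subset)
  then obtain l' r' where r': "strict_mono (r' :: nat \<Rightarrow> nat)" "((\<lambda>n. f (r n) i) \<circ> r') \<longlonglongrightarrow> l'"
    using bounded_imp_convergent_subsequence by blast
  show ?case
  proof (rule exI[of _ "r \<circ> r'"], rule exI[of _ "\<lambda>j. if j = i then l' else l j"], intro conjI ballI)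
    show "strict_mono (r \<circ> r')" by (rule strict_mono_o[OF r(1) r'(1)])
    show "(\<lambda>n. f ((r \<circ> r') n) j) \<longlonglongrightarrow> (if j = i then l' else l j)" if "j \<in> insert i I" for j
      using that r' LIMSEQ_subseq_LIMSEQ[OF r(2)[rule_format, of j] r'(1)] insert.hyps by (auto simp: o_def)
  qed
qed

text \<open>First-order product rule: deviations from 1, measured at the scale \<open>s n\<close>,
  add up with the exponents as multiplicities.\<close>

lemma prod_minus_1_tendsto:
  fixes u :: "nat \<Rightarrow> 'i \<Rightarrow> complex"
  assumes "finite J" "\<And>j. j \<in> J \<Longrightarrow> (\<lambda>n. u n j) \<longlonglongrightarrow> 1" "\<And>j. j \<in> J \<Longrightarrow> (\<lambda>n. (u n j - 1) / s n) \<longlonglongrightarrow> \<eta> j"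
  shows "(\<lambda>n. ((\<Prod>j\<in>J. u n j ^ k j) - 1) / s n) \<longlonglongrightarrow> (\<Sum>j\<in>J. of_nat (k j) * \<eta> j)"
  using assms
proof (induction J)
  case (insert j J)
  have pw: "(\<lambda>n. (u n j ^ m - 1) / s n) \<longlonglongrightarrow> of_nat m * \<eta> j" for m
  proof (induction m)
    case (Suc m)
    have "(\<lambda>n. (u n j ^ m - 1) / s n * u n j + (u n j - 1) / s n) \<longlonglongrightarrow> of_nat m * \<eta> j * 1 + \<eta> j"
      using insert.prems by (intro tendsto_intros Suc) auto
    then show ?case by (simp add: algebra_simps flip: add_divide_distrib)
  qed simp
  have "(\<lambda>n. u n j ^ k j) \<longlonglongrightarrow> 1 ^ k j" using insert.prems by (intro tendsto_intros) auto
  then have "(\<lambda>n. ((\<Prod>j\<in>J. u n j ^ k j) - 1) / s n * u n j ^ k j + (u n j ^ k j - 1) / s n) \<longlonglongrightarrow>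
     (\<Sum>j\<in>J. of_nat (k j) * \<eta> j) * 1 + of_nat (k j) * \<eta> j"
    using insert by (intro tendsto_intros pw) auto
  then show ?case using insert.hyps by (simp add: algebra_simps flip: add_divide_distrib)
qed simp

context pos_chart begin

text \<open>The monomial divided by \<open>x i\<close>, for terms that contain \<open>x i\<close>;
  written without division so that it is continuous at \<open>x i = 0\<close>.\<close>

definition mono1 :: "'b \<Rightarrow> 'i \<Rightarrow> ('i \<Rightarrow> real) \<Rightarrow> real" where
  "mono1 a i x = x i ^ (e a i - 1) * (\<Prod>j\<in>I - {i}. x j ^ e a j)"

lemma mon_eq_mono1: "i \<in> I \<Longrightarrow> e a i > 0 \<Longrightarrow> mon a x = x i * mono1 a i x"
  unfolding mon_def mono1_def using finI by (subst prod.remove[of I i]) (auto simp: gr0_conv_Suc)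

definition ee :: "'b \<Rightarrow> ('i \<Rightarrow> complex) \<Rightarrow> complex" where "ee a u = (\<Prod>i\<in>I. u i ^ e a i)"

lemma cis_ph: "cis (ph a \<theta>) = ee a (\<lambda>i. cis (\<theta> i))"
proof -
  have *: "cis (\<Sum>i\<in>A. f i) = (\<Prod>i\<in>A. cis (f i))" if "finite A" for A :: "'i set" and f
    using that by (induction A rule: finite_induct) (simp_all add: cis_mult [symmetric])
  show ?thesis unfolding ph_def ee_def Complex.DeMoivre *[OF finI] ..
qed

lemma norm_ee_minus_1_le:
  assumes "\<And>i. i \<in> I \<Longrightarrow> cmod (u i) = 1"
  shows "cmod (ee a u - 1) \<le> (\<Sum>i\<in>I. real (e a i) * cmod (u i - 1))"
proof -
  have "cmod (ee a u - (\<Prod>i\<in>I. 1 ^ e a i)) \<le> (\<Sum>i\<in>I. cmod (u i ^ e a i - 1 ^ e a i))"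
    unfolding ee_def by (rule norm_prod_diff) (auto simp: norm_power assms)
  also have "\<dots> \<le> (\<Sum>i\<in>I. real (e a i) * cmod (u i - 1))"
    by (intro sum_mono norm_power_diff) (auto simp: assms)
  finally show ?thesis by simp
qed

lemma tendsto_mon: "(\<And>i. i \<in> I \<Longrightarrow> (\<lambda>n. x n i) \<longlonglongrightarrow> y i) \<Longrightarrow> (\<lambda>n. mon a (x n)) \<longlonglongrightarrow> mon a y"
  unfolding mon_def by (intro tendsto_intros)

lemma tendsto_pr: "(\<And>i. i \<in> I \<Longrightarrow> (\<lambda>n. x n i) \<longlonglongrightarrow> y i) \<Longrightarrow> (\<lambda>n. pr (x n)) \<longlonglongrightarrow> pr y"
  unfolding pr_def by (intro tendsto_intros tendsto_mon)

lemma tendsto_mono1: "i \<in> I \<Longrightarrow> (\<And>i. i \<in> I \<Longrightarrow> (\<lambda>n. x n i) \<longlonglongrightarrow> y i) \<Longrightarrow> (\<lambda>n. mono1 a i (x n)) \<longlonglongrightarrow> mono1 a i y"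
  unfolding mono1_def by (intro tendsto_intros) auto

end

context strict_chart begin

lemma tendsto_wt:
  assumes "nonneg y" "\<And>i. i \<in> I \<Longrightarrow> (\<lambda>n. x n i) \<longlonglongrightarrow> y i"
  shows "(\<lambda>n. wt (x n) a) \<longlonglongrightarrow> wt y a"
  unfolding wt_def using pr_pos[OF assms(1)] assms(2) by (intro tendsto_intros tendsto_mon tendsto_pr) auto

lemma norm_cis_minus_1: "(cmod (cis t - 1))\<^sup>2 = 2 * (1 - cos t)"
  using sin_cos_squared_add[of t] by (simp add: cmod_power2 power2_diff algebra_simps)

text \<open>For numbers X of modulus 1 and weights of total mass 1, 1 - |E X|^2 is the variance of
  X, and it is unchanged when X is replaced by X - 1. The shifted form is the one that can be
  rescaled when the phases tend to 1.\<close>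

lemma variance_form:
  assumes x: "nonneg x"
  shows "1 - (cmod (chi x \<theta>))\<^sup>2 = (\<Sum>a\<in>S. wt x a * (cmod (cis (ph a \<theta>) - 1))\<^sup>2) - (cmod (\<Sum>a\<in>S. of_real (wt x a) * (cis (ph a \<theta>) - 1)))\<^sup>2"
proof -
  define T where "T = (\<Sum>a\<in>S. of_real (wt x a) * (cis (ph a \<theta>) - 1))"
  have chi: "chi x \<theta> = 1 + T"
    using sum_wt[OF x] by (simp add: T_def chi_def right_diff_distrib sum_subtractf flip: of_real_sum)
  have "(\<Sum>a\<in>S. wt x a * (cmod (cis (ph a \<theta>) - 1))\<^sup>2) = - 2 * Re T"
    by (simp add: T_def norm_cis_minus_1 sum_distrib_left)
       (simp add: algebra_simps sum_subtractf sum_distrib_left flip: sum_negf)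
  moreover have "(cmod (1 + T))\<^sup>2 = 1 + 2 * Re T + (cmod T)\<^sup>2"
    unfolding cmod_power2 by (simp add: power2_eq_square algebra_simps)
  ultimately show ?thesis by (simp add: chi T_def)
qed

text \<open>By compactness. Along a failing sequence the quotient of both sides tends to a quadratic
  form in rescaled phase deviations: a variance in the coordinates with positive limit, plus a
  diagonal form in the coordinates with limit 0 whose coefficients are partial derivatives, positive
  by \<open>deriv_pos\<close>. The limit is at most 0, so all deviations vanish, although their
  squares were normalized to sum to 2.\<close>

lemma dominance:
  "\<exists>C>0. \<forall>x \<theta>. (\<forall>i\<in>I. 0 \<le> x i \<and> x i \<le> 1) \<longrightarrow> 1 - (cmod (chi x \<theta>))\<^sup>2 \<ge> C * (\<Sum>i\<in>I. x i * (1 - cos (\<theta> i)))"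
proof (rule ccontr)
  assume "\<not> ?thesis"
  then have neg: "\<exists>x \<theta>. (\<forall>i\<in>I. 0 \<le> x i \<and> x i \<le> 1) \<and> 1 - (cmod (chi x \<theta>))\<^sup>2 < C * (\<Sum>i\<in>I. x i * (1 - cos (\<theta> i)))" if "C > 0" for C
    using that by (simp only: not_ex not_all not_imp not_le de_Morgan_conj) blast
  have "\<exists>x \<theta>. (\<forall>i\<in>I. 0 \<le> x i \<and> x i \<le> 1) \<and> 1 - (cmod (chi x \<theta>))\<^sup>2 < inverse (real (Suc n)) * (\<Sum>i\<in>I. x i * (1 - cos (\<theta> i)))" for n
    by (rule neg) simp
  then have "\<exists>y. \<forall>n. (\<forall>i\<in>I. 0 \<le> fst (y n) i \<and> fst (y n) i \<le> 1) \<and>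
      1 - (cmod (chi (fst (y n)) (snd (y n))))\<^sup>2 < inverse (real (Suc n)) * (\<Sum>i\<in>I. fst (y n) i * (1 - cos (snd (y n) i)))"
    by (intro choice) auto
  then obtain y where y: "\<And>n. (\<forall>i\<in>I. 0 \<le> fst (y n) i \<and> fst (y n) i \<le> 1) \<and>
      1 - (cmod (chi (fst (y n)) (snd (y n))))\<^sup>2 < inverse (real (Suc n)) * (\<Sum>i\<in>I. fst (y n) i * (1 - cos (snd (y n) i)))"
    by blast
  define x0 \<theta>0 where "x0 n = fst (y n)" and "\<theta>0 n = snd (y n)" for n
  have box0: "0 \<le> x0 n i \<and> x0 n i \<le> 1" if "i \<in> I" for n i using y[of n] that by (simp add: x0_def)
  have lt0: "1 - (cmod (chi (x0 n) (\<theta>0 n)))\<^sup>2 < inverse (real (Suc n)) * (\<Sum>i\<in>I. x0 n i * (1 - cos (\<theta>0 n i)))" for n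
    using y[of n] unfolding x0_def \<theta>0_def by blast
  define D0 where "D0 n = (\<Sum>i\<in>I. x0 n i * (1 - cos (\<theta>0 n i)))" for n
  define u0 where "u0 n i = cis (\<theta>0 n i)" for n i
  \<comment> \<open>Phase deviations weighted by the square root of the coordinate, which keeps the
    contribution of a vanishing coordinate visible, and scaled so that their squares sum to
    2.\<close>
  define p0 where "p0 n i = of_real (sqrt (x0 n i)) * (u0 n i - 1) / of_real (sqrt (D0 n))" for n i
  have D0: "D0 n > 0" for n
  proof -
    have "nonneg (x0 n)" using box0 by (auto simp: nonneg_def)
    then have "(cmod (chi (x0 n) (\<theta>0 n)))\<^sup>2 \<le> 1" using chi_le_1 by (simp add: power_le_one)
    then have "0 < inverse (real (Suc n)) * D0 n" using lt0[of n] unfolding D0_def by linarith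
    then show ?thesis by (simp add: zero_less_mult_iff)
  qed
  have u1: "(cmod (u0 n i - 1))\<^sup>2 = 2 * (1 - cos (\<theta>0 n i))" for n i
    using sin_cos_squared_add[of "\<theta>0 n i"] by (simp add: u0_def cmod_power2 power2_diff algebra_simps)
  have p0: "(cmod (p0 n i))\<^sup>2 = 2 * (x0 n i * (1 - cos (\<theta>0 n i)) / D0 n)" if "i \<in> I" for n i
    using box0[OF that] D0[of n] by (simp add: p0_def norm_mult norm_divide power_mult_distrib power_divide u1)
  have sum_p0: "(\<Sum>i\<in>I. (cmod (p0 n i))\<^sup>2) = 2" for n
    using D0[of n] by (simp add: p0 flip: sum_distrib_left sum_divide_distrib) (simp add: D0_def)
  have bp0: "cmod (p0 n i) \<le> 2" if "i \<in> I" for n i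
  proof -
    have "(cmod (p0 n i))\<^sup>2 \<le> (\<Sum>i\<in>I. (cmod (p0 n i))\<^sup>2)" using that finI by (intro member_le_sum) auto
    then have "(cmod (p0 n i))\<^sup>2 \<le> 2\<^sup>2" using sum_p0[of n] by simp
    then show ?thesis by (rule power2_le_imp_le) simp
  qed
  obtain r1 xs where r1: "strict_mono r1" "\<forall>i\<in>I. (\<lambda>n. x0 (r1 n) i) \<longlonglongrightarrow> xs i"
    using finite_conv_subseq[OF finI, of x0] box0 by (force simp: bounded_iff)
  obtain r2 us where r2: "strict_mono r2" "\<forall>i\<in>I. (\<lambda>n. u0 (r1 (r2 n)) i) \<longlonglongrightarrow> us i"
    using finite_conv_subseq[OF finI, of "\<lambda>n. u0 (r1 n)"] by (force simp: bounded_iff u0_def)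
  obtain r3 ps where r3: "strict_mono r3" "\<forall>i\<in>I. (\<lambda>n. p0 (r1 (r2 (r3 n))) i) \<longlonglongrightarrow> ps i"
    using finite_conv_subseq[OF finI, of "\<lambda>n. p0 (r1 (r2 n))"] bp0 by (force simp: bounded_iff)
  define r where "r n = r1 (r2 (r3 n))" for n
  have r: "strict_mono r" using r1(1) r2(1) r3(1) by (auto simp: strict_mono_def r_def)
  define x \<theta> D u p where "x n = x0 (r n)" and "\<theta> n = \<theta>0 (r n)" and "D n = D0 (r n)" and "u n = u0 (r n)" and "p n = p0 (r n)" for n
  have box: "0 \<le> x n i" "x n i \<le> 1" if "i \<in> I" for n i using box0 that by (auto simp: x_def)
  have nn: "nonneg (x n)" for n using box by (auto simp: nonneg_def)
  have D: "D n > 0" for n using D0 by (simp add: D_def)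
  have xl: "(\<lambda>n. x n i) \<longlonglongrightarrow> xs i" if "i \<in> I" for i
    using LIMSEQ_subseq_LIMSEQ[OF r1(2)[rule_format, OF that] strict_mono_o[OF r2(1) r3(1)]] by (simp add: x_def r_def o_def)
  have ul: "(\<lambda>n. u n i) \<longlonglongrightarrow> us i" if "i \<in> I" for i
    using LIMSEQ_subseq_LIMSEQ[OF r2(2)[rule_format, OF that] r3(1)] by (simp add: u_def r_def o_def)
  have pl: "(\<lambda>n. p n i) \<longlonglongrightarrow> ps i" if "i \<in> I" for i
    using r3(2)[rule_format, OF that] by (simp add: p_def r_def)
  have nu: "cmod (u n i) = 1" for n i by (simp add: u_def u0_def)
  have u_eq: "u n i = cis (\<theta> n i)" for n i by (simp add: u_def u0_def \<theta>_def)
  have ph_u: "cis (ph a (\<theta> n)) = ee a (u n)" for a n unfolding cis_ph u_eq[symmetric] by simp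
  have pu: "of_real (sqrt (x n i)) * (u n i - 1) / of_real (sqrt (D n)) = p n i" for n i
    by (simp add: p_def p0_def x_def u_def D_def)
  have nxs: "nonneg xs" unfolding nonneg_def by (intro ballI, rule LIMSEQ_le_const[OF xl]) (use box in auto)
  have V: "1 - (cmod (chi (x n) (\<theta> n)))\<^sup>2 < inverse (real (Suc (r n))) * D n" for n
    using lt0[of "r n"] by (simp add: x_def \<theta>_def D_def D0_def)
  have inv0: "(\<lambda>n. inverse (real (Suc (r n)))) \<longlonglongrightarrow> 0"
    using LIMSEQ_subseq_LIMSEQ[OF LIMSEQ_inverse_real_of_nat r] by (simp add: o_def)
  define \<theta>s where "\<theta>s i = Arg (us i)" for i
  have nus: "cmod (us i) = 1" if "i \<in> I" for i
    using tendsto_norm[OF ul[OF that]] nu LIMSEQ_unique[OF _ tendsto_const] by auto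
  have us: "us i = cis (\<theta>s i)" if "i \<in> I" for i
    using rcis_cmod_Arg[of "us i"] nus[OF that] by (simp add: rcis_def \<theta>s_def)
  have "(\<lambda>n. chi (x n) (\<theta> n)) \<longlonglongrightarrow> chi xs \<theta>s"
  proof -
    have "(\<lambda>n. ee a (u n)) \<longlonglongrightarrow> cis (ph a \<theta>s)" for a
      unfolding cis_ph ee_def using ul us by (intro tendsto_intros) auto
    then show ?thesis unfolding chi_def ph_u by (intro tendsto_intros tendsto_wt[OF nxs xl])
  qed
  then have l1: "(\<lambda>n. 1 - (cmod (chi (x n) (\<theta> n)))\<^sup>2) \<longlonglongrightarrow> 1 - (cmod (chi xs \<theta>s))\<^sup>2"
    by (intro tendsto_intros)
  have l2: "(\<lambda>n. inverse (real (Suc (r n))) * (2 * real (card I))) \<longlonglongrightarrow> 0 * (2 * real (card I))"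
    by (intro tendsto_intros inv0)
  have l3: "1 - (cmod (chi (x n) (\<theta> n)))\<^sup>2 \<le> inverse (real (Suc (r n))) * (2 * real (card I))" for n
  proof -
    have "D n \<le> (\<Sum>i\<in>I. 2)" unfolding D_def D0_def
    proof (intro sum_mono)
      fix i assume i: "i \<in> I"
      have "x0 (r n) i * (1 - cos (\<theta>0 (r n) i)) \<le> 1 * 2"
      proof (intro mult_mono)
        show "1 - cos (\<theta>0 (r n) i) \<le> 2" using cos_ge_minus_one[of "\<theta>0 (r n) i"] by linarith
      qed (use box0[OF i] in auto)
      then show "x0 (r n) i * (1 - cos (\<theta>0 (r n) i)) \<le> 2" by simp
    qed
    then have "D n \<le> 2 * real (card I)" by simp
    then have "inverse (real (Suc (r n))) * D n \<le> inverse (real (Suc (r n))) * (2 * real (card I))"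
      by (intro mult_left_mono) auto
    then show ?thesis using V[of n] by linarith
  qed
  have "1 - (cmod (chi xs \<theta>s))\<^sup>2 \<le> 0" using LIMSEQ_le[OF l1 l2] l3 by auto
  \<comment> \<open>\<open>D\<close> is bounded by 2 * card I, so the failing inequality yields
    |chi| \<ge> 1 at the limit point; by \<open>chi_strict\<close> all coordinates with positive
    limit then have trivial phase there.\<close>
  then have chi1: "\<not> cmod (chi xs \<theta>s) < 1"
    using abs_square_less_1[of "cmod (chi xs \<theta>s)"] by auto
  define J where "J = {i\<in>I. xs i > 0}"
  define K where "K = I - J"
  have finJK: "finite J" "finite K" "J \<subseteq> I" "K \<subseteq> I" using finI by (auto simp: J_def K_def)
  have xsK: "xs i = 0" if "i \<in> K" for i using that nxs by (force simp: J_def K_def nonneg_def)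
  have uJ: "us j = 1" if "j \<in> J" for j
  proof -
    have "cos (\<theta>s j) = 1" using chi_strict[OF nxs, of j \<theta>s] chi1 that by (auto simp: J_def)
    then have "cis (\<theta>s j) = 1" using sin_squared_eq[of "\<theta>s j"] by (simp add: complex_eq_iff)
    then show ?thesis using us that by (auto simp: J_def)
  qed
  \<comment> \<open>Near 1 on the unit circle the real part of u - 1 is of second order, so the
    rescaled deviations have purely imaginary limits \<open>\<i> * h j\<close>.\<close>
  define h where "h j = (if j \<in> J then Im (ps j) / sqrt (xs j) else 0)" for j
  have etaJ: "(\<lambda>n. (u n j - 1) / of_real (sqrt (D n))) \<longlonglongrightarrow> \<i> * of_real (h j)" if j: "j \<in> J" for j
  proof -
    have jI: "j \<in> I" and xj: "xs j > 0" using j by (auto simp: J_def)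
    have lim: "(\<lambda>n. p n j / of_real (sqrt (x n j))) \<longlonglongrightarrow> ps j / of_real (sqrt (xs j))"
      using xj jI by (intro tendsto_intros pl xl) auto
    have "eventually (\<lambda>n. x n j > 0) sequentially" using order_tendstoD(1)[OF xl[OF jI] xj] .
    then have "eventually (\<lambda>n. p n j / of_real (sqrt (x n j)) = (u n j - 1) / of_real (sqrt (D n))) sequentially"
      by eventually_elim (simp add: pu[symmetric])
    then have lim2: "(\<lambda>n. (u n j - 1) / of_real (sqrt (D n))) \<longlonglongrightarrow> ps j / of_real (sqrt (xs j))"
      using lim tendsto_cong by fastforce
    have re: "Re ((u n j - 1) / of_real (sqrt (D n))) = - (cmod (u n j - 1) * cmod ((u n j - 1) / of_real (sqrt (D n)))) / 2" for n
      
    proof -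
      have "Re (u n j - 1) = - (cmod (u n j - 1) * cmod (u n j - 1)) / 2"
        using norm_cis_minus_1[of "\<theta> n j"] by (simp add: u_eq power2_eq_square)
      then show ?thesis using D[of n] by (simp add: norm_divide Re_divide_of_real)
    qed
    have "(\<lambda>n. - (cmod (u n j - 1) * cmod ((u n j - 1) / of_real (sqrt (D n)))) / 2) \<longlonglongrightarrow>
       - (cmod (1 - 1) * cmod (ps j / of_real (sqrt (xs j)))) / 2"
      using ul[OF jI] uJ[OF j] by (intro tendsto_intros lim2) auto
    then have "Re (ps j / of_real (sqrt (xs j))) = 0"
      using tendsto_Re[OF lim2] unfolding re using LIMSEQ_unique by fastforce
    then have "ps j / of_real (sqrt (xs j)) = \<i> * of_real (h j)"
      using j by (simp add: complex_eq_iff h_def Re_divide_of_real Im_divide_of_real)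
    then show ?thesis using lim2 by simp
  qed
  \<comment> \<open>The terms that contain no coordinate vanishing at the limit point.\<close>
  define S0 where "S0 = {a\<in>S. \<forall>i\<in>K. e a i = 0}"
  define eJ where "eJ a n = (\<Prod>j\<in>J. u n j ^ e a j)" for a n
  have eJ1: "(\<lambda>n. (eJ a n - 1) / of_real (sqrt (D n))) \<longlonglongrightarrow> \<i> * of_real (ph a h)" for a
  proof -
    have "(\<lambda>n. (eJ a n - 1) / of_real (sqrt (D n))) \<longlonglongrightarrow> (\<Sum>j\<in>J. of_nat (e a j) * (\<i> * of_real (h j)))"
      unfolding eJ_def using ul uJ finJK by (intro prod_minus_1_tendsto etaJ) force+
    also have "(\<Sum>j\<in>J. of_nat (e a j) * (\<i> * of_real (h j))) = (\<Sum>j\<in>I. of_nat (e a j) * (\<i> * of_real (h j)))"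
      using finJK finI by (intro sum.mono_neutral_left) (auto simp: h_def)
    also have "\<dots> = \<i> * of_real (ph a h)" by (simp add: ph_def sum_distrib_left mult_ac)
    finally show ?thesis .
  qed
  have ee_split: "ee a (u n) = eJ a n * (\<Prod>j\<in>K. u n j ^ e a j)" for a n
    unfolding ee_def eJ_def K_def using finI finJK by (subst prod.subset_diff[of J]) (auto simp: mult_ac)
  have ee0: "ee a (u n) = eJ a n" if "a \<in> S0" for a n
    unfolding ee_split using that by (simp add: S0_def)
  have wlim: "(\<lambda>n. wt (x n) a) \<longlonglongrightarrow> wt xs a" for a by (rule tendsto_wt[OF nxs xl])
  have wts0: "wt xs a = 0" if "a \<in> S - S0" for a
  proof -
    obtain i where "i \<in> K" "e a i \<noteq> 0" using \<open>a \<in> S - S0\<close> by (auto simp: S0_def)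
    then have "mon a xs = 0" using xsK finI finJK by (auto simp: mon_def intro!: bexI[of _ i])
    then show ?thesis by (simp add: wt_def)
  qed
  define W where "W a i n = c a * mono1 a i (x n) / pr (x n)" for a i n
  have Wlim: "(\<lambda>n. W a i n) \<longlonglongrightarrow> c a * mono1 a i xs / pr xs" if "i \<in> I" for a i
    unfolding W_def using pr_pos[OF nxs] by (intro tendsto_intros tendsto_mono1[OF that] tendsto_pr xl) auto
  have wW: "wt (x n) a = x n i * W a i n" if "i \<in> I" "e a i > 0" for a i n
    using that by (simp add: wt_def W_def mon_eq_mono1)
  have bnd: "cmod (ee a (u n) - 1) \<le> (\<Sum>i\<in>I. real (e a i) * cmod (u n i - 1))" for a n
    by (rule norm_ee_minus_1_le) (simp add: nu)
  have S1: "(\<lambda>n. of_real (wt (x n) a) * (ee a (u n) - 1) / of_real (sqrt (D n))) \<longlonglongrightarrow> of_real (wt xs a) * (\<i> * of_real (ph a h))" if a: "a \<in> S" for a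
  proof (cases "a \<in> S0")
    case True
    have "(\<lambda>n. of_real (wt (x n) a) * ((eJ a n - 1) / of_real (sqrt (D n)))) \<longlonglongrightarrow> of_real (wt xs a) * (\<i> * of_real (ph a h))"
      by (intro tendsto_intros wlim eJ1)
    then show ?thesis by (simp add: ee0[OF True])
  next
    case False
    then obtain i where i: "i \<in> K" "e a i > 0" using a by (auto simp: S0_def)
    \<comment> \<open>Of the factor \<open>x n l\<close> of a term outside \<open>S0\<close>, one
      square root is absorbed into \<open>p n l\<close>; what is left still tends to 0, through the
      other root or through another vanishing coordinate.\<close>
    have t: "(\<lambda>n. real (e a l) * (\<bar>wt (x n) a\<bar> * cmod (u n l - 1) / sqrt (D n))) \<longlonglongrightarrow> 0" if l: "l \<in> I" for l
    proof (cases "e a l = 0")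
      case ne: False
      have eq: "\<bar>wt (x n) a\<bar> * cmod (u n l - 1) / sqrt (D n) = \<bar>W a l n\<bar> * sqrt (x n l) * cmod (p n l)" for n
        
      proof -
        have "\<bar>wt (x n) a\<bar> = sqrt (x n l) * sqrt (x n l) * \<bar>W a l n\<bar>" using box[OF l, of n] ne by (simp add: wW[OF l] abs_mult)
        moreover have "cmod (p n l) = sqrt (x n l) * cmod (u n l - 1) / sqrt (D n)"
          using box[OF l, of n] D[of n] by (simp add: pu[symmetric] norm_mult norm_divide)
        ultimately show ?thesis by simp
      qed
      have z: "c a * mono1 a l xs / pr xs * sqrt (xs l) = 0"
      proof (cases "l = i")
        case True then show ?thesis using xsK i by simp
      next
        case False
        then have "mono1 a l xs = 0" unfolding mono1_def using xsK i finI finJK by (auto intro!: bexI[of _ i])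
        then show ?thesis by simp
      qed
      have "(\<lambda>n. \<bar>W a l n\<bar> * sqrt (x n l) * cmod (p n l)) \<longlonglongrightarrow> \<bar>c a * mono1 a l xs / pr xs\<bar> * sqrt (xs l) * cmod (ps l)"
        by (intro tendsto_intros Wlim xl pl l)
      then show ?thesis using z unfolding eq by (auto intro!: tendsto_mult_right_zero)
    qed simp
    have lim0: "(\<lambda>n. (\<Sum>l\<in>I. real (e a l) * (\<bar>wt (x n) a\<bar> * cmod (u n l - 1) / sqrt (D n)))) \<longlonglongrightarrow> 0"
      using tendsto_sum[of I, OF t] by simp
    have "(\<lambda>n. of_real (wt (x n) a) * (ee a (u n) - 1) / of_real (sqrt (D n))) \<longlonglongrightarrow> 0"
    proof (rule Lim_null_comparison[OF always_eventually[OF allI] lim0])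
      fix n
      have "cmod (of_real (wt (x n) a) * (ee a (u n) - 1) / of_real (sqrt (D n))) = \<bar>wt (x n) a\<bar> * cmod (ee a (u n) - 1) / sqrt (D n)"
        using D[of n] by (simp add: norm_mult norm_divide)
      also have "\<dots> \<le> \<bar>wt (x n) a\<bar> * (\<Sum>l\<in>I. real (e a l) * cmod (u n l - 1)) / sqrt (D n)"
        using D[of n] bnd by (intro divide_right_mono mult_left_mono) auto
      also have "\<dots> = (\<Sum>l\<in>I. real (e a l) * (\<bar>wt (x n) a\<bar> * cmod (u n l - 1) / sqrt (D n)))"
        by (simp add: sum_distrib_left sum_divide_distrib mult_ac)
      finally show "cmod (of_real (wt (x n) a) * (ee a (u n) - 1) / of_real (sqrt (D n))) \<le> \<dots>" .
    qed
    then show ?thesis using wts0[of a] a False by simp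
  qed
  \<comment> \<open>A term outside \<open>S0\<close> survives in the limit only if it contains
    exactly one vanishing coordinate, to the first power. Otherwise \<open>mono1\<close> vanishes at
    \<open>xs\<close> whichever of its vanishing coordinates is chosen.\<close>
  define iK where "iK a = (SOME i. i \<in> K \<and> e a i > 0)" for a
  have iK: "iK a \<in> K" "e a (iK a) > 0" if "a \<in> S - S0" for a
  proof -
    have "\<exists>i. i \<in> K \<and> e a i > 0" using that by (auto simp: S0_def)
    then show "iK a \<in> K" "e a (iK a) > 0" unfolding iK_def by (metis (mono_tags, lifting) someI_ex)+
  qed
  define T where "T a = (if a \<in> S0 then wt xs a * (ph a h)\<^sup>2 else c a * mono1 a (iK a) xs / pr xs * (cmod (ps (iK a)))\<^sup>2)" for a
  have S2: "(\<lambda>n. wt (x n) a * (cmod (ee a (u n) - 1))\<^sup>2 / D n) \<longlonglongrightarrow> T a" if a: "a \<in> S" for a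
  proof (cases "a \<in> S0")
    case True
    have "(\<lambda>n. wt (x n) a * (cmod ((eJ a n - 1) / of_real (sqrt (D n))))\<^sup>2) \<longlonglongrightarrow> wt xs a * (cmod (\<i> * of_real (ph a h)))\<^sup>2"
      by (intro tendsto_intros wlim eJ1)
    then show ?thesis using D[THEN less_imp_le] by (simp add: ee0[OF True] T_def True norm_mult norm_divide power_divide)
  next
    case False
    define i where "i = iK a"
    have i: "i \<in> K" "e a i > 0" "i \<in> I" using iK[of a] a False finJK by (auto simp: i_def)
    show ?thesis
    proof (cases "\<exists>l\<in>K. l \<noteq> i \<and> e a l > 0 \<or> e a i > 1")
      case True
      have z: "mono1 a l xs = 0" if "l \<in> I" for l
      proof (cases "l = i")
        case li: True
        show ?thesis
        proof (cases "e a i > 1")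
          case True then show ?thesis using xsK[OF i(1)] by (simp add: mono1_def li)
        next
          case F: False
          then obtain k where "k \<in> K" "k \<noteq> i" "e a k > 0" using True by auto
          then show ?thesis using xsK finI finJK unfolding mono1_def li by (auto intro!: bexI[of _ k])
        qed
      next
        case False
        then show ?thesis using xsK[OF i(1)] i finI unfolding mono1_def by (auto intro!: bexI[of _ i])
      qed
      have t: "(\<lambda>n. (real (e a l))\<^sup>2 * (\<bar>wt (x n) a\<bar> * (cmod (u n l - 1))\<^sup>2 / D n)) \<longlonglongrightarrow> 0" if l: "l \<in> I" for l
      proof (cases "e a l = 0")
        case ne: False
        have eq: "\<bar>wt (x n) a\<bar> * (cmod (u n l - 1))\<^sup>2 / D n = \<bar>W a l n\<bar> * (cmod (p n l))\<^sup>2" for n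
          using box[OF l, of n] ne D[of n] by (simp add: wW[OF l] pu[symmetric] norm_mult norm_divide abs_mult power_mult_distrib power_divide)
        have "(\<lambda>n. \<bar>W a l n\<bar> * (cmod (p n l))\<^sup>2) \<longlonglongrightarrow> \<bar>c a * mono1 a l xs / pr xs\<bar> * (cmod (ps l))\<^sup>2"
          by (intro tendsto_intros Wlim pl l)
        then show ?thesis using z[OF l] unfolding eq by (auto intro!: tendsto_mult_right_zero)
      qed simp
      have lim0: "(\<lambda>n. real (card I) * (\<Sum>l\<in>I. (real (e a l))\<^sup>2 * (\<bar>wt (x n) a\<bar> * (cmod (u n l - 1))\<^sup>2 / D n))) \<longlonglongrightarrow> 0"
        using tendsto_mult[OF tendsto_const[of "real (card I)"] tendsto_sum[of I, OF t]] by simp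
      have "(\<lambda>n. wt (x n) a * (cmod (ee a (u n) - 1))\<^sup>2 / D n) \<longlonglongrightarrow> 0"
      proof (rule Lim_null_comparison[OF always_eventually[OF allI] lim0])
        fix n
        have "norm (wt (x n) a * (cmod (ee a (u n) - 1))\<^sup>2 / D n) = \<bar>wt (x n) a\<bar> * (cmod (ee a (u n) - 1))\<^sup>2 / D n"
          using D[of n] by (simp add: abs_mult)
        also have "\<dots> \<le> \<bar>wt (x n) a\<bar> * (\<Sum>l\<in>I. real (e a l) * cmod (u n l - 1))\<^sup>2 / D n"
          using D[of n] bnd by (intro divide_right_mono mult_left_mono power_mono) auto
        also have "\<dots> \<le> \<bar>wt (x n) a\<bar> * (real (card I) * (\<Sum>l\<in>I. (real (e a l) * cmod (u n l - 1))\<^sup>2)) / D n"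
          using D[of n] sum_squared_le_sum_of_squares[of "\<lambda>l. real (e a l) * cmod (u n l - 1)" I]
          by (intro divide_right_mono mult_left_mono) (auto simp: mult_ac)
        also have "\<dots> = real (card I) * (\<Sum>l\<in>I. (real (e a l))\<^sup>2 * (\<bar>wt (x n) a\<bar> * (cmod (u n l - 1))\<^sup>2 / D n))"
          by (simp add: sum_distrib_left sum_divide_distrib mult_ac power_mult_distrib)
        finally show "norm (wt (x n) a * (cmod (ee a (u n) - 1))\<^sup>2 / D n) \<le> \<dots>" .
      qed
      then show ?thesis using False z[OF i(3)] by (simp add: T_def i_def)
    next
      case one: False
      then have e1: "e a i = 1" and el: "\<And>l. l \<in> K \<Longrightarrow> l \<noteq> i \<Longrightarrow> e a l = 0" using i by force+
      have "(\<Prod>j\<in>K. u n j ^ e a j) = (\<Prod>j\<in>{i}. u n j ^ e a j)" for n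
        using i el finJK by (intro prod.mono_neutral_right) auto
      then have eei: "ee a (u n) = eJ a n * u n i" for n unfolding ee_split by (simp add: e1)
      \<comment> \<open>The phase of the term is \<open>eJ a n * u n i\<close>; its deviation from 1
        splits into the deviations of the two factors, and the second one carries sqrt (x n i),
        which tends to 0.\<close>
      have eq: "wt (x n) a * (cmod (ee a (u n) - 1))\<^sup>2 / D n =
         W a i n * (cmod (eJ a n * p n i + of_real (sqrt (x n i)) * ((eJ a n - 1) / of_real (sqrt (D n)))))\<^sup>2" for n
      proof -
        have "eJ a n * p n i + of_real (sqrt (x n i)) * ((eJ a n - 1) / of_real (sqrt (D n))) = of_real (sqrt (x n i)) * (ee a (u n) - 1) / of_real (sqrt (D n))"
          using D[of n] by (simp add: pu[symmetric] eei field_simps)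
        then show ?thesis using box[OF i(3), of n] D[of n] i
          by (simp add: wW[OF i(3)] norm_mult norm_divide power_mult_distrib power_divide)
      qed
      have eJl: "(\<lambda>n. eJ a n) \<longlonglongrightarrow> (\<Prod>j\<in>J. 1 ^ e a j)"
        unfolding eJ_def using ul uJ finJK by (intro tendsto_intros) force
      have "(\<lambda>n. W a i n * (cmod (eJ a n * p n i + of_real (sqrt (x n i)) * ((eJ a n - 1) / of_real (sqrt (D n)))))\<^sup>2) \<longlonglongrightarrow>
        (c a * mono1 a i xs / pr xs) * (cmod ((\<Prod>j\<in>J. 1 ^ e a j) * ps i + of_real (sqrt (xs i)) * (\<i> * of_real (ph a h))))\<^sup>2"
        by (intro tendsto_intros Wlim eJl pl xl eJ1 i)
      then show ?thesis unfolding eq using False xsK[OF i(1)] by (simp add: T_def i_def)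
    qed
  qed
  have Vl: "(\<lambda>n. (1 - (cmod (chi (x n) (\<theta> n)))\<^sup>2) / D n) \<longlonglongrightarrow> (\<Sum>a\<in>S. T a) - (cmod (\<Sum>a\<in>S. of_real (wt xs a) * (\<i> * of_real (ph a h))))\<^sup>2"
  proof -
    have eq: "(1 - (cmod (chi (x n) (\<theta> n)))\<^sup>2) / D n = (\<Sum>a\<in>S. wt (x n) a * (cmod (ee a (u n) - 1))\<^sup>2 / D n)
       - (cmod (\<Sum>a\<in>S. of_real (wt (x n) a) * (ee a (u n) - 1) / of_real (sqrt (D n))))\<^sup>2" for n
      unfolding variance_form[OF nn] ph_u using D[of n]
      by (simp add: diff_divide_distrib sum_divide_distrib[symmetric] norm_divide power_divide)
    show ?thesis unfolding eq by (intro tendsto_intros S1 S2)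
  qed
  have "(1 - (cmod (chi (x n) (\<theta> n)))\<^sup>2) / D n \<le> inverse (real (Suc (r n)))" for n
    using V[of n] D[of n] by (simp add: pos_divide_le_eq less_imp_le)
  then have le0: "(\<Sum>a\<in>S. T a) - (cmod (\<Sum>a\<in>S. of_real (wt xs a) * (\<i> * of_real (ph a h))))\<^sup>2 \<le> 0"
    using LIMSEQ_le[OF Vl inv0] by blast
  have "(\<Sum>a\<in>S. of_real (wt xs a) * (\<i> * of_real (ph a h))) = \<i> * of_real (\<Sum>a\<in>S. wt xs a * ph a h)"
    by (simp add: sum_distrib_left mult_ac)
  then have m1: "(cmod (\<Sum>a\<in>S. of_real (wt xs a) * (\<i> * of_real (ph a h))))\<^sup>2 = (\<Sum>a\<in>S. wt xs a * ph a h)\<^sup>2"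
    by (simp only: norm_mult norm_of_real) simp
  \<comment> \<open>The partial derivative in the direction \<open>i\<close> at the limit point,
    divided by \<open>pr xs\<close>.\<close>
  define B where "B i = (\<Sum>a | a \<in> S \<and> e a i = 1. c a * (\<Prod>j\<in>I - {i}. xs j ^ e a j)) / pr xs" for i
  have B: "B i > 0" if "i \<in> K" for i
    unfolding B_def using deriv_pos[OF nxs _ xsK[OF that]] pr_pos[OF nxs] that finJK by auto
  have TB: "(\<Sum>a\<in>S. T a) = (\<Sum>a\<in>S. wt xs a * (ph a h)\<^sup>2) + (\<Sum>i\<in>K. B i * (cmod (ps i))\<^sup>2)"
  proof -
    have "(\<Sum>a\<in>S. T a) = (\<Sum>a\<in>S0. T a) + (\<Sum>a\<in>S - S0. T a)"
      using finS by (subst sum.subset_diff[of S0]) (auto simp: S0_def)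
    also have "(\<Sum>a\<in>S0. T a) = (\<Sum>a\<in>S. wt xs a * (ph a h)\<^sup>2)"
    proof -
      have "(\<Sum>a\<in>S0. T a) = (\<Sum>a\<in>S0. wt xs a * (ph a h)\<^sup>2)" by (simp add: T_def)
      also have "\<dots> = (\<Sum>a\<in>S. wt xs a * (ph a h)\<^sup>2)"
        using finS wts0 by (intro sum.mono_neutral_left) (auto simp: S0_def)
      finally show ?thesis .
    qed
    also have "(\<Sum>a\<in>S - S0. T a) = (\<Sum>i\<in>K. \<Sum>a\<in>{a\<in>S - S0. iK a = i}. T a)"
      using finS finJK iK by (intro sum.group[symmetric]) auto
    also have "\<dots> = (\<Sum>i\<in>K. B i * (cmod (ps i))\<^sup>2)"
    proof (intro sum.cong refl)
      fix i assume i: "i \<in> K"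
      have iI: "i \<in> I" using i finJK by auto
      have m1: "mono1 a i xs = (if e a i = 1 then (\<Prod>j\<in>I - {i}. xs j ^ e a j) else 0)" if "e a i > 0" for a
        using xsK[OF i] that by (auto simp: mono1_def)
      have "(\<Sum>a\<in>{a\<in>S - S0. iK a = i}. T a) = (\<Sum>a\<in>{a\<in>S - S0. iK a = i}. (if e a i = 1 then c a * (\<Prod>j\<in>I - {i}. xs j ^ e a j) / pr xs else 0)) * (cmod (ps i))\<^sup>2"
        unfolding sum_distrib_right
      proof (intro sum.cong refl)
        fix a assume a: "a \<in> {a \<in> S - S0. iK a = i}"
        then have "e a i > 0" "iK a = i" "a \<notin> S0" using iK[of a] by auto
        then show "T a = (if e a i = 1 then c a * (\<Prod>j\<in>I - {i}. xs j ^ e a j) / pr xs else 0) * (cmod (ps i))\<^sup>2"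
          using m1[of a] by (auto simp: T_def)
      qed
      also have "(\<Sum>a\<in>{a\<in>S - S0. iK a = i}. (if e a i = 1 then c a * (\<Prod>j\<in>I - {i}. xs j ^ e a j) / pr xs else 0))
        = (\<Sum>a | a \<in> S \<and> e a i = 1. c a * (\<Prod>j\<in>I - {i}. xs j ^ e a j) / pr xs)"
      proof (rule sum.mono_neutral_cong)
        fix a assume a: "a \<in> {a. a \<in> S \<and> e a i = 1} - {a \<in> S - S0. iK a = i}"
        then have "a \<in> S - S0" using i by (auto simp: S0_def intro!: bexI[of _ i])
        then have "iK a \<noteq> i" "iK a \<in> K" "e a (iK a) > 0" using a iK by auto
        then have "(\<Prod>j\<in>I - {i}. xs j ^ e a j) = 0" using xsK finI finJK by (auto intro!: bexI[of _ "iK a"])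
        then show "c a * (\<Prod>j\<in>I - {i}. xs j ^ e a j) / pr xs = 0" by simp
      qed (use finS in auto)
      also have "\<dots> = B i" by (simp add: B_def sum_divide_distrib)
      finally show "(\<Sum>a\<in>{a\<in>S - S0. iK a = i}. T a) = B i * (cmod (ps i))\<^sup>2" .
    qed
    finally show ?thesis .
  qed
  have Bn: "B i * (cmod (ps i))\<^sup>2 \<ge> 0" if "i \<in> K" for i using B[OF that] by simp
  then have K0: "(\<Sum>i\<in>K. B i * (cmod (ps i))\<^sup>2) \<ge> 0" by (intro sum_nonneg)
  \<comment> \<open>A nonzero \<open>h j\<close> would make the variance part positive by
    \<open>var_pos\<close>.\<close>
  have hJ: "h j = 0" if "j \<in> I" for j
  proof (rule ccontr)
    assume "h j \<noteq> 0"
    then have "j \<in> J" by (auto simp: h_def split: if_splits)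
    then have "(\<Sum>a\<in>S. wt xs a * (ph a h)\<^sup>2) - (\<Sum>a\<in>S. wt xs a * ph a h)\<^sup>2 > 0"
      using \<open>h j \<noteq> 0\<close> by (intro var_pos[OF nxs, of j]) (auto simp: J_def)
    then show False using le0 TB m1 K0 by linarith
  qed
  then have "ph a h = 0" for a by (simp add: ph_def)
  then have "(\<Sum>i\<in>K. B i * (cmod (ps i))\<^sup>2) \<le> 0" using le0 TB m1 by simp
  then have "\<forall>i\<in>K. B i * (cmod (ps i))\<^sup>2 = 0"
    using K0 finJK Bn sum_nonneg_eq_0_iff[of K "\<lambda>i. B i * (cmod (ps i))\<^sup>2"] by auto
  then have psK: "ps i = 0" if "i \<in> K" for i using B that by fastforce
  have psJ: "ps i = 0" if "i \<in> J" for i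
  proof -
    have iI: "i \<in> I" "xs i > 0" using that by (auto simp: J_def)
    have "(\<lambda>n. of_real (sqrt (x n i)) * ((u n i - 1) / of_real (sqrt (D n)))) \<longlonglongrightarrow> of_real (sqrt (xs i)) * (\<i> * of_real (h i))"
      by (intro tendsto_intros xl etaJ iI that)
    then have "(\<lambda>n. p n i) \<longlonglongrightarrow> 0" using hJ[OF iI(1)] pu by simp
    then show ?thesis using pl[OF iI(1)] LIMSEQ_unique by blast
  qed
  have "(\<lambda>n. \<Sum>i\<in>I. (cmod (p n i))\<^sup>2) \<longlonglongrightarrow> (\<Sum>i\<in>I. (cmod (ps i))\<^sup>2)"
    by (intro tendsto_intros pl)
  moreover have "(\<Sum>i\<in>I. (cmod (p n i))\<^sup>2) = 2" for n using sum_p0 by (simp add: p_def)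
  ultimately have "(\<Sum>i\<in>I. (cmod (ps i))\<^sup>2) = 2" using LIMSEQ_unique[OF _ tendsto_const] by fastforce
  moreover have "(\<Sum>i\<in>I. (cmod (ps i))\<^sup>2) = 0" using psK psJ by (intro sum.neutral) (auto simp: K_def)
  ultimately show False by simp
qed

end

section \<open>The local limit theorem in a chart\<close>

lemma has_bochner_integral_cis:
  assumes k: "\<kappa> > 0"
  shows "has_bochner_integral lborel (\<lambda>t. indicator {-(pi * \<kappa>)..pi * \<kappa>} t *\<^sub>R cis (real_of_int j * (t / \<kappa>))) (if j = 0 then of_real (2 * pi * \<kappa>) else 0)"
proof (cases "j = 0")
  case True
  have "has_bochner_integral lborel (\<lambda>t. indicator {-(pi * \<kappa>)..pi * \<kappa>} t *\<^sub>R (1::complex)) (measure lborel {-(pi * \<kappa>)..pi * \<kappa>} *\<^sub>R 1)"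
    by (intro has_bochner_integral_scaleR_left has_bochner_integral_real_indicator) (auto simp: emeasure_lborel_Icc_eq)
  moreover have "measure lborel {-(pi * \<kappa>)..pi * \<kappa>} = 2 * pi * \<kappa>" using k by simp
  ultimately show ?thesis using True by (simp add: scaleR_conv_of_real)
next
  case False
  define F where "F t = of_real \<kappa> / (\<i> * of_int j) * cis (real_of_int j * (t / \<kappa>))" for t
  have "has_bochner_integral lborel (\<lambda>t. indicator {-(pi * \<kappa>)..pi * \<kappa>} t *\<^sub>R cis (real_of_int j * (t / \<kappa>))) (F (pi * \<kappa>) - F (-(pi * \<kappa>)))"
  proof (rule has_bochner_integral_FTC_Icc)
    show "-(pi * \<kappa>) \<le> pi * \<kappa>" using k by simp
    show "(F has_vector_derivative cis (real_of_int j * (t / \<kappa>))) (at t within {-(pi * \<kappa>)..pi * \<kappa>})" for t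
      unfolding F_def cis_conv_exp using k False
      by (auto intro!: derivative_eq_intros has_vector_derivative_real_field simp: field_simps)
    show "continuous_on {-(pi * \<kappa>)..pi * \<kappa>} (\<lambda>t. cis (real_of_int j * (t / \<kappa>)))"
      unfolding cis_conv_exp using k by (intro continuous_intros) auto
  qed
  moreover have "F (pi * \<kappa>) = F (-(pi * \<kappa>))"
  proof -
    have "cis (real_of_int j * pi) = cis (- (real_of_int j * pi))"
      by (simp add: complex_eq_iff mult.commute)
    then show ?thesis using k by (simp add: F_def)
  qed
  ultimately show ?thesis using False by simp
qed

text \<open>The integral is 2 pi times the probability exp (-M) M^M / M! that a Poisson variable of
  mean M takes the value M: expand exp (M e^(it)) and integrate termwise; only j = M
  survives.\<close>

lemma poisson_integral_pos:
  fixes M :: nat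
  shows "\<exists>r>0. (\<integral>t. indicator {-pi..pi} t *\<^sub>R exp (of_nat M * (cis t - 1 - \<i> * of_real t)) \<partial>lborel) = of_real r"
proof -
  define f where "f j t = of_real (exp (- real M) * real M ^ j / fact j) * (indicator {-pi..pi} t *\<^sub>R cis (real_of_int (int j - int M) * (t / 1)))" for j t
  have hb: "has_bochner_integral lborel (f j) (of_real (exp (- real M) * real M ^ j / fact j) * (if int j - int M = 0 then of_real (2 * pi * 1) else 0))" for j
    unfolding f_def
    using has_bochner_integral_cis[of 1 "int j - int M"] by (intro has_bochner_integral_mult_right) simp
  have nf: "norm (f j t) = exp (- real M) * (indicator {-pi..pi} t * (real M ^ j / fact j))" for j t
    by (simp add: f_def norm_mult norm_divide norm_power)
  have sexp: "summable (\<lambda>j. real M ^ j / fact j)" using summable_exp[of "real M"] by (simp add: field_simps)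
  have "(\<lambda>j. integral\<^sup>L lborel (f j)) sums (\<integral>t. suminf (\<lambda>j. f j t) \<partial>lborel)"
  proof (rule sums_integral)
    show "integrable lborel (f j)" for j by (rule integrable.intros[OF hb])
    show "AE t in lborel. summable (\<lambda>j. norm (f j t))"
      unfolding nf by (intro AE_I2 summable_mult sexp)
    have "(\<integral>t. norm (f j t) \<partial>lborel) = exp (- real M) * (2 * pi) * (real M ^ j / fact j)" for j
    proof -
      have "(\<integral>t. norm (f j t) \<partial>lborel) = (\<integral>t. exp (- real M) * (real M ^ j / fact j) * indicator {-pi..pi} t \<partial>lborel)"
        unfolding nf by (intro Bochner_Integration.integral_cong) auto
      also have "\<dots> = exp (- real M) * (real M ^ j / fact j) * measure lborel {-pi..pi}" by simp
      finally show ?thesis by simp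
    qed
    then show "summable (\<lambda>j. \<integral>t. norm (f j t) \<partial>lborel)" using sexp by (simp only: summable_mult)
  qed
  moreover have "suminf (\<lambda>j. f j t) = indicator {-pi..pi} t *\<^sub>R exp (of_nat M * (cis t - 1 - \<i> * of_real t))" for t
  proof -
    have "(\<lambda>j. (of_real (exp (- real M)) * cis (- (real M * t)) * indicator {-pi..pi} t) * ((of_nat M * cis t) ^ j /\<^sub>R fact j)) sums
      ((of_real (exp (- real M)) * cis (- (real M * t)) * indicator {-pi..pi} t) * exp (of_nat M * cis t))"
      by (intro sums_mult exp_converges)
    also have "(\<lambda>j. (of_real (exp (- real M)) * cis (- (real M * t)) * indicator {-pi..pi} t) * ((of_nat M * cis t) ^ j /\<^sub>R fact j)) = (\<lambda>j. f j t)"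
    proof
      fix j
      have "cis (real_of_int (int j - int M) * t) = cis t ^ j * cis (- (real M * t))"
        by (simp add: Complex.DeMoivre cis_mult algebra_simps)
      then show "(of_real (exp (- real M)) * cis (- (real M * t)) * indicator {-pi..pi} t) * ((of_nat M * cis t) ^ j /\<^sub>R fact j) = f j t"
        by (auto simp: f_def power_mult_distrib scaleR_conv_of_real field_simps indicator_def)
    qed
    also have "(of_real (exp (- real M)) * cis (- (real M * t)) * indicator {-pi..pi} t) * exp (of_nat M * cis t) = indicator {-pi..pi} t *\<^sub>R exp (of_nat M * (cis t - 1 - \<i> * of_real t))"
      by (auto simp: cis_conv_exp exp_of_real[symmetric] exp_add[symmetric] algebra_simps indicator_def)
    finally show ?thesis by (rule sums_unique[symmetric])
  qed
  ultimately have s: "(\<lambda>j. integral\<^sup>L lborel (f j)) sums (\<integral>t. indicator {-pi..pi} t *\<^sub>R exp (of_nat M * (cis t - 1 - \<i> * of_real t)) \<partial>lborel)" by simp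
  have "(\<lambda>j. integral\<^sup>L lborel (f j)) = (\<lambda>j. if j = M then of_real (exp (- real M) * real M ^ M / fact M * (2 * pi)) else 0)"
    using has_bochner_integral_integral_eq[OF hb] by (auto simp: fun_eq_iff)
  then have "(\<lambda>j. integral\<^sup>L lborel (f j)) sums of_real (exp (- real M) * real M ^ M / fact M * (2 * pi))"
    using sums_single[of M "\<lambda>_. of_real (exp (- real M) * real M ^ M / fact M * (2 * pi)) :: complex"] by simp
  from sums_unique2[OF s this] show ?thesis
    by (intro exI[of _ "exp (- real M) * real M ^ M / fact M * (2 * pi)"]) (cases "M = 0"; auto)
qed

text \<open>\<open>z n\<close> is of order 1 / sqrt (k n), so log (1 + z) may be replaced by z - z^2
  / 2, and k z^2 tends to -l^2. The factor exp (- y n) removes a phase that may diverge.\<close>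

lemma power_tendsto_exp:
  fixes z :: "nat \<Rightarrow> complex" and k :: "nat \<Rightarrow> nat"
  assumes bd: "\<And>n. cmod (1 + z n) \<le> 1" and k: "filterlim k at_top sequentially"
    and s: "(\<lambda>n. of_real (sqrt (real (k n))) * z n) \<longlonglongrightarrow> \<i> * of_real l"
    and L: "(\<lambda>n. of_nat (k n) * z n - y n) \<longlonglongrightarrow> L" and y: "\<And>n. Re (y n) = 0"
  shows "(\<lambda>n. (1 + z n) ^ k n * exp (- y n)) \<longlonglongrightarrow> exp (L + of_real (l\<^sup>2 / 2))"
proof -
  define w where "w n = z n - (z n)\<^sup>2 / 2" for n
  have kr: "filterlim (\<lambda>n. real (k n)) at_top sequentially"
    using filterlim_compose[OF filterlim_real_sequentially k] .
  have sq0: "(\<lambda>n. 1 / sqrt (real (k n))) \<longlonglongrightarrow> 0"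
    using kr by (intro tendsto_divide_0[OF tendsto_const] filterlim_at_top_imp_at_infinity filterlim_compose[OF sqrt_at_top])
  have kpos: "eventually (\<lambda>n. k n > 0) sequentially" using k 
  proof -
    have "eventually (\<lambda>n. 0 < real (k n)) sequentially" using kr unfolding filterlim_at_top_dense by blast
    then show ?thesis by simp
  qed
  have z0: "z \<longlonglongrightarrow> 0"
  proof -
    have "(\<lambda>n. of_real (1 / sqrt (real (k n))) * (of_real (sqrt (real (k n))) * z n)) \<longlonglongrightarrow> of_real 0 * (\<i> * of_real l)"
      by (intro tendsto_intros sq0 s)
    moreover have "eventually (\<lambda>n. of_real (1 / sqrt (real (k n))) * (of_real (sqrt (real (k n))) * z n) = z n) sequentially"
      using kpos by eventually_elim simp
    ultimately show ?thesis using tendsto_cong by fastforce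
  qed
  have kz2: "(\<lambda>n. of_nat (k n) * (z n)\<^sup>2) \<longlonglongrightarrow> - of_real (l\<^sup>2)"
  proof -
    have "(\<lambda>n. (of_real (sqrt (real (k n))) * z n)\<^sup>2) \<longlonglongrightarrow> (\<i> * of_real l)\<^sup>2" by (intro tendsto_intros s)
    moreover have "(of_real (sqrt (real (k n))) * z n)\<^sup>2 = of_nat (k n) * (z n)\<^sup>2" for n
    proof -
      have "(complex_of_real (sqrt (real (k n))))\<^sup>2 = of_nat (k n)"
        unfolding of_real_power[symmetric] by simp
      then show ?thesis by (simp only: power_mult_distrib)
    qed
    ultimately have "(\<lambda>n. of_nat (k n) * (z n)\<^sup>2) \<longlonglongrightarrow> (\<i> * of_real l)\<^sup>2" by (simp only:)
    then show ?thesis by (simp add: power_mult_distrib)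
  qed
  have E: "(\<lambda>n. of_nat (k n) * w n - y n) \<longlonglongrightarrow> L - (- of_real (l\<^sup>2)) / 2"
  proof -
    have "(\<lambda>n. (of_nat (k n) * z n - y n) - of_nat (k n) * (z n)\<^sup>2 / 2) \<longlonglongrightarrow> L - (- of_real (l\<^sup>2)) / 2"
      by (intro tendsto_intros L kz2) auto
    then show ?thesis by (simp add: w_def algebra_simps)
  qed
  have E2: "(\<lambda>n. exp (w n) ^ k n * exp (- y n)) \<longlonglongrightarrow> exp (L + of_real (l\<^sup>2 / 2))"
  proof -
    have "(\<lambda>n. exp (of_nat (k n) * w n - y n)) \<longlonglongrightarrow> exp (L - (- of_real (l\<^sup>2)) / 2)" by (intro tendsto_intros E)
    moreover have "exp (of_nat (k n) * w n - y n) = exp (w n) ^ k n * exp (- y n)" for n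
      by (simp add: exp_diff exp_minus exp_of_nat_mult divide_inverse)
    moreover have "L - (- of_real (l\<^sup>2)) / 2 = L + complex_of_real (l\<^sup>2 / 2)" by simp
    ultimately show ?thesis by (simp only:)
  qed
  have ny: "cmod (exp (- y n)) = 1" for n by (simp add: y)
  have nb: "(\<lambda>n. cmod (exp (w n)) ^ k n) \<longlonglongrightarrow> cmod (exp (L + of_real (l\<^sup>2 / 2)))"
    using tendsto_norm[OF E2] by (simp add: norm_mult norm_power y)
  \<comment> \<open>The constant is generous: the Taylor remainder of exp costs 36 |v|^3, and the
    polynomial difference, which has only cubic and quartic terms, costs |v|^3.\<close>
  have cub: "cmod (1 + v - exp (v - v\<^sup>2 / 2)) \<le> 100 * cmod v ^ 3" if v: "cmod v \<le> 1" for v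
  proof -
    define u where "u = v - v\<^sup>2 / 2"
    have nu: "cmod u \<le> 2 * cmod v"
    proof -
      have "cmod u \<le> cmod v + cmod (v\<^sup>2 / 2)" unfolding u_def by (rule norm_triangle_ineq4)
      also have "cmod (v\<^sup>2 / 2) \<le> cmod v" using v 
      proof -
        have "cmod v * cmod v \<le> cmod v * 1" using v by (intro mult_left_mono) auto
        then have "cmod v * cmod v / 2 \<le> cmod v" using norm_ge_zero[of v] by linarith
        then show ?thesis by (simp add: norm_divide norm_mult power2_eq_square)
      qed
      finally show ?thesis by simp
    qed
    have "cmod (exp u - (\<Sum>i\<le>2. u ^ i / fact i)) \<le> exp \<bar>Re u\<bar> * cmod u ^ Suc 2 / fact 2" by (rule Taylor_exp)
    also have "\<dots> \<le> exp 2 * (2 * cmod v) ^ 3 / 2"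
    proof -
      have "\<bar>Re u\<bar> \<le> 2" using abs_Re_le_cmod[of u] nu v by linarith
      moreover have "cmod u ^ 3 \<le> (2 * cmod v) ^ 3" using nu by (intro power_mono) auto
      ultimately have "exp \<bar>Re u\<bar> * cmod u ^ 3 \<le> exp 2 * (2 * cmod v) ^ 3" by (intro mult_mono) auto
      then show ?thesis by (simp add: eval_nat_numeral mult_ac)
    qed
    also have "\<dots> \<le> 9 * (2 * cmod v) ^ 3 / 2"
    proof -
      have "exp (2::real) = exp 1 * exp 1" by (simp flip: exp_add)
      also have "\<dots> \<le> 3 * 3" using exp_le by (intro mult_mono) auto
      finally show ?thesis by (intro divide_right_mono mult_right_mono) auto
    qed
    finally have 1: "cmod (exp u - (1 + u + u\<^sup>2 / 2)) \<le> 36 * cmod v ^ 3"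
      by (simp add: power_mult_distrib numeral_2_eq_2)
    have "1 + v - (1 + u + u\<^sup>2 / 2) = v ^ 3 * (1 / 2 - v / 8)"
      by (simp add: u_def power2_eq_square power3_eq_cube field_simps)
    then have "cmod (1 + v - (1 + u + u\<^sup>2 / 2)) = cmod v ^ 3 * cmod (1 / 2 - v / 8)"
      by (simp add: norm_mult norm_power)
    also have "\<dots> \<le> cmod v ^ 3 * 1"
    proof (intro mult_left_mono)
      have "cmod (1 / 2 - v / 8) \<le> cmod (1 / 2) + cmod (v / 8)" by (rule norm_triangle_ineq4)
      then show "cmod (1 / 2 - v / 8) \<le> 1" using v by (simp add: norm_divide)
    qed auto
    finally have 2: "cmod (1 + v - (1 + u + u\<^sup>2 / 2)) \<le> cmod v ^ 3" by simp
    have "1 + v - exp u = (1 + v - (1 + u + u\<^sup>2 / 2)) - (exp u - (1 + u + u\<^sup>2 / 2))" by simp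
    also have "cmod \<dots> \<le> cmod (1 + v - (1 + u + u\<^sup>2 / 2)) + cmod (exp u - (1 + u + u\<^sup>2 / 2))" by (rule norm_triangle_ineq4)
    finally have "cmod (1 + v - exp u) \<le> 37 * cmod v ^ 3" using 1 2 by linarith
    also have "\<dots> \<le> 100 * cmod v ^ 3" by simp
    finally show ?thesis by (simp add: u_def)
  qed
  \<comment> \<open>Telescoping; the maximum bounds all intermediate powers of \<open>b\<close>,
    while those of \<open>a\<close> are at most 1.\<close>
  have diff: "cmod (a ^ m - b ^ m) \<le> real m * cmod (a - b) * max 1 (cmod b ^ m)" if a: "cmod a \<le> 1" for a b :: complex and m
  proof (induction m)
    case (Suc m)
    have "a ^ Suc m - b ^ Suc m = a * (a ^ m - b ^ m) + (a - b) * b ^ m" by (simp add: algebra_simps)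
    also have "cmod \<dots> \<le> cmod (a * (a ^ m - b ^ m)) + cmod ((a - b) * b ^ m)" by (rule norm_triangle_ineq)
    also have "\<dots> \<le> real m * cmod (a - b) * max 1 (cmod b ^ m) + cmod (a - b) * max 1 (cmod b ^ m)"
    proof (intro add_mono)
      have "cmod (a * (a ^ m - b ^ m)) \<le> 1 * cmod (a ^ m - b ^ m)" unfolding norm_mult using a by (intro mult_right_mono) auto
      then show "cmod (a * (a ^ m - b ^ m)) \<le> real m * cmod (a - b) * max 1 (cmod b ^ m)" using Suc by linarith
      show "cmod ((a - b) * b ^ m) \<le> cmod (a - b) * max 1 (cmod b ^ m)"
        unfolding norm_mult norm_power by (intro mult_left_mono) auto
    qed
    also have "\<dots> = real (Suc m) * cmod (a - b) * max 1 (cmod b ^ m)" by (simp add: algebra_simps)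
    also have "\<dots> \<le> real (Suc m) * cmod (a - b) * max 1 (cmod b ^ Suc m)"
    proof (intro mult_left_mono)
      show "max 1 (cmod b ^ m) \<le> max 1 (cmod b ^ Suc m)"
      proof (cases "cmod b \<le> 1")
        case True
        then show ?thesis using power_le_one[of "cmod b" m] by auto
      next
        case False
        then show ?thesis using power_increasing[of m "Suc m" "cmod b"] by linarith
      qed
    qed auto
    finally show ?case .
  qed simp
  have "(\<lambda>n. (1 + z n) ^ k n - exp (w n) ^ k n) \<longlonglongrightarrow> 0"
  proof (rule Lim_null_comparison)
    have "eventually (\<lambda>n. cmod (z n) < 1) sequentially"
      using order_tendstoD(2)[OF tendsto_norm[OF z0], of 1] by simp
    then show "eventually (\<lambda>n. cmod ((1 + z n) ^ k n - exp (w n) ^ k n) \<le> 100 * (cmod (of_nat (k n) * (z n)\<^sup>2) * cmod (z n)) * max 1 (cmod (exp (w n)) ^ k n)) sequentially"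
    proof eventually_elim
      case (elim n)
      have "cmod ((1 + z n) ^ k n - exp (w n) ^ k n) \<le> real (k n) * cmod (1 + z n - exp (w n)) * max 1 (cmod (exp (w n)) ^ k n)"
        by (rule diff[OF bd])
      also have "\<dots> \<le> real (k n) * (100 * cmod (z n) ^ 3) * max 1 (cmod (exp (w n)) ^ k n)"
        unfolding w_def using elim by (intro mult_left_mono mult_right_mono cub) auto
      finally show ?case by (simp add: norm_mult norm_power power2_eq_square power3_eq_cube mult_ac)
    qed
    have "(\<lambda>n. 100 * (cmod (of_nat (k n) * (z n)\<^sup>2) * cmod (z n)) * max 1 (cmod (exp (w n)) ^ k n)) \<longlonglongrightarrow>
      100 * (cmod (- of_real (l\<^sup>2)) * cmod 0) * max 1 (cmod (exp (L + of_real (l\<^sup>2 / 2))))"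
      by (intro tendsto_intros kz2 z0 nb)
    then show "(\<lambda>n. 100 * (cmod (of_nat (k n) * (z n)\<^sup>2) * cmod (z n)) * max 1 (cmod (exp (w n)) ^ k n)) \<longlonglongrightarrow> 0" by simp
  qed
  then have "(\<lambda>n. ((1 + z n) ^ k n - exp (w n) ^ k n) * exp (- y n)) \<longlonglongrightarrow> 0"
    by (subst tendsto_norm_zero_iff[symmetric]) (simp only: norm_mult ny mult_1_right tendsto_norm_zero_iff)
  from tendsto_add[OF this E2] show ?thesis by (simp add: algebra_simps)
qed

lemma nat_subseq_const_or_large:
  fixes f :: "nat \<Rightarrow> nat"
  shows "\<exists>r. strict_mono (r :: nat \<Rightarrow> nat) \<and> ((\<exists>M. \<forall>n. f (r n) = M) \<or> (\<forall>n. f (r n) > n))"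
proof (cases "\<exists>M. infinite {n. f n = M}")
  case True
  then obtain M where M: "infinite {n. f n = M}" by blast
  from infinite_enumerate[OF this] obtain r where "strict_mono (r :: nat \<Rightarrow> nat)" "\<forall>n. r n \<in> {n. f n = M}" by blast
  then show ?thesis by auto
next
  case False
  have fin: "finite {n. f n \<le> N}" for N
  proof -
    have "{n. f n \<le> N} = (\<Union>M\<le>N. {n. f n = M})" by auto
    then show ?thesis using False by auto
  qed
  have ex: "\<exists>m>p. f m > N" for p N
  proof -
    have "infinite (- ({n. f n \<le> N} \<union> {..p}))" using fin by (metis finite_Un finite_atMost finite_compl infinite_UNIV_nat)
    then obtain m where "m \<in> - ({n. f n \<le> N} \<union> {..p})" using infinite_imp_nonempty by blast
    then show ?thesis by (intro exI[of _ m]) auto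
  qed
  have "\<exists>r. \<forall>n. f (r n) > n \<and> r n < r (Suc n)"
    using ex by (intro dependent_nat_choice) blast+
  then show ?thesis by (auto simp: strict_mono_Suc_iff)
qed

text \<open>Separates, along a subsequence, the Poissonian coordinates, whose exponent is constant,
  from the Gaussian ones, whose exponent tends to infinity.\<close>

lemma finite_nat_subseq_const_or_large:
  fixes f :: "nat \<Rightarrow> 'i \<Rightarrow> nat"
  assumes "finite I"
  shows "\<exists>r. strict_mono (r :: nat \<Rightarrow> nat) \<and> (\<forall>i\<in>I. (\<exists>M. \<forall>n. f (r n) i = M) \<or> (\<forall>n. f (r n) i > n))"
  using assms
proof (induction I rule: finite_induct)
  case empty
  show ?case by (auto intro: strict_mono_id[unfolded id_def])
next
  case (insert i I)
  then obtain r where r: "strict_mono (r :: nat \<Rightarrow> nat)" "\<forall>i\<in>I. (\<exists>M. \<forall>n. f (r n) i = M) \<or> (\<forall>n. f (r n) i > n)" by auto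
  obtain r' where r': "strict_mono (r' :: nat \<Rightarrow> nat)" "(\<exists>M. \<forall>n. f (r (r' n)) i = M) \<or> (\<forall>n. f (r (r' n)) i > n)"
    using nat_subseq_const_or_large[of "\<lambda>n. f (r n) i"] by blast
  have "(\<exists>M. \<forall>n. f (r (r' n)) j = M) \<or> (\<forall>n. f (r (r' n)) j > n)" if "j \<in> I" for j
    using r(2)[rule_format, OF that] seq_suble[OF r'(1)] by (meson order_le_less_trans)
  then show ?case using r' strict_mono_o[OF r(1) r'(1)] by (intro exI[of _ "r \<circ> r'"]) (auto simp: o_def)
qed

lemma integrable_exp_neg_square:
  fixes c :: real assumes "c > 0"
  shows "integrable lborel (\<lambda>t. exp (- (c * t\<^sup>2)))"
proof -
  define \<sigma> where "\<sigma> = 1 / sqrt (2 * c)"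
  have s: "\<sigma> > 0" "\<sigma>\<^sup>2 = 1 / (2 * c)" using assms by (auto simp: \<sigma>_def power_divide)
  have "(\<lambda>t. exp (- (c * t\<^sup>2))) = (\<lambda>t. sqrt (2 * pi * \<sigma>\<^sup>2) * normal_density 0 \<sigma> t)"
    using s assms by (auto simp: normal_density_def fun_eq_iff real_sqrt_mult field_simps)
  then show ?thesis using integrable_normal_density[OF s(1), of 0] by simp
qed

text \<open>1 - cos t = 2 sin (t/2)^2, and sin s \<ge> s / 2 on [0, pi/2]; with s = t/2 this is 2
  (t/4)^2.\<close>

lemma one_minus_cos_ge:
  fixes t :: real assumes "\<bar>t\<bar> \<le> pi"
  shows "t\<^sup>2 / 8 \<le> 1 - cos t"
proof -
  have *: "(s / 2)\<^sup>2 \<le> (sin s)\<^sup>2" if s: "0 \<le> s" "s \<le> pi / 2" for s :: real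
  proof -
    have "(\<Sum>m<3. sin_coeff m * s ^ m) = s" by (simp add: eval_nat_numeral sin_coeff_def)
    then have "\<bar>sin s - s\<bar> \<le> inverse (fact 3) * \<bar>s\<bar> ^ 3" using Maclaurin_sin_bound[of s 3] by simp
    then have "\<bar>sin s - s\<bar> * 6 \<le> s ^ 3" using s by (simp add: fact_numeral)
    then have "\<bar>sin s - s\<bar> \<le> s ^ 3 / 6" by simp
    from abs_le_D2[OF this] have "sin s \<ge> s - s ^ 3 / 6" by simp
    moreover have "s * s\<^sup>2 \<le> s * 3"
    proof (intro mult_left_mono)
      have "s \<le> 17 / 10" using s pi_approx by simp
      then have "s\<^sup>2 \<le> (17 / 10)\<^sup>2" using s by (intro power_mono) auto
      then show "s\<^sup>2 \<le> 3" by (simp add: power2_eq_square)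
    qed (use s in auto)
    ultimately have "sin s \<ge> s / 2" by (simp add: power2_eq_square power3_eq_cube)
    then show ?thesis using s by (intro power_mono) auto
  qed
  have "1 - cos t = 2 * (sin (\<bar>t\<bar> / 2))\<^sup>2"
    using cos_double_sin[of "\<bar>t\<bar> / 2"] by simp
  moreover have "(\<bar>t\<bar> / 2 / 2)\<^sup>2 \<le> (sin (\<bar>t\<bar> / 2))\<^sup>2" using assms by (intro *) auto
  ultimately show ?thesis by (simp add: power_divide)
qed

section \<open>Means of exponents and Fourier integrals of coefficients\<close>

context strict_chart begin

text \<open>The mean of the \<open>i\<close>-th exponent divided by \<open>x i\<close>, in a form that makes sense at \<open>x i = 0\<close>.\<close>

definition Rr :: "'a \<Rightarrow> ('a \<Rightarrow> real) \<Rightarrow> real" where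
  "Rr i x = (\<Sum>a\<in>S. c a * real (e a i) * mono1 a i x) / pr x"

lemma mean_eq: "i \<in> I \<Longrightarrow> (\<Sum>a\<in>S. wt x a * real (e a i)) = x i * Rr i x"
proof -
  assume i: "i \<in> I"
  have "wt x a * real (e a i) = x i * (c a * real (e a i) * mono1 a i x / pr x)" for a
    by (cases "e a i = 0") (auto simp: wt_def mon_eq_mono1[OF i])
  then show ?thesis by (simp add: Rr_def sum_distrib_left sum_divide_distrib)
qed

lemma tendsto_Rr:
  assumes "nonneg y" "i \<in> I" "\<And>i. i \<in> I \<Longrightarrow> (\<lambda>n. x n i) \<longlonglongrightarrow> y i"
  shows "(\<lambda>n. Rr i (x n)) \<longlonglongrightarrow> Rr i y"
  unfolding Rr_def using pr_pos[OF assms(1)] assms(2,3) by (intro tendsto_intros tendsto_mono1 tendsto_pr) auto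

text \<open>At \<open>x i = 0\<close> this is \<open>deriv_pos\<close>. Elsewhere, the mean exponent
  as a function of t = log x_i has a variance as derivative and is nondecreasing; for small positive
  x_i it is positive because \<open>Rr\<close> is continuous.\<close>

lemma Rr_pos:
  assumes x: "nonneg x" and i: "i \<in> I"
  shows "Rr i x > 0"
proof -
  have zero: "Rr i x > 0" if x: "nonneg x" and x0: "x i = 0" for x
  proof -
    have "(\<Sum>a\<in>S. c a * real (e a i) * mono1 a i x) = (\<Sum>a | a \<in> S \<and> e a i = 1. c a * (\<Prod>j\<in>I - {i}. x j ^ e a j))"
      using finS x0 by (intro sum.mono_neutral_cong_right) (auto simp: mono1_def)
    then show ?thesis using deriv_pos[OF x i x0] pr_pos[OF x] by (simp add: Rr_def)
  qed
  show ?thesis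
  proof (cases "x i = 0")
    case True then show ?thesis using zero x by blast
  next
    case False
    then have xi: "x i > 0" using x i by (force simp: nonneg_def)
    define m where "m a = (\<Prod>j\<in>I - {i}. x j ^ e a j)" for a
    define X where "X s = x(i := s)" for s
    have nX: "nonneg (X s)" if "s \<ge> 0" for s using x that by (auto simp: X_def nonneg_def)
    have monX: "mon a (X s) = m a * s ^ e a i" for a s
      unfolding mon_def m_def using finI i by (subst prod.remove[of I i]) (auto simp: X_def mult.commute intro!: prod.cong)
    \<comment> \<open>\<open>P\<close>, \<open>N\<close> and, below, \<open>Q\<close> are the
      polynomial and its first two derivatives in t = log x_i, the other coordinates being
      fixed.\<close>
    define N P where "N t = (\<Sum>a\<in>S. c a * m a * real (e a i) * exp (real (e a i) * t))"
       and "P t = (\<Sum>a\<in>S. c a * m a * exp (real (e a i) * t))" for t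
    define Q where "Q t = (\<Sum>a\<in>S. c a * m a * (real (e a i))\<^sup>2 * exp (real (e a i) * t))" for t
    have Pp: "P t = pr (X (exp t))" for t
      by (simp add: P_def pr_def monX exp_of_nat_mult exp_of_nat2_mult mult_ac)
    have Ppos: "P t > 0" for t unfolding Pp by (intro pr_pos nX) simp
    have Wt: "wt (X (exp t)) a = c a * m a * exp (real (e a i) * t) / P t" for a t
      by (simp add: wt_def Pp monX exp_of_nat_mult exp_of_nat2_mult mult_ac)
    have mu: "N t / P t = exp t * Rr i (X (exp t))" for t
    proof -
      have "N t / P t = (\<Sum>a\<in>S. wt (X (exp t)) a * real (e a i))"
        unfolding N_def Wt sum_divide_distrib by (intro sum.cong) simp_all
      then show ?thesis unfolding mean_eq[OF i] by (simp add: X_def)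
    qed
    have der: "((\<lambda>t. N t / P t) has_real_derivative ((Q t * P t - N t * N t) / (P t * P t))) (at t)" for t
      unfolding N_def P_def Q_def using Ppos[of t]
      by (auto intro!: derivative_eq_intros simp: P_def power2_eq_square mult_ac)
    have dpos: "(Q t * P t - N t * N t) / (P t * P t) \<ge> 0" for t
    proof -
      define \<eta> where "\<eta> j = (if j = i then 1 else 0 :: real)" for j
      have ph: "ph a \<eta> = real (e a i)" for a
        unfolding ph_def using i finI by (simp add: \<eta>_def if_distrib[of "\<lambda>z. _ * z"] sum.delta cong: if_cong)
      have "(\<Sum>a\<in>S. wt (X (exp t)) a * (ph a \<eta>)\<^sup>2) - (\<Sum>a\<in>S. wt (X (exp t)) a * ph a \<eta>)\<^sup>2 > 0"
        by (rule var_pos[OF nX i]) (auto simp: \<eta>_def X_def)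
      also have "(\<Sum>a\<in>S. wt (X (exp t)) a * (ph a \<eta>)\<^sup>2) = Q t / P t"
        by (simp add: Wt ph Q_def sum_divide_distrib mult_ac)
      also have "(\<Sum>a\<in>S. wt (X (exp t)) a * ph a \<eta>) = N t / P t"
        by (simp add: Wt ph N_def sum_divide_distrib mult_ac)
      also have "Q t / P t - (N t / P t)\<^sup>2 = (Q t * P t - N t * N t) / (P t * P t)"
        using Ppos[of t] by (simp add: power2_eq_square field_simps)
      finally show ?thesis by simp
    qed
    have mono: "N s / P s \<le> N t / P t" if "s \<le> t" for s t
      using that der dpos by (intro DERIV_nonneg_imp_nondecreasing[OF that]) blast
    have "(\<lambda>n. Rr i (X (inverse (real (Suc n))))) \<longlonglongrightarrow> Rr i (X 0)"
    proof (rule tendsto_Rr[OF nX i])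
      show "(\<lambda>n. X (inverse (real (Suc n))) j) \<longlonglongrightarrow> X 0 j" if "j \<in> I" for j
        using LIMSEQ_inverse_real_of_nat by (cases "j = i") (auto simp: X_def)
    qed simp
    moreover have "Rr i (X 0) > 0" by (intro zero nX) (auto simp: X_def)
    ultimately have "eventually (\<lambda>n. Rr i (X (inverse (real (Suc n)))) > 0) sequentially" by (rule order_tendstoD(1))
    moreover have "eventually (\<lambda>n. inverse (real (Suc n)) < x i) sequentially"
      using order_tendstoD(2)[OF LIMSEQ_inverse_real_of_nat xi] .
    ultimately have "eventually (\<lambda>n. Rr i (X (inverse (real (Suc n)))) > 0 \<and> inverse (real (Suc n)) < x i) sequentially"
      by eventually_elim simp
    then obtain n where n: "Rr i (X (inverse (real (Suc n)))) > 0" "inverse (real (Suc n)) < x i"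
      using eventually_happens by force
    define s where "s = ln (inverse (real (Suc n)))"
    have s: "exp s = inverse (real (Suc n))" unfolding s_def by (intro exp_ln) simp
    have "0 < exp s * Rr i (X (exp s))" using n s by simp
    also have "\<dots> = N s / P s" by (simp add: mu)
    also have "\<dots> \<le> N (ln (x i)) / P (ln (x i))"
      using n(2) xi unfolding s_def by (intro mono) simp
    also have "\<dots> = x i * Rr i (X (x i))" using xi by (simp add: mu)
    also have "X (x i) = x" by (simp add: X_def)
    finally show ?thesis using xi by (simp add: zero_less_mult_iff)
  qed
qed

text \<open>The phases are rescaled by \<open>\<kappa>\<close>, later sqrt (k x_i) in a Gaussian
  direction and 1 in a Poissonian one; the indicators cut out one period of each phase.\<close>

definition fourier_integrand :: "nat \<Rightarrow> ('a \<Rightarrow> nat) \<Rightarrow> ('a \<Rightarrow> real) \<Rightarrow> ('a \<Rightarrow> real) \<Rightarrow> ('a \<Rightarrow> real) \<Rightarrow> complex" where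
  "fourier_integrand k m x \<kappa> \<phi> = of_real (\<Prod>i\<in>I. indicator {-(pi * \<kappa> i)..pi * \<kappa> i} (\<phi> i)) * (chi x (\<lambda>i. \<phi> i / \<kappa> i)) ^ k * cis (- (\<Sum>i\<in>I. real (m i) * (\<phi> i / \<kappa> i)))"

lemma cis_sum: "cis (\<Sum>i\<in>I. f i) = (\<Prod>i\<in>I. cis (f i))"
  using finI by (induction I rule: finite_induct) (simp_all add: cis_mult [symmetric])

text \<open>Orthogonality of characters on the torus. The expansion of the k-th power enters as an
  abstract finite sum; by \<open>inj\<close> the exponents on \<open>I\<close> single out the index
  \<open>\<beta>\<close>.\<close>

lemma coeff_integral:
  fixes B :: "'d set" and d :: "'d \<Rightarrow> real" and g :: "'d \<Rightarrow> 'a \<Rightarrow> nat"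
  assumes finB: "finite B"
    and ex: "\<And>\<theta>. (of_real (pr x) * chi x \<theta>) ^ k = (\<Sum>\<beta>\<in>B. of_real (d \<beta> * (\<Prod>i\<in>I. x i ^ g \<beta> i)) * cis (\<Sum>i\<in>I. real (g \<beta> i) * \<theta> i))"
    and inj: "\<And>\<beta>'. \<beta>' \<in> B \<Longrightarrow> (\<And>i. i \<in> I \<Longrightarrow> g \<beta>' i = m i) \<Longrightarrow> \<beta>' = \<beta>"
    and \<beta>: "\<beta> \<in> B" "\<And>i. i \<in> I \<Longrightarrow> g \<beta> i = m i" and \<kappa>: "\<And>i. i \<in> I \<Longrightarrow> \<kappa> i > 0"
  shows "of_real (pr x) ^ k * (\<integral>\<phi>. fourier_integrand k m x \<kappa> \<phi> \<partial>Pi\<^sub>M I (\<lambda>_. lborel)) = of_real (d \<beta> * (\<Prod>i\<in>I. x i ^ m i) * (\<Prod>i\<in>I. 2 * pi * \<kappa> i))"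
proof -
  interpret P: product_sigma_finite "\<lambda>_::'a. lborel :: real measure" by standard
  define h where "h \<beta> i t = indicator {-(pi * \<kappa> i)..pi * \<kappa> i} t *\<^sub>R cis (real_of_int (int (g \<beta> i) - int (m i)) * (t / \<kappa> i))" for \<beta> i t
  have eq: "of_real (pr x) ^ k * fourier_integrand k m x \<kappa> \<phi> = (\<Sum>\<beta>\<in>B. of_real (d \<beta> * (\<Prod>i\<in>I. x i ^ g \<beta> i)) * (\<Prod>i\<in>I. h \<beta> i (\<phi> i)))" for \<phi>
  proof -
    have "of_real (pr x) ^ k * fourier_integrand k m x \<kappa> \<phi> = of_real (\<Prod>i\<in>I. indicator {-(pi * \<kappa> i)..pi * \<kappa> i} (\<phi> i)) *
       (of_real (pr x) * chi x (\<lambda>i. \<phi> i / \<kappa> i)) ^ k * cis (- (\<Sum>i\<in>I. real (m i) * (\<phi> i / \<kappa> i)))"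
      by (simp add: fourier_integrand_def power_mult_distrib mult_ac)
    also have "\<dots> = (\<Sum>\<beta>\<in>B. of_real (d \<beta> * (\<Prod>i\<in>I. x i ^ g \<beta> i)) * (of_real (\<Prod>i\<in>I. indicator {-(pi * \<kappa> i)..pi * \<kappa> i} (\<phi> i)) *
         (cis (\<Sum>i\<in>I. real (g \<beta> i) * (\<phi> i / \<kappa> i)) * cis (- (\<Sum>i\<in>I. real (m i) * (\<phi> i / \<kappa> i))))))"
      unfolding ex sum_distrib_left sum_distrib_right by (intro sum.cong) (simp_all only: mult_ac)
    also have "\<dots> = (\<Sum>\<beta>\<in>B. of_real (d \<beta> * (\<Prod>i\<in>I. x i ^ g \<beta> i)) * (\<Prod>i\<in>I. h \<beta> i (\<phi> i)))"
    proof (intro sum.cong refl arg_cong2[where f = "(*)"])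
      fix \<beta>
      have "cis (\<Sum>i\<in>I. real (g \<beta> i) * (\<phi> i / \<kappa> i)) * cis (- (\<Sum>i\<in>I. real (m i) * (\<phi> i / \<kappa> i))) = cis (\<Sum>i\<in>I. real_of_int (int (g \<beta> i) - int (m i)) * (\<phi> i / \<kappa> i))"
        by (simp add: cis_mult left_diff_distrib sum_subtractf diff_divide_distrib)
      then show "of_real (\<Prod>i\<in>I. indicator {-(pi * \<kappa> i)..pi * \<kappa> i} (\<phi> i)) * (cis (\<Sum>i\<in>I. real (g \<beta> i) * (\<phi> i / \<kappa> i)) * cis (- (\<Sum>i\<in>I. real (m i) * (\<phi> i / \<kappa> i)))) = (\<Prod>i\<in>I. h \<beta> i (\<phi> i))"
        by (simp add: h_def cis_sum scaleR_conv_of_real prod.distrib)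
    qed
    finally show ?thesis .
  qed
  have hi: "has_bochner_integral lborel (h \<beta> i) (if int (g \<beta> i) - int (m i) = 0 then of_real (2 * pi * \<kappa> i) else 0)" if "i \<in> I" for \<beta> i
    unfolding h_def by (rule has_bochner_integral_cis[OF \<kappa>[OF that]])
  have int: "integrable (Pi\<^sub>M I (\<lambda>_. lborel)) (\<lambda>\<phi>. \<Prod>i\<in>I. h \<beta> i (\<phi> i))" for \<beta>
    by (intro P.product_integrable_prod finI integrable.intros[OF hi])
  have val: "(\<integral>\<phi>. (\<Prod>i\<in>I. h \<beta>' i (\<phi> i)) \<partial>Pi\<^sub>M I (\<lambda>_. lborel)) = (if \<beta>' = \<beta> then of_real (\<Prod>i\<in>I. 2 * pi * \<kappa> i) else 0)" if b: "\<beta>' \<in> B" for \<beta>'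
  proof -
    have "(\<integral>\<phi>. (\<Prod>i\<in>I. h \<beta>' i (\<phi> i)) \<partial>Pi\<^sub>M I (\<lambda>_. lborel)) = (\<Prod>i\<in>I. integral\<^sup>L lborel (h \<beta>' i))"
      by (intro P.product_integral_prod finI integrable.intros[OF hi])
    also have "\<dots> = (\<Prod>i\<in>I. if int (g \<beta>' i) - int (m i) = 0 then of_real (2 * pi * \<kappa> i) else 0)"
      by (intro prod.cong refl has_bochner_integral_integral_eq hi)
    also have "\<dots> = (if \<beta>' = \<beta> then of_real (\<Prod>i\<in>I. 2 * pi * \<kappa> i) else 0)"
    proof (cases "\<beta>' = \<beta>")
      case True
      then show ?thesis using \<beta>(2) by simp
    next
      case False
      then obtain i where "i \<in> I" "g \<beta>' i \<noteq> m i" using inj[OF b] by blast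
      then show ?thesis using False finI by (auto intro!: bexI[of _ i])
    qed
    finally show ?thesis .
  qed
  have "of_real (pr x) ^ k * (\<integral>\<phi>. fourier_integrand k m x \<kappa> \<phi> \<partial>Pi\<^sub>M I (\<lambda>_. lborel)) = (\<integral>\<phi>. of_real (pr x) ^ k * fourier_integrand k m x \<kappa> \<phi> \<partial>Pi\<^sub>M I (\<lambda>_. lborel))"
    by (cases "of_real (pr x) ^ k = (0::complex)") simp_all
  also have "\<dots> = (\<Sum>\<beta>\<in>B. of_real (d \<beta> * (\<Prod>i\<in>I. x i ^ g \<beta> i)) * (\<integral>\<phi>. (\<Prod>i\<in>I. h \<beta> i (\<phi> i)) \<partial>Pi\<^sub>M I (\<lambda>_. lborel)))"
    unfolding eq by (subst Bochner_Integration.integral_sum) (use int in auto)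
  also have "\<dots> = (\<Sum>\<beta>'\<in>B. if \<beta>' = \<beta> then of_real (d \<beta> * (\<Prod>i\<in>I. x i ^ g \<beta> i)) * of_real (\<Prod>i\<in>I. 2 * pi * \<kappa> i) else 0)"
    by (intro sum.cong) (auto simp: val)
  also have "\<dots> = of_real (d \<beta> * (\<Prod>i\<in>I. x i ^ m i) * (\<Prod>i\<in>I. 2 * pi * \<kappa> i))"
    using finB \<beta> by simp
  finally show ?thesis .
qed

end

lemma cis_remainder: "cmod (cis y - 1 - \<i> * of_real y + of_real (y\<^sup>2 / 2)) \<le> \<bar>y\<bar> ^ 3"
proof -
  have "cmod (exp (\<i> * of_real y) - (\<Sum>j\<le>2. (\<i> * of_real y) ^ j / fact j)) \<le> exp \<bar>Re (\<i> * of_real y)\<bar> * cmod (\<i> * of_real y) ^ Suc 2 / fact 2"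
    by (rule Taylor_exp)
  also have "Re (\<i> * complex_of_real y) = 0" by simp
  also have "cmod (\<i> * complex_of_real y) = \<bar>y\<bar>" by (simp add: norm_mult)
  also have "exp \<bar>0\<bar> * \<bar>y\<bar> ^ Suc 2 / fact 2 \<le> \<bar>y\<bar> ^ 3"
    by (simp only: abs_zero exp_zero mult_1 numeral_2_eq_2[symmetric] numeral_3_eq_3[symmetric] eval_nat_numeral(3)[symmetric]) simp
  also have "(\<Sum>j\<le>2. (\<i> * of_real y) ^ j / fact j) = 1 + \<i> * of_real y - complex_of_real (y\<^sup>2 / 2)"
    by (simp add: numeral_2_eq_2 complex_eq_iff)
  finally show ?thesis by (simp add: cis_conv_exp algebra_simps)
qed

section \<open>The limit of the rescaled Fourier integrals\<close>

context strict_chart begin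

text \<open>By \<open>mom\<close>, k times the mean exponent at \<open>x n\<close> is
  \<open>m n\<close>, so the linear phases cancel. The integrand tends to a Gaussian in the
  directions \<open>U\<close> times one Poissonian factor for each other direction, and
  \<open>dominance\<close> supplies an integrable majorant. Both factors have positive
  integral.\<close>

lemma local_limit:
  fixes x :: "nat \<Rightarrow> 'a \<Rightarrow> real" and m :: "nat \<Rightarrow> 'a \<Rightarrow> nat" and k :: "nat \<Rightarrow> nat"
  assumes k: "filterlim k at_top sequentially" and k0: "\<And>n. k n > 0"
    and box: "\<And>n i. i \<in> I \<Longrightarrow> 0 \<le> x n i \<and> x n i \<le> 1"
    and mom: "\<And>n i. i \<in> I \<Longrightarrow> real (k n) * (x n i * Rr i (x n)) = real (m n i)"
    and UI: "U \<subseteq> I" and U: "\<And>n i. i \<in> U \<Longrightarrow> m n i > n" and Bd: "\<And>n i. i \<in> I - U \<Longrightarrow> m n i = M i"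
    and xl: "\<And>i. i \<in> I \<Longrightarrow> (\<lambda>n. x n i) \<longlonglongrightarrow> xs i"
  shows "\<exists>\<kappa>. (\<forall>n. \<forall>i\<in>I. \<kappa> n i > 0) \<and> (\<exists>r>0. (\<lambda>n. \<integral>\<phi>. fourier_integrand (k n) (m n) (x n) (\<kappa> n) \<phi> \<partial>Pi\<^sub>M I (\<lambda>_. lborel)) \<longlonglongrightarrow> of_real r)"
proof -
  interpret P: product_sigma_finite "\<lambda>_::'a. lborel :: real measure" by standard
  have nn: "nonneg (x n)" for n using box by (auto simp: nonneg_def)
  have nxs: "nonneg xs" unfolding nonneg_def by (intro ballI, rule LIMSEQ_le_const[OF xl]) (use box in auto)
  have Rl: "(\<lambda>n. Rr i (x n)) \<longlonglongrightarrow> Rr i xs" if "i \<in> I" for i by (rule tendsto_Rr[OF nxs that xl])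
  have Rp: "Rr i (x n) > 0" "Rr i xs > 0" if "i \<in> I" for i n by (auto intro!: Rr_pos nn nxs that)
  have kr: "filterlim (\<lambda>n. real (k n)) at_top sequentially"
    using filterlim_compose[OF filterlim_real_sequentially k] .
  have kx: "real (k n) * x n i = real (m n i) / Rr i (x n)" if "i \<in> I" for n i
    using mom[OF that, of n] Rp(1)[OF that, of n] by (simp add: field_simps)
  define J where "J = I - U"
  have finUJ: "finite U" "finite J" using finI UI by (auto simp: J_def intro: finite_subset)
  have IUJ: "I = U \<union> J" "U \<inter> J = {}" using UI by (auto simp: J_def)
  \<comment> \<open>sqrt (k x_i) has the order of the standard deviation of the i-th exponent in the
    k-th power.\<close>
  define \<kappa> where "\<kappa> n i = (if i \<in> U then sqrt (real (k n) * x n i) else 1)" for n i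
  have kxU: "real (k n) * x n i > 0" "x n i > 0" if "i \<in> U" for n i
  proof -
    have iI: "i \<in> I" using that UI by auto
    show 1: "real (k n) * x n i > 0" using U[OF that, of n] Rp[OF iI] by (simp add: kx[OF iI])
    then show "x n i > 0" by (simp add: zero_less_mult_iff)
  qed
  have kpos: "\<kappa> n i > 0" for n i using kxU by (simp add: \<kappa>_def)
  have kxUl: "filterlim (\<lambda>n. real (k n) * x n i) at_top sequentially" if "i \<in> U" for i
  proof -
    have iI: "i \<in> I" using that UI by auto
    have "filterlim (\<lambda>n. m n i) at_top sequentially"
      using U[OF that] by (intro filterlim_at_top_mono[OF filterlim_ident]) (auto intro!: always_eventually less_imp_le)
    then have "filterlim (\<lambda>n. real (m n i)) at_top sequentially" by (rule filterlim_compose[OF filterlim_real_sequentially])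
    moreover have R': "(\<lambda>n. inverse (Rr i (x n))) \<longlonglongrightarrow> inverse (Rr i xs)" using Rl[OF iI] Rp[OF iI] by (intro tendsto_intros) auto
    ultimately have "filterlim (\<lambda>n. inverse (Rr i (x n)) * real (m n i)) at_top sequentially"
      using Rp(2)[OF iI] by (intro filterlim_tendsto_pos_mult_at_top[OF R']) auto
    then show ?thesis by (simp add: kx[OF iI] divide_inverse mult.commute)
  qed
  have kUl: "filterlim (\<lambda>n. \<kappa> n i) at_top sequentially" if "i \<in> U" for i
    unfolding \<kappa>_def using that by (simp add: filterlim_compose[OF sqrt_at_top kxUl[OF that]])
  have kxB: "(\<lambda>n. real (k n) * x n i) \<longlonglongrightarrow> real (M i) / Rr i xs" if "i \<in> J" for i
  proof -
    have iI: "i \<in> I" "i \<in> I - U" using that by (auto simp: J_def)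
    show ?thesis unfolding kx[OF iI(1)] Bd[OF iI(2)] using Rl[OF iI(1)] Rp(2)[OF iI(1)] by (intro tendsto_intros) auto
  qed
  have ik0: "(\<lambda>n. 1 / real (k n)) \<longlonglongrightarrow> 0"
    using kr by (intro tendsto_divide_0[OF tendsto_const] filterlim_at_top_imp_at_infinity)
  have isk0: "(\<lambda>n. 1 / sqrt (real (k n))) \<longlonglongrightarrow> 0"
    using kr by (intro tendsto_divide_0[OF tendsto_const] filterlim_at_top_imp_at_infinity filterlim_compose[OF sqrt_at_top])
  \<comment> \<open>A bounded exponent keeps k x_i bounded, so the coordinate itself tends to
    0.\<close>
  have xsJ: "xs i = 0" if "i \<in> J" for i
  proof -
    have "(\<lambda>n. (real (k n) * x n i) * (1 / real (k n))) \<longlonglongrightarrow> real (M i) / Rr i xs * 0"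
      by (intro tendsto_intros kxB that ik0)
    then have "(\<lambda>n. x n i) \<longlonglongrightarrow> 0" using k0 by simp
    then show ?thesis using xl[of i] that LIMSEQ_unique by (auto simp: J_def)
  qed
  define E where "E t = cis t - 1 - \<i> * of_real t" for t
  define Sa where "Sa = {a\<in>S. \<forall>b\<in>J. e a b = 0}"
  \<comment> \<open>\<open>v a\<close> is the limit of sqrt (k |wt a|) times the phase of the term
    \<open>a\<close>; the root needs the absolute value, and the sign of \<open>c a\<close> returns
    in \<open>GU\<close>. \<open>l\<close> is the limit of sqrt k times the mean phase, so the
    exponent of \<open>GU\<close> is minus one half of a limit variance.\<close>
  define v where "v a \<phi> = (\<Sum>i\<in>U. real (e a i) * sqrt (\<bar>c a\<bar> * mono1 a i xs / pr xs) * \<phi> i)" for a and \<phi> :: "'a \<Rightarrow> real"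
  define l where "l \<phi> = (\<Sum>i\<in>U. sqrt (xs i) * Rr i xs * \<phi> i)" for \<phi> :: "'a \<Rightarrow> real"
  define GU where "GU \<phi> = exp (((l \<phi>)\<^sup>2 - (\<Sum>a\<in>Sa. sgn (c a) * (v a \<phi>)\<^sup>2)) / 2)" for \<phi> :: "'a \<Rightarrow> real"
  define hb where "hb b t = indicator {-pi..pi} t *\<^sub>R exp (of_nat (M b) * E t)" for b t
  define gl where "gl \<phi> = of_real (GU \<phi>) * (\<Prod>b\<in>J. hb b (\<phi> b))" for \<phi> :: "'a \<Rightarrow> real"
  have ptw: "(\<lambda>n. fourier_integrand (k n) (m n) (x n) (\<kappa> n) \<phi>) \<longlonglongrightarrow> gl \<phi>" for \<phi> :: "'a \<Rightarrow> real"
  proof -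
    define \<theta> where "\<theta> n i = \<phi> i / \<kappa> n i" for n i
    have thU: "(\<lambda>n. \<theta> n i) \<longlonglongrightarrow> 0" if "i \<in> U" for i
      unfolding \<theta>_def using kUl[OF that] by (intro tendsto_divide_0[OF tendsto_const] filterlim_at_top_imp_at_infinity)
    have thJ: "\<theta> n i = \<phi> i" if "i \<in> J" for n i using that by (simp add: \<theta>_def \<kappa>_def J_def)
    define y where "y n = \<i> * complex_of_real (\<Sum>i\<in>I. real (m n i) * \<theta> n i)" for n
    have phl: "(\<lambda>n. ph a (\<theta> n)) \<longlonglongrightarrow> (\<Sum>b\<in>J. real (e a b) * \<phi> b)" for a
    proof -
      have "(\<lambda>n. (\<Sum>i\<in>U. real (e a i) * \<theta> n i) + (\<Sum>b\<in>J. real (e a b) * \<phi> b)) \<longlonglongrightarrow> (\<Sum>i\<in>U. real (e a i) * 0) + (\<Sum>b\<in>J. real (e a b) * \<phi> b)"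
        by (intro tendsto_intros thU)
      moreover have "ph a (\<theta> n) = (\<Sum>i\<in>U. real (e a i) * \<theta> n i) + (\<Sum>b\<in>J. real (e a b) * \<phi> b)" for n
        unfolding ph_def by (subst IUJ(1), subst sum.union_disjoint) (auto simp: finUJ IUJ(2) thJ)
      ultimately show ?thesis by simp
    qed
    \<comment> \<open>By \<open>mom\<close> and \<open>mean_eq\<close>, \<open>y n\<close> is \<i> k
      times the mean phase; subtracting it removes the linear part of every term and leaves
      \<open>E\<close>.\<close>
    have dec: "of_nat (k n) * (chi (x n) (\<theta> n) - 1) - y n = (\<Sum>a\<in>S. of_real (real (k n) * wt (x n) a) * E (ph a (\<theta> n)))" for n
    proof -
      have "(\<Sum>i\<in>I. real (m n i) * \<theta> n i) = (\<Sum>i\<in>I. real (k n) * ((\<Sum>a\<in>S. wt (x n) a * real (e a i)) * \<theta> n i))"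
        by (intro sum.cong refl) (simp add: mom[symmetric] mean_eq)
      also have "\<dots> = (\<Sum>a\<in>S. real (k n) * wt (x n) a * ph a (\<theta> n))"
        by (simp add: ph_def sum_distrib_left sum_distrib_right mult_ac sum.swap[of _ I S])
      finally have "y n = (\<Sum>a\<in>S. of_real (real (k n) * wt (x n) a) * (\<i> * of_real (ph a (\<theta> n))))"
        by (simp add: y_def sum_distrib_left mult_ac)
      moreover have "chi (x n) (\<theta> n) - 1 = (\<Sum>a\<in>S. of_real (wt (x n) a) * (cis (ph a (\<theta> n)) - 1))"
        using sum_wt[OF nn, of n] by (simp add: chi_def right_diff_distrib sum_subtractf flip: of_real_sum)
      ultimately show ?thesis
        by (simp add: E_def sum_distrib_left sum_subtractf[symmetric] algebra_simps)
    qed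
    \<comment> \<open>The limit of k * wt a for a term \<open>a\<close> that contains the bounded
      coordinate \<open>b\<close>.\<close>
    define \<omega> where "\<omega> a b = (real (M b) / Rr b xs) * (c a * mono1 a b xs / pr xs)" for a b
    define Lt where "Lt a = (if a \<in> Sa then - of_real (sgn (c a) * (v a \<phi>)\<^sup>2 / 2) else 0) + (\<Sum>b\<in>J. of_real (real (e a b) * \<omega> a b) * E (\<phi> b))" for a
    have lim_t: "(\<lambda>n. of_real (real (k n) * wt (x n) a) * E (ph a (\<theta> n))) \<longlonglongrightarrow> Lt a" if a: "a \<in> S" for a
    proof (cases "a \<in> Sa")
      case True
      have e0: "e a b = 0" if "b \<in> J" for b using True that by (simp add: Sa_def)
      define vn where "vn n = (\<Sum>i\<in>U. real (e a i) * sqrt (\<bar>c a\<bar> * mono1 a i (x n) / pr (x n)) * \<phi> i)" for n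
      have vl: "vn \<longlonglongrightarrow> v a \<phi>"
        unfolding vn_def v_def using pr_pos[OF nxs] UI by (intro tendsto_intros tendsto_mono1 tendsto_pr xl) auto
      have m1: "mono1 a i (x n) \<ge> 0" if "i \<in> I" for i n
        unfolding mono1_def using box that by (intro mult_nonneg_nonneg prod_nonneg zero_le_power) auto
      have sv: "sqrt (real (k n) * \<bar>wt (x n) a\<bar>) * ph a (\<theta> n) = vn n" for n
      proof -
        have A: "ph a (\<theta> n) = (\<Sum>i\<in>U. real (e a i) * \<theta> n i)"
          unfolding ph_def by (subst IUJ(1), subst sum.union_disjoint) (auto simp: finUJ IUJ(2) e0)
        have B: "sqrt (real (k n) * \<bar>wt (x n) a\<bar>) * (real (e a i) * \<theta> n i) = real (e a i) * sqrt (\<bar>c a\<bar> * mono1 a i (x n) / pr (x n)) * \<phi> i" if i: "i \<in> U" for i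
        proof (cases "e a i = 0")
          case False
          have iI: "i \<in> I" using i UI by auto
          have "real (k n) * \<bar>wt (x n) a\<bar> = (real (k n) * x n i) * (\<bar>c a\<bar> * mono1 a i (x n) / pr (x n))"
            using False kxU(2)[OF i, of n] pr_pos[OF nn, of n] m1[OF iI, of n] by (simp add: wt_def mon_eq_mono1[OF iI] abs_mult)
          then have "sqrt (real (k n) * \<bar>wt (x n) a\<bar>) = sqrt (real (k n) * x n i) * sqrt (\<bar>c a\<bar> * mono1 a i (x n) / pr (x n))"
            by (simp only: real_sqrt_mult)
          then have "sqrt (real (k n) * \<bar>wt (x n) a\<bar>) = \<kappa> n i * sqrt (\<bar>c a\<bar> * mono1 a i (x n) / pr (x n))"
            using i by (simp add: \<kappa>_def)
          then show ?thesis using kpos[of n i] by (simp add: \<theta>_def)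
        qed simp
        show ?thesis unfolding vn_def A sum_distrib_left by (intro sum.cong refl B)
      qed
      have sv2: "real (k n) * \<bar>wt (x n) a\<bar> * (ph a (\<theta> n))\<^sup>2 = (vn n)\<^sup>2" for n
        unfolding sv[symmetric] by (simp add: power_mult_distrib)
      have ph0: "(\<lambda>n. ph a (\<theta> n)) \<longlonglongrightarrow> 0" using phl[of a] e0 by simp
      have "(\<lambda>n. of_real (real (k n) * \<bar>wt (x n) a\<bar>) * E (ph a (\<theta> n)) + of_real ((vn n)\<^sup>2 / 2)) \<longlonglongrightarrow> 0"
      proof (rule Lim_null_comparison[OF always_eventually[OF allI]])
        show "(\<lambda>n. (vn n)\<^sup>2 * \<bar>ph a (\<theta> n)\<bar>) \<longlonglongrightarrow> 0"
          using tendsto_mult[OF tendsto_power[OF vl, of 2] tendsto_rabs[OF ph0]] by simp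
        fix n
        have "of_real (real (k n) * \<bar>wt (x n) a\<bar>) * E (ph a (\<theta> n)) + of_real ((vn n)\<^sup>2 / 2) =
          of_real (real (k n) * \<bar>wt (x n) a\<bar>) * (cis (ph a (\<theta> n)) - 1 - \<i> * of_real (ph a (\<theta> n)) + of_real ((ph a (\<theta> n))\<^sup>2 / 2))"
          unfolding sv2[symmetric] E_def by (simp add: algebra_simps)
        also have "cmod \<dots> \<le> real (k n) * \<bar>wt (x n) a\<bar> * \<bar>ph a (\<theta> n)\<bar> ^ 3"
          unfolding norm_mult norm_of_real abs_mult abs_abs by (intro mult_mono cis_remainder) auto
        also have "\<dots> = (vn n)\<^sup>2 * \<bar>ph a (\<theta> n)\<bar>"
          unfolding sv2[symmetric] by (simp add: power3_eq_cube power2_eq_square abs_mult[symmetric] mult_ac)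
        finally show "cmod (of_real (real (k n) * \<bar>wt (x n) a\<bar>) * E (ph a (\<theta> n)) + of_real ((vn n)\<^sup>2 / 2)) \<le> (vn n)\<^sup>2 * \<bar>ph a (\<theta> n)\<bar>" .
      qed
      then have "(\<lambda>n. of_real (sgn (c a)) * ((of_real (real (k n) * \<bar>wt (x n) a\<bar>) * E (ph a (\<theta> n)) + of_real ((vn n)\<^sup>2 / 2)) - of_real ((vn n)\<^sup>2 / 2))) \<longlonglongrightarrow> of_real (sgn (c a)) * (0 - of_real ((v a \<phi>)\<^sup>2 / 2))"
        by (intro tendsto_intros vl) auto
      moreover have "of_real (sgn (c a)) * ((of_real (real (k n) * \<bar>wt (x n) a\<bar>) * E (ph a (\<theta> n)) + of_real ((vn n)\<^sup>2 / 2)) - of_real ((vn n)\<^sup>2 / 2))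
          = of_real (real (k n) * wt (x n) a) * E (ph a (\<theta> n))" for n
      proof -
        have "mon a (x n) \<ge> 0" unfolding mon_def using box by (intro prod_nonneg zero_le_power) auto
        then have "\<bar>wt (x n) a\<bar> = \<bar>c a\<bar> * (mon a (x n) / pr (x n))" using pr_pos[OF nn, of n] by (simp add: wt_def abs_mult)
        then have "sgn (c a) * \<bar>wt (x n) a\<bar> = (sgn (c a) * \<bar>c a\<bar>) * (mon a (x n) / pr (x n))" by simp
        then have "sgn (c a) * \<bar>wt (x n) a\<bar> = wt (x n) a" by (simp add: sgn_mult_abs wt_def)
        then have "of_real (sgn (c a)) * of_real \<bar>wt (x n) a\<bar> = complex_of_real (wt (x n) a)" by (simp flip: of_real_mult)
        then show ?thesis by (simp add: mult_ac)
      qed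
      moreover have "Lt a = of_real (sgn (c a)) * (0 - of_real ((v a \<phi>)\<^sup>2 / 2))"
        using True e0 by (simp add: Lt_def)
      ultimately show ?thesis by (simp only:)
    next
      case False
      then obtain b where b: "b \<in> J" "e a b > 0" using a by (auto simp: Sa_def)
      have bI: "b \<in> I" using b by (auto simp: J_def)
      have "(\<lambda>n. (real (k n) * x n b) * (c a * mono1 a b (x n) / pr (x n))) \<longlonglongrightarrow> \<omega> a b"
        unfolding \<omega>_def using pr_pos[OF nxs] b bI by (intro tendsto_intros kxB tendsto_mono1 tendsto_pr xl) auto
      moreover have "(real (k n) * x n b) * (c a * mono1 a b (x n) / pr (x n)) = real (k n) * wt (x n) a" for n
        using b by (simp add: wt_def mon_eq_mono1[OF bI])
      ultimately have w: "(\<lambda>n. real (k n) * wt (x n) a) \<longlonglongrightarrow> \<omega> a b" by simp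
      have lim: "(\<lambda>n. of_real (real (k n) * wt (x n) a) * E (ph a (\<theta> n))) \<longlonglongrightarrow> of_real (\<omega> a b) * E (\<Sum>b\<in>J. real (e a b) * \<phi> b)"
        unfolding E_def by (intro tendsto_intros w phl)
      \<comment> \<open>Terms with two bounded coordinates, or with a higher power of one, have
        limit 0 even after multiplication by k; only terms linear in one bounded coordinate feed the
        Poissonian part.\<close>
      have "of_real (\<omega> a b) * E (\<Sum>b\<in>J. real (e a b) * \<phi> b) = (\<Sum>b\<in>J. of_real (real (e a b) * \<omega> a b) * E (\<phi> b))"
      proof (cases "e a b = 1 \<and> (\<forall>b'\<in>J. b' \<noteq> b \<longrightarrow> e a b' = 0)")
        case True
        have "(\<Sum>b\<in>J. real (e a b) * \<phi> b) = (\<Sum>b\<in>{b}. real (e a b) * \<phi> b)"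
          using True b finUJ by (intro sum.mono_neutral_right) auto
        moreover have "(\<Sum>b\<in>J. of_real (real (e a b) * \<omega> a b) * E (\<phi> b)) = (\<Sum>b\<in>{b}. of_real (real (e a b) * \<omega> a b) * E (\<phi> b))"
          using True b finUJ by (intro sum.mono_neutral_right) auto
        ultimately show ?thesis using True by simp
      next
        case nt: False
        have z: "mono1 a b' xs = 0" if b': "b' \<in> J" "e a b' > 0" for b'
        proof (cases "e a b' > 1")
          case True then show ?thesis using xsJ[OF b'(1)] by (simp add: mono1_def)
        next
          case F: False
          have "\<exists>b''\<in>J. b'' \<noteq> b' \<and> e a b'' > 0"
          proof (cases "b' = b")
            case True then show ?thesis using nt F b' by auto
          next
            case False then show ?thesis using b by auto
          qed
          then obtain b'' where "b'' \<in> J" "b'' \<noteq> b'" "e a b'' > 0" by blast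
          then show ?thesis using xsJ finI unfolding mono1_def by (auto intro!: bexI[of _ b''] simp: J_def)
        qed
        have "real (e a b') * \<omega> a b' = 0" if "b' \<in> J" for b' using z[OF that] by (cases "e a b' = 0") (auto simp: \<omega>_def)
        then have "(\<Sum>b\<in>J. of_real (real (e a b) * \<omega> a b) * E (\<phi> b)) = 0"
          by (intro sum.neutral ballI) (simp only: of_real_0 mult_zero_left)
        then show ?thesis using z[OF b] by (simp add: \<omega>_def)
      qed
      then show ?thesis using lim False by (simp add: Lt_def)
    qed
    define L where "L = (\<Sum>a\<in>S. Lt a)"
    have L: "(\<lambda>n. of_nat (k n) * (chi (x n) (\<theta> n) - 1) - y n) \<longlonglongrightarrow> L"
      unfolding dec L_def by (intro tendsto_intros lim_t)
    have Leq: "L = - of_real ((\<Sum>a\<in>Sa. sgn (c a) * (v a \<phi>)\<^sup>2) / 2) + (\<Sum>b\<in>J. of_nat (M b) * E (\<phi> b))"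
    proof -
      have "(\<Sum>a\<in>S. if a \<in> Sa then - complex_of_real (sgn (c a) * (v a \<phi>)\<^sup>2 / 2) else 0) = (\<Sum>a\<in>Sa. - complex_of_real (sgn (c a) * (v a \<phi>)\<^sup>2 / 2))"
        using finS by (intro sum.mono_neutral_cong_right) (auto simp: Sa_def)
      also have "\<dots> = - of_real ((\<Sum>a\<in>Sa. sgn (c a) * (v a \<phi>)\<^sup>2) / 2)"
        by (simp add: sum_negf sum_divide_distrib)
      finally have 1: "(\<Sum>a\<in>S. if a \<in> Sa then - complex_of_real (sgn (c a) * (v a \<phi>)\<^sup>2 / 2) else 0) = - of_real ((\<Sum>a\<in>Sa. sgn (c a) * (v a \<phi>)\<^sup>2) / 2)" .
      have "(\<Sum>a\<in>S. \<Sum>b\<in>J. of_real (real (e a b) * \<omega> a b) * E (\<phi> b)) = (\<Sum>b\<in>J. \<Sum>a\<in>S. of_real (real (e a b) * \<omega> a b) * E (\<phi> b))"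
        by (rule sum.swap)
      also have "\<dots> = (\<Sum>b\<in>J. of_nat (M b) * E (\<phi> b))"
      proof (intro sum.cong refl)
        fix b assume b: "b \<in> J"
        then have bI: "b \<in> I" by (auto simp: J_def)
        have R: "Rr b xs = (\<Sum>a\<in>S. c a * real (e a b) * mono1 a b xs / pr xs)" by (simp add: Rr_def sum_divide_distrib)
        \<comment> \<open>The Poisson intensities of the terms containing \<open>b\<close> add up to
          \<open>M b\<close>; this is where the denominator \<open>Rr b xs\<close> in
          \<open>\<omega>\<close> comes from.\<close>
        have "(\<Sum>a\<in>S. real (e a b) * \<omega> a b) = (real (M b) / Rr b xs) * (\<Sum>a\<in>S. c a * real (e a b) * mono1 a b xs / pr xs)"
          unfolding sum_distrib_left \<omega>_def by (intro sum.cong) simp_all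
        then have "(\<Sum>a\<in>S. real (e a b) * \<omega> a b) = real (M b)" using Rp(2)[OF bI] unfolding R[symmetric] by simp
        then show "(\<Sum>a\<in>S. of_real (real (e a b) * \<omega> a b) * E (\<phi> b)) = of_nat (M b) * E (\<phi> b)"
          by (simp only: of_real_sum[symmetric] sum_distrib_right[symmetric] of_real_of_nat_eq)
      qed
      finally show ?thesis unfolding L_def Lt_def sum.distrib 1 by simp
    qed
    have sl: "(\<lambda>n. of_real (sqrt (real (k n))) * (chi (x n) (\<theta> n) - 1)) \<longlonglongrightarrow> \<i> * of_real (l \<phi>)"
    proof -
      have yl: "(\<lambda>n. \<Sum>i\<in>I. real (m n i) * \<theta> n i * (1 / sqrt (real (k n)))) \<longlonglongrightarrow> l \<phi>"
      proof -
        have "(\<lambda>n. (\<Sum>i\<in>U. sqrt (x n i) * Rr i (x n) * \<phi> i) + (\<Sum>i\<in>J. real (M i) * \<phi> i * (1 / sqrt (real (k n))))) \<longlonglongrightarrow> (\<Sum>i\<in>U. sqrt (xs i) * Rr i xs * \<phi> i) + (\<Sum>i\<in>J. real (M i) * \<phi> i * 0)"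
          using UI by (intro tendsto_intros xl Rl isk0) auto
        moreover have "(\<Sum>i\<in>I. real (m n i) * \<theta> n i * (1 / sqrt (real (k n)))) = (\<Sum>i\<in>U. sqrt (x n i) * Rr i (x n) * \<phi> i) + (\<Sum>i\<in>J. real (M i) * \<phi> i * (1 / sqrt (real (k n))))" for n
        proof -
          have "real (m n i) * \<theta> n i * (1 / sqrt (real (k n))) = sqrt (x n i) * Rr i (x n) * \<phi> i" if i: "i \<in> U" for i
          proof -
            have iI: "i \<in> I" using i UI by auto
            have *: "real (k n) * x n i = \<kappa> n i * (sqrt (real (k n)) * sqrt (x n i))" "\<kappa> n i > 0"
            proof -
              have "\<kappa> n i * \<kappa> n i = real (k n) * x n i" using kxU[OF i, of n] i by (simp add: \<kappa>_def)
              moreover have "\<kappa> n i = sqrt (real (k n)) * sqrt (x n i)" using i by (simp add: \<kappa>_def real_sqrt_mult)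
              ultimately show "real (k n) * x n i = \<kappa> n i * (sqrt (real (k n)) * sqrt (x n i))" by simp
            qed (rule kpos)
            have "real (m n i) = \<kappa> n i * (sqrt (real (k n)) * sqrt (x n i)) * Rr i (x n)"
              using mom[OF iI, of n] *(1) by (simp add: mult.assoc[symmetric])
            then show ?thesis using *(2) k0[of n] by (simp add: \<theta>_def field_simps)
          qed
          then show ?thesis
            by (subst IUJ(1), subst sum.union_disjoint) (auto simp: finUJ IUJ(2) thJ Bd J_def[symmetric] intro!: sum.cong, (metis Bd J_def)?)
        qed
        ultimately show ?thesis by (simp add: l_def)
      qed
      have "(\<lambda>n. (of_nat (k n) * (chi (x n) (\<theta> n) - 1) - y n) * of_real (1 / sqrt (real (k n))) + \<i> * of_real (\<Sum>i\<in>I. real (m n i) * \<theta> n i * (1 / sqrt (real (k n)))))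
         \<longlonglongrightarrow> L * of_real 0 + \<i> * of_real (l \<phi>)"
        by (intro tendsto_intros L isk0 yl)
      moreover have "(of_nat (k n) * (chi (x n) (\<theta> n) - 1) - y n) * of_real (1 / sqrt (real (k n))) + \<i> * of_real (\<Sum>i\<in>I. real (m n i) * \<theta> n i * (1 / sqrt (real (k n))))
          = of_real (sqrt (real (k n))) * (chi (x n) (\<theta> n) - 1)" for n
      proof -
        have 1: "\<i> * of_real (\<Sum>i\<in>I. real (m n i) * \<theta> n i * (1 / sqrt (real (k n)))) = y n * of_real (1 / sqrt (real (k n)))"
          unfolding y_def sum_distrib_right[symmetric] by simp
        have "real (k n) * (1 / sqrt (real (k n))) = sqrt (real (k n))"
          using k0[of n] by (simp add: real_div_sqrt)
        then have 2: "of_nat (k n) * complex_of_real (1 / sqrt (real (k n))) = of_real (sqrt (real (k n)))"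
          by (metis of_real_mult of_real_of_nat_eq)
        show ?thesis unfolding 1 2[symmetric] by (simp add: algebra_simps add_divide_distrib diff_divide_distrib)
      qed
      ultimately show ?thesis by simp
    qed
    have main: "(\<lambda>n. (1 + (chi (x n) (\<theta> n) - 1)) ^ k n * exp (- y n)) \<longlonglongrightarrow> exp (L + of_real ((l \<phi>)\<^sup>2 / 2))"
      by (rule power_tendsto_exp[OF _ k sl L]) (auto simp: y_def chi_le_1 nn)
    have ind: "(\<lambda>n. complex_of_real (\<Prod>i\<in>I. indicator {-(pi * \<kappa> n i)..pi * \<kappa> n i} (\<phi> i))) \<longlonglongrightarrow> of_real (\<Prod>b\<in>J. indicator {-pi..pi} (\<phi> b))"
    proof (rule tendsto_of_real, rule tendsto_eventually)
      have "eventually (\<lambda>n. \<forall>i\<in>U. indicator {-(pi * \<kappa> n i)..pi * \<kappa> n i} (\<phi> i) = (1::real)) sequentially"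
      proof (intro eventually_ball_finite ballI finUJ)
        fix i assume "i \<in> U"
        then have "eventually (\<lambda>n. \<kappa> n i > \<bar>\<phi> i\<bar> / pi) sequentially" using kUl by (simp add: filterlim_at_top_dense)
        then show "eventually (\<lambda>n. indicator {-(pi * \<kappa> n i)..pi * \<kappa> n i} (\<phi> i) = (1::real)) sequentially"
        proof eventually_elim
          case (elim n)
          then have "\<bar>\<phi> i\<bar> < pi * \<kappa> n i" by (simp add: field_simps)
          then show ?case by (auto simp: indicator_def)
        qed
      qed
      then show "eventually (\<lambda>n. (\<Prod>i\<in>I. indicator {-(pi * \<kappa> n i)..pi * \<kappa> n i} (\<phi> i)) = (\<Prod>b\<in>J. indicator {-pi..pi} (\<phi> b) :: real)) sequentially"
      proof eventually_elim
        case (elim n)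
        show ?case
          by (subst IUJ(1), subst prod.union_disjoint) (use elim in \<open>auto simp: finI finUJ IUJ(2) \<kappa>_def J_def intro!: prod.cong\<close>)
      qed
    qed
    have "(\<lambda>n. complex_of_real (\<Prod>i\<in>I. indicator {-(pi * \<kappa> n i)..pi * \<kappa> n i} (\<phi> i)) * ((1 + (chi (x n) (\<theta> n) - 1)) ^ k n * exp (- y n)))
      \<longlonglongrightarrow> of_real (\<Prod>b\<in>J. indicator {-pi..pi} (\<phi> b)) * exp (L + of_real ((l \<phi>)\<^sup>2 / 2))"
      by (intro tendsto_mult ind main)
    moreover have "complex_of_real (\<Prod>i\<in>I. indicator {-(pi * \<kappa> n i)..pi * \<kappa> n i} (\<phi> i)) * ((1 + (chi (x n) (\<theta> n) - 1)) ^ k n * exp (- y n)) = fourier_integrand (k n) (m n) (x n) (\<kappa> n) \<phi>" for n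
      by (simp add: fourier_integrand_def y_def \<theta>_def[abs_def] cis_conv_exp mult_ac)
    moreover have "of_real (\<Prod>b\<in>J. indicator {-pi..pi} (\<phi> b)) * exp (L + of_real ((l \<phi>)\<^sup>2 / 2)) = gl \<phi>"
    proof -
      have "exp (L + of_real ((l \<phi>)\<^sup>2 / 2)) = of_real (GU \<phi>) * (\<Prod>b\<in>J. exp (of_nat (M b) * E (\<phi> b)))"
        unfolding Leq GU_def exp_of_real[symmetric] exp_sum[OF finUJ(2), symmetric] exp_add[symmetric]
        by (simp add: field_simps)
      then show ?thesis by (simp add: gl_def hb_def scaleR_conv_of_real prod.distrib mult_ac)
    qed
    ultimately show ?thesis by simp
  qed
  obtain C where C: "C > 0" and dom: "\<And>x \<theta>. (\<forall>i\<in>I. 0 \<le> x i \<and> x i \<le> 1) \<Longrightarrow> 1 - (cmod (chi x \<theta>))\<^sup>2 \<ge> C * (\<Sum>i\<in>I. x i * (1 - cos (\<theta> i)))"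
    using dominance by blast
  \<comment> \<open>\<open>dominance\<close> and \<open>one_minus_cos_ge\<close> bound the square of
    |chi|^k by exp (- C * \<phi>^2 / 8) in each direction of \<open>U\<close>; taking the root gives
    C / 16.\<close>
  define ww where "ww i t = (if i \<in> U then exp (- (C / 16 * t\<^sup>2)) else indicator {-pi..pi} t)" for i t
  define w where "w \<phi> = (\<Prod>i\<in>I. ww i (\<phi> i))" for \<phi> :: "'a \<Rightarrow> real"
  have ww0: "ww i t \<ge> 0" for i t by (simp add: ww_def)
  have ww_int: "integrable lborel (ww i)" for i
  proof (cases "i \<in> U")
    case True
    then show ?thesis unfolding ww_def using integrable_exp_neg_square[of "C / 16"] C by simp
  next
    case False
    then show ?thesis unfolding ww_def by (simp add: integrable_real_indicator emeasure_lborel_Icc_eq)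
  qed
  have w_int: "integrable (Pi\<^sub>M I (\<lambda>_. lborel)) w"
    unfolding w_def by (intro P.product_integrable_prod finI ww_int)
  have bound: "cmod (fourier_integrand (k n) (m n) (x n) (\<kappa> n) \<phi>) \<le> w \<phi>" for n and \<phi> :: "'a \<Rightarrow> real"
  proof (cases "\<forall>i\<in>I. \<phi> i \<in> {-(pi * \<kappa> n i)..pi * \<kappa> n i}")
    case False
    then have "(\<Prod>i\<in>I. indicator {-(pi * \<kappa> n i)..pi * \<kappa> n i} (\<phi> i)) = (0::real)" using finI by (auto simp: indicator_def)
    then show ?thesis unfolding fourier_integrand_def w_def using ww0 by (simp add: prod_nonneg)
  next
    case True
    define \<theta> where "\<theta> i = \<phi> i / \<kappa> n i" for i
    have thpi: "\<bar>\<theta> i\<bar> \<le> pi" if "i \<in> I" for i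
    proof -
      have "\<bar>\<phi> i\<bar> \<le> pi * \<kappa> n i" using True that by auto
      then show ?thesis using kpos[of n i] by (simp add: \<theta>_def field_simps)
    qed
    have "(cmod (chi (x n) \<theta>))\<^sup>2 \<le> 1 + - (C * (\<Sum>i\<in>I. x n i * (1 - cos (\<theta> i))))"
      using dom[of "x n" \<theta>] box by auto
    also have "\<dots> \<le> exp (- (C * (\<Sum>i\<in>I. x n i * (1 - cos (\<theta> i)))))" by (rule exp_ge_add_one_self)
    finally have "((cmod (chi (x n) \<theta>))\<^sup>2) ^ k n \<le> exp (- (C * (\<Sum>i\<in>I. x n i * (1 - cos (\<theta> i))))) ^ k n"
      by (intro power_mono) auto
    also have "\<dots> = exp (- (C * (\<Sum>i\<in>I. real (k n) * x n i * (1 - cos (\<theta> i)))))"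
      by (simp add: exp_of_nat_mult[symmetric] sum_distrib_left mult_ac)
    also have "\<dots> \<le> exp (- (C * (\<Sum>i\<in>U. (\<phi> i)\<^sup>2 / 8)))"
    proof -
      have "(\<Sum>i\<in>U. (\<phi> i)\<^sup>2 / 8) \<le> (\<Sum>i\<in>U. real (k n) * x n i * (1 - cos (\<theta> i)))"
      proof (intro sum_mono)
        fix i assume i: "i \<in> U"
        have "(\<kappa> n i)\<^sup>2 = real (k n) * x n i" using kxU[OF i, of n] i by (simp add: \<kappa>_def)
        then have "(\<phi> i)\<^sup>2 / 8 = real (k n) * x n i * ((\<theta> i)\<^sup>2 / 8)" using kxU[OF i, of n] k0[of n] by (simp add: \<theta>_def power_divide)
        also have "\<dots> \<le> real (k n) * x n i * (1 - cos (\<theta> i))"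
          using kxU[OF i, of n] thpi[of i] UI i by (intro mult_left_mono one_minus_cos_ge) auto
        finally show "(\<phi> i)\<^sup>2 / 8 \<le> real (k n) * x n i * (1 - cos (\<theta> i))" .
      qed
      also have "\<dots> \<le> (\<Sum>i\<in>I. real (k n) * x n i * (1 - cos (\<theta> i)))"
        using finI UI box by (intro sum_mono2) (auto intro!: mult_nonneg_nonneg)
      finally show ?thesis using C by simp
    qed
    also have "\<dots> = (exp (- (C / 16 * (\<Sum>i\<in>U. (\<phi> i)\<^sup>2))))\<^sup>2"
      by (simp add: exp_double[symmetric] sum_divide_distrib[symmetric])
    finally have "(cmod (chi (x n) \<theta>) ^ k n)\<^sup>2 \<le> (exp (- (C / 16 * (\<Sum>i\<in>U. (\<phi> i)\<^sup>2))))\<^sup>2"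
      by (simp add: power_mult[symmetric] mult.commute)
    then have "cmod (chi (x n) \<theta>) ^ k n \<le> exp (- (C / 16 * (\<Sum>i\<in>U. (\<phi> i)\<^sup>2)))" by (rule power2_le_imp_le) simp
    also have "\<dots> = (\<Prod>i\<in>U. ww i (\<phi> i))"
      by (simp add: ww_def exp_sum[OF finUJ(1), symmetric] sum_negf sum_distrib_left)
    also have "\<dots> = w \<phi>"
    proof -
      have "ww i (\<phi> i) = 1" if "i \<in> J" for i using that True by (auto simp: ww_def J_def \<kappa>_def indicator_def)
      then show ?thesis unfolding w_def by (subst IUJ(1), subst prod.union_disjoint) (auto simp: finUJ IUJ(2))
    qed
    finally have 1: "cmod (chi (x n) \<theta>) ^ k n \<le> w \<phi>" .
    have "(\<Prod>i\<in>I. indicator {-(pi * \<kappa> n i)..pi * \<kappa> n i} (\<phi> i)) = (1::real)" using True by (intro prod.neutral) (auto simp: indicator_def)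
    then show ?thesis using 1 by (simp add: fourier_integrand_def \<theta>_def[abs_def] norm_mult norm_power)
  qed
  have Gm: "(\<lambda>\<phi>. fourier_integrand (k n) (m n) (x n) (\<kappa> n) \<phi>) \<in> borel_measurable (Pi\<^sub>M I (\<lambda>_. lborel))" for n
    unfolding fourier_integrand_def chi_def ph_def cis_conv_exp by measurable
  have GUm: "GU \<in> borel_measurable (Pi\<^sub>M A (\<lambda>_. lborel))" if "U \<subseteq> A" for A
  proof -
    have comp: "(\<lambda>\<phi>. \<phi> i) \<in> borel_measurable (Pi\<^sub>M A (\<lambda>_. lborel :: real measure))" if "i \<in> U" for i
      using measurable_component_singleton[of i A "\<lambda>_. lborel :: real measure"] that \<open>U \<subseteq> A\<close> by auto
    have [measurable]: "l \<in> borel_measurable (Pi\<^sub>M A (\<lambda>_. lborel))" "v a \<in> borel_measurable (Pi\<^sub>M A (\<lambda>_. lborel))" for a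
      unfolding l_def[abs_def] v_def[abs_def] by (intro borel_measurable_sum borel_measurable_times borel_measurable_const comp; assumption)+
    show ?thesis unfolding GU_def[abs_def] by measurable
  qed
  have hbm: "hb b \<in> borel_measurable lborel" for b
    unfolding hb_def E_def cis_conv_exp by measurable
  have glm: "gl \<in> borel_measurable (Pi\<^sub>M I (\<lambda>_. lborel))"
  proof -
    have "(\<lambda>\<phi>. hb b (\<phi> b)) \<in> borel_measurable (Pi\<^sub>M I (\<lambda>_. lborel))" if "b \<in> J" for b
      by (rule measurable_compose[OF _ hbm]) (use that in \<open>auto simp: J_def intro!: measurable_component_singleton\<close>)
    then show ?thesis unfolding gl_def using GUm[OF UI] by measurable
  qed
  have conv: "(\<lambda>n. \<integral>\<phi>. fourier_integrand (k n) (m n) (x n) (\<kappa> n) \<phi> \<partial>Pi\<^sub>M I (\<lambda>_. lborel)) \<longlonglongrightarrow> (\<integral>\<phi>. gl \<phi> \<partial>Pi\<^sub>M I (\<lambda>_. lborel))"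
    and gl_int: "integrable (Pi\<^sub>M I (\<lambda>_. lborel)) gl"
    using integral_dominated_convergence[OF glm Gm w_int AE_I2[OF ptw] AE_I2[OF bound]]
      integrable_dominated_convergence[OF glm Gm w_int AE_I2[OF ptw] AE_I2[OF bound]] by blast+
  have "\<exists>r>0. integral\<^sup>L lborel (hb b) = of_real r" for b
    using poisson_integral_pos[of "M b"] by (simp add: hb_def[abs_def] E_def)
  then obtain rb where rb: "\<And>b. rb b > 0" "\<And>b. integral\<^sup>L lborel (hb b) = of_real (rb b)" by metis
  have hb_int: "integrable lborel (hb b)" for b
  proof (rule ccontr)
    assume "\<not> ?thesis"
    then have "integral\<^sup>L lborel (hb b) = 0" by (rule not_integrable_integral_eq)
    then show False using rb[of b] by simp
  qed
  define H where "H = (\<Prod>b\<in>J. rb b)"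
  have H: "H > 0" unfolding H_def using rb by (intro prod_pos) auto
  have "(\<integral>\<phi>. gl \<phi> \<partial>Pi\<^sub>M I (\<lambda>_. lborel)) = (\<integral>\<phi>. (\<integral>\<psi>. gl (merge U J (\<phi>, \<psi>)) \<partial>Pi\<^sub>M J (\<lambda>_. lborel)) \<partial>Pi\<^sub>M U (\<lambda>_. lborel))"
    using P.product_integral_fold[OF IUJ(2) finUJ, of gl] gl_int IUJ(1) by simp
  also have "\<dots> = (\<integral>\<phi>. of_real (GU \<phi> * H) \<partial>Pi\<^sub>M U (\<lambda>_. lborel))"
  proof (intro Bochner_Integration.integral_cong refl)
    fix \<phi> :: "'a \<Rightarrow> real"
    have GUe: "GU (merge U J (\<phi>, \<psi>)) = GU \<phi>" for \<psi>
    proof -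
      have "l (merge U J (\<phi>, \<psi>)) = l \<phi>" unfolding l_def by (intro sum.cong) (auto simp: merge_def)
      moreover have "v a (merge U J (\<phi>, \<psi>)) = v a \<phi>" for a unfolding v_def by (intro sum.cong) (auto simp: merge_def)
      ultimately show ?thesis by (simp add: GU_def)
    qed
    have hbe: "(\<Prod>b\<in>J. hb b (merge U J (\<phi>, \<psi>) b)) = (\<Prod>b\<in>J. hb b (\<psi> b))" for \<psi>
      using IUJ(2) by (intro prod.cong) (auto simp: merge_def)
    have "(\<integral>\<psi>. gl (merge U J (\<phi>, \<psi>)) \<partial>Pi\<^sub>M J (\<lambda>_. lborel)) = of_real (GU \<phi>) * (\<integral>\<psi>. (\<Prod>b\<in>J. hb b (\<psi> b)) \<partial>Pi\<^sub>M J (\<lambda>_. lborel))"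
      unfolding gl_def GUe hbe by (rule Bochner_Integration.integral_mult_right) (intro P.product_integrable_prod finUJ hb_int)
    also have "(\<integral>\<psi>. (\<Prod>b\<in>J. hb b (\<psi> b)) \<partial>Pi\<^sub>M J (\<lambda>_. lborel)) = of_real H"
      unfolding H_def by (subst P.product_integral_prod) (auto simp: finUJ hb_int rb)
    finally show "(\<integral>\<psi>. gl (merge U J (\<phi>, \<psi>)) \<partial>Pi\<^sub>M J (\<lambda>_. lborel)) = of_real (GU \<phi> * H)" by simp
  qed
  also have "\<dots> = of_real (integral\<^sup>L (Pi\<^sub>M U (\<lambda>_. lborel)) GU * H)"
    by (subst integral_complex_of_real) simp
  finally have val: "(\<integral>\<phi>. gl \<phi> \<partial>Pi\<^sub>M I (\<lambda>_. lborel)) = of_real (integral\<^sup>L (Pi\<^sub>M U (\<lambda>_. lborel)) GU * H)" .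
  have GUpos: "GU \<phi> > 0" for \<phi> by (simp add: GU_def)
  \<comment> \<open>No diagonalization of the quadratic form: with the bounded coordinates set to 0,
    where the Poissonian factors are 1, the limit of \<open>bound\<close> shows that
    \<open>GU\<close> lies below the same product of Gaussians.\<close>
  have GU_int: "integrable (Pi\<^sub>M U (\<lambda>_. lborel)) GU"
  proof (rule Bochner_Integration.integrable_bound)
    show "integrable (Pi\<^sub>M U (\<lambda>_. lborel)) (\<lambda>\<phi>. \<Prod>i\<in>U. ww i (\<phi> i))"
      by (intro P.product_integrable_prod finUJ ww_int)
    show "GU \<in> borel_measurable (Pi\<^sub>M U (\<lambda>_. lborel))" by (rule GUm) simp
    show "AE \<phi> in Pi\<^sub>M U (\<lambda>_. lborel). norm (GU \<phi>) \<le> norm (\<Prod>i\<in>U. ww i (\<phi> i))"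
    proof (intro AE_I2)
      fix \<phi> :: "'a \<Rightarrow> real"
      define \<psi> where "\<psi> i = (if i \<in> U then \<phi> i else 0)" for i
      have "cmod (gl \<psi>) \<le> w \<psi>" using LIMSEQ_le_const2[OF tendsto_norm[OF ptw[of \<psi>]]] bound by blast
      moreover have "gl \<psi> = of_real (GU \<psi>)"
      proof -
        have "hb b (\<psi> b) = 1" if "b \<in> J" for b using that by (simp add: \<psi>_def J_def hb_def E_def indicator_def)
        then show ?thesis by (simp add: gl_def)
      qed
      moreover have "GU \<psi> = GU \<phi>"
        by (simp add: GU_def l_def v_def \<psi>_def)
      moreover have "w \<psi> = (\<Prod>i\<in>U. ww i (\<phi> i))"
      proof -
        have "ww i (\<psi> i) = 1" if "i \<in> J" for i using that by (simp add: ww_def J_def \<psi>_def indicator_def)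
        then have "w \<psi> = (\<Prod>i\<in>U. ww i (\<psi> i))" unfolding w_def by (subst IUJ(1), subst prod.union_disjoint) (auto simp: finUJ IUJ(2))
        then show ?thesis by (simp add: \<psi>_def)
      qed
      ultimately show "norm (GU \<phi>) \<le> norm (\<Prod>i\<in>U. ww i (\<phi> i))" by simp
    qed
  qed
  have "integral\<^sup>L (Pi\<^sub>M U (\<lambda>_. lborel)) GU > 0"
  proof (rule ccontr)
    assume "\<not> ?thesis"
    moreover have "integral\<^sup>L (Pi\<^sub>M U (\<lambda>_. lborel)) GU \<ge> 0" using GUpos by (intro integral_nonneg_AE AE_I2) (auto intro: less_imp_le)
    ultimately have "integral\<^sup>L (Pi\<^sub>M U (\<lambda>_. lborel)) GU = 0" by simp
    then have "AE \<phi> in Pi\<^sub>M U (\<lambda>_. lborel). GU \<phi> = 0"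
      using integral_nonneg_eq_0_iff_AE[OF GU_int] GUpos by (auto simp: less_imp_le)
    then have "AE \<phi> in Pi\<^sub>M U (\<lambda>_. lborel :: real measure). False" by eventually_elim (use GUpos in \<open>auto simp: less_le\<close>)
    then have "emeasure (Pi\<^sub>M U (\<lambda>_. lborel :: real measure)) (space (Pi\<^sub>M U (\<lambda>_. lborel))) = 0"
      by (simp add: AE_iff_null null_sets_def)
    moreover have "emeasure (Pi\<^sub>M U (\<lambda>_. lborel :: real measure)) (space (Pi\<^sub>M U (\<lambda>_. lborel))) = (\<Prod>i\<in>U. emeasure lborel (UNIV :: real set))"
      unfolding space_PiM by (subst P.emeasure_PiM) (auto simp: finUJ)
    ultimately show False using finUJ by (simp add: prod_zero_iff)
  qed
  then have "integral\<^sup>L (Pi\<^sub>M U (\<lambda>_. lborel)) GU * H > 0" using H by simp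
  then show ?thesis using conv kpos unfolding val by (intro exI[of _ \<kappa>] conjI) blast+
qed

text \<open>\<open>local_limit\<close> speaks of sequences only. Uniformity in \<open>x\<close> and
  \<open>m\<close> follows since counterexamples with growing k have a subsequence to which it
  applies.\<close>

lemma integral_pos_eventually:
  "\<exists>k0. \<forall>k\<ge>k0. \<forall>x m. (\<forall>i\<in>I. 0 \<le> x i \<and> x i \<le> 1 \<and> real k * (x i * Rr i x) = real (m i)) \<longrightarrow>
     (\<exists>\<kappa>. (\<forall>i\<in>I. \<kappa> i > 0) \<and> Re (\<integral>\<phi>. fourier_integrand k m x \<kappa> \<phi> \<partial>Pi\<^sub>M I (\<lambda>_. lborel)) > 0)"
proof (rule ccontr)
  assume neg: "\<not> ?thesis"
  have "\<exists>k x m. k \<ge> Suc n \<and> (\<forall>i\<in>I. 0 \<le> x i \<and> x i \<le> 1 \<and> real k * (x i * Rr i x) = real (m i)) \<and>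
     \<not> (\<exists>\<kappa>. (\<forall>i\<in>I. \<kappa> i > 0) \<and> Re (\<integral>\<phi>. fourier_integrand k m x \<kappa> \<phi> \<partial>Pi\<^sub>M I (\<lambda>_. lborel)) > 0)" for n
    using neg by (simp only: not_ex not_all not_imp) blast
  then have "\<forall>n. \<exists>y. fst y \<ge> Suc n \<and> (\<forall>i\<in>I. 0 \<le> fst (snd y) i \<and> fst (snd y) i \<le> 1 \<and> real (fst y) * (fst (snd y) i * Rr i (fst (snd y))) = real (snd (snd y) i)) \<and>
     \<not> (\<exists>\<kappa>. (\<forall>i\<in>I. \<kappa> i > 0) \<and> Re (\<integral>\<phi>. fourier_integrand (fst y) (snd (snd y)) (fst (snd y)) \<kappa> \<phi> \<partial>Pi\<^sub>M I (\<lambda>_. lborel)) > 0)"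
    by simp
  from choice[OF this] obtain y where y: "\<And>n. fst (y n) \<ge> Suc n \<and> (\<forall>i\<in>I. 0 \<le> fst (snd (y n)) i \<and> fst (snd (y n)) i \<le> 1 \<and> real (fst (y n)) * (fst (snd (y n)) i * Rr i (fst (snd (y n)))) = real (snd (snd (y n)) i)) \<and>
     \<not> (\<exists>\<kappa>. (\<forall>i\<in>I. \<kappa> i > 0) \<and> Re (\<integral>\<phi>. fourier_integrand (fst (y n)) (snd (snd (y n))) (fst (snd (y n))) \<kappa> \<phi> \<partial>Pi\<^sub>M I (\<lambda>_. lborel)) > 0)"
    by blast
  define k x m where "k n = fst (y n)" and "x n = fst (snd (y n))" and "m n = snd (snd (y n))" for n
  have kn: "k n \<ge> Suc n" and box: "\<And>i. i \<in> I \<Longrightarrow> 0 \<le> x n i \<and> x n i \<le> 1"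
    and mom: "\<And>i. i \<in> I \<Longrightarrow> real (k n) * (x n i * Rr i (x n)) = real (m n i)"
    and bad: "\<And>\<kappa>. (\<forall>i\<in>I. \<kappa> i > 0) \<Longrightarrow> \<not> Re (\<integral>\<phi>. fourier_integrand (k n) (m n) (x n) \<kappa> \<phi> \<partial>Pi\<^sub>M I (\<lambda>_. lborel)) > 0" for n
    using y[of n] unfolding k_def x_def m_def by blast+
  obtain r1 xs where r1: "strict_mono r1" "\<forall>i\<in>I. (\<lambda>n. x (r1 n) i) \<longlonglongrightarrow> xs i"
    using finite_conv_subseq[OF finI, of x] box by (force simp: bounded_iff)
  obtain r2 where r2: "strict_mono r2" "\<forall>i\<in>I. (\<exists>M. \<forall>n. m (r1 (r2 n)) i = M) \<or> (\<forall>n. m (r1 (r2 n)) i > n)"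
    using finite_nat_subseq_const_or_large[OF finI, of "\<lambda>n. m (r1 n)"] by blast
  define r where "r n = r1 (r2 n)" for n
  have rn: "r n \<ge> n" for n
    using seq_suble[OF r1(1), of "r2 n"] seq_suble[OF r2(1), of n] by (simp add: r_def)
  define U where "U = {i\<in>I. \<forall>n. m (r n) i > n}"
  define M where "M i = m (r 0) i" for i
  have "\<exists>\<kappa>. (\<forall>n. \<forall>i\<in>I. \<kappa> n i > 0) \<and> (\<exists>s>0. (\<lambda>n. \<integral>\<phi>. fourier_integrand (k (r n)) (m (r n)) (x (r n)) (\<kappa> n) \<phi> \<partial>Pi\<^sub>M I (\<lambda>_. lborel)) \<longlonglongrightarrow> of_real s)"
  proof (rule local_limit[where U = U and M = M and xs = xs])
    show "filterlim (\<lambda>n. k (r n)) at_top sequentially"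
    proof (rule filterlim_at_top_mono[OF filterlim_ident], intro always_eventually allI)
      show "n \<le> k (r n)" for n using kn[of "r n"] rn[of n] by simp
    qed
    show "k (r n) > 0" for n using kn[of "r n"] by simp
    show "(\<lambda>n. x (r n) i) \<longlonglongrightarrow> xs i" if "i \<in> I" for i
      using LIMSEQ_subseq_LIMSEQ[OF r1(2)[rule_format, OF that] r2(1)] by (simp add: r_def o_def)
    show "m (r n) i = M i" if i: "i \<in> I - U" for n i
    proof -
      have "\<exists>M. \<forall>n. m (r n) i = M" using r2(2) i unfolding U_def r_def by blast
      then show ?thesis by (auto simp: M_def)
    qed
  qed (use box mom in \<open>auto simp: U_def\<close>)
  then obtain \<kappa> s where ks: "\<And>n i. i \<in> I \<Longrightarrow> \<kappa> n i > 0" "s > 0"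
    "(\<lambda>n. \<integral>\<phi>. fourier_integrand (k (r n)) (m (r n)) (x (r n)) (\<kappa> n) \<phi> \<partial>Pi\<^sub>M I (\<lambda>_. lborel)) \<longlonglongrightarrow> of_real s" by blast
  have "(\<lambda>n. Re (\<integral>\<phi>. fourier_integrand (k (r n)) (m (r n)) (x (r n)) (\<kappa> n) \<phi> \<partial>Pi\<^sub>M I (\<lambda>_. lborel))) \<longlonglongrightarrow> s"
    using tendsto_Re[OF ks(3)] by simp
  then have "eventually (\<lambda>n. Re (\<integral>\<phi>. fourier_integrand (k (r n)) (m (r n)) (x (r n)) (\<kappa> n) \<phi> \<partial>Pi\<^sub>M I (\<lambda>_. lborel)) > 0) sequentially"
    using ks(2) by (rule order_tendstoD(1))
  then obtain n where "Re (\<integral>\<phi>. fourier_integrand (k (r n)) (m (r n)) (x (r n)) (\<kappa> n) \<phi> \<partial>Pi\<^sub>M I (\<lambda>_. lborel)) > 0"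
    using eventually_happens by force
  then show False using bad[of "\<kappa> n" "r n"] ks(1) by blast
qed

text \<open>By \<open>coeff_integral\<close> the coefficient times a nonnegative number equals a
  positive integral. The threshold depends on the chart alone, not on the expansion, the exponent or
  the point.\<close>

lemma coeff_pos_eventually:
  "\<exists>k0. \<forall>k\<ge>k0. \<forall>(B :: 'd set) (d :: 'd \<Rightarrow> real) g \<beta> x. finite B \<longrightarrow>
     (\<forall>\<theta>. (of_real (pr x) * chi x \<theta>) ^ k = (\<Sum>\<beta>\<in>B. of_real (d \<beta> * (\<Prod>i\<in>I. x i ^ g \<beta> i)) * cis (\<Sum>i\<in>I. real (g \<beta> i) * \<theta> i))) \<longrightarrow>
     (\<forall>\<beta>'\<in>B. (\<forall>i\<in>I. g \<beta>' i = g \<beta> i) \<longrightarrow> \<beta>' = \<beta>) \<longrightarrow> \<beta> \<in> B \<longrightarrow>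
     (\<forall>i\<in>I. 0 \<le> x i \<and> x i \<le> 1 \<and> real k * (x i * Rr i x) = real (g \<beta> i)) \<longrightarrow> d \<beta> > 0"
proof -
  from integral_pos_eventually obtain k0 where k0: "\<And>k x m. k \<ge> k0 \<Longrightarrow> (\<forall>i\<in>I. 0 \<le> x i \<and> x i \<le> 1 \<and> real k * (x i * Rr i x) = real (m i)) \<Longrightarrow>
     (\<exists>\<kappa>. (\<forall>i\<in>I. \<kappa> i > 0) \<and> Re (\<integral>\<phi>. fourier_integrand k m x \<kappa> \<phi> \<partial>Pi\<^sub>M I (\<lambda>_. lborel)) > 0)" by blast
  show ?thesis
  proof (intro exI[of _ k0] allI impI)
    fix k and B :: "'d set" and d :: "'d \<Rightarrow> real" and g :: "'d \<Rightarrow> 'a \<Rightarrow> nat" and \<beta> x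
    assume A: "k \<ge> k0" "finite B"
      "\<forall>\<theta>. (of_real (pr x) * chi x \<theta>) ^ k = (\<Sum>\<beta>\<in>B. of_real (d \<beta> * (\<Prod>i\<in>I. x i ^ g \<beta> i)) * cis (\<Sum>i\<in>I. real (g \<beta> i) * \<theta> i))"
      "\<forall>\<beta>'\<in>B. (\<forall>i\<in>I. g \<beta>' i = g \<beta> i) \<longrightarrow> \<beta>' = \<beta>" "\<beta> \<in> B"
      "\<forall>i\<in>I. 0 \<le> x i \<and> x i \<le> 1 \<and> real k * (x i * Rr i x) = real (g \<beta> i)"
    from k0[OF A(1,6)] obtain \<kappa> where \<kappa>: "\<And>i. i \<in> I \<Longrightarrow> \<kappa> i > 0" and
      re: "Re (\<integral>\<phi>. fourier_integrand k (g \<beta>) x \<kappa> \<phi> \<partial>Pi\<^sub>M I (\<lambda>_. lborel)) > 0" by blast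
    have nx: "nonneg x" using A(6) by (auto simp: nonneg_def)
    have "of_real (pr x) ^ k * (\<integral>\<phi>. fourier_integrand k (g \<beta>) x \<kappa> \<phi> \<partial>Pi\<^sub>M I (\<lambda>_. lborel)) = of_real (d \<beta> * (\<Prod>i\<in>I. x i ^ g \<beta> i) * (\<Prod>i\<in>I. 2 * pi * \<kappa> i))"
      by (rule coeff_integral[where B = B and g = g and \<beta> = \<beta>]) (use A \<kappa> in auto)
    then have "Re (of_real (pr x ^ k) * (\<integral>\<phi>. fourier_integrand k (g \<beta>) x \<kappa> \<phi> \<partial>Pi\<^sub>M I (\<lambda>_. lborel))) = d \<beta> * ((\<Prod>i\<in>I. x i ^ g \<beta> i) * (\<Prod>i\<in>I. 2 * pi * \<kappa> i))"
      by (simp only: of_real_power Re_complex_of_real mult.assoc)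
    then have "0 < d \<beta> * ((\<Prod>i\<in>I. x i ^ g \<beta> i) * (\<Prod>i\<in>I. 2 * pi * \<kappa> i))"
      using re pr_pos[OF nx]
      by (simp only: scaleR_conv_of_real[symmetric] scaleR_complex.sel(1)) (metis mult_pos_pos zero_less_power)
    moreover have "0 \<le> (\<Prod>i\<in>I. x i ^ g \<beta> i) * (\<Prod>i\<in>I. 2 * pi * \<kappa> i)"
      using A(6) \<kappa> by (intro mult_nonneg_nonneg prod_nonneg ballI zero_le_power) (auto intro: less_imp_le)
    ultimately show "d \<beta> > 0" by (simp add: zero_less_mult_iff)
  qed
qed

end

section \<open>Saddle points in the unit box\<close>

context strict_chart begin

text \<open>The function maximized in the saddle point method: the vanishing of its logarithmic
  derivatives is the moment equation \<open>mom\<close> of \<open>local_limit\<close>.\<close>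

definition monomial_ratio :: "('a \<Rightarrow> nat) \<Rightarrow> nat \<Rightarrow> ('a \<Rightarrow> real) \<Rightarrow> real" where
  "monomial_ratio \<alpha> k x = (\<Prod>i\<in>I. x i ^ \<alpha> i) / pr x ^ k"

lemma monomial_ratio_box_max: "\<exists>x. (\<forall>i\<in>I. 0 \<le> x i \<and> x i \<le> 1) \<and> (\<forall>y. (\<forall>i\<in>I. 0 \<le> y i \<and> y i \<le> 1) \<longrightarrow> monomial_ratio \<alpha> k y \<le> monomial_ratio \<alpha> k x)"
proof -
  \<comment> \<open>Coordinates outside \<open>I\<close> are frozen at 0, so that the box is compact
    in the space of all functions.\<close>
  define K where "K = (PiE UNIV (\<lambda>i. if i \<in> I then {0..1} else {0}) :: ('a \<Rightarrow> real) set)"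
  have "compactin (product_topology (\<lambda>i. euclidean) UNIV) K"
    unfolding K_def compactin_PiE by auto
  then have K: "compact K" by (simp add: euclidean_product_topology compactin_euclidean_iff)
  have nn: "nonneg y" if "y \<in> K" for y
    using that unfolding K_def nonneg_def PiE_def Pi_def by (auto split: if_splits)
  have cont: "continuous_on K (monomial_ratio \<alpha> k)"
    unfolding monomial_ratio_def[abs_def] pr_def mon_def
    by (intro continuous_intros continuous_on_subset[OF continuous_on_product_coordinates])
       (use pr_pos[OF nn] in \<open>force simp: pr_def mon_def\<close>)+
  have "(\<lambda>_. 0) \<in> K" by (auto simp: K_def)
  then have "K \<noteq> {}" by blast
  from continuous_attains_sup[OF K this cont] obtain x where x: "x \<in> K" "\<And>y. y \<in> K \<Longrightarrow> monomial_ratio \<alpha> k y \<le> monomial_ratio \<alpha> k x" by blast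
  show ?thesis
  proof (intro exI[of _ x] conjI allI impI)
    show "\<forall>i\<in>I. 0 \<le> x i \<and> x i \<le> 1" using x(1) unfolding K_def PiE_def Pi_def by (auto split: if_splits)
    fix y :: "'a \<Rightarrow> real" assume y: "\<forall>i\<in>I. 0 \<le> y i \<and> y i \<le> 1"
    define y' where "y' i = (if i \<in> I then y i else 0)" for i
    have "monomial_ratio \<alpha> k y = monomial_ratio \<alpha> k y'" by (simp add: monomial_ratio_def pr_def mon_def y'_def)
    also have "\<dots> \<le> monomial_ratio \<alpha> k x" using y by (intro x(2)) (auto simp: K_def y'_def)
    finally show "monomial_ratio \<alpha> k y \<le> monomial_ratio \<alpha> k x" .
  qed
qed

text \<open>Maximality among positive points extends to nonnegative points by continuity. A
  coordinate equal to 0 must have \<open>\<alpha> i = 0\<close>, as the maximum is positive, and for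
  a positive coordinate the logarithmic derivative vanishes.\<close>

lemma critical_point:
  assumes x: "nonneg x" and pos: "monomial_ratio \<alpha> k x > 0"
    and max: "\<And>y. (\<And>i. i \<in> I \<Longrightarrow> y i > 0) \<Longrightarrow> monomial_ratio \<alpha> k y \<le> monomial_ratio \<alpha> k x" and i: "i \<in> I"
  shows "real k * (x i * Rr i x) = real (\<alpha> i)"
proof -
  have max': "monomial_ratio \<alpha> k y \<le> monomial_ratio \<alpha> k x" if y: "nonneg y" for y
  proof -
    have "(\<lambda>n. monomial_ratio \<alpha> k (\<lambda>j. y j + inverse (real (Suc n)))) \<longlonglongrightarrow> monomial_ratio \<alpha> k (\<lambda>j. y j)"
    proof -
      have l: "(\<lambda>n. y j + inverse (real (Suc n))) \<longlonglongrightarrow> y j" for j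
        using tendsto_add[OF tendsto_const[of "y j"] LIMSEQ_inverse_real_of_nat] by simp
      show ?thesis unfolding monomial_ratio_def using pr_pos[OF y]
        by (intro tendsto_intros tendsto_pr l) auto
    qed
    moreover have "monomial_ratio \<alpha> k (\<lambda>j. y j + inverse (real (Suc n))) \<le> monomial_ratio \<alpha> k x" for n
      using y by (intro max) (auto simp: nonneg_def intro!: add_nonneg_pos)
    ultimately show ?thesis by (intro LIMSEQ_le_const2) auto
  qed
  have xpow: "x j ^ \<alpha> j > 0" if "j \<in> I" for j
  proof -
    have "(\<Prod>i\<in>I. x i ^ \<alpha> i) \<noteq> 0" using pos by (auto simp: monomial_ratio_def)
    then have "x j ^ \<alpha> j \<noteq> 0" using that unfolding prod_zero_iff[OF finI] by blast
    moreover have "x j ^ \<alpha> j \<ge> 0" using x that by (intro zero_le_power) (auto simp: nonneg_def)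
    ultimately show ?thesis by linarith
  qed
  show ?thesis
  proof (cases "x i = 0")
    case True
    then have "\<alpha> i = 0" using xpow[OF i] by (cases "\<alpha> i") auto
    then show ?thesis using True by simp
  next
    case False
    then have xi: "x i > 0" using x i by (simp add: nonneg_def less_le)
    define X where "X t = x(i := t)" for t
    define A where "A = (\<Prod>j\<in>I - {i}. x j ^ \<alpha> j)"
    have A: "A > 0" unfolding A_def using xpow by (intro prod_pos) auto
    define m where "m a = (\<Prod>j\<in>I - {i}. x j ^ e a j)" for a
    have nX: "nonneg (X t)" if "t > 0" for t using x that by (auto simp: X_def nonneg_def)
    have monX: "mon a (X t) = m a * t ^ e a i" for a t
      unfolding mon_def m_def using finI i by (subst prod.remove[of I i]) (auto simp: X_def mult.commute intro!: prod.cong)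
    have prX: "pr (X t) = (\<Sum>a\<in>S. c a * m a * t ^ e a i)" for t
      by (simp add: pr_def monX mult_ac)
    have ffX: "monomial_ratio \<alpha> k (X t) = t ^ \<alpha> i * A / pr (X t) ^ k" for t
      unfolding monomial_ratio_def A_def using finI i by (subst prod.remove[of I i]) (auto simp: X_def intro!: prod.cong)
    define g where "g t = real (\<alpha> i) * ln t - real k * ln (pr (X t))" for t
    have lnff: "ln (monomial_ratio \<alpha> k (X t)) = g t + ln A" if t: "t > 0" for t
      unfolding ffX g_def using A t pr_pos[OF nX[OF t]] by (simp add: ln_mult ln_div ln_realpow)
    have gm: "g t \<le> g (x i)" if t: "t > 0" for t
    proof -
      have "X (x i) = x" by (simp add: X_def)
      have "monomial_ratio \<alpha> k (X t) > 0" unfolding ffX using A t pr_pos[OF nX[OF t]] by simp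
      then have "ln (monomial_ratio \<alpha> k (X t)) \<le> ln (monomial_ratio \<alpha> k (X (x i)))"
        using max'[OF nX[OF t]] \<open>X (x i) = x\<close> by simp
      then show ?thesis using lnff[OF t] lnff[OF xi] by simp
    qed
    define Q where "Q = (\<Sum>a\<in>S. c a * m a * (real (e a i) * x i ^ (e a i - 1)))"
    have "((\<lambda>t. pr (X t)) has_real_derivative Q) (at (x i))"
      unfolding prX Q_def by (auto intro!: derivative_eq_intros simp: mult_ac)
    then have "(g has_real_derivative (real (\<alpha> i) / x i - real k * (Q / pr (X (x i))))) (at (x i))"
      unfolding g_def using xi pr_pos[OF nX[OF xi]] by (auto intro!: derivative_eq_intros simp: divide_inverse mult_ac)
    then have "real (\<alpha> i) / x i - real k * (Q / pr (X (x i))) = 0"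
      by (rule DERIV_local_max[OF _ xi]) (use gm in \<open>auto simp: abs_if split: if_splits\<close>)
    moreover have "Q / pr (X (x i)) = Rr i x"
      by (simp add: Q_def Rr_def X_def mono1_def m_def mult_ac)
    ultimately show ?thesis using xi by (simp add: field_simps)
  qed
qed

end

section \<open>Evaluation of polynomials\<close>

locale coeff_hom =
  fixes h :: "'a::comm_semiring_1 \<Rightarrow> 'b::comm_semiring_1"
  assumes h0: "h 0 = 0" and h1: "h 1 = 1" and hadd: "h (a + b) = h a + h b" and hmult: "h (a * b) = h a * h b"
begin

end

global_interpretation of_int_coeff: coeff_hom "of_int :: int \<Rightarrow> 'b::comm_ring_1" by unfold_locales auto
global_interpretation of_nat_coeff: coeff_hom "of_nat :: nat \<Rightarrow> 'b::comm_semiring_1" by unfold_locales auto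

definition monomial_value :: "('v \<Rightarrow>\<^sub>0 nat) \<Rightarrow> ('v \<Rightarrow> 'b::comm_semiring_1) \<Rightarrow> 'b" where
  "monomial_value \<alpha> z = (\<Prod>v\<in>Poly_Mapping.keys \<alpha>. z v ^ Poly_Mapping.lookup \<alpha> v)"

lemma monomial_value_superset:
  assumes "finite W" "Poly_Mapping.keys \<alpha> \<subseteq> W"
  shows "monomial_value \<alpha> z = (\<Prod>v\<in>W. z v ^ Poly_Mapping.lookup \<alpha> v)"
  unfolding monomial_value_def using assms by (intro prod.mono_neutral_left) (auto simp: in_keys_iff)

lemma monomial_value_add: "monomial_value (\<alpha> + \<beta>) z = monomial_value \<alpha> z * monomial_value \<beta> z"
proof -
  define W where "W = Poly_Mapping.keys \<alpha> \<union> Poly_Mapping.keys \<beta>"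
  have W: "finite W" "Poly_Mapping.keys \<alpha> \<subseteq> W" "Poly_Mapping.keys \<beta> \<subseteq> W" "Poly_Mapping.keys (\<alpha> + \<beta>) \<subseteq> W"
    using Poly_Mapping.keys_add[of \<alpha> \<beta>] by (auto simp: W_def)
  show ?thesis using W by (simp add: monomial_value_superset[of W] lookup_add power_add prod.distrib)
qed

lemma monomial_value_0 [simp]: "monomial_value 0 z = 1" by (simp add: monomial_value_def)

lemma poly_value_alt: "poly_value h q z = (\<Sum>\<alpha>\<in>Poly_Mapping.keys q. h (Poly_Mapping.lookup q \<alpha>) * monomial_value \<alpha> z)"
  by (simp add: poly_value_def monomial_value_def)

lemma poly_mapping_eq_sum_single: "q = (\<Sum>\<alpha>\<in>Poly_Mapping.keys q. Poly_Mapping.single \<alpha> (Poly_Mapping.lookup q \<alpha>))"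
proof (rule poly_mapping_eqI)
  fix k
  show "Poly_Mapping.lookup q k = Poly_Mapping.lookup (\<Sum>\<alpha>\<in>Poly_Mapping.keys q. Poly_Mapping.single \<alpha> (Poly_Mapping.lookup q \<alpha>)) k"
    by (cases "k \<in> Poly_Mapping.keys q") (auto simp: lookup_sum lookup_single when_def in_keys_iff)
qed

context coeff_hom begin

lemma poly_value_superset:
  assumes "finite W" "Poly_Mapping.keys q \<subseteq> W"
  shows "poly_value h q z = (\<Sum>\<alpha>\<in>W. h (Poly_Mapping.lookup q \<alpha>) * monomial_value \<alpha> z)"
  unfolding poly_value_alt using assms by (intro sum.mono_neutral_left) (auto simp: in_keys_iff h0)

lemma poly_value_0 [simp]: "poly_value h 0 z = 0" by (simp add: poly_value_alt)

lemma poly_value_add: "poly_value h (p + q) z = poly_value h p z + poly_value h q z"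
proof -
  define W where "W = Poly_Mapping.keys p \<union> Poly_Mapping.keys q"
  have W: "finite W" "Poly_Mapping.keys p \<subseteq> W" "Poly_Mapping.keys q \<subseteq> W" "Poly_Mapping.keys (p + q) \<subseteq> W"
    using Poly_Mapping.keys_add[of p q] by (auto simp: W_def)
  show ?thesis using W by (simp add: poly_value_superset[of W] lookup_add hadd distrib_right sum.distrib)
qed

lemma poly_value_sum: "poly_value h (sum f A) z = (\<Sum>a\<in>A. poly_value h (f a) z)"
  by (induction A rule: infinite_finite_induct) (auto simp: poly_value_add)

lemma poly_value_single: "poly_value h (Poly_Mapping.single \<alpha> c) z = h c * monomial_value \<alpha> z"
  by (cases "c = 0") (auto simp: poly_value_alt h0)

lemma poly_value_mult: "poly_value h (p * q) z = poly_value h p z * poly_value h q z"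
proof -
  let ?s = "\<lambda>p. (\<lambda>\<alpha>. Poly_Mapping.single \<alpha> (Poly_Mapping.lookup p \<alpha>))"
  have "p * q = (\<Sum>\<alpha>\<in>Poly_Mapping.keys p. ?s p \<alpha>) * (\<Sum>\<beta>\<in>Poly_Mapping.keys q. ?s q \<beta>)"
    using poly_mapping_eq_sum_single[of p] poly_mapping_eq_sum_single[of q] by simp
  also have "\<dots> = (\<Sum>\<alpha>\<in>Poly_Mapping.keys p. \<Sum>\<beta>\<in>Poly_Mapping.keys q. Poly_Mapping.single (\<alpha> + \<beta>) (Poly_Mapping.lookup p \<alpha> * Poly_Mapping.lookup q \<beta>))"
    by (simp add: sum_product mult_single)
  finally show ?thesis
    by (simp add: poly_value_sum poly_value_single monomial_value_add hmult)
       (simp add: poly_value_alt sum_product mult_ac)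
qed

lemma poly_value_1 [simp]: "poly_value h 1 z = 1"
  using poly_value_single[of 0 1 z] by (simp add: h1)

lemma poly_value_power: "poly_value h (p ^ k) z = poly_value h p z ^ k"
  by (induction k) (auto simp: poly_value_mult)

end

lemma polys_over_add: "p \<in> polys_over V \<Longrightarrow> q \<in> polys_over V \<Longrightarrow> p + q \<in> polys_over V"
  using Poly_Mapping.keys_add[of p q] by (fastforce simp: polys_over_def)

lemma polys_over_mult:
  fixes p q :: "('v, 'a::comm_semiring_1) multipoly"
  assumes "p \<in> polys_over V" "q \<in> polys_over V" shows "p * q \<in> polys_over V"
proof -
  have "Poly_Mapping.keys \<alpha> \<subseteq> V" if al: "\<alpha> \<in> Poly_Mapping.keys (p * q)" for \<alpha>
  proof -
    obtain a b where "\<alpha> = a + b" "a \<in> Poly_Mapping.keys p" "b \<in> Poly_Mapping.keys q"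
      using Poly_Mapping.keys_mult[of p q] al by blast
    then show ?thesis using Poly_Mapping.keys_add[of a b] assms by (fastforce simp: polys_over_def)
  qed
  then show ?thesis by (auto simp: polys_over_def)
qed

lemma polys_over_0 [simp]: "0 \<in> polys_over V" by (simp add: polys_over_def)
lemma polys_over_1 [simp]: "1 \<in> polys_over V" by (simp add: polys_over_def)

lemma polys_over_power:
  fixes p :: "('v, 'a::comm_semiring_1) multipoly"
  shows "p \<in> polys_over V \<Longrightarrow> p ^ k \<in> polys_over V"
  by (induction k) (auto simp: polys_over_mult)

lemma polys_over_sum: "(\<And>a. a \<in> A \<Longrightarrow> f a \<in> polys_over V) \<Longrightarrow> sum f A \<in> polys_over V"
  by (induction A rule: infinite_finite_induct) (auto simp: polys_over_add)

lemma inner_real_vec: "real_vec x \<bullet> real_vec y = of_int (lattice_pairing x y)"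
  by (simp add: inner_vec_def real_vec_def lattice_pairing_def)

lemma real_vec_add: "real_vec (x + y) = real_vec x + real_vec y"
  and real_vec_diff: "real_vec (x - y) = real_vec x - real_vec y"
  and real_vec_scale: "real_vec (c *s x) = of_int c *\<^sub>R real_vec x"
  and real_vec_0 [simp]: "real_vec 0 = 0"
  by (simp_all add: real_vec_def Finite_Cartesian_Product.vec_eq_iff)

lemma real_vec_sum: "real_vec (sum f A) = (\<Sum>a\<in>A. real_vec (f a))"
  by (induction A rule: infinite_finite_induct) (auto simp: real_vec_add)

lemma real_vec_eq_iff [simp]: "real_vec x = real_vec y \<longleftrightarrow> x = y"
  by (simp add: real_vec_def Finite_Cartesian_Product.vec_eq_iff)

lemma lattice_pairing_add: "lattice_pairing (x + y) w = lattice_pairing x w + lattice_pairing y w"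
  and lattice_pairing_diff: "lattice_pairing (x - y) w = lattice_pairing x w - lattice_pairing y w"
  and lattice_pairing_0 [simp]: "lattice_pairing 0 w = 0"
  and lattice_pairing_scale: "lattice_pairing (c *s x) w = c * lattice_pairing x w"
  by (simp_all add: lattice_pairing_def algebra_simps sum.distrib sum_subtractf sum_distrib_left)

lemma lattice_pairing_commute: "lattice_pairing x y = lattice_pairing y x"
  by (simp add: lattice_pairing_def mult.commute)

section \<open>Powers of the homogenization\<close>

text \<open>The combinatorial data of the fan of a smooth polytope: \<open>sg v\<close> is the set of rays of the maximal cone
  of the vertex \<open>v\<close>, and the edge vectors \<open>eb v\<close> at \<open>v\<close> are dual to the normals of these rays.\<close>

locale fan_data =
  fixes V :: "'v set" and u :: "'v \<Rightarrow> int ^ 'n" and a :: "'v \<Rightarrow> int" and p :: "(int ^ 'n) \<Rightarrow>\<^sub>0 int"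
    and verts :: "(int ^ 'n) set" and sg :: "int ^ 'n \<Rightarrow> 'v set" and eb :: "int ^ 'n \<Rightarrow> 'v \<Rightarrow> int ^ 'n"
  assumes finV: "finite V" and fin_verts: "finite verts" and verts_ne: "verts \<noteq> {}"
    and sgV: "v \<in> verts \<Longrightarrow> sg v \<subseteq> V" and sg_ne: "v \<in> verts \<Longrightarrow> sg v \<noteq> {}"
    and dual: "v \<in> verts \<Longrightarrow> \<rho> \<in> sg v \<Longrightarrow> \<rho>' \<in> sg v \<Longrightarrow> lattice_pairing (eb v \<rho>) (u \<rho>') = (if \<rho> = \<rho>' then 1 else 0)"
    and expand: "v \<in> verts \<Longrightarrow> m = (\<Sum>\<rho>\<in>sg v. lattice_pairing m (u \<rho>) *s eb v \<rho>)"
    and vert0: "v \<in> verts \<Longrightarrow> \<rho> \<in> sg v \<Longrightarrow> lattice_pairing v (u \<rho>) + a \<rho> = 0"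
    and supp_nonneg: "m \<in> Poly_Mapping.keys p \<Longrightarrow> \<rho> \<in> V \<Longrightarrow> lattice_pairing m (u \<rho>) + a \<rho> \<ge> 0"
    and max_vert: "\<exists>v\<in>verts. \<forall>\<rho>\<in>sg v. s \<bullet> real_vec (eb v \<rho>) \<le> 0"
begin

lemma fin_sg: "v \<in> verts \<Longrightarrow> finite (sg v)"
  using sgV finV finite_subset by blast

definition xp :: "int ^ 'n \<Rightarrow> 'v \<Rightarrow> nat" where "xp m \<rho> = nat (lattice_pairing m (u \<rho>) + a \<rho>)"
definition hx :: "int ^ 'n \<Rightarrow> 'v \<Rightarrow>\<^sub>0 nat" where "hx m = (\<Sum>\<rho>\<in>V. Poly_Mapping.single \<rho> (xp m \<rho>))"
definition qq :: "('v, int) multipoly" where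
  "qq = (\<Sum>m\<in>Poly_Mapping.keys p. Poly_Mapping.single (hx m) (Poly_Mapping.lookup p m))"

abbreviation "cf m \<equiv> Poly_Mapping.lookup p m"
abbreviation "ks \<equiv> Poly_Mapping.keys p"

lemma xp_int: "m \<in> ks \<Longrightarrow> \<rho> \<in> V \<Longrightarrow> int (xp m \<rho>) = lattice_pairing m (u \<rho>) + a \<rho>"
  using supp_nonneg by (simp add: xp_def)

lemma lookup_hx: "Poly_Mapping.lookup (hx m) \<rho> = (if \<rho> \<in> V then xp m \<rho> else 0)"
  using finV by (simp add: hx_def lookup_sum lookup_single when_def)

lemma keys_hx: "Poly_Mapping.keys (hx m) \<subseteq> V"
  by (auto simp: in_keys_iff lookup_hx split: if_splits)

lemma monomial_value_hx: "monomial_value (hx m) z = (\<Prod>\<rho>\<in>V. z \<rho> ^ xp m \<rho>)"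
  by (subst monomial_value_superset[OF finV keys_hx]) (simp add: lookup_hx)

lemma value_qq: "poly_value of_int qq z = (\<Sum>m\<in>ks. of_int (cf m) * (\<Prod>\<rho>\<in>V. z \<rho> ^ xp m \<rho>))" for z :: "'v \<Rightarrow> 'b::comm_ring_1"
  by (simp add: qq_def of_int_coeff.poly_value_sum of_int_coeff.poly_value_single monomial_value_hx)

lemma qq_over: "qq \<in> polys_over V"
proof -
  have "Poly_Mapping.single (hx m) c \<in> polys_over V" for m and c :: int
    using keys_hx by (cases "c = 0") (auto simp: polys_over_def)
  then show ?thesis unfolding qq_def by (intro polys_over_sum)
qed

text \<open>Points outside \<open>Z(\<Sigma>)\<close> (\<open>nd\<close>), the set \<open>(G \<inter> U(1)) \<cdot> \<real>\<^sub>+\<close> (\<open>tw\<close>) and the positivity conditions,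
  for functions that are arbitrary outside \<open>V\<close>.\<close>

definition nd :: "('v \<Rightarrow> 'c::zero) \<Rightarrow> bool" where "nd z \<longleftrightarrow> (\<exists>v\<in>verts. \<forall>\<rho>\<in>V - sg v. z \<rho> \<noteq> 0)"

definition tw :: "('v \<Rightarrow> complex) \<Rightarrow> bool" where
  "tw z \<longleftrightarrow> (\<exists>t x. (\<forall>\<rho>\<in>V. cmod (t \<rho>) = 1 \<and> 0 \<le> x \<rho> \<and> z \<rho> = t \<rho> * complex_of_real (x \<rho>)) \<and>
     (\<forall>m. (\<Prod>\<rho>\<in>V. t \<rho> powi lattice_pairing m (u \<rho>)) = 1))"

definition P1 :: bool where "P1 \<longleftrightarrow> (\<forall>v\<in>verts. poly_value of_int qq (\<lambda>\<rho>. if \<rho> \<in> sg v then 0 else 1 :: real) > 0)"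
definition P2 :: bool where "P2 \<longleftrightarrow> (\<forall>\<rho>\<in>V. \<forall>x. (\<forall>\<rho>'\<in>V. 0 \<le> x \<rho>') \<longrightarrow> x \<rho> = 0 \<longrightarrow> nd x \<longrightarrow>
  deriv (\<lambda>s. poly_value of_int qq (x(\<rho> := s :: real))) 0 > 0)"
definition P3 :: bool where "P3 \<longleftrightarrow> (\<forall>z. nd z \<longrightarrow> \<not> tw z \<longrightarrow>
  cmod (poly_value of_int qq z) < poly_value of_int qq (\<lambda>\<rho>. cmod (z \<rho>)))"

abbreviation "cc \<equiv> (\<lambda>m. real_of_int (cf m))"
abbreviation "Pr v \<equiv> pos_chart.pr (sg v) ks cc xp"
abbreviation "Chi v \<equiv> pos_chart.chi (sg v) ks cc xp"

lemma pos_chart: "v \<in> verts \<Longrightarrow> pos_chart (sg v) ks"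
  by unfold_locales (auto simp: fin_sg)

text \<open>Dehomogenization: setting the coordinates off the maximal cone of \<open>v\<close> to 1
  embeds the affine chart of \<open>v\<close>.\<close>

definition ext :: "int ^ 'n \<Rightarrow> ('v \<Rightarrow> 'c::one) \<Rightarrow> 'v \<Rightarrow> 'c" where "ext v y \<rho> = (if \<rho> \<in> sg v then y \<rho> else 1)"

lemma prod_ext: "v \<in> verts \<Longrightarrow> (\<Prod>\<rho>\<in>V. ext v y \<rho> ^ k \<rho>) = (\<Prod>\<rho>\<in>sg v. y \<rho> ^ k \<rho>)" for y :: "'v \<Rightarrow> 'c::comm_semiring_1"
  using sgV finV by (intro prod.mono_neutral_cong_right) (auto simp: ext_def)

lemma Pr_eq: "v \<in> verts \<Longrightarrow> poly_value of_int qq (ext v y) = Pr v y"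
  by (simp add: value_qq prod_ext pos_chart.pr_def[OF pos_chart] pos_chart.mon_def[OF pos_chart])

lemma cis_ph_prod: "v \<in> verts \<Longrightarrow> of_real (pos_chart.mon (sg v) xp m y) * cis (pos_chart.ph (sg v) xp m \<theta>) = (\<Prod>\<rho>\<in>sg v. (of_real (y \<rho>) * cis (\<theta> \<rho>)) ^ xp m \<rho>)"
proof -
  assume v: "v \<in> verts"
  interpret pos_chart "sg v" ks cc xp by (rule pos_chart[OF v])
  show ?thesis unfolding cis_ph ee_def mon_def by (simp add: power_mult_distrib prod.distrib)
qed

lemma PrChi_eq:
  assumes v: "v \<in> verts" and p: "Pr v y \<noteq> 0"
  shows "of_real (Pr v y) * Chi v y \<theta> = poly_value of_int qq (ext v (\<lambda>\<rho>. of_real (y \<rho>) * cis (\<theta> \<rho>)))"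
proof -
  interpret pos_chart "sg v" ks cc xp by (rule pos_chart[OF v])
  have "of_real (Pr v y) * Chi v y \<theta> = (\<Sum>m\<in>ks. of_int (cf m) * (of_real (mon m y) * cis (ph m \<theta>)))"
    unfolding chi_def sum_distrib_left using p by (intro sum.cong) (simp_all add: wt_def)
  then show ?thesis by (simp add: value_qq prod_ext[OF v] cis_ph_prod[OF v])
qed

lemma deriv_qq:
  fixes x :: "'v \<Rightarrow> real"
  assumes \<rho>: "\<rho> \<in> V"
  shows "((\<lambda>s. poly_value of_int qq (x(\<rho> := s))) has_real_derivative
     (\<Sum>m | m \<in> ks \<and> xp m \<rho> = 1. of_int (cf m) * (\<Prod>\<rho>'\<in>V - {\<rho>}. x \<rho>' ^ xp m \<rho>'))) (at 0)"
proof -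
  have eq: "poly_value of_int qq (x(\<rho> := s)) = (\<Sum>m\<in>ks. of_int (cf m) * (\<Prod>\<rho>'\<in>V - {\<rho>}. x \<rho>' ^ xp m \<rho>') * s ^ xp m \<rho>)" for s
    unfolding value_qq using finV \<rho> by (intro sum.cong refl) (subst prod.remove[of V \<rho>], auto simp: mult_ac intro!: prod.cong)
  have "((\<lambda>s. poly_value of_int qq (x(\<rho> := s))) has_real_derivative (\<Sum>m\<in>ks. of_int (cf m) * (\<Prod>\<rho>'\<in>V - {\<rho>}. x \<rho>' ^ xp m \<rho>') * (real (xp m \<rho>) * 0 ^ (xp m \<rho> - 1)))) (at 0)"
    unfolding eq by (auto intro!: derivative_eq_intros simp: mult_ac)
  also have "(\<Sum>m\<in>ks. of_int (cf m) * (\<Prod>\<rho>'\<in>V - {\<rho>}. x \<rho>' ^ xp m \<rho>') * (real (xp m \<rho>) * 0 ^ (xp m \<rho> - 1))) =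
     (\<Sum>m | m \<in> ks \<and> xp m \<rho> = 1. of_int (cf m) * (\<Prod>\<rho>'\<in>V - {\<rho>}. x \<rho>' ^ xp m \<rho>'))"
    by (intro sum.mono_neutral_cong_right) (auto simp: power_0_left)
  finally show ?thesis .
qed

text \<open>If the point were in the twisted orthant, its phases would be 1 off the cone, where its
  coordinates are 1. The group equation for \<open>eb v i\<close>, which is dual to the normals of
  the cone, then reduces to t_i = 1, against the choice of \<theta>.\<close>

lemma chart_strict:
  assumes P3 and v: "v \<in> verts" and y: "\<And>\<rho>. \<rho> \<in> sg v \<Longrightarrow> 0 \<le> y \<rho>" and i: "i \<in> sg v" "y i > 0" "cos (\<theta> i) \<noteq> 1"
  shows "cmod (poly_value of_int qq (ext v (\<lambda>\<rho>. of_real (y \<rho>) * cis (\<theta> \<rho>)))) < Pr v y"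
proof -
  define z where "z = ext v (\<lambda>\<rho>. of_real (y \<rho>) * cis (\<theta> \<rho>))"
  have "nd z" unfolding nd_def z_def ext_def using v by auto
  moreover have "\<not> tw z"
  proof
    assume "tw z"
    then obtain t x where t: "\<And>\<rho>. \<rho> \<in> V \<Longrightarrow> cmod (t \<rho>) = 1" and x: "\<And>\<rho>. \<rho> \<in> V \<Longrightarrow> 0 \<le> x \<rho>" and z: "\<And>\<rho>. \<rho> \<in> V \<Longrightarrow> z \<rho> = t \<rho> * complex_of_real (x \<rho>)"
      and g: "\<And>m. (\<Prod>\<rho>\<in>V. t \<rho> powi lattice_pairing m (u \<rho>)) = 1" unfolding tw_def by blast
    have zx: "cmod (z \<rho>) = x \<rho>" if "\<rho> \<in> V" for \<rho> using t[OF that] x[OF that] z[OF that] by (simp add: norm_mult)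
    have t1: "t \<rho> = 1" if "\<rho> \<in> V - sg v" for \<rho>
    proof -
      have "z \<rho> = 1" using that by (simp add: z_def ext_def)
      then show ?thesis using zx[of \<rho>] z[of \<rho>] that by simp
    qed
    have iV: "i \<in> V" using i sgV[OF v] by blast
    have "(\<Prod>\<rho>\<in>V. t \<rho> powi lattice_pairing (eb v i) (u \<rho>)) = (\<Prod>\<rho>\<in>{i}. t \<rho> powi lattice_pairing (eb v i) (u \<rho>))"
    proof (intro prod.mono_neutral_right ballI)
      show "t r powi lattice_pairing (eb v i) (u r) = 1" if "r \<in> V - {i}" for r
        using that t1[of r] dual[OF v i(1), of r] by (cases "r \<in> sg v") auto
    qed (use iV finV in auto)
    then have "t i = 1" using g[of "eb v i"] dual[OF v i(1) i(1)] by simp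
    then have "of_real (y i) * cis (\<theta> i) = complex_of_real (x i)" using z[OF iV] i by (simp add: z_def ext_def)
    moreover have "x i = y i" using zx[OF iV] i by (simp add: z_def ext_def norm_mult)
    ultimately have "cis (\<theta> i) = 1" using i by simp
    then show False using i by (simp add: complex_eq_iff)
  qed
  ultimately have "cmod (poly_value of_int qq z) < poly_value of_int qq (\<lambda>\<rho>. cmod (z \<rho>))"
    using \<open>P3\<close> unfolding P3_def by blast
  also have "poly_value of_int qq (\<lambda>\<rho>. cmod (z \<rho>)) = poly_value of_int qq (ext v y)"
    unfolding value_qq
    by (intro sum.cong refl arg_cong2[where f = "(*)"] prod.cong arg_cong2[where f = "(^)"]) (auto simp: z_def ext_def norm_mult y)
  finally show ?thesis unfolding Pr_eq[OF v] z_def .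
qed

text \<open>As soon as one coordinate is positive, \<open>pr_pos\<close> follows from (Pos3) with
  all phases turned by pi, a modulus being nonnegative; at the origin of the chart it is
  (Pos1).\<close>

lemma strict_chart:
  assumes P1 P2 P3 and v: "v \<in> verts"
  shows "strict_chart (sg v) ks cc xp"
proof -
  interpret pos_chart "sg v" ks cc xp by (rule pos_chart[OF v])
  have pos: "Pr v y > 0" if y: "nonneg y" for y
  proof (cases "\<exists>i\<in>sg v. y i > 0")
    case True
    then obtain i where i: "i \<in> sg v" "y i > 0" by blast
    have "cmod (poly_value of_int qq (ext v (\<lambda>\<rho>. of_real (y \<rho>) * cis pi))) < Pr v y"
      using y i by (intro chart_strict[OF \<open>P3\<close> v, of y i "\<lambda>_. pi"]) (auto simp: nonneg_def)
    then show ?thesis using norm_ge_zero order_le_less_trans by blast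
  next
    case False
    then have y0: "y i = 0" if "i \<in> sg v" for i using y that by (force simp: nonneg_def)
    have "poly_value of_int qq (\<lambda>\<rho>. if \<rho> \<in> sg v then 0 else 1 :: real) = poly_value of_int qq (ext v y)"
      unfolding value_qq
      by (intro sum.cong refl arg_cong2[where f = "(*)"] prod.cong arg_cong2[where f = "(^)"]) (auto simp: ext_def y0)
    then show ?thesis using \<open>P1\<close> v Pr_eq[OF v, of y] by (auto simp: P1_def)
  qed
  show ?thesis
  proof unfold_locales
    show "pr y > 0" if "nonneg y" for y using pos that by simp
    show "cmod (chi y \<theta>) < 1" if y: "nonneg y" and i: "i \<in> sg v" "y i > 0" "cos (\<theta> i) \<noteq> 1" for y i \<theta>
    proof -
      have "cmod (of_real (Pr v y) * Chi v y \<theta>) < Pr v y"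
        using chart_strict[OF \<open>P3\<close> v, of y i \<theta>] i PrChi_eq[OF v, of y \<theta>] pos[OF y] y by (auto simp: nonneg_def)
      then show ?thesis using pos[OF y] by (simp add: norm_mult)
    qed
    show "(\<Sum>m | m \<in> ks \<and> xp m i = 1. real_of_int (cf m) * (\<Prod>j\<in>sg v - {i}. y j ^ xp m j)) > 0"
      if y: "nonneg y" and i: "i \<in> sg v" "y i = 0" for y i
    proof -
      have iV: "i \<in> V" using i sgV[OF v] by blast
      have "nd (ext v y)" unfolding nd_def ext_def using v by auto
      then have "deriv (\<lambda>s. poly_value of_int qq ((ext v y)(i := s))) 0 > 0"
        using \<open>P2\<close> iV y i unfolding P2_def by (auto simp: ext_def nonneg_def)
      then have "(\<Sum>m | m \<in> ks \<and> xp m i = 1. real_of_int (cf m) * (\<Prod>j\<in>V - {i}. ext v y j ^ xp m j)) > 0"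
        using DERIV_imp_deriv[OF deriv_qq[OF iV, of "ext v y"]] by simp
      moreover have "(\<Prod>j\<in>V - {i}. ext v y j ^ xp m j) = (\<Prod>j\<in>sg v - {i}. y j ^ xp m j)" for m
        using sgV[OF v] finV by (intro prod.mono_neutral_cong_right) (auto simp: ext_def)
      ultimately show ?thesis by simp
    qed
  qed
qed

lemma exp_prod:
  assumes v: "v \<in> verts" and w: "\<And>\<rho>. \<rho> \<in> sg v \<Longrightarrow> lattice_pairing w (u \<rho>) = int (\<alpha> \<rho>)"
  shows "(\<Prod>\<rho>\<in>sg v. exp (s \<bullet> real_vec (eb v \<rho>)) ^ \<alpha> \<rho>) = exp (s \<bullet> real_vec w)"
proof -
  have "real_vec w = (\<Sum>\<rho>\<in>sg v. real (\<alpha> \<rho>) *\<^sub>R real_vec (eb v \<rho>))"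
    by (subst expand[OF v, of w]) (simp add: real_vec_sum real_vec_scale w)
  then show ?thesis by (simp add: inner_sum_right exp_sum fin_sg[OF v] exp_of_nat_mult)
qed

text \<open>A point \<open>s\<close> of the real torus has the coordinates exp (s . eb v \<rho>) in
  the chart of \<open>v\<close>, and there the ratios of all charts are one function
  \<open>E\<close>. By \<open>max_vert\<close> every \<open>s\<close> lies in the unit box of some
  chart, so the largest of the box maxima is maximal over the whole torus and hence critical even if
  it lies on the boundary of its box.\<close>

lemma saddle:
  assumes "P1" "P2" "P3" and \<alpha>: "\<And>\<rho>. \<rho> \<in> V \<Longrightarrow> lattice_pairing m (u \<rho>) + int k * a \<rho> = int (\<alpha> \<rho>)"
  shows "\<exists>v\<in>verts. \<exists>x. \<forall>i\<in>sg v. 0 \<le> x i \<and> x i \<le> 1 \<and> real k * (x i * strict_chart.Rr (sg v) ks cc xp i x) = real (\<alpha> i)"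
proof -
  note sc = strict_chart[OF assms(1-3)]
  define FF where "FF v = strict_chart.monomial_ratio (sg v) ks cc xp \<alpha> k" for v
  define E where "E s = exp (s \<bullet> real_vec m) / (\<Sum>m'\<in>ks. of_int (cf m') * exp (s \<bullet> real_vec m')) ^ k" for s :: "real ^ 'n"
  have FE: "FF v (\<lambda>\<rho>. exp (s \<bullet> real_vec (eb v \<rho>))) = E s" if v: "v \<in> verts" for v s
  proof -
    interpret strict_chart "sg v" ks cc xp by (rule sc[OF v])
    have 1: "(\<Prod>\<rho>\<in>sg v. exp (s \<bullet> real_vec (eb v \<rho>)) ^ \<alpha> \<rho>) = exp (s \<bullet> real_vec (m - int k *s v))"
    proof (rule exp_prod[OF v])
      fix \<rho> assume \<rho>: "\<rho> \<in> sg v"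
      have "lattice_pairing (m - int k *s v) (u \<rho>) = lattice_pairing m (u \<rho>) - int k * lattice_pairing v (u \<rho>)"
        by (simp add: lattice_pairing_diff lattice_pairing_scale)
      also have "lattice_pairing v (u \<rho>) = - a \<rho>" using vert0[OF v \<rho>] by linarith
      finally show "lattice_pairing (m - int k *s v) (u \<rho>) = int (\<alpha> \<rho>)" using \<alpha>[of \<rho>] sgV[OF v] \<rho> by auto
    qed
    have 2: "mon m' (\<lambda>\<rho>. exp (s \<bullet> real_vec (eb v \<rho>))) = exp (s \<bullet> real_vec m') / exp (s \<bullet> real_vec v)" if "m' \<in> ks" for m'
    proof -
      have "(\<Prod>\<rho>\<in>sg v. exp (s \<bullet> real_vec (eb v \<rho>)) ^ xp m' \<rho>) = exp (s \<bullet> real_vec (m' - v))"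
      proof (rule exp_prod[OF v])
        fix \<rho> assume \<rho>: "\<rho> \<in> sg v"
        then show "lattice_pairing (m' - v) (u \<rho>) = int (xp m' \<rho>)"
          using xp_int[OF that, of \<rho>] vert0[OF v \<rho>] sgV[OF v] by (auto simp: lattice_pairing_diff)
      qed
      then show ?thesis by (simp add: mon_def real_vec_diff inner_diff_right exp_diff)
    qed
    have 3: "pr (\<lambda>\<rho>. exp (s \<bullet> real_vec (eb v \<rho>))) = (\<Sum>m'\<in>ks. of_int (cf m') * exp (s \<bullet> real_vec m')) / exp (s \<bullet> real_vec v)"
      by (simp add: pr_def 2 sum_divide_distrib)
    show ?thesis unfolding FF_def monomial_ratio_def 1 3 E_def
      by (simp add: real_vec_diff real_vec_scale inner_diff_right exp_diff power_divide exp_of_nat_mult)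
  qed
  have "\<forall>v\<in>verts. \<exists>x. (\<forall>i\<in>sg v. 0 \<le> x i \<and> x i \<le> 1) \<and> (\<forall>y. (\<forall>i\<in>sg v. 0 \<le> y i \<and> y i \<le> 1) \<longrightarrow> FF v y \<le> FF v x)"
    unfolding FF_def using strict_chart.monomial_ratio_box_max[OF sc] by blast
  then obtain X where X: "\<And>v i. v \<in> verts \<Longrightarrow> i \<in> sg v \<Longrightarrow> 0 \<le> X v i \<and> X v i \<le> 1"
    and Xmax: "\<And>v y. v \<in> verts \<Longrightarrow> (\<forall>i\<in>sg v. 0 \<le> y i \<and> y i \<le> 1) \<Longrightarrow> FF v y \<le> FF v (X v)" by metis
  obtain v where v: "v \<in> verts" and vmax: "\<And>v'. v' \<in> verts \<Longrightarrow> FF v' (X v') \<le> FF v (X v)"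
  proof -
    have "finite ((\<lambda>v. FF v (X v)) ` verts)" "(\<lambda>v. FF v (X v)) ` verts \<noteq> {}" using fin_verts verts_ne by auto
    from Max_in[OF this] Max_ge[OF this(1)] show ?thesis using that by auto
  qed
  have gmax: "FF v' y \<le> FF v (X v)" if v': "v' \<in> verts" and y: "\<And>i. i \<in> sg v' \<Longrightarrow> y i > 0" for v' y
  proof -
    interpret C: strict_chart "sg v'" ks cc xp by (rule sc[OF v'])
    \<comment> \<open>By duality this is the point with the given coordinates: s . eb v' \<rho> = ln
      (y \<rho>).\<close>
    define s where "s = (\<Sum>\<rho>\<in>sg v'. ln (y \<rho>) *\<^sub>R real_vec (u \<rho>))"
    have "exp (s \<bullet> real_vec (eb v' \<rho>)) = y \<rho>" if \<rho>: "\<rho> \<in> sg v'" for \<rho>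
    proof -
      have "s \<bullet> real_vec (eb v' \<rho>) = (\<Sum>\<rho>'\<in>sg v'. ln (y \<rho>') * (if \<rho> = \<rho>' then 1 else 0))"
        unfolding s_def inner_sum_left
        by (intro sum.cong refl) (simp add: inner_real_vec lattice_pairing_commute[of "u _"] dual[OF v' \<rho>])
      also have "\<dots> = ln (y \<rho>)" using \<rho> fin_sg[OF v'] by (simp add: if_distrib[of "\<lambda>z. _ * z"] cong: if_cong)
      finally show ?thesis using y[OF \<rho>] by simp
    qed
    then have "FF v' y = FF v' (\<lambda>\<rho>. exp (s \<bullet> real_vec (eb v' \<rho>)))"
      unfolding FF_def C.monomial_ratio_def C.pr_def C.mon_def by simp
    also have "\<dots> = E s" by (rule FE[OF v'])
    also obtain v'' where v'': "v'' \<in> verts" "\<forall>\<rho>\<in>sg v''. s \<bullet> real_vec (eb v'' \<rho>) \<le> 0" using max_vert by blast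
    have "E s = FF v'' (\<lambda>\<rho>. exp (s \<bullet> real_vec (eb v'' \<rho>)))" by (rule FE[OF v''(1), symmetric])
    also have "\<dots> \<le> FF v'' (X v'')" using v'' by (intro Xmax) auto
    also have "\<dots> \<le> FF v (X v)" by (rule vmax[OF v''(1)])
    finally show ?thesis .
  qed
  interpret C: strict_chart "sg v" ks cc xp by (rule sc[OF v])
  have "0 < FF v (\<lambda>_. 1)" unfolding FF_def C.monomial_ratio_def using C.pr_pos[of "\<lambda>_. 1"] by (simp add: C.nonneg_def)
  also have "\<dots> \<le> FF v (X v)" by (rule gmax[OF v]) simp
  finally have "FF v (X v) > 0" .
  then have "\<forall>i\<in>sg v. real k * (X v i * C.Rr i (X v)) = real (\<alpha> i)"
    using X[OF v] gmax[OF v] unfolding FF_def by (intro ballI C.critical_point) (auto simp: C.nonneg_def)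
  then show ?thesis using v X[OF v] by blast
qed

text \<open>Like those of the polynomial, the exponents of its powers come from lattice points, with
  offsets multiplied by k. This makes an exponent recoverable from its coordinates on one maximal
  cone.\<close>

lemma keys_qq_power:
  assumes "\<beta> \<in> Poly_Mapping.keys (qq ^ k)"
  shows "\<exists>m. \<forall>\<rho>\<in>V. int (Poly_Mapping.lookup \<beta> \<rho>) = lattice_pairing m (u \<rho>) + int k * a \<rho>"
  using assms
proof (induction k arbitrary: \<beta>)
  case 0
  then show ?case by (intro exI[of _ 0]) (auto simp: in_keys_iff lookup_one when_def split: if_splits)
next
  case (Suc k)
  then obtain \<beta>1 \<beta>2 where b: "\<beta> = \<beta>1 + \<beta>2" "\<beta>1 \<in> Poly_Mapping.keys qq" "\<beta>2 \<in> Poly_Mapping.keys (qq ^ k)"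
    using Poly_Mapping.keys_mult[of qq "qq ^ k"] by auto
  have "\<beta>1 \<in> hx ` ks"
  proof -
    have "Poly_Mapping.lookup qq \<beta>1 \<noteq> 0" using b by (simp add: in_keys_iff)
    then have "\<exists>m\<in>ks. Poly_Mapping.lookup (Poly_Mapping.single (hx m) (cf m)) \<beta>1 \<noteq> 0"
      unfolding qq_def lookup_sum by (meson sum.neutral)
    then show ?thesis by (auto simp: lookup_single when_def split: if_splits)
  qed
  then obtain m1 where m1: "m1 \<in> ks" "\<beta>1 = hx m1" by blast
  obtain m2 where m2: "\<forall>\<rho>\<in>V. int (Poly_Mapping.lookup \<beta>2 \<rho>) = lattice_pairing m2 (u \<rho>) + int k * a \<rho>"
    using Suc.IH[OF b(3)] by blast
  show ?case
    by (intro exI[of _ "m1 + m2"]) (use m1 m2 xp_int in \<open>auto simp: b(1) lookup_add lookup_hx lattice_pairing_add algebra_simps\<close>)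
qed

theorem eventually_positive_coefficients:
  assumes "P1" "P2" "P3"
  shows "\<exists>k0. \<forall>k\<ge>k0. \<forall>\<beta>\<in>Poly_Mapping.keys (qq ^ k). Poly_Mapping.lookup (qq ^ k) \<beta> > 0"
proof -
  note sc = strict_chart[OF assms]
  define good where "good v k \<longleftrightarrow> (\<forall>(B :: ('v \<Rightarrow>\<^sub>0 nat) set) (d :: ('v \<Rightarrow>\<^sub>0 nat) \<Rightarrow> real) g \<beta> x. finite B \<longrightarrow>
     (\<forall>\<theta>. (of_real (Pr v x) * Chi v x \<theta>) ^ k = (\<Sum>\<beta>\<in>B. of_real (d \<beta> * (\<Prod>i\<in>sg v. x i ^ g \<beta> i)) * cis (\<Sum>i\<in>sg v. real (g \<beta> i) * \<theta> i))) \<longrightarrow>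
     (\<forall>\<beta>'\<in>B. (\<forall>i\<in>sg v. g \<beta>' i = g \<beta> i) \<longrightarrow> \<beta>' = \<beta>) \<longrightarrow> \<beta> \<in> B \<longrightarrow>
     (\<forall>i\<in>sg v. 0 \<le> x i \<and> x i \<le> 1 \<and> real k * (x i * strict_chart.Rr (sg v) ks cc xp i x) = real (g \<beta> i)) \<longrightarrow> d \<beta> > 0)" for v k
  have "\<forall>v\<in>verts. \<exists>k0. \<forall>k\<ge>k0. good v k"
    unfolding good_def using strict_chart.coeff_pos_eventually[OF sc] by (intro ballI)
  from bchoice[OF this] obtain K where K: "\<And>v k. v \<in> verts \<Longrightarrow> k \<ge> K v \<Longrightarrow> good v k" by blast
  show ?thesis
  proof (intro exI[of _ "Max (K ` verts)"] allI impI ballI)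
    fix k \<beta> assume k: "Max (K ` verts) \<le> k" and \<beta>: "\<beta> \<in> Poly_Mapping.keys (qq ^ k)"
    obtain m where m: "\<And>\<rho>. \<rho> \<in> V \<Longrightarrow> int (Poly_Mapping.lookup \<beta> \<rho>) = lattice_pairing m (u \<rho>) + int k * a \<rho>"
      using keys_qq_power[OF \<beta>] by blast
    obtain v x where v: "v \<in> verts" and x: "\<forall>i\<in>sg v. 0 \<le> x i \<and> x i \<le> 1 \<and> real k * (x i * strict_chart.Rr (sg v) ks cc xp i x) = real (Poly_Mapping.lookup \<beta> i)"
      using saddle[OF assms, of m k "Poly_Mapping.lookup \<beta>"] m by fastforce
    interpret C: strict_chart "sg v" ks cc xp by (rule sc[OF v])
    have kv: "K v \<le> k" using k Max_ge[OF finite_imageI[OF fin_verts] imageI[OF v], of K] by linarith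
    have keysV: "Poly_Mapping.keys \<beta>' \<subseteq> V" if "\<beta>' \<in> Poly_Mapping.keys (qq ^ k)" for \<beta>'
      using polys_over_power[OF qq_over, of k] that by (auto simp: polys_over_def)
    have prpos: "Pr v x > 0" using x by (intro C.pr_pos) (auto simp: C.nonneg_def)
    have "real_of_int (Poly_Mapping.lookup (qq ^ k) \<beta>) > 0"
    proof (rule K[OF v kv, unfolded good_def, rule_format, of "Poly_Mapping.keys (qq ^ k)" x "\<lambda>\<beta>. real_of_int (Poly_Mapping.lookup (qq ^ k) \<beta>)" Poly_Mapping.lookup \<beta>])
      show "(of_real (Pr v x) * Chi v x \<theta>) ^ k = (\<Sum>\<beta>\<in>Poly_Mapping.keys (qq ^ k). of_real (real_of_int (Poly_Mapping.lookup (qq ^ k) \<beta>) * (\<Prod>i\<in>sg v. x i ^ Poly_Mapping.lookup \<beta> i)) * cis (\<Sum>i\<in>sg v. real (Poly_Mapping.lookup \<beta> i) * \<theta> i))" for \<theta>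
      proof -
        have "(of_real (Pr v x) * Chi v x \<theta>) ^ k = poly_value of_int (qq ^ k) (ext v (\<lambda>\<rho>. of_real (x \<rho>) * cis (\<theta> \<rho>)))"
          using prpos by (simp add: PrChi_eq[OF v] of_int_coeff.poly_value_power)
        also have "\<dots> = (\<Sum>\<beta>\<in>Poly_Mapping.keys (qq ^ k). of_int (Poly_Mapping.lookup (qq ^ k) \<beta>) * (\<Prod>i\<in>sg v. (of_real (x i) * cis (\<theta> i)) ^ Poly_Mapping.lookup \<beta> i))"
          unfolding poly_value_alt by (intro sum.cong refl) (simp add: monomial_value_superset[OF finV keysV] prod_ext[OF v])
        also have "\<dots> = (\<Sum>\<beta>\<in>Poly_Mapping.keys (qq ^ k). of_real (real_of_int (Poly_Mapping.lookup (qq ^ k) \<beta>) * (\<Prod>i\<in>sg v. x i ^ Poly_Mapping.lookup \<beta> i)) * cis (\<Sum>i\<in>sg v. real (Poly_Mapping.lookup \<beta> i) * \<theta> i))"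
          unfolding C.cis_sum by (intro sum.cong refl) (simp add: power_mult_distrib prod.distrib Complex.DeMoivre)
        finally show ?thesis .
      qed
      \<comment> \<open>The exponents on the cone of \<open>v\<close> determine the lattice point
        through \<open>expand\<close>, and it determines all other exponents.\<close>
      show "\<beta>' = \<beta>" if \<beta>': "\<beta>' \<in> Poly_Mapping.keys (qq ^ k)" and eq: "\<And>i. i \<in> sg v \<Longrightarrow> Poly_Mapping.lookup \<beta>' i = Poly_Mapping.lookup \<beta> i" for \<beta>'
      proof -
        obtain m' where m': "\<And>\<rho>. \<rho> \<in> V \<Longrightarrow> int (Poly_Mapping.lookup \<beta>' \<rho>) = lattice_pairing m' (u \<rho>) + int k * a \<rho>"
          using keys_qq_power[OF \<beta>'] by blast
        have "lattice_pairing m' (u \<rho>) = lattice_pairing m (u \<rho>)" if "\<rho> \<in> sg v" for \<rho>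
          using m[of \<rho>] m'[of \<rho>] eq that sgV[OF v] by auto
        then have "m' = m" using expand[OF v, of m'] expand[OF v, of m] by simp
        then have "Poly_Mapping.lookup \<beta>' \<rho> = Poly_Mapping.lookup \<beta> \<rho>" for \<rho>
          
          using m[of \<rho>] m'[of \<rho>] keysV[OF \<beta>] keysV[OF \<beta>'] by (cases "\<rho> \<in> V") (simp, metis in_keys_iff subsetD)
        then show "\<beta>' = \<beta>" by (intro poly_mapping_eqI)
      qed
    qed (use \<beta> x in auto)
    then show "Poly_Mapping.lookup (qq ^ k) \<beta> > 0" by simp
  qed
qed

end

section \<open>Spectral radii of nonnegative matrices and polynomials over the naturals\<close>

lemma eigenvalue_iff_fun:
  assumes A: "A \<in> carrier_mat n n"
  shows "eigenvalue A k \<longleftrightarrow> (\<exists>w. (\<exists>i<n. w i \<noteq> 0) \<and> (\<forall>i<n. (\<Sum>j<n. A $$ (i, j) * w j) = k * w i))"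
proof -
  have prod: "vec_index (A *\<^sub>v v) i = (\<Sum>j<n. A $$ (i, j) * vec_index v j)" if "v \<in> carrier_vec n" "i < n" for v i
    using A that by (simp add: scalar_prod_def atLeast0LessThan)
  show ?thesis
  proof
    assume "eigenvalue A k"
    then obtain v where v: "v \<in> carrier_vec n" "v \<noteq> 0\<^sub>v n" "A *\<^sub>v v = k \<cdot>\<^sub>v v"
      using A by (auto simp: eigenvalue_def eigenvector_def)
    have "\<exists>i<n. vec_index v i \<noteq> 0"
    proof (rule ccontr)
      assume "\<not> ?thesis"
      then have "v = 0\<^sub>v n" using v(1) by (intro eq_vecI) auto
      then show False using v(2) by simp
    qed
    moreover have "(\<Sum>j<n. A $$ (i, j) * vec_index v j) = k * vec_index v i" if "i < n" for i
      using prod[OF v(1) that] v(1,3) that by simp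
    ultimately show "\<exists>w. (\<exists>i<n. w i \<noteq> 0) \<and> (\<forall>i<n. (\<Sum>j<n. A $$ (i, j) * w j) = k * w i)" by blast
  next
    assume "\<exists>w. (\<exists>i<n. w i \<noteq> 0) \<and> (\<forall>i<n. (\<Sum>j<n. A $$ (i, j) * w j) = k * w i)"
    then obtain w i where w: "i < n" "w i \<noteq> 0" "\<And>i. i < n \<Longrightarrow> (\<Sum>j<n. A $$ (i, j) * w j) = k * w i" by blast
    define v where "v = Matrix.vec n w"
    have v: "v \<in> carrier_vec n" by (simp add: v_def)
    have "v \<noteq> 0\<^sub>v n"
    proof
      assume "v = 0\<^sub>v n"
      then have "vec_index v i = 0" using w(1) by simp
      then show False using w by (simp add: v_def)
    qed
    moreover have "A *\<^sub>v v = k \<cdot>\<^sub>v v"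
    proof (rule eq_vecI)
      show "dim_vec (A *\<^sub>v v) = dim_vec (k \<cdot>\<^sub>v v)" using A v by simp
      fix i assume "i < dim_vec (k \<cdot>\<^sub>v v)"
      then have i: "i < n" using v by simp
      show "vec_index (A *\<^sub>v v) i = vec_index (k \<cdot>\<^sub>v v) i"
        unfolding prod[OF v i] using i w(3)[OF i] by (simp add: v_def)
    qed
    ultimately show "eigenvalue A k" using A v by (auto simp: eigenvalue_def eigenvector_def)
  qed
qed

lemma spectral_radius_ge:
  assumes "A \<in> carrier_mat n n" "n > 0" "eigenvalue A k"
  shows "cmod k \<le> spectral_radius A"
  using spectral_radius_mem_max(2)[OF assms(1)] assms by (auto simp: spectrum_def)

lemma spectral_radius_attained:
  assumes "A \<in> carrier_mat n n" "n > 0"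
  shows "\<exists>k. eigenvalue A k \<and> cmod k = spectral_radius A"
  using spectral_radius_mem_max(1)[OF assms(1)] assms by (auto simp: spectrum_def)

text \<open>A positive eigenvector controls every other eigenvector \<open>w\<close>: if c is the
  largest ratio |w_i| / v_i, attained at i, then row i gives |k| c v_i \<le> r c v_i.\<close>

lemma spectral_radius_of_positive_eigenvector:
  fixes A :: "complex mat" and a :: "nat \<Rightarrow> nat \<Rightarrow> real"
  assumes A: "A \<in> carrier_mat n n" and n: "n > 0"
    and Aa: "\<And>i j. i < n \<Longrightarrow> j < n \<Longrightarrow> A $$ (i, j) = of_real (a i j)" and a0: "\<And>i j. i < n \<Longrightarrow> j < n \<Longrightarrow> a i j \<ge> 0"
    and v0: "\<And>i. i < n \<Longrightarrow> v i > 0" and ev: "\<And>i. i < n \<Longrightarrow> (\<Sum>j<n. a i j * v j) = r * v i"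
  shows "spectral_radius A = r"
proof (rule antisym)
  have r0: "r \<ge> 0"
  proof -
    have "0 \<le> (\<Sum>j<n. a 0 j * v j)" using a0 v0 n by (intro sum_nonneg mult_nonneg_nonneg) (auto intro: less_imp_le)
    then show ?thesis using ev[of 0] v0[of 0] n by (simp add: zero_le_mult_iff)
  qed
  have "eigenvalue A (of_real r)"
    unfolding eigenvalue_iff_fun[OF A]
  proof (intro exI[of _ "\<lambda>i. of_real (v i)"] conjI allI impI)
    show "\<exists>i<n. complex_of_real (v i) \<noteq> 0" using n v0[of 0] by (intro exI[of _ 0]) auto
    fix i assume i: "i < n"
    have "(\<Sum>j<n. A $$ (i, j) * of_real (v j)) = of_real (\<Sum>j<n. a i j * v j)" using i by (simp add: Aa)
    then show "(\<Sum>j<n. A $$ (i, j) * of_real (v j)) = of_real r * of_real (v i)" using ev[OF i] by simp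
  qed
  from spectral_radius_ge[OF A n this] r0 show "r \<le> spectral_radius A" by simp
  obtain k where k: "eigenvalue A k" "cmod k = spectral_radius A" using spectral_radius_attained[OF A n] by blast
  then obtain w i0 where w: "i0 < n" "w i0 \<noteq> 0" "\<And>i. i < n \<Longrightarrow> (\<Sum>j<n. A $$ (i, j) * w j) = k * w i"
    unfolding eigenvalue_iff_fun[OF A] by blast
  define c where "c = Max ((\<lambda>i. cmod (w i) / v i) ` {..<n})"
  have cin: "c \<in> (\<lambda>i. cmod (w i) / v i) ` {..<n}" unfolding c_def using n by (intro Max_in) auto
  have cge: "cmod (w i) / v i \<le> c" if "i < n" for i unfolding c_def using that by (intro Max_ge) auto
  obtain i where i: "i < n" "c = cmod (w i) / v i" using cin by auto
  have "0 < cmod (w i0) / v i0" using w v0 by simp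
  then have c: "c > 0" using cge[OF w(1)] by linarith
  have "cmod k * (c * v i) = cmod (k * w i)" using i v0[OF i(1)] by (simp add: norm_mult)
  also have "\<dots> = cmod (\<Sum>j<n. A $$ (i, j) * w j)" by (simp add: w(3)[OF i(1)])
  also have "\<dots> \<le> (\<Sum>j<n. a i j * (c * v j))"
  proof (rule sum_norm_le)
    fix j assume j: "j \<in> {..<n}"
    have "cmod (w j) \<le> c * v j" using cge[of j] v0[of j] j by (simp add: field_simps)
    then show "cmod (A $$ (i, j) * w j) \<le> a i j * (c * v j)"
      using a0[of i j] i(1) j mult_left_mono[of "cmod (w j)" "c * v j" "a i j"] by (simp add: Aa norm_mult)
  qed
  also have "\<dots> = c * (\<Sum>j<n. a i j * v j)" by (simp add: sum_distrib_left mult_ac)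
  also have "\<dots> = r * (c * v i)" by (simp add: ev[OF i(1)])
  finally show "spectral_radius A \<le> r" using c v0[OF i(1)] k by (simp add: mult_le_cancel_right)
qed

text \<open>A semiring homomorphism to the integers that is positive on nonzero polynomials; it
  shows that there are no zero divisors and no cancellation in sums.\<close>

definition coeff_sum :: "('v, nat) multipoly \<Rightarrow> int" where "coeff_sum g = poly_value of_nat g (\<lambda>_. 1)"

lemma coeff_sum_pos: "g \<noteq> 0 \<Longrightarrow> coeff_sum g > 0"
proof -
  assume "g \<noteq> 0"
  then obtain \<alpha> where \<alpha>: "\<alpha> \<in> Poly_Mapping.keys g" by (metis all_not_in_conv keys_eq_empty)
  have "0 < Poly_Mapping.lookup g \<alpha>" using \<alpha> by (simp add: in_keys_iff)
  also have "\<dots> \<le> (\<Sum>\<alpha>\<in>Poly_Mapping.keys g. Poly_Mapping.lookup g \<alpha>)" using \<alpha> by (intro member_le_sum) auto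
  finally have "0 < (\<Sum>\<alpha>\<in>Poly_Mapping.keys g. int (Poly_Mapping.lookup g \<alpha>))"
    unfolding of_nat_sum[symmetric] of_nat_0_less_iff .
  then show ?thesis by (simp add: coeff_sum_def poly_value_def)
qed

lemma nat_multipoly_mult_eq_0_iff: "f * g = 0 \<longleftrightarrow> f = 0 \<or> g = 0" for f g :: "('v, nat) multipoly"
proof -
  have "coeff_sum (f * g) = coeff_sum f * coeff_sum g" by (simp add: coeff_sum_def of_nat_coeff.poly_value_mult)
  then have "f = 0 \<or> g = 0" if "f * g = 0"
    using that coeff_sum_pos[of f] coeff_sum_pos[of g] by (force simp: coeff_sum_def[of 0])
  then show ?thesis by auto
qed

lemma poly_value_nonneg:
  fixes x :: "'v \<Rightarrow> real"
  assumes "g \<in> polys_over V" "\<And>v. v \<in> V \<Longrightarrow> x v \<ge> 0"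
  shows "poly_value of_nat g x \<ge> 0"
proof -
  have "monomial_value \<alpha> x \<ge> 0" if "\<alpha> \<in> Poly_Mapping.keys g" for \<alpha>
    unfolding monomial_value_def using assms that by (intro prod_nonneg ballI zero_le_power) (auto simp: polys_over_def)
  then show ?thesis unfolding poly_value_alt by (intro sum_nonneg mult_nonneg_nonneg) auto
qed

lemma nat_multipoly_sum_eq_0_iff:
  fixes f :: "'i \<Rightarrow> ('v, nat) multipoly"
  assumes "finite A"
  shows "sum f A = 0 \<longleftrightarrow> (\<forall>i\<in>A. f i = 0)"
proof
  assume s: "sum f A = 0"
  have "(\<Sum>i\<in>A. coeff_sum (f i)) = coeff_sum (sum f A)" by (simp add: coeff_sum_def of_nat_coeff.poly_value_sum)
  also have "\<dots> = 0" by (simp add: s coeff_sum_def)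
  finally have "(\<Sum>i\<in>A. coeff_sum (f i)) = 0" .
  moreover have "coeff_sum (f i) \<ge> 0" for i using coeff_sum_pos[of "f i"] by (cases "f i = 0") (auto simp: coeff_sum_def)
  ultimately have "\<forall>i\<in>A. coeff_sum (f i) = 0" using assms sum_nonneg_eq_0_iff[of A "\<lambda>i. coeff_sum (f i)"] by simp
  then show "\<forall>i\<in>A. f i = 0" using coeff_sum_pos by fastforce
qed simp

lemma index_mult_mat_sum:
  "A \<in> carrier_mat n n \<Longrightarrow> B \<in> carrier_mat n n \<Longrightarrow> i < n \<Longrightarrow> j < n \<Longrightarrow> (A * B) $$ (i, j) = (\<Sum>l<n. A $$ (i, l) * B $$ (l, j))"
  by (simp add: scalar_prod_def atLeast0LessThan)

lemma pow_mat_add: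
  fixes A :: "'a::semiring_1 mat"
  assumes A: "A \<in> carrier_mat n n"
  shows "A ^\<^sub>m (k + k') = A ^\<^sub>m k * A ^\<^sub>m k'"
proof (induction k')
  case 0
  then show ?case using A right_mult_one_mat[of "A ^\<^sub>m k" n n] by simp
next
  case (Suc k')
  then show ?case using A assoc_mult_mat[of "A ^\<^sub>m k" n n "A ^\<^sub>m k'" n A n] by simp
qed

lemma mat_power_entry_nonzero:
  fixes A :: "('v, nat) multipoly mat"
  assumes A: "A \<in> carrier_mat n n" and i: "i < n" "l < n" "j < n"
    and 1: "(A ^\<^sub>m k) $$ (i, l) \<noteq> 0" and 2: "(A ^\<^sub>m k') $$ (l, j) \<noteq> 0"
  shows "(A ^\<^sub>m (k + k')) $$ (i, j) \<noteq> 0"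
proof -
  have c: "A ^\<^sub>m k \<in> carrier_mat n n" "A ^\<^sub>m k' \<in> carrier_mat n n" using A by (auto intro: pow_carrier_mat)
  have "A ^\<^sub>m (k + k') = A ^\<^sub>m k * A ^\<^sub>m k'" using A by (rule pow_mat_add)
  then have "(A ^\<^sub>m (k + k')) $$ (i, j) = (\<Sum>l<n. (A ^\<^sub>m k) $$ (i, l) * (A ^\<^sub>m k') $$ (l, j))"
    using c i by (simp add: index_mult_mat_sum)
  moreover have "\<dots> \<noteq> 0" using 1 2 i by (auto simp: nat_multipoly_sum_eq_0_iff nat_multipoly_mult_eq_0_iff)
  ultimately show ?thesis by simp
qed

section \<open>Companion matrices over the semiring\<close>

definition to_nat_poly :: "('v, int) multipoly \<Rightarrow> ('v, nat) multipoly" where "to_nat_poly g = Poly_Mapping.map nat g"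

lemma lookup_to_nat_poly: "Poly_Mapping.lookup (to_nat_poly g) \<alpha> = nat (Poly_Mapping.lookup g \<alpha>)"
  by (simp add: to_nat_poly_def Poly_Mapping.map.rep_eq when_def)

lemma keys_to_nat_poly: "Poly_Mapping.keys (to_nat_poly g) \<subseteq> Poly_Mapping.keys g"
  by (auto simp: in_keys_iff lookup_to_nat_poly)

lemma to_nat_poly_over: "g \<in> polys_over V \<Longrightarrow> to_nat_poly g \<in> polys_over V"
  using keys_to_nat_poly[of g] by (auto simp: polys_over_def)

lemma poly_value_to_nat_poly:
  assumes "\<And>\<alpha>. Poly_Mapping.lookup g \<alpha> \<ge> 0"
  shows "poly_value of_nat (to_nat_poly g) x = (poly_value of_int g x :: real)"
  using assms by (subst of_nat_coeff.poly_value_superset[OF _ keys_to_nat_poly]) (auto simp: poly_value_alt lookup_to_nat_poly)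

lemma to_nat_poly_nonzero: "Poly_Mapping.lookup g \<alpha> > 0 \<Longrightarrow> to_nat_poly g \<noteq> 0"
  using lookup_to_nat_poly[of g \<alpha>] by auto

text \<open>With \<open>K = 2 k + 1\<close> and a single term \<open>m\<close> of \<open>q ^ k\<close>, the last row of the matrix expresses
  \<open>q ^ K = (q ^ k - m) q ^ k * q + m q ^ (k + 1)\<close>. Both coefficients are nonzero, which gives cycles of the
  coprime lengths \<open>K - 1\<close> and \<open>K\<close>; the vector of powers of \<open>q\<close> is an eigenvector.\<close>

theorem aperiodic_companion_matrix:
  fixes q :: "('v, int) multipoly"
  assumes q: "q \<in> polys_over V" and pos: "\<And>x. x \<in> V \<rightarrow>\<^sub>E {0<..} \<Longrightarrow> poly_value of_int q x > (0::real)"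
    and k: "k \<ge> 1" and nn: "\<And>\<alpha>. Poly_Mapping.lookup (q ^ k) \<alpha> \<ge> 0" "\<And>\<alpha>. Poly_Mapping.lookup (q ^ Suc k) \<alpha> \<ge> 0"
    and two: "\<beta> \<in> Poly_Mapping.keys (q ^ k)" "\<gamma> \<in> Poly_Mapping.keys (q ^ k)" "\<beta> \<noteq> \<gamma>"
    and ne: "q ^ Suc k \<noteq> 0"
  shows "\<exists>A. square_matrix_over V A \<and> aperiodic_matrix A \<and> is_spectral_radius_fun V q A"
proof -
  define f where "f = q ^ k"
  define mm where "mm = Poly_Mapping.single \<beta> (Poly_Mapping.lookup f \<beta>)"
  define r where "r = f - mm"
  define A1 A0 where "A1 = to_nat_poly r * to_nat_poly f" and "A0 = to_nat_poly mm * to_nat_poly (q ^ Suc k)"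
  define K where "K = 2 * k + 1"
  have K3: "K \<ge> 3" using k by (simp add: K_def)
  have lr: "Poly_Mapping.lookup r \<alpha> = (if \<alpha> = \<beta> then 0 else Poly_Mapping.lookup f \<alpha>)" for \<alpha>
    by (simp add: r_def mm_def lookup_minus lookup_single when_def)
  have lm: "Poly_Mapping.lookup mm \<alpha> = (if \<alpha> = \<beta> then Poly_Mapping.lookup f \<alpha> else 0)" for \<alpha>
    by (simp add: mm_def lookup_single when_def)
  have fn: "Poly_Mapping.lookup f \<alpha> \<ge> 0" for \<alpha> using nn(1) by (simp add: f_def)
  have rn: "Poly_Mapping.lookup r \<alpha> \<ge> 0" and mn: "Poly_Mapping.lookup mm \<alpha> \<ge> 0" for \<alpha> using fn by (auto simp: lr lm)
  have fpos: "Poly_Mapping.lookup f \<alpha> > 0" if "\<alpha> \<in> Poly_Mapping.keys (q ^ k)" for \<alpha>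
    using fn[of \<alpha>] that by (auto simp: f_def in_keys_iff less_le)
  have nz: "to_nat_poly f \<noteq> 0" "to_nat_poly r \<noteq> 0" "to_nat_poly mm \<noteq> 0"
    using fpos[OF two(1)] fpos[OF two(2)] two(3)
    by (auto intro!: to_nat_poly_nonzero[of f \<beta>] to_nat_poly_nonzero[of r \<gamma>] to_nat_poly_nonzero[of mm \<beta>] simp: lm lr)
  have nz2: "to_nat_poly (q ^ Suc k) \<noteq> 0"
  proof -
    obtain \<alpha> where "\<alpha> \<in> Poly_Mapping.keys (q ^ Suc k)" using ne by (metis all_not_in_conv keys_eq_empty)
    then have "Poly_Mapping.lookup (q ^ Suc k) \<alpha> > 0" using nn(2)[of \<alpha>] by (simp add: in_keys_iff less_le del: power_Suc)
    then show ?thesis by (rule to_nat_poly_nonzero)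
  qed
  have A1nz: "A1 \<noteq> 0" and A0nz: "A0 \<noteq> 0" using nz nz2 by (auto simp: A1_def A0_def nat_multipoly_mult_eq_0_iff)
  have fV: "f \<in> polys_over V" unfolding f_def by (rule polys_over_power[OF q])
  have rV: "r \<in> polys_over V" "mm \<in> polys_over V"
  proof -
    have "Poly_Mapping.keys r \<subseteq> Poly_Mapping.keys f" "Poly_Mapping.keys mm \<subseteq> Poly_Mapping.keys f"
      by (auto simp: in_keys_iff lr lm split: if_splits)
    then show "r \<in> polys_over V" "mm \<in> polys_over V" using fV by (auto simp: polys_over_def)
  qed
  have A1V: "A1 \<in> polys_over V" and A0V: "A0 \<in> polys_over V" unfolding A1_def A0_def
    by (intro polys_over_mult to_nat_poly_over fV rV polys_over_power[OF q])+
  have rel: "poly_value of_nat A0 x + poly_value of_nat A1 x * poly_value of_int q x = (poly_value of_int q x :: real) ^ K" for x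
  proof -
    let ?v = "\<lambda>g. poly_value of_int g x :: real"
    have fr: "?v f = ?v r + ?v mm" using of_int_coeff.poly_value_add[of r mm x] by (simp add: r_def)
    have "poly_value of_nat A0 x = ?v mm * (?v q * ?v f)"
      unfolding A0_def of_nat_coeff.poly_value_mult poly_value_to_nat_poly[OF mn] poly_value_to_nat_poly[OF nn(2)]
      by (simp add: of_int_coeff.poly_value_mult f_def)
    moreover have "poly_value of_nat A1 x = ?v r * ?v f"
      unfolding A1_def of_nat_coeff.poly_value_mult poly_value_to_nat_poly[OF rn] poly_value_to_nat_poly[OF fn] ..
    moreover have "?v q ^ K = ?v f * ?v f * ?v q"
      by (simp add: f_def of_int_coeff.poly_value_power K_def mult_2 power_add)
    ultimately show ?thesis by (simp add: fr algebra_simps)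
  qed
  define A where "A = mat K K (\<lambda>(i, j). if i < K - 1 then (if j = i + 1 then 1 else 0) else if j = 0 then A0 else if j = 1 then A1 else 0)"
  have Ac: "A \<in> carrier_mat K K" by (simp add: A_def)
  have Aij: "A $$ (i, j) = (if i < K - 1 then (if j = i + 1 then 1 else 0) else if j = 0 then A0 else if j = 1 then A1 else 0)" if "i < K" "j < K" for i j
    using that by (simp add: A_def)
  have sq: "square_matrix_over V A"
    unfolding square_matrix_over_def using K3 A0V A1V by (auto simp: elements_mat_def A_def)
  have sr: "is_spectral_radius_fun V q A"
    unfolding is_spectral_radius_fun_def
  proof
    fix x :: "'v \<Rightarrow> real" assume x: "x \<in> V \<rightarrow>\<^sub>E {0<..}"
    define b where "b = (poly_value of_int q x :: real)"
    have b: "b > 0" using pos[OF x] by (simp add: b_def)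
    have x0: "poly_value of_nat (A $$ (i, j)) x \<ge> 0" if ij: "i < K" "j < K" for i j
    proof -
      have "A $$ (i, j) \<in> polys_over V" using A0V A1V by (simp add: Aij ij)
      then show ?thesis by (rule poly_value_nonneg) (use x in \<open>auto simp: PiE_def Pi_def intro: less_imp_le\<close>)
    qed
    have "spectral_radius_fun A x = b"
      unfolding spectral_radius_fun_def
    proof (rule spectral_radius_of_positive_eigenvector[where n = K and v = "\<lambda>i. b ^ i" and a = "\<lambda>i j. poly_value of_nat (A $$ (i, j)) x"])
      fix i assume i: "i < K"
      show "(\<Sum>j<K. poly_value of_nat (A $$ (i, j)) x * b ^ j) = b * b ^ i"
      proof (cases "i < K - 1")
        case True
        have "(\<Sum>j<K. poly_value of_nat (A $$ (i, j)) x * b ^ j) = (\<Sum>j\<in>{i + 1}. poly_value of_nat (A $$ (i, j)) x * b ^ j)"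
          using True by (intro sum.mono_neutral_right) (auto simp: Aij)
        then show ?thesis using True by (simp add: Aij)
      next
        case False
        have "(\<Sum>j<K. poly_value of_nat (A $$ (i, j)) x * b ^ j) = (\<Sum>j\<in>{0, 1}. poly_value of_nat (A $$ (i, j)) x * b ^ j)"
          using False K3 i by (intro sum.mono_neutral_right) (auto simp: Aij)
        also have "\<dots> = poly_value of_nat A0 x + poly_value of_nat A1 x * b" using False K3 i by (simp add: Aij)
        also have "\<dots> = b ^ K" unfolding b_def by (rule rel)
        also have "b ^ K = b ^ Suc i" using False i by (intro arg_cong[of _ _ "\<lambda>n. b ^ n"]) simp
        finally show ?thesis by (simp only: power_Suc)
      qed
    qed (use Ac K3 x0 b in auto)
    then show "poly_value of_int q x = spectral_radius_fun A x" by (simp add: b_def)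
  qed
  let ?W = "\<lambda>k i j. (A ^\<^sub>m k) $$ (i, j) \<noteq> 0"
  have W1: "?W 1 i j" if "A $$ (i, j) \<noteq> 0" "i < K" "j < K" for i j
    using that Ac by simp
  have W0: "?W 0 i i" if "i < K" for i using that Ac by simp
  have Wt: "?W (k + k') i j" if "?W k i l" "?W k' l j" "i < K" "l < K" "j < K" for k k' i l j
    using mat_power_entry_nonzero[OF Ac that(3-5) that(1,2)] .
  have step: "?W d i (i + d)" if "i + d < K" for i d
    using that
  proof (induction d)
    case 0 then show ?case using W0 by simp
  next
    case (Suc d)
    have "?W 1 (i + d) (i + Suc d)" using Suc.prems by (intro W1) (auto simp: Aij)
    then show ?case using Wt[OF Suc.IH, of 1 "i + Suc d"] Suc.prems by simp
  qed
  have loopK: "?W K (K - 1) (K - 1)"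
  proof -
    have "?W 1 (K - 1) 0" using K3 A0nz by (intro W1) (auto simp: Aij)
    from Wt[OF this, of "K - 1" "K - 1"] step[of 0 "K - 1"] K3 show ?thesis by simp
  qed
  have loopK1: "?W (K - 1) (K - 1) (K - 1)"
  proof -
    have "?W 1 (K - 1) 1" using K3 A1nz by (intro W1) (auto simp: Aij)
    moreover have eq: "1 + (K - 2) = K - 1" using K3 by simp
    moreover have "?W (K - 2) 1 (K - 1)" unfolding eq[symmetric] by (rule step) (use K3 in auto)
    ultimately have "?W (1 + (K - 2)) (K - 1) (K - 1)" by (intro Wt) (use K3 in auto)
    then show ?thesis unfolding eq .
  qed
  have mult: "?W (c * d) (K - 1) (K - 1)" if "?W d (K - 1) (K - 1)" for c d
  proof (induction c)
    case 0 then show ?case using W0[of "K - 1"] K3 by simp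
  next
    case (Suc c)
    have "?W (d + c * d) (K - 1) (K - 1)" by (rule Wt[OF that Suc.IH]) (use K3 in auto)
    then show ?case by simp
  qed
  \<comment> \<open>The coin problem for K - 1 and K: n = c + (K - 1) e consists of e - c loops of
    length K - 1 and c loops of length K; \<open>n \<ge> K * K\<close> guarantees c \<le> e.\<close>
  have loop: "?W n (K - 1) (K - 1)" if n: "n \<ge> K * K" for n
  proof -
    define c where "c = n mod (K - 1)"
    have "c < K - 1" unfolding c_def using K3 by (intro mod_less_divisor) simp
    then have "c * K \<le> K * K" by (intro mult_right_mono) auto
    then have cn: "c * K \<le> n" using n by linarith
    have "c \<le> n" "(n - c) mod (K - 1) = 0" unfolding c_def by (auto simp: mod_less_eq_dividend minus_mod_eq_mult_div)
    then obtain e where e: "n = c + (K - 1) * e" unfolding c_def by (metis mod_mult_div_eq)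
    have cK: "c * K = c * (K - 1) + c" using K3 by (cases K) auto
    then have "c * (K - 1) \<le> (K - 1) * e" using cn e by simp
    then have "c \<le> e" using K3 by (simp add: mult.commute)
    then have "(K - 1) * e = (e - c) * (K - 1) + c * (K - 1)" by (simp add: diff_mult_distrib mult.commute)
    then have "n = (e - c) * (K - 1) + c * K" using e cK by linarith
    moreover have "?W ((e - c) * (K - 1) + c * K) (K - 1) (K - 1)"
      by (rule Wt[OF mult[OF loopK1] mult[OF loopK]]) (use K3 in auto)
    ultimately show ?thesis by simp
  qed
  have "aperiodic_matrix A"
    unfolding aperiodic_matrix_def
  proof (intro exI[of _ "K * K + 2 * K"] conjI allI impI)
    show "1 \<le> K * K + 2 * K" using K3 by simp
    fix i j assume "i < dim_row A" "j < dim_row A"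
    then have ij: "i < K" "j < K" using Ac by auto
    \<comment> \<open>The length splits into K - 1 - i steps from i to the last index, n steps of
      loops there, and 1 + j steps from there to j; the surplus 2 * K covers the outer two parts, so
      n \<ge> K * K.\<close>
    define n where "n = K * K + 2 * K - (K - 1 - i) - (1 + j)"
    have n: "n \<ge> K * K" "K * K + 2 * K = (K - 1 - i) + (n + (1 + j))" using ij by (auto simp: n_def)
    have 1: "?W (K - 1 - i) i (K - 1)" using step[of i "K - 1 - i"] ij by simp
    have "?W 1 (K - 1) 0" using K3 A0nz by (intro W1) (auto simp: Aij)
    then have 3: "?W (1 + j) (K - 1) j" using Wt[of 1 "K - 1" 0 j j] step[of 0 j] ij K3 by simp
    have "?W (n + (1 + j)) (K - 1) j" by (rule Wt[OF loop[OF n(1)] 3]) (use ij in auto)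
    then show "?W (K * K + 2 * K) i j" unfolding n(2) by (rule Wt[OF 1]) (use ij in auto)
  qed
  then show ?thesis using sq sr by blast
qed

text \<open>For t strictly between the spectral radius and s, the powers of A / t are bounded
  because its spectral radius is below 1, whereas the hypothesis makes them grow like (s / t)^k on
  \<open>w\<close>.\<close>

lemma spectral_radius_growth:
  fixes A :: "complex mat" and a :: "nat \<Rightarrow> nat \<Rightarrow> real"
  assumes A: "A \<in> carrier_mat n n" and n: "n > 0"
    and Aa: "\<And>i j. i < n \<Longrightarrow> j < n \<Longrightarrow> A $$ (i, j) = of_real (a i j)" and a0: "\<And>i j. i < n \<Longrightarrow> j < n \<Longrightarrow> a i j \<ge> 0"
    and w0: "\<And>i. i < n \<Longrightarrow> w i \<ge> 0" and wi: "i0 < n" "w i0 > 0"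
    and gr: "\<And>i. i < n \<Longrightarrow> s * w i \<le> (\<Sum>j<n. a i j * w j)"
  shows "s \<le> spectral_radius A"
proof (rule ccontr)
  assume "\<not> ?thesis"
  then have lt: "spectral_radius A < s" by simp
  obtain k0 where "eigenvalue A k0" "cmod k0 = spectral_radius A" using spectral_radius_attained[OF A n] by blast
  then have sr0: "spectral_radius A \<ge> 0" by (metis norm_ge_zero)
  define t where "t = (spectral_radius A + s) / 2"
  have t: "t > 0" "spectral_radius A < t" "t < s" using lt sr0 by (auto simp: t_def)
  define B where "B = mat n n (\<lambda>(i, j). complex_of_real (a i j / t))"
  have B: "B \<in> carrier_mat n n" by (simp add: B_def)
  have "spectral_radius B < 1"
  proof -
    obtain k where k: "eigenvalue B k" "cmod k = spectral_radius B" using spectral_radius_attained[OF B n] by blast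
    then obtain v i where v: "i < n" "v i \<noteq> 0" "\<And>i. i < n \<Longrightarrow> (\<Sum>j<n. B $$ (i, j) * v j) = k * v i"
      unfolding eigenvalue_iff_fun[OF B] by blast
    have "(\<Sum>j<n. A $$ (i, j) * v j) = (of_real t * k) * v i" if i: "i < n" for i
    proof -
      have "(\<Sum>j<n. A $$ (i, j) * v j) = (\<Sum>j<n. of_real t * (B $$ (i, j) * v j))"
        using t i by (intro sum.cong) (auto simp: B_def Aa)
      then show ?thesis using v(3)[OF i] by (simp flip: sum_distrib_left)
    qed
    then have "eigenvalue A (of_real t * k)" unfolding eigenvalue_iff_fun[OF A] using v(1,2) by blast
    from spectral_radius_ge[OF A n this] have "t * cmod k \<le> spectral_radius A" using t by (simp add: norm_mult)
    then have "t * cmod k < t" using t by linarith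
    then have "cmod k < 1" using t(1) by (metis mult.right_neutral mult_less_cancel_left_pos)
    then show ?thesis using k(2) by simp
  qed
  from spectral_radius_jnf_norm_bound_less_1_upper_triangular[OF B this] obtain C where C: "\<And>k. norm_bound (B ^\<^sub>m k) C" by blast
  have nonneg: "\<exists>b. (B ^\<^sub>m k) $$ (i, j) = complex_of_real b \<and> b \<ge> 0" if "i < n" "j < n" for k i j
    using that
  proof (induction k arbitrary: i j)
    case 0 then show ?case using B by (auto intro: exI[of _ "0::real"] exI[of _ "1::real"])
  next
    case (Suc k)
    obtain b where b: "\<And>i j. i < n \<Longrightarrow> j < n \<Longrightarrow> (B ^\<^sub>m k) $$ (i, j) = complex_of_real (b i j) \<and> b i j \<ge> 0"
      using Suc.IH by metis
    have "(B ^\<^sub>m Suc k) $$ (i, j) = (\<Sum>l<n. (B ^\<^sub>m k) $$ (i, l) * B $$ (l, j))"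
      unfolding pow_mat.simps using Suc.prems by (intro index_mult_mat_sum[OF pow_carrier_mat[OF B] B])
    also have "\<dots> = complex_of_real (\<Sum>l<n. b i l * (a l j / t))" using b Suc.prems by (simp add: B_def)
    finally show ?case using b Suc.prems a0 t by (intro exI[of _ "\<Sum>l<n. b i l * (a l j / t)"]) (auto intro!: sum_nonneg)
  qed
  define b where "b k i j = Re ((B ^\<^sub>m k) $$ (i, j))" for k i j
  have b: "(B ^\<^sub>m k) $$ (i, j) = of_real (b k i j)" "b k i j \<ge> 0" if "i < n" "j < n" for k i j
    using nonneg[OF that, of k] by (auto simp: b_def)
  have bC: "b k i j \<le> C" if "i < n" "j < n" for k i j
  proof -
    have "norm ((B ^\<^sub>m k) $$ (i, j)) \<le> C" using C[of k] that B by (auto simp: norm_bound_def)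
    then show ?thesis using b[OF that, of k] by simp
  qed
  have grow: "(s / t) ^ k * w i \<le> (\<Sum>j<n. b k i j * w j)" if "i < n" for k i
    using that
  proof (induction k arbitrary: i)
    case 0
    have "(\<Sum>j<n. b 0 i j * w j) = (\<Sum>j<n. if i = j then w j else 0)"
      using 0 B by (intro sum.cong) (auto simp: b_def)
    then show ?case using 0 by simp
  next
    case (Suc k)
    have "complex_of_real (b (Suc k) i j) = of_real (\<Sum>l<n. b k i l * (a l j / t))" if "j < n" for j
    proof -
      have "(B ^\<^sub>m Suc k) $$ (i, j) = (\<Sum>l<n. (B ^\<^sub>m k) $$ (i, l) * B $$ (l, j))"
        unfolding pow_mat.simps using Suc.prems that by (intro index_mult_mat_sum[OF pow_carrier_mat[OF B] B])
      then show ?thesis using b[OF Suc.prems that, of "Suc k"] b(1)[OF Suc.prems] that by (simp add: B_def)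
    qed
    then have bs: "b (Suc k) i j = (\<Sum>l<n. b k i l * (a l j / t))" if "j < n" for j using that by (simp only: of_real_eq_iff)
    have "(s / t) ^ Suc k * w i = (s / t) * ((s / t) ^ k * w i)" by simp
    also have "\<dots> \<le> (s / t) * (\<Sum>l<n. b k i l * w l)" using Suc.IH[OF Suc.prems] t by (intro mult_left_mono) auto
    also have "\<dots> = (\<Sum>l<n. b k i l * (s * w l / t))" by (simp add: sum_distrib_left mult_ac)
    also have "\<dots> \<le> (\<Sum>l<n. b k i l * ((\<Sum>j<n. a l j * w j) / t))"
      using b(2)[OF Suc.prems] gr t by (intro sum_mono mult_left_mono divide_right_mono) auto
    also have "\<dots> = (\<Sum>j<n. \<Sum>l<n. b k i l * (a l j / t) * w j)"
      by (subst sum.swap) (simp add: sum_distrib_left sum_divide_distrib mult_ac)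
    also have "\<dots> = (\<Sum>j<n. b (Suc k) i j * w j)" by (simp add: bs sum_distrib_right)
    finally show ?case .
  qed
  have "(s / t) ^ k \<le> C * (\<Sum>j<n. w j) / w i0" for k
  proof -
    have "(s / t) ^ k * w i0 \<le> (\<Sum>j<n. b k i0 j * w j)" by (rule grow[OF wi(1)])
    also have "\<dots> \<le> (\<Sum>j<n. C * w j)" using bC[OF wi(1)] w0 by (intro sum_mono mult_right_mono) auto
    finally show ?thesis using wi by (simp add: sum_distrib_left field_simps)
  qed
  moreover obtain k where "C * (\<Sum>j<n. w j) / w i0 < (s / t) ^ k"
    using real_arch_pow[of "s / t" "C * (\<Sum>j<n. w j) / w i0"] t by auto
  ultimately show False by (meson not_le)
qed

section \<open>Perron-Frobenius theory\<close>

text \<open>Strong connectivity of the graph of positive entries, in the form that no proper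
  nonempty subset is closed under edges; powers of the matrix do not occur.\<close>

definition irreducible_on :: "nat set \<Rightarrow> (nat \<Rightarrow> nat \<Rightarrow> real) \<Rightarrow> bool" where
  "irreducible_on S C \<longleftrightarrow> (\<forall>T. T \<subseteq> S \<longrightarrow> T \<noteq> {} \<longrightarrow> T \<noteq> S \<longrightarrow> (\<exists>i\<in>T. \<exists>j\<in>S - T. C i j > 0))"

text \<open>For a nonnegative matrix this says that the spectral radius is at most \<open>r\<close>.
  Expressed by inequalities, the condition is easy to transfer to blocks and to limits.\<close>

definition no_growth :: "nat set \<Rightarrow> (nat \<Rightarrow> nat \<Rightarrow> real) \<Rightarrow> real \<Rightarrow> bool" where
  "no_growth S C r \<longleftrightarrow> (\<forall>w \<epsilon>. \<epsilon> > 0 \<longrightarrow> (\<forall>i\<in>S. w i \<ge> 0) \<longrightarrow> (\<exists>i\<in>S. w i > 0) \<longrightarrow> \<not> (\<forall>i\<in>S. (r + \<epsilon>) * w i \<le> (\<Sum>j\<in>S. C i j * w j)))"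

locale pf =
  fixes S :: "nat set" and C :: "nat \<Rightarrow> nat \<Rightarrow> real" and r :: real
  assumes finS: "finite S" and C0: "\<And>i j. i \<in> S \<Longrightarrow> j \<in> S \<Longrightarrow> C i j \<ge> 0"
    and irr: "irreducible_on S C" and ng: "no_growth S C r" and r0: "r \<ge> 0"
begin

text \<open>Induction on the number of equalities. If all inequalities are strict, r can be
  increased, against \<open>no_growth\<close>. Otherwise an edge leads from an equality index i to a
  strict index j, and enlarging y_j a little keeps j strict and makes i strict.\<close>

lemma no_strict:
  assumes "\<forall>i\<in>S. y i \<ge> 0" "\<exists>i\<in>S. y i > 0" "\<forall>i\<in>S. r * y i \<le> (\<Sum>j\<in>S. C i j * y j)"
  shows "{i\<in>S. r * y i < (\<Sum>j\<in>S. C i j * y j)} = {}"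
  using assms
proof (induction "card {i\<in>S. r * y i = (\<Sum>j\<in>S. C i j * y j)}" arbitrary: y rule: less_induct)
  case less
  define \<delta> where "\<delta> i = (\<Sum>j\<in>S. C i j * y j) - r * y i" for i
  define Z where "Z = {i\<in>S. r * y i < (\<Sum>j\<in>S. C i j * y j)}"
  have d0: "\<delta> i \<ge> 0" if "i \<in> S" for i using less.prems(3) that by (simp add: \<delta>_def)
  have dZ: "\<delta> i > 0 \<longleftrightarrow> i \<in> Z" if "i \<in> S" for i using that by (simp add: \<delta>_def Z_def)
  have "Z = {}"
  proof (rule ccontr)
    assume ne: "Z \<noteq> {}"
    show False
    proof (cases "Z = S")
      case True
      \<comment> \<open>The summand 1 avoids a division by \<open>y i = 0\<close>.\<close>
      define \<epsilon> where "\<epsilon> = Min ((\<lambda>i. \<delta> i / (1 + y i)) ` S)"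
      have Sne: "S \<noteq> {}" using less.prems(2) by auto
      have "\<epsilon> \<in> (\<lambda>i. \<delta> i / (1 + y i)) ` S" unfolding \<epsilon>_def using finS Sne by (intro Min_in) auto
      then obtain i where i: "i \<in> S" "\<epsilon> = \<delta> i / (1 + y i)" by blast
      have e: "\<epsilon> > 0" unfolding i(2) using dZ[OF i(1)] True i less.prems(1) by (intro divide_pos_pos) (auto intro: add_pos_nonneg)
      have "(r + \<epsilon>) * y i \<le> (\<Sum>j\<in>S. C i j * y j)" if "i \<in> S" for i
      proof -
        have y: "y i \<ge> 0" using less.prems(1) that by blast
        have "\<epsilon> \<le> \<delta> i / (1 + y i)" unfolding \<epsilon>_def using finS that by (intro Min_le) auto
        then have "\<epsilon> * (1 + y i) \<le> \<delta> i" using y by (simp add: pos_le_divide_eq)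
        then have "\<epsilon> * y i \<le> \<delta> i" using e by (simp add: algebra_simps)
        then show ?thesis by (simp add: \<delta>_def algebra_simps)
      qed
      then show False using ng e less.prems(1,2) unfolding no_growth_def by blast
    next
      case False
      have "S - Z \<subseteq> S" "S - Z \<noteq> {}" "S - Z \<noteq> S" using False ne by (auto simp: Z_def)
      then obtain i j where ij: "i \<in> S - Z" "j \<in> S - (S - Z)" "C i j > 0" using irr unfolding irreducible_on_def by meson
      have jZ: "j \<in> Z" "j \<in> S" using ij by auto
      have iS: "i \<in> S" "i \<noteq> j" using ij jZ by auto
      \<comment> \<open>Small enough for j to stay strict, since r * \<eta> < \<delta> j.\<close>
      define \<eta> where "\<eta> = \<delta> j / (1 + r)"
      have eta: "\<eta> > 0" "r * \<eta> < \<delta> j" using dZ[OF jZ(2)] jZ r0 by (auto simp: \<eta>_def field_simps)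
      define y' where "y' = y(j := y j + \<eta>)"
      have S': "(\<Sum>l\<in>S. C k l * y' l) = (\<Sum>l\<in>S. C k l * y l) + C k j * \<eta>" for k
      proof -
        have "(\<Sum>l\<in>S. C k l * y' l) = (\<Sum>l\<in>S. C k l * y l + (if l = j then C k j * \<eta> else 0))"
          by (intro sum.cong) (auto simp: y'_def algebra_simps)
        then show ?thesis using finS jZ(2) by (simp add: sum.distrib)
      qed
      have st: "r * y' k \<le> (\<Sum>l\<in>S. C k l * y' l)" "k \<in> Z \<or> k = i \<Longrightarrow> r * y' k < (\<Sum>l\<in>S. C k l * y' l)" if k: "k \<in> S" for k
      proof -
        have c: "C k j * \<eta> \<ge> 0" using C0[OF k jZ(2)] eta by simp
        have "(r * y' k \<le> (\<Sum>l\<in>S. C k l * y' l)) \<and> (k \<in> Z \<or> k = i \<longrightarrow> r * y' k < (\<Sum>l\<in>S. C k l * y' l))"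
        proof (cases "k = j")
          case True
          then show ?thesis unfolding S' using eta(2) c by (simp add: y'_def \<delta>_def algebra_simps)
        next
          case kj: False
          have "k = i \<Longrightarrow> C k j * \<eta> > 0" using ij eta by simp
          moreover have "\<delta> k \<ge> 0" "k \<in> Z \<Longrightarrow> \<delta> k > 0" using d0[OF k] dZ[OF k] by auto
          ultimately show ?thesis unfolding S' using kj c by (auto simp: y'_def \<delta>_def)
        qed
        then show "r * y' k \<le> (\<Sum>l\<in>S. C k l * y' l)" "k \<in> Z \<or> k = i \<Longrightarrow> r * y' k < (\<Sum>l\<in>S. C k l * y' l)" by blast+
      qed
      have "{k\<in>S. r * y' k = (\<Sum>l\<in>S. C k l * y' l)} \<subset> {k\<in>S. r * y k = (\<Sum>l\<in>S. C k l * y l)}"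
      proof
        show "{k\<in>S. r * y' k = (\<Sum>l\<in>S. C k l * y' l)} \<subseteq> {k\<in>S. r * y k = (\<Sum>l\<in>S. C k l * y l)}"
        proof safe
          fix k assume k: "k \<in> S" "r * y' k = (\<Sum>l\<in>S. C k l * y' l)"
          then have "k \<notin> Z" using st(2)[OF k(1)] by auto
          then show "r * y k = (\<Sum>l\<in>S. C k l * y l)" using k less.prems(3) by (force simp: Z_def)
        qed
        have "r * y i = (\<Sum>l\<in>S. C i l * y l)" using ij(1) less.prems(3) by (force simp: Z_def)
        then show "{k\<in>S. r * y' k = (\<Sum>l\<in>S. C k l * y' l)} \<noteq> {k\<in>S. r * y k = (\<Sum>l\<in>S. C k l * y l)}" 
          using st(2)[OF iS(1)] iS(1) by (metis (mono_tags, lifting) less_irrefl mem_Collect_eq)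
      qed
      then have "card {k\<in>S. r * y' k = (\<Sum>l\<in>S. C k l * y' l)} < card {k\<in>S. r * y k = (\<Sum>l\<in>S. C k l * y l)}"
        using finS by (intro psubset_card_mono) auto
      moreover have "\<forall>i\<in>S. y' i \<ge> 0" "\<exists>i\<in>S. y' i > 0" using less.prems(1) jZ eta by (auto simp: y'_def add_nonneg_pos intro!: bexI[of _ j])
      ultimately have "{i\<in>S. r * y' i < (\<Sum>j\<in>S. C i j * y' j)} = {}" using st(1) by (intro less.hyps) auto
      then show False using st(2)[OF iS(1)] iS by blast
    qed
  qed
  then show ?case by (simp add: Z_def)
qed

text \<open>Equality is \<open>no_strict\<close>. An edge from the zero set of \<open>y\<close> to
  its complement would make a vanishing row sum positive, so the zero set is closed under edges and
  hence empty.\<close>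

lemma pf_equality:
  assumes y0: "\<And>i. i \<in> S \<Longrightarrow> y i \<ge> 0" and yi: "i0 \<in> S" "y i0 > 0" and ge: "\<And>i. i \<in> S \<Longrightarrow> r * y i \<le> (\<Sum>j\<in>S. C i j * y j)" and i: "i \<in> S"
  shows "(\<Sum>j\<in>S. C i j * y j) = r * y i" "y i > 0"
proof -
  have eq: "(\<Sum>j\<in>S. C i j * y j) = r * y i" if "i \<in> S" for i
    using no_strict[of y] y0 yi ge that by (force simp: not_less)
  then show "(\<Sum>j\<in>S. C i j * y j) = r * y i" using i by blast
  define T where "T = {i\<in>S. y i = 0}"
  have "T = {}"
  proof (rule ccontr)
    assume "T \<noteq> {}"
    moreover have "T \<subseteq> S" "i0 \<notin> T" using yi by (auto simp: T_def)
    moreover from this have "T \<noteq> S" using yi by blast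
    ultimately obtain i j where ij: "i \<in> T" "j \<in> S - T" "C i j > 0" using irr unfolding irreducible_on_def by meson
    have "0 < C i j * y j" using ij y0[of j] by (auto simp: T_def less_le)
    also have "\<dots> \<le> (\<Sum>j\<in>S. C i j * y j)"
      using ij finS C0 y0 by (intro member_le_sum[of j S "\<lambda>j. C i j * y j"]) (auto simp: T_def)
    also have "\<dots> = 0" using eq[of i] ij by (simp add: T_def)
    finally show False by simp
  qed
  then show "y i > 0" using i y0[OF i] by (auto simp: T_def less_le)
qed

text \<open>Subtract the largest multiple of \<open>v\<close> that leaves a nonnegative vector. The
  difference vanishes at some index, so by \<open>pf_equality\<close> it is zero.\<close>

lemma geometric_simple:
  fixes w :: "nat \<Rightarrow> real"
  assumes v: "\<And>i. i \<in> S \<Longrightarrow> v i > 0" "\<And>i. i \<in> S \<Longrightarrow> (\<Sum>j\<in>S. C i j * v j) = r * v i"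
    and w: "\<And>i. i \<in> S \<Longrightarrow> (\<Sum>j\<in>S. C i j * w j) = r * w i"
  shows "\<exists>\<kappa>. \<forall>i\<in>S. w i = \<kappa> * v i"
proof (cases "S = {}")
  case False
  define \<kappa> where "\<kappa> = Min ((\<lambda>i. w i / v i) ` S)"
  have "\<kappa> \<in> (\<lambda>i. w i / v i) ` S" unfolding \<kappa>_def using finS False by (intro Min_in) auto
  then obtain i where i: "i \<in> S" "\<kappa> = w i / v i" by blast
  define d where "d i = w i - \<kappa> * v i" for i
  have d0: "d j \<ge> 0" if "j \<in> S" for j
  proof -
    have "\<kappa> \<le> w j / v j" unfolding \<kappa>_def using finS that by (intro Min_le) auto
    then show ?thesis using v(1)[OF that] by (simp add: d_def field_simps)
  qed
  have de: "(\<Sum>j\<in>S. C k j * d j) = r * d k" if "k \<in> S" for k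
    using v(2)[OF that] w[OF that] by (simp add: d_def right_diff_distrib sum_subtractf mult.left_commute[of _ \<kappa>] flip: sum_distrib_left)
  have di: "d i = 0" using i v(1)[OF i(1)] by (simp add: d_def)
  have "d j = 0" if "j \<in> S" for j
  proof (rule ccontr)
    assume "d j \<noteq> 0"
    then have "d j > 0" using d0[OF that] by simp
    from pf_equality(2)[of d j i, OF d0 that this _ i(1)] de di show False by auto
  qed
  then show ?thesis by (intro exI[of _ \<kappa>]) (simp add: d_def)
qed simp

text \<open>Pairing with the positive right eigenvector \<open>v\<close> excludes growth of the
  transpose.\<close>

lemma transposed:
  assumes v: "\<And>i. i \<in> S \<Longrightarrow> v i > 0" "\<And>i. i \<in> S \<Longrightarrow> (\<Sum>j\<in>S. C i j * v j) = r * v i"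
  shows "pf S (\<lambda>i j. C j i) r"
proof unfold_locales
  show "irreducible_on S (\<lambda>i j. C j i)"
    unfolding irreducible_on_def
  proof (intro allI impI)
    fix T assume T: "T \<subseteq> S" "T \<noteq> {}" "T \<noteq> S"
    then have "S - T \<subseteq> S" "S - T \<noteq> {}" "S - T \<noteq> S" by auto
    then obtain i j where "i \<in> S - T" "j \<in> S - (S - T)" "C i j > 0" using irr unfolding irreducible_on_def by meson
    then show "\<exists>i\<in>T. \<exists>j\<in>S - T. C j i > 0" by blast
  qed
  show "no_growth S (\<lambda>i j. C j i) r"
    unfolding no_growth_def
  proof (intro allI impI notI)
    fix w \<epsilon> assume e: "\<epsilon> > (0::real)" and w: "\<forall>i\<in>S. w i \<ge> 0" "\<exists>i\<in>S. w i > 0" and g: "\<forall>i\<in>S. (r + \<epsilon>) * w i \<le> (\<Sum>j\<in>S. C j i * w j)"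
    have "(r + \<epsilon>) * (\<Sum>i\<in>S. v i * w i) = (\<Sum>i\<in>S. v i * ((r + \<epsilon>) * w i))" by (simp add: sum_distrib_left mult_ac)
    also have "\<dots> \<le> (\<Sum>i\<in>S. v i * (\<Sum>j\<in>S. C j i * w j))" using g v(1) by (intro sum_mono mult_left_mono) (auto intro: less_imp_le)
    also have "\<dots> = (\<Sum>j\<in>S. \<Sum>i\<in>S. w j * (C j i * v i))" by (subst sum.swap) (simp add: sum_distrib_left mult_ac)
    also have "\<dots> = (\<Sum>j\<in>S. w j * (r * v j))" by (intro sum.cong refl) (simp add: v(2) flip: sum_distrib_left)
    also have "\<dots> = r * (\<Sum>i\<in>S. v i * w i)" by (simp add: sum_distrib_left mult_ac)
    finally have "\<epsilon> * (\<Sum>i\<in>S. v i * w i) \<le> 0" by (simp add: algebra_simps)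
    moreover have "(\<Sum>i\<in>S. v i * w i) > 0"
    proof -
      obtain i where "i \<in> S" "w i > 0" using w by blast
      then have "0 < v i * w i" using v(1) by simp
      also have "\<dots> \<le> (\<Sum>i\<in>S. v i * w i)"
        using \<open>i \<in> S\<close> finS w(1) v(1) by (intro member_le_sum[of i S "\<lambda>i. v i * w i"]) (auto simp: less_imp_le)
      finally show ?thesis .
    qed
    ultimately show False using e by (simp add: mult_le_0_iff)
  qed
qed (use finS C0 r0 in auto)

end

text \<open>The equality case of the triangle inequality, stated without division so that zero
  summands and a zero sum are included.\<close>

lemma sum_norm_eq_imp_aligned:
  fixes f :: "'i \<Rightarrow> complex"
  assumes "finite A" "cmod (\<Sum>i\<in>A. f i) = (\<Sum>i\<in>A. cmod (f i))" "i \<in> A"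
  shows "f i * of_real (cmod (\<Sum>i\<in>A. f i)) = of_real (cmod (f i)) * (\<Sum>i\<in>A. f i)"
proof (cases "(\<Sum>i\<in>A. f i) = 0")
  case True
  then have "\<forall>i\<in>A. cmod (f i) = 0" using assms(1,2) sum_nonneg_eq_0_iff[of A "\<lambda>i. cmod (f i)"] by simp
  then show ?thesis using True assms(3) by simp
next
  case False
  define s where "s = (\<Sum>i\<in>A. f i)"
  have ns: "cmod s > 0" using False by (simp add: s_def)
  \<comment> \<open>The summands rotated so that their sum is a positive real; each then has real
    part equal to its modulus.\<close>
  define g where "g i = f i * cnj s / of_real (cmod s)" for i
  have ng: "cmod (g i) = cmod (f i)" for i using ns by (simp add: g_def norm_mult norm_divide)
  have "(\<Sum>i\<in>A. g i) = s * cnj s / of_real (cmod s)" by (simp add: g_def s_def sum_distrib_right sum_divide_distrib)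
  also have "\<dots> = of_real (cmod s)" using ns by (simp add: complex_norm_square[symmetric] power2_eq_square flip: of_real_mult of_real_divide)
  finally have "(\<Sum>i\<in>A. Re (g i)) = cmod s" by (metis Re_complex_of_real Re_sum)
  then have "(\<Sum>i\<in>A. cmod (g i) - Re (g i)) = 0" using assms(2) by (simp add: sum_subtractf ng s_def)
  then have "cmod (g i) - Re (g i) = 0"
    using assms(1,3) sum_nonneg_eq_0_iff[of A "\<lambda>i. cmod (g i) - Re (g i)"] complex_Re_le_cmod by auto
  then have "g i = of_real (cmod (f i))"
    using ng[of i] cmod_eq_Re[of "g i"] by (metis cmod_Re_le_iff complex_eq_iff cmod_eq_Re Re_complex_of_real Im_complex_of_real cmod_power2 diff_eq_diff_eq diff_self add_cancel_right_right eq_iff_diff_eq_0 power2_eq_iff zero_eq_power2)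
  then have "f i * cnj s = of_real (cmod (f i)) * of_real (cmod s)" using ns by (simp add: g_def field_simps)
  then have "f i * (s * cnj s) = of_real (cmod (f i)) * of_real (cmod s) * s" by (simp add: mult_ac)
  moreover have "s * cnj s = of_real (cmod s) * of_real (cmod s)" by (simp add: complex_norm_square[symmetric] power2_eq_square flip: of_real_mult)
  ultimately have "(f i * of_real (cmod s)) * of_real (cmod s) = (of_real (cmod (f i)) * s) * of_real (cmod s)" by (simp add: mult_ac)
  then show ?thesis using ns by (simp add: s_def)
qed

text \<open>The moduli of the entries satisfy the inequality assumed in \<open>pf_equality\<close>,
  which turns them into a positive eigenvector.\<close>

lemma (in pf) complex_eigenvector:
  fixes w :: "nat \<Rightarrow> complex"
  assumes wi: "i0 \<in> S" "w i0 \<noteq> 0" and w: "\<And>i. i \<in> S \<Longrightarrow> (\<Sum>j\<in>S. M i j * w j) = k * w i"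
    and M: "\<And>i j. i \<in> S \<Longrightarrow> j \<in> S \<Longrightarrow> cmod (M i j) \<le> C i j" and k: "r \<le> cmod k"
  shows "\<And>i. i \<in> S \<Longrightarrow> (\<Sum>j\<in>S. C i j * cmod (w j)) = r * cmod (w i)" "\<And>i. i \<in> S \<Longrightarrow> cmod (w i) > 0" "cmod k = r"
proof -
  have ge: "cmod k * cmod (w i) \<le> (\<Sum>j\<in>S. C i j * cmod (w j))" if "i \<in> S" for i
  proof -
    have "cmod k * cmod (w i) = cmod (\<Sum>j\<in>S. M i j * w j)" by (simp add: w[OF that] norm_mult)
    also have "\<dots> \<le> (\<Sum>j\<in>S. C i j * cmod (w j))"
      by (rule sum_norm_le) (simp add: norm_mult mult_right_mono M that)
    finally show ?thesis .
  qed
  have ge': "r * cmod (w i) \<le> (\<Sum>j\<in>S. C i j * cmod (w j))" if "i \<in> S" for i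
    using ge[OF that] mult_right_mono[OF k, of "cmod (w i)"] by simp
  have i0: "cmod (w i0) > 0" using wi by simp
  show eq: "\<And>i. i \<in> S \<Longrightarrow> (\<Sum>j\<in>S. C i j * cmod (w j)) = r * cmod (w i)" and "\<And>i. i \<in> S \<Longrightarrow> cmod (w i) > 0"
    using pf_equality[of "\<lambda>i. cmod (w i)" i0, OF _ wi(1) i0 ge'] by auto
  show "cmod k = r" using ge[OF wi(1)] eq[OF wi(1)] k i0 by (auto intro: antisym)
qed

text \<open>The Perron eigenvalue is simple. As \<open>\<mu> n\<close> differs from
  \<open>rn n\<close>, its eigenvector is orthogonal to the left eigenvector \<open>u n\<close>. In
  the limit a positive left eigenvector is orthogonal to a nonzero eigenvector for \<open>r\<close>,
  whose real and imaginary parts are multiples of the positive \<open>v\<close>: impossible.\<close>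

lemma (in pf) no_branching:
  fixes Cn :: "nat \<Rightarrow> nat \<Rightarrow> nat \<Rightarrow> real" and w :: "nat \<Rightarrow> nat \<Rightarrow> complex" and \<mu> :: "nat \<Rightarrow> complex"
  assumes Cl: "\<And>i j. i \<in> S \<Longrightarrow> j \<in> S \<Longrightarrow> (\<lambda>n. Cn n i j) \<longlonglongrightarrow> C i j"
    and rl: "rn \<longlonglongrightarrow> r" and ml: "\<mu> \<longlonglongrightarrow> of_real r" and ne: "\<And>n. \<mu> n \<noteq> of_real (rn n)"
    and wne: "\<And>n. \<exists>i\<in>S. w n i \<noteq> 0" and w: "\<And>n i. i \<in> S \<Longrightarrow> (\<Sum>j\<in>S. of_real (Cn n i j) * w n j) = \<mu> n * w n i"
    and u0: "\<And>n i. i \<in> S \<Longrightarrow> u n i > 0" and u: "\<And>n i. i \<in> S \<Longrightarrow> (\<Sum>j\<in>S. Cn n j i * u n j) = rn n * u n i"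
    and v: "\<And>i. i \<in> S \<Longrightarrow> v i > 0" "\<And>i. i \<in> S \<Longrightarrow> (\<Sum>j\<in>S. C i j * v j) = r * v i"
  shows False
proof -
  interpret T: pf S "\<lambda>i j. C j i" r by (rule transposed[OF v])
  have Sne: "S \<noteq> {}" using wne[of 0] by blast
  define nw where "nw n = (\<Sum>i\<in>S. cmod (w n i))" for n
  define nu where "nu n = (\<Sum>i\<in>S. u n i)" for n
  have nw: "nw n > 0" for n
  proof -
    obtain i where i: "i \<in> S" "w n i \<noteq> 0" using wne by blast
    then have "0 < cmod (w n i)" by simp
    also have "\<dots> \<le> nw n" unfolding nw_def using i finS by (intro member_le_sum) auto
    finally show ?thesis .
  qed
  have nu: "nu n > 0" for n unfolding nu_def using u0 Sne finS by (intro sum_pos) auto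
  define w' u' where "w' n i = w n i / of_real (nw n)" and "u' n i = u n i / nu n" for n i
  have sw: "(\<Sum>i\<in>S. cmod (w' n i)) = 1" for n
  proof -
    have "cmod (w' n i) = cmod (w n i) / nw n" for i using nw[of n] by (simp add: w'_def norm_divide)
    then show ?thesis using nw[of n] by (simp add: nw_def flip: sum_divide_distrib)
  qed
  have su: "(\<Sum>i\<in>S. u' n i) = 1" for n using nu[of n] by (simp add: u'_def nu_def flip: sum_divide_distrib)
  have u'0: "u' n i > 0" if "i \<in> S" for n i using u0[OF that] nu[of n] by (simp add: u'_def)
  have wb: "cmod (w' n i) \<le> 1" if "i \<in> S" for n i using sw[of n] member_le_sum[OF that, of "\<lambda>i. cmod (w' n i)"] finS by simp
  have ub: "u' n i \<le> 1" if "i \<in> S" for n i using su[of n] member_le_sum[OF that, of "u' n"] finS u'0 by (auto simp: less_imp_le)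
  obtain r1 wl where r1: "strict_mono r1" "\<forall>i\<in>S. (\<lambda>n. w' (r1 n) i) \<longlonglongrightarrow> wl i"
    using finite_conv_subseq[OF finS, of w'] wb by (force simp: bounded_iff)
  obtain r2 ul where r2: "strict_mono r2" "\<forall>i\<in>S. (\<lambda>n. u' (r1 (r2 n)) i) \<longlonglongrightarrow> ul i"
  proof -
    have "bounded (range (\<lambda>n. u' (r1 n) i))" if i: "i \<in> S" for i
      unfolding bounded_iff by (rule exI[of _ 1]) (use ub[OF i] u'0[OF i] in \<open>auto simp: abs_of_pos\<close>)
    then show thesis using finite_conv_subseq[OF finS, of "\<lambda>n. u' (r1 n)"] that by blast
  qed
  define s where "s n = r1 (r2 n)" for n
  have s: "strict_mono s" using r1(1) r2(1) by (auto simp: strict_mono_def s_def)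
  have wl: "(\<lambda>n. w' (s n) i) \<longlonglongrightarrow> wl i" if "i \<in> S" for i
    using LIMSEQ_subseq_LIMSEQ[OF r1(2)[rule_format, OF that] r2(1)] by (simp add: s_def o_def)
  have ul: "(\<lambda>n. u' (s n) i) \<longlonglongrightarrow> ul i" if "i \<in> S" for i using r2(2) that by (simp add: s_def)
  have Cs: "(\<lambda>n. Cn (s n) i j) \<longlonglongrightarrow> C i j" if "i \<in> S" "j \<in> S" for i j
    using LIMSEQ_subseq_LIMSEQ[OF Cl[OF that] s] by (simp add: o_def)
  have rs: "(\<lambda>n. rn (s n)) \<longlonglongrightarrow> r" using LIMSEQ_subseq_LIMSEQ[OF rl s] by (simp add: o_def)
  have ms: "(\<lambda>n. \<mu> (s n)) \<longlonglongrightarrow> of_real r" using LIMSEQ_subseq_LIMSEQ[OF ml s] by (simp add: o_def)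
  have w': "(\<Sum>j\<in>S. of_real (Cn n i j) * w' n j) = \<mu> n * w' n i" if "i \<in> S" for n i
    using w[OF that, of n] by (simp add: w'_def flip: sum_divide_distrib)
  have u': "(\<Sum>j\<in>S. Cn n j i * u' n j) = rn n * u' n i" if "i \<in> S" for n i
    using u[OF that, of n] by (simp add: u'_def flip: sum_divide_distrib)
  have swl: "(\<Sum>i\<in>S. cmod (wl i)) = 1"
  proof -
    have "(\<lambda>n. \<Sum>i\<in>S. cmod (w' (s n) i)) \<longlonglongrightarrow> (\<Sum>i\<in>S. cmod (wl i))" by (intro tendsto_intros wl)
    then show ?thesis using sw LIMSEQ_unique[OF _ tendsto_const] by fastforce
  qed
  have sul: "(\<Sum>i\<in>S. ul i) = 1"
  proof -
    have "(\<lambda>n. \<Sum>i\<in>S. u' (s n) i) \<longlonglongrightarrow> (\<Sum>i\<in>S. ul i)" by (intro tendsto_intros ul)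
    then show ?thesis using su LIMSEQ_unique[OF _ tendsto_const] by fastforce
  qed
  have ewl: "(\<Sum>j\<in>S. of_real (C i j) * wl j) = of_real r * wl i" if i: "i \<in> S" for i
  proof -
    have "(\<lambda>n. \<Sum>j\<in>S. of_real (Cn (s n) i j) * w' (s n) j) \<longlonglongrightarrow> (\<Sum>j\<in>S. of_real (C i j) * wl j)" by (intro tendsto_intros wl Cs i)
    moreover have "(\<lambda>n. \<mu> (s n) * w' (s n) i) \<longlonglongrightarrow> of_real r * wl i" by (intro tendsto_intros ms wl i)
    ultimately show ?thesis unfolding w'[OF i] using LIMSEQ_unique by blast
  qed
  have eul: "(\<Sum>j\<in>S. C j i * ul j) = r * ul i" if i: "i \<in> S" for i
  proof -
    have "(\<lambda>n. \<Sum>j\<in>S. Cn (s n) j i * u' (s n) j) \<longlonglongrightarrow> (\<Sum>j\<in>S. C j i * ul j)" by (intro tendsto_intros ul Cs i)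
    moreover have "(\<lambda>n. rn (s n) * u' (s n) i) \<longlonglongrightarrow> r * ul i" by (intro tendsto_intros rs ul i)
    ultimately show ?thesis unfolding u'[OF i] using LIMSEQ_unique by blast
  qed
  have ul0: "ul i \<ge> 0" if "i \<in> S" for i
    by (rule LIMSEQ_le_const[OF ul[OF that]]) (use u'0[OF that] in \<open>auto simp: less_imp_le\<close>)
  have ulp: "ul i > 0" if "i \<in> S" for i
  proof -
    have "\<exists>i0\<in>S. ul i0 > 0"
    proof (rule ccontr)
      assume "\<not> ?thesis"
      then have "(\<Sum>i\<in>S. ul i) \<le> 0" by (intro sum_nonpos) (auto simp: not_less)
      then show False using sul by simp
    qed
    then obtain i0 where "i0 \<in> S" "ul i0 > 0" by blast
    then show ?thesis using T.pf_equality(2)[of ul i0 i] ul0 eul that by auto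
  qed
  have orth: "(\<Sum>i\<in>S. of_real (u' n i) * w' n i) = 0" for n
  proof -
    have "\<mu> n * (\<Sum>i\<in>S. of_real (u' n i) * w' n i) = (\<Sum>i\<in>S. of_real (u' n i) * (\<Sum>j\<in>S. of_real (Cn n i j) * w' n j))"
    proof -
      have "\<mu> n * (\<Sum>i\<in>S. of_real (u' n i) * w' n i) = (\<Sum>i\<in>S. of_real (u' n i) * (\<mu> n * w' n i))"
        by (simp add: sum_distrib_left mult_ac)
      also have "\<dots> = (\<Sum>i\<in>S. of_real (u' n i) * (\<Sum>j\<in>S. of_real (Cn n i j) * w' n j))"
        by (intro sum.cong refl) (simp only: w')
      finally show ?thesis .
    qed
    also have "\<dots> = (\<Sum>j\<in>S. of_real (\<Sum>i\<in>S. Cn n i j * u' n i) * w' n j)"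
      by (simp add: sum_distrib_left sum_distrib_right mult_ac) (rule sum.swap)
    also have "\<dots> = of_real (rn n) * (\<Sum>i\<in>S. of_real (u' n i) * w' n i)"
    proof -
      have "(\<Sum>j\<in>S. of_real (\<Sum>i\<in>S. Cn n i j * u' n i) * w' n j) = (\<Sum>j\<in>S. of_real (rn n * u' n j) * w' n j)"
        by (intro sum.cong refl) (simp only: u')
      then show ?thesis by (simp add: sum_distrib_left mult_ac)
    qed
    finally have "(\<mu> n - of_real (rn n)) * (\<Sum>i\<in>S. of_real (u' n i) * w' n i) = 0" by (simp add: left_diff_distrib)
    then show ?thesis using ne[of n] by simp
  qed
  have orthl: "(\<Sum>i\<in>S. of_real (ul i) * wl i) = 0"
  proof -
    have "(\<lambda>n. \<Sum>i\<in>S. of_real (u' (s n) i) * w' (s n) i) \<longlonglongrightarrow> (\<Sum>i\<in>S. of_real (ul i) * wl i)" by (intro tendsto_intros ul wl)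
    then show ?thesis unfolding orth using LIMSEQ_unique[OF _ tendsto_const] by fastforce
  qed
  have uv: "(\<Sum>i\<in>S. ul i * v i) > 0" using ulp v(1) Sne finS by (intro sum_pos) auto
  have zero: "f i = 0" if "i \<in> S" and f: "\<And>i. i \<in> S \<Longrightarrow> (\<Sum>j\<in>S. C i j * f j) = r * f i" and o: "(\<Sum>i\<in>S. ul i * f i) = 0" for f :: "nat \<Rightarrow> real" and i
  proof -
    obtain \<kappa> where k: "\<forall>i\<in>S. f i = \<kappa> * v i" using geometric_simple[OF v f] by blast
    then have "(\<Sum>i\<in>S. ul i * f i) = \<kappa> * (\<Sum>i\<in>S. ul i * v i)" by (simp add: sum_distrib_left mult_ac)
    then have "\<kappa> = 0" using o uv by simp
    then show ?thesis using k that by simp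
  qed
  have "Re (wl i) = 0" if "i \<in> S" for i
  proof (rule zero[OF that])
    show "(\<Sum>j\<in>S. C i j * Re (wl j)) = r * Re (wl i)" if "i \<in> S" for i using arg_cong[OF ewl[OF that], of Re] by simp
    show "(\<Sum>i\<in>S. ul i * Re (wl i)) = 0" using arg_cong[OF orthl, of Re] by simp
  qed
  moreover have "Im (wl i) = 0" if "i \<in> S" for i
  proof (rule zero[OF that])
    show "(\<Sum>j\<in>S. C i j * Im (wl j)) = r * Im (wl i)" if "i \<in> S" for i using arg_cong[OF ewl[OF that], of Im] by simp
    show "(\<Sum>i\<in>S. ul i * Im (wl i)) = 0" using arg_cong[OF orthl, of Im] by simp
  qed
  ultimately have "wl i = 0" if "i \<in> S" for i using that by (simp add: complex_eq_iff)
  then show False using swl by simp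
qed

section \<open>Determinants of blocks and the identity principle\<close>

text \<open>The identity outside \<open>S\<close> turns principal minors into determinants of one fixed size.\<close>

definition bordered :: "nat \<Rightarrow> nat set \<Rightarrow> (nat \<Rightarrow> nat \<Rightarrow> 'a::comm_ring_1) \<Rightarrow> 'a \<Rightarrow> 'a mat" where
  "bordered n S M q = mat n n (\<lambda>(i, j). if i \<in> S \<and> j \<in> S then (if i = j then q else 0) - M i j else if i = j then 1 else 0)"

lemma det_bordered_eq_0_iff:
  fixes M :: "nat \<Rightarrow> nat \<Rightarrow> complex"
  assumes S: "S \<subseteq> {..<n}"
  shows "det (bordered n S M q) = 0 \<longleftrightarrow> (\<exists>w. (\<exists>i\<in>S. w i \<noteq> 0) \<and> (\<forall>i\<in>S. (\<Sum>j\<in>S. M i j * w j) = q * w i))"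
proof -
  have finS: "finite S" using S finite_subset by blast
  define B where "B = bordered n S M q"
  have B: "B \<in> carrier_mat n n" by (simp add: B_def bordered_def)
  have row: "vec_index (B *\<^sub>v v) i = (if i \<in> S then q * vec_index v i - (\<Sum>j\<in>S. M i j * vec_index v j) else vec_index v i)"
    if v: "v \<in> carrier_vec n" and i: "i < n" for v i
  proof -
    have "vec_index (B *\<^sub>v v) i = (\<Sum>j<n. B $$ (i, j) * vec_index v j)"
      using B v i by (simp add: scalar_prod_def atLeast0LessThan)
    also have "\<dots> = (if i \<in> S then q * vec_index v i - (\<Sum>j\<in>S. M i j * vec_index v j) else vec_index v i)"
    proof (cases "i \<in> S")
      case True
      have "(\<Sum>j<n. B $$ (i, j) * vec_index v j) = (\<Sum>j\<in>S. ((if i = j then q else 0) - M i j) * vec_index v j)"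
        using True S i by (intro sum.mono_neutral_cong_right) (auto simp: B_def bordered_def)
      also have "\<dots> = (\<Sum>j\<in>S. if i = j then q * vec_index v j else 0) - (\<Sum>j\<in>S. M i j * vec_index v j)"
        by (simp add: left_diff_distrib sum_subtractf if_distrib[of "\<lambda>x. x * _"] cong: if_cong)
      finally show ?thesis using True finS by simp
    next
      case False
      have "(\<Sum>j<n. B $$ (i, j) * vec_index v j) = (\<Sum>j<n. if i = j then vec_index v j else 0)"
        using False i by (intro sum.cong) (auto simp: B_def bordered_def)
      then show ?thesis using False i by simp
    qed
    finally show ?thesis .
  qed
  show ?thesis
    unfolding B_def[symmetric] det_0_iff_vec_prod_zero[OF B]
  proof
    assume "\<exists>v. v \<in> carrier_vec n \<and> v \<noteq> 0\<^sub>v n \<and> B *\<^sub>v v = 0\<^sub>v n"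
    then obtain v where v: "v \<in> carrier_vec n" "v \<noteq> 0\<^sub>v n" "B *\<^sub>v v = 0\<^sub>v n" by blast
    have r: "(if i \<in> S then q * vec_index v i - (\<Sum>j\<in>S. M i j * vec_index v j) else vec_index v i) = 0" if "i < n" for i
      unfolding row[OF v(1) that, symmetric] using v(3) that by simp
    have "\<exists>i\<in>S. vec_index v i \<noteq> 0"
    proof (rule ccontr)
      assume n: "\<not> ?thesis"
      have "v = 0\<^sub>v n"
      proof (rule eq_vecI)
        fix i assume "i < dim_vec (0\<^sub>v n :: complex Matrix.vec)"
        then show "vec_index v i = vec_index (0\<^sub>v n) i" using n r[of i] by (cases "i \<in> S") auto
      qed (use v in simp)
      then show False using v(2) by simp
    qed
    moreover have "(\<Sum>j\<in>S. M i j * vec_index v j) = q * vec_index v i" if "i \<in> S" for i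
      using r[of i] that S by auto
    ultimately show "\<exists>w. (\<exists>i\<in>S. w i \<noteq> 0) \<and> (\<forall>i\<in>S. (\<Sum>j\<in>S. M i j * w j) = q * w i)" by blast
  next
    assume "\<exists>w. (\<exists>i\<in>S. w i \<noteq> 0) \<and> (\<forall>i\<in>S. (\<Sum>j\<in>S. M i j * w j) = q * w i)"
    then obtain w i0 where w: "i0 \<in> S" "w i0 \<noteq> 0" "\<And>i. i \<in> S \<Longrightarrow> (\<Sum>j\<in>S. M i j * w j) = q * w i" by blast
    define v where "v = Matrix.vec n (\<lambda>i. if i \<in> S then w i else 0)"
    have v: "v \<in> carrier_vec n" by (simp add: v_def)
    have vi: "vec_index v i = (if i \<in> S then w i else 0)" if "i < n" for i using that by (simp add: v_def)
    have "v \<noteq> 0\<^sub>v n"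
    proof
      assume "v = 0\<^sub>v n"
      then have "vec_index v i0 = 0" using w(1) S by auto
      then show False using w S vi[of i0] by auto
    qed
    moreover have "B *\<^sub>v v = 0\<^sub>v n"
    proof (rule eq_vecI)
      fix i assume "i < dim_vec (0\<^sub>v n :: complex Matrix.vec)"
      then have i: "i < n" by simp
      have "(\<Sum>j\<in>S. M i j * vec_index v j) = (\<Sum>j\<in>S. M i j * w j)" using S vi by (intro sum.cong) auto
      then show "vec_index (B *\<^sub>v v) i = vec_index (0\<^sub>v n) i" unfolding row[OF v i] using w(3)[of i] vi[OF i] i by auto
    qed (use B in simp)
    ultimately show "\<exists>v. v \<in> carrier_vec n \<and> v \<noteq> 0\<^sub>v n \<and> B *\<^sub>v v = 0\<^sub>v n" using v by blast
  qed
qed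

lemma det_bordered_transpose: "det (bordered n S (\<lambda>i j. M j i) q) = det (bordered n S M q)" for M :: "nat \<Rightarrow> nat \<Rightarrow> complex"
proof -
  have "bordered n S (\<lambda>i j. M j i) q = transpose_mat (bordered n S M q)"
    by (rule eq_matI) (auto simp: bordered_def)
  then show ?thesis using det_transpose[of "bordered n S M q" n] by (simp add: bordered_def)
qed

text \<open>Polynomial on every complex line: this suffices for the identity principle.\<close>

definition line_poly :: "(('v \<Rightarrow> complex) \<Rightarrow> complex) \<Rightarrow> bool" where
  "line_poly F \<longleftrightarrow> (\<forall>a b. \<exists>P. \<forall>s. F (\<lambda>v. a v + s * b v) = poly P s)"

lemma line_poly_const: "line_poly (\<lambda>_. c)"
  unfolding line_poly_def by (intro allI exI[of _ "[:c:]"]) simp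

lemma line_poly_coord: "line_poly (\<lambda>z. z v)"
  unfolding line_poly_def
proof (intro allI)
  fix a b :: "'a \<Rightarrow> complex"
  show "\<exists>P. \<forall>s. a v + s * b v = poly P s" by (intro exI[of _ "[:a v, b v:]"]) simp
qed

lemma line_poly_add: "line_poly F \<Longrightarrow> line_poly G \<Longrightarrow> line_poly (\<lambda>z. F z + G z)"
  unfolding line_poly_def by (metis poly_add)

lemma line_poly_mult: "line_poly F \<Longrightarrow> line_poly G \<Longrightarrow> line_poly (\<lambda>z. F z * G z)"
  unfolding line_poly_def by (metis poly_mult)

lemma line_poly_diff: "line_poly F \<Longrightarrow> line_poly G \<Longrightarrow> line_poly (\<lambda>z. F z - G z)"
  unfolding line_poly_def by (metis poly_diff)

lemma line_poly_sum: "(\<And>i. i \<in> A \<Longrightarrow> line_poly (F i)) \<Longrightarrow> line_poly (\<lambda>z. \<Sum>i\<in>A. F i z)"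
  by (induction A rule: infinite_finite_induct) (auto intro: line_poly_const line_poly_add)

lemma line_poly_prod: "(\<And>i. i \<in> A \<Longrightarrow> line_poly (F i)) \<Longrightarrow> line_poly (\<lambda>z. \<Prod>i\<in>A. F i z)"
  by (induction A rule: infinite_finite_induct) (auto intro: line_poly_const line_poly_mult)

lemma line_poly_power: "line_poly F \<Longrightarrow> line_poly (\<lambda>z. F z ^ k)"
  by (induction k) (auto intro: line_poly_const line_poly_mult)

lemma line_poly_value: "(\<And>v. line_poly (\<lambda>z. \<phi> z v)) \<Longrightarrow> line_poly (\<lambda>z. poly_value h q (\<phi> z))"
  unfolding poly_value_def by (intro line_poly_sum line_poly_mult line_poly_const line_poly_prod line_poly_power)

lemma line_poly_det:
  assumes "\<And>i j. i < n \<Longrightarrow> j < n \<Longrightarrow> line_poly (\<lambda>z. B z $$ (i, j))" and "\<And>z. B z \<in> carrier_mat n n"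
  shows "line_poly (\<lambda>z. det (B z))"
proof -
  have "(\<lambda>z. det (B z)) = (\<lambda>z. \<Sum>p | p permutes {0..<n}. signof p * (\<Prod>i = 0..<n. B z $$ (i, p i)))"
    by (rule ext) (rule det_def'[OF assms(2)])
  then show ?thesis
    by (simp only:) (intro line_poly_sum line_poly_mult line_poly_const line_poly_prod assms(1); auto dest: permutes_in_image)
qed

text \<open>Otherwise both factors are nonzero polynomials on the line joining a point where
  \<open>F\<close> is nonzero to one where \<open>G\<close> is nonzero.\<close>

lemma line_poly_mult_eq_0:
  assumes F: "line_poly F" and G: "line_poly G" and 0: "\<And>z. F z * G z = 0"
  shows "(\<forall>z. F z = 0) \<or> (\<forall>z. G z = 0)"
proof (rule ccontr)
  assume "\<not> ?thesis"
  then obtain a b where a: "F a \<noteq> 0" and b: "G b \<noteq> 0" by blast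
  obtain P where P: "\<And>s. F (\<lambda>v. a v + s * (b v - a v)) = poly P s"
    using F[unfolded line_poly_def, rule_format, of a "\<lambda>v. b v - a v"] by blast
  obtain Q where Q: "\<And>s. G (\<lambda>v. a v + s * (b v - a v)) = poly Q s"
    using G[unfolded line_poly_def, rule_format, of a "\<lambda>v. b v - a v"] by blast
  have "poly (P * Q) s = 0" for s using 0[of "\<lambda>v. a v + s * (b v - a v)"] P[of s] Q[of s] by simp
  then have "P * Q = 0" using poly_all_0_iff_0 by blast
  moreover have "P \<noteq> 0" using P[of 0] a by auto
  moreover have "Q \<noteq> 0" using Q[of 1] b by auto
  ultimately show False by simp
qed

lemma poly_zero_of_small_reals:
  fixes P :: "complex poly"
  assumes "e > 0" "\<And>s::real. 0 < s \<Longrightarrow> s < e \<Longrightarrow> poly P (of_real s) = 0"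
  shows "P = 0"
proof (rule ccontr)
  assume "P \<noteq> 0"
  then have "finite {s. poly P s = 0}" by (rule poly_roots_finite)
  moreover have "complex_of_real ` {0<..<e} \<subseteq> {s. poly P s = 0}" using assms(2) by auto
  ultimately have "finite (complex_of_real ` {0<..<e})" using finite_subset by blast
  then have "finite {0<..<e}" by (rule finite_imageD) (auto simp: inj_on_def)
  then show False using assms(1) infinite_Ioo[of 0 e] by blast
qed

text \<open>Two lines suffice. Lines through the point with all coordinates 1 stay positive for
  small parameters and reach every real point; the line Re z + s Im z is real for real s and passes
  through z at s = \<i>.\<close>

lemma line_poly_zero_of_positive:
  assumes F: "line_poly F" and V: "finite V" and 0: "\<And>y. (\<And>v. v \<in> V \<Longrightarrow> y v > 0) \<Longrightarrow> F (\<lambda>v. of_real (y v)) = 0"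
  shows "F z = 0"
proof -
  have real: "F (\<lambda>v. of_real (b v)) = 0" for b
  proof -
    obtain P where P: "\<And>s. F (\<lambda>v. 1 + s * of_real (b v - 1)) = poly P s"
      using F[unfolded line_poly_def, rule_format, of "\<lambda>_. 1" "\<lambda>v. of_real (b v - 1)"] by blast
    define e where "e = inverse (1 + (\<Sum>v\<in>V. \<bar>b v - 1\<bar>))"
    have e: "e > 0" unfolding e_def by (intro positive_imp_inverse_positive add_pos_nonneg sum_nonneg) auto
    have "P = 0"
    proof (rule poly_zero_of_small_reals[OF e])
      fix s :: real assume s: "0 < s" "s < e"
      have "1 + s * (b v - 1) > 0" if v: "v \<in> V" for v
      proof -
        have "\<bar>b v - 1\<bar> \<le> (\<Sum>v\<in>V. \<bar>b v - 1\<bar>)" using V v by (intro member_le_sum) auto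
        then have "\<bar>s * (b v - 1)\<bar> \<le> s * (1 + (\<Sum>v\<in>V. \<bar>b v - 1\<bar>))" using s by (simp add: abs_mult)
        also have "\<dots> < e * (1 + (\<Sum>v\<in>V. \<bar>b v - 1\<bar>))" using s by (intro mult_strict_right_mono add_pos_nonneg sum_nonneg) auto
        also have "\<dots> = 1"
        proof -
          have "1 + (\<Sum>v\<in>V. \<bar>b v - 1\<bar>) > 0" by (intro add_pos_nonneg sum_nonneg) auto
          then show ?thesis by (simp add: e_def)
        qed
        finally show ?thesis by linarith
      qed
      then show "poly P (of_real s) = 0" using 0[of "\<lambda>v. 1 + s * (b v - 1)"] P[of "of_real s"] by simp
    qed
    then show ?thesis using P[of 1] by simp
  qed
  obtain P where P: "\<And>s. F (\<lambda>v. of_real (Re (z v)) + s * of_real (Im (z v))) = poly P s"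
    using F[unfolded line_poly_def, rule_format, of "\<lambda>v. of_real (Re (z v))" "\<lambda>v. of_real (Im (z v))"] by blast
  have "P = 0"
  proof (rule poly_zero_of_small_reals[of 1])
    fix s :: real
    show "poly P (of_real s) = 0" using real[of "\<lambda>v. Re (z v) + s * Im (z v)"] P[of "of_real s"] by simp
  qed simp
  moreover have "(\<lambda>v. of_real (Re (z v)) + \<i> * of_real (Im (z v))) = z" by (simp add: complex_eq[symmetric])
  ultimately show ?thesis using P[of \<i>] by simp
qed

lemma poly_value_cong:
  assumes "q \<in> polys_over V" "\<And>v. v \<in> V \<Longrightarrow> z v = z' v"
  shows "poly_value h q z = poly_value h q z'"
  unfolding poly_value_alt monomial_value_def
  using assms by (intro sum.cong refl arg_cong2[where f = "(*)"] prod.cong arg_cong2[where f = "(^)"]) (auto simp: polys_over_def)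

lemma poly_value_of_nat_of_real: "poly_value of_nat g (\<lambda>v. complex_of_real (x v)) = of_real (poly_value of_nat g x)"
  by (simp add: poly_value_def)

lemma poly_value_of_int_of_real: "poly_value of_int g (\<lambda>v. complex_of_real (x v)) = of_real (poly_value of_int g x)"
  by (simp add: poly_value_def)

lemma cmod_monomial_value: "cmod (monomial_value \<alpha> z) = monomial_value \<alpha> (\<lambda>v. cmod (z v))"
  by (simp add: monomial_value_def norm_power flip: prod_norm)

lemma cmod_poly_value_le: "cmod (poly_value of_nat g z) \<le> poly_value of_nat g (\<lambda>v. cmod (z v))"
  unfolding poly_value_alt by (rule sum_norm_le) (simp add: norm_mult cmod_monomial_value)

lemma monomial_value_mono:
  fixes x y :: "'v \<Rightarrow> real"
  assumes "\<And>v. v \<in> Poly_Mapping.keys \<alpha> \<Longrightarrow> 0 \<le> x v \<and> x v \<le> y v"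
  shows "monomial_value \<alpha> x \<le> monomial_value \<alpha> y"
  unfolding monomial_value_def using assms by (intro prod_mono) (auto intro!: power_mono)

lemma poly_value_mono:
  fixes x y :: "'v \<Rightarrow> real"
  assumes "g \<in> polys_over V" "\<And>v. v \<in> V \<Longrightarrow> 0 \<le> x v \<and> x v \<le> y v"
  shows "poly_value of_nat g x \<le> poly_value of_nat g y"
  unfolding poly_value_alt using assms
  by (intro sum_mono mult_left_mono monomial_value_mono) (auto simp: polys_over_def)

lemma tendsto_poly_value:
  fixes x :: "nat \<Rightarrow> 'v \<Rightarrow> 'b::{real_normed_field}"
  assumes "g \<in> polys_over V" "\<And>v. v \<in> V \<Longrightarrow> (\<lambda>n. x n v) \<longlonglongrightarrow> y v"
  shows "(\<lambda>n. poly_value h g (x n)) \<longlonglongrightarrow> poly_value h g y"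
  unfolding poly_value_def using assms by (intro tendsto_intros) (auto simp: polys_over_def)

text \<open>If no edge left \<open>T\<close>, no power of the matrix could have a nonzero entry from
  \<open>T\<close> to its complement.\<close>

lemma irreducible_matrix_entry:
  fixes A :: "('v, nat) multipoly mat"
  assumes A: "A \<in> carrier_mat n n" and irr: "irreducible_matrix A" and T: "T \<subseteq> {..<n}" "T \<noteq> {}" "T \<noteq> {..<n}"
  shows "\<exists>i\<in>T. \<exists>j\<in>{..<n} - T. A $$ (i, j) \<noteq> 0"
proof (rule ccontr)
  assume n: "\<not> ?thesis"
  have z: "(A ^\<^sub>m k) $$ (i, j) = 0" if "i \<in> T" "j \<in> {..<n} - T" for k i j
    using that
  proof (induction k arbitrary: j)
    case 0
    then have "i < n" "j < n" "i \<noteq> j" using T by auto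
    then show ?case using A by simp
  next
    case (Suc k)
    have "(A ^\<^sub>m Suc k) $$ (i, j) = (\<Sum>l<n. (A ^\<^sub>m k) $$ (i, l) * A $$ (l, j))"
      unfolding pow_mat.simps using Suc.prems T by (intro index_mult_mat_sum[OF pow_carrier_mat[OF A] A]) auto
    also have "\<dots> = 0"
    proof (intro sum.neutral ballI)
      fix l assume "l \<in> {..<n}"
      then show "(A ^\<^sub>m k) $$ (i, l) * A $$ (l, j) = 0"
        using Suc n by (cases "l \<in> T") auto
    qed
    finally show ?case .
  qed
  obtain i where i: "i \<in> T" using T by blast
  obtain j where j: "j \<in> {..<n} - T" using T by blast
  show False using irr i j T A z[OF i j] unfolding irreducible_matrix_def by auto
qed

section \<open>The spectral radius as an algebraic eigenvalue\<close>

locale beta_matrix =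
  fixes V :: "'v set" and q :: "('v, int) multipoly" and A :: "('v, nat) multipoly mat" and n :: nat
  assumes finV: "finite V" and qV: "q \<in> polys_over V" and A: "A \<in> carrier_mat n n" and n0: "n > 0"
    and AV: "\<And>i j. i < n \<Longrightarrow> j < n \<Longrightarrow> A $$ (i, j) \<in> polys_over V"
    and irrA: "irreducible_matrix A"
    and beta: "is_spectral_radius_fun V q A"
begin

definition Q :: "('v \<Rightarrow> 'b::comm_ring_1) \<Rightarrow> 'b" where "Q z = poly_value of_int q z"
definition av :: "nat \<Rightarrow> nat \<Rightarrow> ('v \<Rightarrow> 'b::comm_semiring_1) \<Rightarrow> 'b" where "av i j z = poly_value of_nat (A $$ (i, j)) z"

lemma av_real: "av i j (\<lambda>v. complex_of_real (x v)) = of_real (av i j x)"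
  by (simp add: av_def poly_value_of_nat_of_real)

lemma Q_real: "Q (\<lambda>v. complex_of_real (x v)) = of_real (Q x)"
  by (simp add: Q_def poly_value_of_int_of_real)

lemma av_nonneg: "i < n \<Longrightarrow> j < n \<Longrightarrow> (\<And>v. v \<in> V \<Longrightarrow> x v \<ge> 0) \<Longrightarrow> av i j x \<ge> (0::real)"
  unfolding av_def by (rule poly_value_nonneg[OF AV])

lemma Q_eq_spectral_radius:
  assumes y: "\<And>v. v \<in> V \<Longrightarrow> y v > (0::real)"
  shows "Q y = spectral_radius (mat n n (\<lambda>(i, j). complex_of_real (av i j y)))"
proof -
  define y' where "y' = restrict y V"
  have "Q y = Q y'" unfolding Q_def by (rule poly_value_cong[OF qV]) (simp add: y'_def)
  also have "\<dots> = spectral_radius_fun A y'"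
    using beta y unfolding is_spectral_radius_fun_def Q_def by (auto simp: y'_def)
  also have "map_mat (\<lambda>q. complex_of_real (poly_value of_nat q y')) A = mat n n (\<lambda>(i, j). complex_of_real (av i j y))"
  proof (rule eq_matI)
    fix i j assume "i < dim_row (mat n n (\<lambda>(i, j). complex_of_real (av i j y)))" "j < dim_col (mat n n (\<lambda>(i, j). complex_of_real (av i j y)))"
    then have ij: "i < n" "j < n" by auto
    have "poly_value of_nat (A $$ (i, j)) y' = av i j y" unfolding av_def by (rule poly_value_cong[OF AV[OF ij]]) (simp add: y'_def)
    then show "map_mat (\<lambda>q. complex_of_real (poly_value of_nat q y')) A $$ (i, j) = mat n n (\<lambda>(i, j). complex_of_real (av i j y)) $$ (i, j)"
      using ij A by simp
  qed (use A in auto)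
  then have "spectral_radius_fun A y' = spectral_radius (mat n n (\<lambda>(i, j). complex_of_real (av i j y)))"
    unfolding spectral_radius_fun_def by simp
  finally show ?thesis .
qed

text \<open>A growing vector on a block, extended by 0, grows under the whole nonnegative matrix, so
  \<open>spectral_radius_growth\<close> applies.\<close>

lemma Q_growth:
  assumes y: "\<And>v. v \<in> V \<Longrightarrow> y v > (0::real)" and S: "S \<subseteq> {..<n}"
    and w: "\<And>i. i \<in> S \<Longrightarrow> w i \<ge> 0" "i0 \<in> S" "w i0 > 0" and gr: "\<And>i. i \<in> S \<Longrightarrow> s * w i \<le> (\<Sum>j\<in>S. av i j y * w j)"
  shows "s \<le> Q y"
proof (cases "s \<ge> 0")
  case True
  define w' where "w' i = (if i \<in> S then w i else 0)" for i
  have nn: "av i j y \<ge> 0" if "i < n" "j < n" for i j using av_nonneg[OF that] y by (simp add: less_imp_le)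
  have eq: "(\<Sum>j<n. av i j y * w' j) = (\<Sum>j\<in>S. av i j y * w j)" for i
    using S by (intro sum.mono_neutral_cong_right) (auto simp: w'_def)
  have "s \<le> spectral_radius (mat n n (\<lambda>(i, j). complex_of_real (av i j y)))"
  proof (rule spectral_radius_growth[where n = n and a = "\<lambda>i j. av i j y" and w = w' and ?i0.0 = i0])
    fix i assume i: "i < n"
    show "s * w' i \<le> (\<Sum>j<n. av i j y * w' j)"
    proof (cases "i \<in> S")
      case True
      then show ?thesis unfolding eq using gr by (simp add: w'_def)
    next
      case False
      then show ?thesis unfolding eq using S w nn i by (auto simp: w'_def intro!: sum_nonneg mult_nonneg_nonneg)
    qed
  qed (use n0 nn w S in \<open>auto simp: w'_def\<close>)
  also have "\<dots> = Q y" by (rule Q_eq_spectral_radius[of y, symmetric]) (rule y)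
  finally show ?thesis .
next
  case False
  obtain k where "cmod k = spectral_radius (mat n n (\<lambda>(i, j). complex_of_real (av i j y)))"
    using spectral_radius_attained[of "mat n n (\<lambda>(i, j). complex_of_real (av i j y))" n] n0 by auto
  moreover have "Q y = spectral_radius (mat n n (\<lambda>(i, j). complex_of_real (av i j y)))" by (rule Q_eq_spectral_radius) (rule y)
  ultimately have "Q y \<ge> 0" by (metis norm_ge_zero)
  then show ?thesis using False by simp
qed

text \<open>The characteristic polynomial of the block \<open>S\<close> at the value
  \<open>Q z\<close>. As a polynomial in \<open>z\<close> it makes sense at complex points and on
  strata, where no statement about spectral radii is given.\<close>

definition stratum_det :: "nat set \<Rightarrow> ('v \<Rightarrow> complex) \<Rightarrow> complex" where
  "stratum_det S z = det (bordered n S (\<lambda>i j. av i j z) (Q z))"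

lemma stratum_det_eq_0_iff:
  "S \<subseteq> {..<n} \<Longrightarrow> stratum_det S z = 0 \<longleftrightarrow> (\<exists>w. (\<exists>i\<in>S. w i \<noteq> 0) \<and> (\<forall>i\<in>S. (\<Sum>j\<in>S. av i j z * w j) = Q z * w i))"
  unfolding stratum_det_def by (rule det_bordered_eq_0_iff)

lemma stratum_det_transposed_eq_0:
  assumes "S \<subseteq> {..<n}" "stratum_det S z = 0"
  shows "\<exists>w. (\<exists>i\<in>S. w i \<noteq> 0) \<and> (\<forall>i\<in>S. (\<Sum>j\<in>S. av j i z * w j) = Q z * w i)"
proof -
  have "det (bordered n S (\<lambda>i j. av j i z) (Q z)) = 0"
    using assms(2) det_bordered_transpose[of n S "\<lambda>i j. av i j z" "Q z"] by (simp add: stratum_det_def)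
  then show ?thesis unfolding det_bordered_eq_0_iff[OF assms(1)] .
qed

lemma line_poly_FF:
  assumes "\<And>v. line_poly (\<lambda>z. \<phi> z v)"
  shows "line_poly (\<lambda>z. stratum_det S (\<phi> z))"
  unfolding stratum_det_def
proof (rule line_poly_det)
  fix i j assume ij: "i < n" "j < n"
  have 1: "line_poly (\<lambda>z. Q (\<phi> z))" "line_poly (\<lambda>z. av i j (\<phi> z))" unfolding Q_def av_def by (intro line_poly_value assms)+
  have "line_poly (\<lambda>z. if i \<in> S \<and> j \<in> S then (if i = j then Q (\<phi> z) else 0) - av i j (\<phi> z) else if i = j then 1 else 0)"
    using line_poly_diff[OF 1] line_poly_diff[OF line_poly_const 1(2), of 0] line_poly_const
    by (cases "i \<in> S"; cases "j \<in> S"; cases "i = j"; simp)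
  then show "line_poly (\<lambda>z. bordered n S (\<lambda>i j. av i j (\<phi> z)) (Q (\<phi> z)) $$ (i, j))" using ij by (simp add: bordered_def)
qed (simp add: bordered_def)

lemma no_growth_interior:
  assumes y: "\<And>v. v \<in> V \<Longrightarrow> y v > (0::real)" and S: "S \<subseteq> {..<n}"
  shows "no_growth S (\<lambda>i j. av i j y) (Q y)"
  unfolding no_growth_def
proof (intro allI impI notI)
  fix w \<epsilon> assume e: "(\<epsilon>::real) > 0" and w: "\<forall>i\<in>S. w i \<ge> 0" "\<exists>i\<in>S. w i > 0" and g: "\<forall>i\<in>S. (Q y + \<epsilon>) * w i \<le> (\<Sum>j\<in>S. av i j y * w j)"
  obtain i0 where "i0 \<in> S" "w i0 > 0" using w by blast
  then have "Q y + \<epsilon> \<le> Q y" by (intro Q_growth[of y S w i0, OF y S]) (use w g in auto)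
  then show False using e by simp
qed

lemma Q_nonneg: "(\<And>v. v \<in> V \<Longrightarrow> y v > (0::real)) \<Longrightarrow> Q y \<ge> 0"
  by (rule Q_growth[of y "{..<n}" "\<lambda>_. 1" 0]) (use n0 in \<open>auto intro!: sum_nonneg av_nonneg simp: less_imp_le\<close>)

lemma av_pos:
  assumes "i < n" "j < n" "\<alpha> \<in> Poly_Mapping.keys (A $$ (i, j))" and y: "\<And>v. v \<in> V \<Longrightarrow> y v \<ge> 0" "\<And>v. v \<in> Poly_Mapping.keys \<alpha> \<Longrightarrow> y v > (0::real)"
  shows "av i j y > 0"
proof -
  have m: "monomial_value \<beta> y \<ge> 0" if "\<beta> \<in> Poly_Mapping.keys (A $$ (i, j))" for \<beta>
    unfolding monomial_value_def using AV[OF assms(1,2)] y(1) that by (intro prod_nonneg ballI zero_le_power) (auto simp: polys_over_def)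
  have "monomial_value \<alpha> y > 0" unfolding monomial_value_def using y(2) by (intro prod_pos) auto
  then have "0 < real (Poly_Mapping.lookup (A $$ (i, j)) \<alpha>) * monomial_value \<alpha> y" using assms(3) by (simp add: in_keys_iff)
  also have "\<dots> \<le> av i j y" unfolding av_def poly_value_alt
    using assms(3) m by (intro member_le_sum[of \<alpha> _ "\<lambda>\<alpha>. real (Poly_Mapping.lookup (A $$ (i, j)) \<alpha>) * monomial_value \<alpha> y"]) auto
  finally show ?thesis .
qed

text \<open>On the open orthant the spectral radius is itself an eigenvalue, by Perron-Frobenius;
  the identity principle carries this equation to all complex points.\<close>

lemma stratum_det_full: "stratum_det {..<n} z = 0"
proof (rule line_poly_zero_of_positive[where F = "stratum_det {..<n}", OF _ finV])
  show "line_poly (stratum_det {..<n})" by (rule line_poly_FF[of "\<lambda>z. z", OF line_poly_coord])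
  fix y :: "'v \<Rightarrow> real" assume y: "\<And>v. v \<in> V \<Longrightarrow> y v > 0"
  interpret pf "{..<n}" "\<lambda>i j. av i j y" "Q y"
  proof unfold_locales
    show "irreducible_on {..<n} (\<lambda>i j. av i j y)"
      unfolding irreducible_on_def
    proof (intro allI impI)
      fix T assume T: "T \<subseteq> {..<n}" "T \<noteq> {}" "T \<noteq> {..<n}"
      obtain i j where ij: "i \<in> T" "j \<in> {..<n} - T" "A $$ (i, j) \<noteq> 0" using irreducible_matrix_entry[OF A irrA T] by blast
      then obtain \<alpha> where \<alpha>: "\<alpha> \<in> Poly_Mapping.keys (A $$ (i, j))" by (metis all_not_in_conv keys_eq_empty)
      have lt: "i < n" "j < n" using ij T by auto
      have "av i j y > 0" using AV[OF lt] \<alpha> y by (intro av_pos[OF lt \<alpha>]) (auto simp: polys_over_def intro!: less_imp_le)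
      then show "\<exists>i\<in>T. \<exists>j\<in>{..<n} - T. av i j y > 0" using ij by blast
    qed
  qed (use y in \<open>auto intro!: av_nonneg no_growth_interior Q_nonneg simp: less_imp_le\<close>)
  have Bc: "mat n n (\<lambda>(i, j). complex_of_real (av i j y)) \<in> carrier_mat n n" by simp
  obtain k where k: "eigenvalue (mat n n (\<lambda>(i, j). complex_of_real (av i j y))) k" "cmod k = Q y"
    using spectral_radius_attained[OF Bc n0] Q_eq_spectral_radius[of y, OF y] by auto
  then obtain w i0 where w: "i0 < n" "w i0 \<noteq> 0" "\<And>i. i < n \<Longrightarrow> (\<Sum>j<n. mat n n (\<lambda>(i, j). complex_of_real (av i j y)) $$ (i, j) * w j) = k * w i"
    unfolding eigenvalue_iff_fun[OF Bc] by blast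
  have w': "(\<Sum>j<n. of_real (av i j y) * w j) = k * w i" if "i \<in> {..<n}" for i
    using w(3)[of i] that by simp
  have M: "cmod (complex_of_real (av i j y)) \<le> av i j y" if "i \<in> {..<n}" "j \<in> {..<n}" for i j using C0[OF that] by simp
  have "(\<Sum>j<n. av i j y * cmod (w j)) = Q y * cmod (w i)" if "i < n" for i
    using complex_eigenvector(1)[of i0 w "\<lambda>i j. of_real (av i j y)" k i] w w' M k that by auto
  then have "(\<Sum>j<n. av i j (\<lambda>v. complex_of_real (y v)) * of_real (cmod (w j))) = Q (\<lambda>v. complex_of_real (y v)) * of_real (cmod (w i))" if "i < n" for i
    using that unfolding av_real Q_real by (simp flip: of_real_mult of_real_sum)
  then show "stratum_det {..<n} (\<lambda>v. complex_of_real (y v)) = 0"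
    unfolding stratum_det_eq_0_iff[OF subset_refl] using w(1,2) by (intro exI[of _ "\<lambda>i. of_real (cmod (w i))"]) auto
qed

end

section \<open>Alignment of phases on a stratum\<close>

context beta_matrix begin

text \<open>The set \<open>\<tau>\<close> of vanishing coordinates describes a stratum of the toric variety. A minimal index set \<open>S\<close>
  on which \<open>stratum_det\<close> vanishes identically on the stratum carries an irreducible block of \<open>A\<close>.\<close>

lemma stratum_alignment:
  fixes \<tau> :: "'v set" and z :: "'v \<Rightarrow> complex" and x :: "'v \<Rightarrow> real" and t :: "'v \<Rightarrow> complex"
    and R :: "('v \<Rightarrow> complex) \<Rightarrow> 'v \<Rightarrow> complex" and Rr :: "('v \<Rightarrow> real) \<Rightarrow> 'v \<Rightarrow> real"
  defines "R \<equiv> \<lambda>y v. if v \<in> \<tau> then 0 else y v" and "Rr \<equiv> \<lambda>y v. if v \<in> \<tau> then 0 else y v"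
  defines "x \<equiv> \<lambda>v. cmod (z v)" and "t \<equiv> \<lambda>v. z v / of_real (cmod (z v))"
  assumes zne: "\<And>v. v \<in> V \<Longrightarrow> v \<notin> \<tau> \<Longrightarrow> z v \<noteq> 0"
    and Qne: "\<exists>y. Q (R y) \<noteq> 0" and ge: "Q (Rr x) \<le> cmod (Q (R z))"
  shows "\<exists>lm. lm \<noteq> 0 \<and> (\<forall>y. Q (R (\<lambda>v. t v * y v)) = lm * Q (R y))"
proof -
  have Rreal: "R (\<lambda>v. of_real (y v)) = (\<lambda>v. of_real (Rr y v))" for y by (auto simp: R_def Rr_def)
  have R_line: "line_poly (\<lambda>y. R y v)" for v
    by (cases "v \<in> \<tau>") (simp_all add: R_def line_poly_const line_poly_coord)
  have Rt_line: "line_poly (\<lambda>y. R (\<lambda>v. t v * y v) v)" for v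
    by (cases "v \<in> \<tau>") (simp_all add: R_def line_poly_const line_poly_coord line_poly_mult)
  define bad where "bad \<alpha> \<longleftrightarrow> Poly_Mapping.keys \<alpha> \<inter> \<tau> \<noteq> {}" for \<alpha> :: "'v \<Rightarrow>\<^sub>0 nat"
  have mv_bad: "monomial_value \<alpha> (R y) = 0" if b: "bad \<alpha>" for \<alpha> y
  proof -
    obtain v where "v \<in> Poly_Mapping.keys \<alpha>" "v \<in> \<tau>" using b by (auto simp: bad_def)
    then show ?thesis by (auto simp: monomial_value_def R_def in_keys_iff intro!: bexI[of _ v])
  qed
  have mv_good: "monomial_value \<alpha> (R y) = monomial_value \<alpha> y" if "\<not> bad \<alpha>" for \<alpha> y
    unfolding monomial_value_def using that by (intro prod.cong) (auto simp: R_def bad_def)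
  define ok where "ok S \<longleftrightarrow> S \<subseteq> {..<n} \<and> S \<noteq> {} \<and> (\<forall>y. stratum_det S (R y) = 0)" for S
  have "ok {..<n}" unfolding ok_def using stratum_det_full n0 by auto
  from exists_least_iff[THEN iffD1, of "\<lambda>k. \<exists>S. ok S \<and> card S = k"] this
  obtain k where k: "\<exists>S. ok S \<and> card S = k" "\<forall>m<k. \<not> (\<exists>S. ok S \<and> card S = m)" by blast
  then obtain S where okS: "ok S" "card S = k" by blast
  have S: "S \<subseteq> {..<n}" "S \<noteq> {}" and zero: "\<And>y. stratum_det S (R y) = 0" using okS unfolding ok_def by blast+
  have min0: "card S \<le> card T" if "T \<subseteq> {..<n}" "T \<noteq> {}" "\<forall>y. stratum_det T (R y) = 0" for T
    using k(2) okS(2) that unfolding ok_def by (metis not_le)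
  have finS: "finite S" using S(1) finite_subset by blast
  have min: "\<exists>y. stratum_det T (R y) \<noteq> 0" if "T \<subset> S" "T \<noteq> {}" for T
    using min0[of T] psubset_card_mono[OF finS that(1)] that S(1) by (meson leD order_trans psubset_imp_subset)
  have lt: "i < n" if "i \<in> S" for i using that S(1) by auto
  have av_bad: "av i j (R y) = (0::complex)" if "\<forall>\<alpha>\<in>Poly_Mapping.keys (A $$ (i, j)). bad \<alpha>" for i j y
    unfolding av_def poly_value_alt using that mv_bad by (intro sum.neutral) auto
  \<comment> \<open>If the block of \<open>S\<close> were reducible on the stratum, at every point
    the determinant of \<open>T\<close> or that of \<open>S - T\<close> would vanish; then one of
    them would vanish identically, against the minimality of \<open>S\<close>.\<close>
  have nz: "\<exists>i\<in>T. \<exists>j\<in>S - T. \<exists>\<alpha>\<in>Poly_Mapping.keys (A $$ (i, j)). \<not> bad \<alpha>" if T: "T \<subseteq> S" "T \<noteq> {}" "T \<noteq> S" for T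
  proof (rule ccontr)
    assume neg: "\<not> ?thesis"
    have a0: "av i j (R y) = 0" if "i \<in> T" "j \<in> S - T" for i j y using neg that by (intro av_bad) blast
    have Tn: "T \<subseteq> {..<n}" "S - T \<subseteq> {..<n}" using T S by auto
    have "stratum_det T (R y) * stratum_det (S - T) (R y) = 0" for y
    proof -
      obtain w where w: "\<exists>i\<in>S. w i \<noteq> 0" "\<And>i. i \<in> S \<Longrightarrow> (\<Sum>j\<in>S. av i j (R y) * w j) = Q (R y) * w i"
        using zero[of y] stratum_det_eq_0_iff[OF S(1)] by blast
      show ?thesis
      proof (cases "\<exists>i\<in>T. w i \<noteq> 0")
        case True
        have "(\<Sum>j\<in>T. av i j (R y) * w j) = Q (R y) * w i" if "i \<in> T" for i
        proof -
          have "(\<Sum>j\<in>S. av i j (R y) * w j) = (\<Sum>j\<in>T. av i j (R y) * w j)"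
            using T finS a0[OF that] by (intro sum.mono_neutral_right) auto
          then show ?thesis using w(2)[of i] that T by auto
        qed
        then have "stratum_det T (R y) = 0" using True stratum_det_eq_0_iff[OF Tn(1)] by blast
        then show ?thesis by simp
      next
        case False
        have "(\<Sum>j\<in>S - T. av i j (R y) * w j) = Q (R y) * w i" if "i \<in> S - T" for i
        proof -
          have "(\<Sum>j\<in>S. av i j (R y) * w j) = (\<Sum>j\<in>S - T. av i j (R y) * w j)"
            using finS False by (intro sum.mono_neutral_right) auto
          then show ?thesis using w(2)[of i] that by auto
        qed
        moreover have "\<exists>i\<in>S - T. w i \<noteq> 0" using w(1) False by blast
        ultimately have "stratum_det (S - T) (R y) = 0" using stratum_det_eq_0_iff[OF Tn(2)] by blast
        then show ?thesis by simp
      qed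
    qed
    then have "(\<forall>y. stratum_det T (R y) = 0) \<or> (\<forall>y. stratum_det (S - T) (R y) = 0)"
      by (intro line_poly_mult_eq_0 line_poly_FF R_line)
    moreover have "\<exists>y. stratum_det T (R y) \<noteq> 0" using T by (intro min) auto
    moreover have "\<exists>y. stratum_det (S - T) (R y) \<noteq> 0" using T by (intro min) auto
    ultimately show False by blast
  qed
  have av_good_pos: "av i j (Rr y) > 0" if y: "\<And>v. v \<in> V \<Longrightarrow> v \<notin> \<tau> \<Longrightarrow> y v > 0" and ij: "i \<in> S" "j \<in> S" and al: "\<alpha> \<in> Poly_Mapping.keys (A $$ (i, j))" "\<not> bad \<alpha>" for y i j \<alpha>
  proof (rule av_pos[OF lt[OF ij(1)] lt[OF ij(2)] al(1)])
    show "Rr y v \<ge> 0" if "v \<in> V" for v using y that by (auto simp: Rr_def less_imp_le)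
    show "Rr y v > 0" if "v \<in> Poly_Mapping.keys \<alpha>" for v
      using AV[OF lt[OF ij(1)] lt[OF ij(2)]] al that y by (auto simp: Rr_def bad_def polys_over_def)
  qed
  \<comment> \<open>Perron-Frobenius data at a boundary point. Passing to the positive points
    \<open>ym m\<close> only enlarges the entries, so growth at a rate above \<open>Q (Rr y)\<close>
    would persist there, although \<open>Q (ym m)\<close> tends to \<open>Q (Rr y)\<close>.\<close>
  have pfy: "pf S (\<lambda>i j. av i j (Rr y)) (Q (Rr y))" if y: "\<And>v. v \<in> V \<Longrightarrow> v \<notin> \<tau> \<Longrightarrow> y v > 0" for y
  proof -
    have Rr0: "Rr y v \<ge> 0" if "v \<in> V" for v using y that by (auto simp: Rr_def less_imp_le)
    define ym where "ym m v = (if v \<in> \<tau> then inverse (real (Suc m)) else y v)" for m v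
    have ympos: "ym m v > 0" if "v \<in> V" for m v using y that by (auto simp: ym_def)
    have "(\<lambda>m. ym m v) \<longlonglongrightarrow> Rr y v" for v
      using LIMSEQ_inverse_real_of_nat by (cases "v \<in> \<tau>") (auto simp: ym_def Rr_def)
    then have Ql: "(\<lambda>m. Q (ym m)) \<longlonglongrightarrow> Q (Rr y)" unfolding Q_def by (intro tendsto_poly_value[OF qV])
    show ?thesis
    proof unfold_locales
      show "irreducible_on S (\<lambda>i j. av i j (Rr y))"
        unfolding irreducible_on_def
      proof (intro allI impI)
        fix T assume T: "T \<subseteq> S" "T \<noteq> {}" "T \<noteq> S"
        obtain i j \<alpha> where ij: "i \<in> T" "j \<in> S - T" "\<alpha> \<in> Poly_Mapping.keys (A $$ (i, j))" "\<not> bad \<alpha>" using nz[OF T] by blast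
        have "av i j (Rr y) > 0" by (rule av_good_pos[of y i j \<alpha>]) (use y ij T in auto)
        then show "\<exists>i\<in>T. \<exists>j\<in>S - T. av i j (Rr y) > 0" using ij by blast
      qed
      have "Q (ym m) \<ge> 0" for m by (rule Q_nonneg) (rule ympos)
      then show "Q (Rr y) \<ge> 0" by (intro LIMSEQ_le_const[OF Ql]) auto
      show "no_growth S (\<lambda>i j. av i j (Rr y)) (Q (Rr y))"
        unfolding no_growth_def
      proof (intro allI impI notI)
        fix w \<epsilon> assume e: "(\<epsilon>::real) > 0" and w: "\<forall>i\<in>S. w i \<ge> 0" "\<exists>i\<in>S. w i > 0"
          and g: "\<forall>i\<in>S. (Q (Rr y) + \<epsilon>) * w i \<le> (\<Sum>j\<in>S. av i j (Rr y) * w j)"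
        obtain i0 where i0: "i0 \<in> S" "w i0 > 0" using w by blast
        have "Q (Rr y) + \<epsilon> \<le> Q (ym m)" for m
        proof (rule Q_growth[of "ym m" S w i0])
          show "(Q (Rr y) + \<epsilon>) * w i \<le> (\<Sum>j\<in>S. av i j (ym m) * w j)" if i: "i \<in> S" for i
          proof -
            have "(Q (Rr y) + \<epsilon>) * w i \<le> (\<Sum>j\<in>S. av i j (Rr y) * w j)" using g i by blast
            also have "\<dots> \<le> (\<Sum>j\<in>S. av i j (ym m) * w j)"
            proof (intro sum_mono mult_right_mono)
              fix j assume j: "j \<in> S"
              show "av i j (Rr y) \<le> av i j (ym m)" unfolding av_def
                by (rule poly_value_mono[OF AV[OF lt[OF i] lt[OF j]]]) (use Rr0 in \<open>auto simp: Rr_def ym_def\<close>)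
            qed (use w in auto)
            finally show ?thesis .
          qed
        qed (use ympos S w i0 in auto)
        then have "Q (Rr y) + \<epsilon> \<le> Q (Rr y)" by (intro LIMSEQ_le_const[OF Ql]) auto
        then show False using e by simp
      qed
    qed (use finS Rr0 lt in \<open>auto intro!: av_nonneg\<close>)
  qed
  have vecs: "\<exists>v u. (\<forall>i\<in>S. v i > 0 \<and> (\<Sum>j\<in>S. av i j (Rr y) * v j) = Q (Rr y) * v i) \<and>
      (\<forall>i\<in>S. u i > 0 \<and> (\<Sum>j\<in>S. av j i (Rr y) * u j) = Q (Rr y) * u i)"
    if y: "\<And>v. v \<in> V \<Longrightarrow> v \<notin> \<tau> \<Longrightarrow> y v > 0" for y
  proof -
    interpret pf S "\<lambda>i j. av i j (Rr y)" "Q (Rr y)" by (rule pfy) (rule y)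
    have avc: "av i j (R (\<lambda>v. of_real (y v))) = complex_of_real (av i j (Rr y))" for i j unfolding Rreal by (rule av_real)
    have Qc: "Q (R (\<lambda>v. of_real (y v))) = complex_of_real (Q (Rr y))" unfolding Rreal by (rule Q_real)
    have "\<exists>w. (\<exists>i\<in>S. w i \<noteq> 0) \<and> (\<forall>i\<in>S. (\<Sum>j\<in>S. complex_of_real (av i j (Rr y)) * w j) = of_real (Q (Rr y)) * w i)"
      using zero[of "\<lambda>v. of_real (y v)"] unfolding stratum_det_eq_0_iff[OF S(1)] avc Qc .
    then obtain w where w: "\<exists>i\<in>S. w i \<noteq> 0" "\<And>i. i \<in> S \<Longrightarrow> (\<Sum>j\<in>S. complex_of_real (av i j (Rr y)) * w j) = of_real (Q (Rr y)) * w i"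
      by blast
    then obtain i0 where i0: "i0 \<in> S" "w i0 \<noteq> 0" by blast
    have M: "cmod (complex_of_real (av i j (Rr y))) \<le> av i j (Rr y)" if "i \<in> S" "j \<in> S" for i j using C0[OF that] by simp
    have kk: "Q (Rr y) \<le> cmod (complex_of_real (Q (Rr y)))" by simp
    note ce = complex_eigenvector[OF i0 w(2) M kk]
    have v: "cmod (w i) > 0" "(\<Sum>j\<in>S. av i j (Rr y) * cmod (w j)) = Q (Rr y) * cmod (w i)" if "i \<in> S" for i
      using ce(1)[of i] ce(2)[of i] that by auto
    interpret T: pf S "\<lambda>i j. av j i (Rr y)" "Q (Rr y)" by (rule transposed[of "\<lambda>i. cmod (w i)"]) (use v in auto)
    obtain w' where w': "\<exists>i\<in>S. w' i \<noteq> 0" "\<And>i. i \<in> S \<Longrightarrow> (\<Sum>j\<in>S. complex_of_real (av j i (Rr y)) * w' j) = of_real (Q (Rr y)) * w' i"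
      using stratum_det_transposed_eq_0[OF S(1) zero[of "\<lambda>v. of_real (y v)"]] unfolding avc Qc by blast
    then obtain i1 where i1: "i1 \<in> S" "w' i1 \<noteq> 0" by blast
    note ce' = T.complex_eigenvector[OF i1 w'(2) M kk]
    have u: "cmod (w' i) > 0" "(\<Sum>j\<in>S. av j i (Rr y) * cmod (w' j)) = Q (Rr y) * cmod (w' i)" if "i \<in> S" for i
      using ce'(1)[of i] ce'(2)[of i] that by auto
    show ?thesis using u v by (intro exI[of _ "\<lambda>i. cmod (w i)"] exI[of _ "\<lambda>i. cmod (w' i)"]) auto
  qed
  have xpos: "x v > 0" if "v \<in> V" "v \<notin> \<tau>" for v using zne that by (simp add: x_def)
  interpret X: pf S "\<lambda>i j. av i j (Rr x)" "Q (Rr x)" by (rule pfy) (rule xpos)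
  define r where "r = Q (Rr x)"
  obtain w i0 where i0: "i0 \<in> S" "w i0 \<noteq> 0" and w: "\<And>i. i \<in> S \<Longrightarrow> (\<Sum>j\<in>S. av i j (R z) * w j) = Q (R z) * w i"
    using zero[of z] stratum_det_eq_0_iff[OF S(1)] by blast
  have nR: "(\<lambda>v. cmod (R z v)) = Rr x" by (auto simp: R_def Rr_def x_def)
  have M: "cmod (av i j (R z)) \<le> av i j (Rr x)" for i j unfolding av_def nR[symmetric] by (rule cmod_poly_value_le)
  note ce = X.complex_eigenvector[OF i0 w M ge]
  have wp: "cmod (w i) > 0" and we: "(\<Sum>j\<in>S. av i j (Rr x) * cmod (w j)) = r * cmod (w i)" if "i \<in> S" for i
    using ce(1)[of i] ce(2)[of i] that by (auto simp: r_def)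
  have Qr: "cmod (Q (R z)) = r" using ce(3) by (simp add: r_def)
  \<comment> \<open>With r = 0 the positive eigenvector kills all entries of the block on the
    stratum, and then \<open>Q\<close> vanishes there, against \<open>Qne\<close>.\<close>
  have rpos: "r > 0"
  proof (rule ccontr)
    assume "\<not> r > 0"
    then have r: "r = 0" using X.r0 by (simp add: r_def)
    have "av i j (R y) = 0" if ij: "i \<in> S" "j \<in> S" for i j y
    proof (rule av_bad, rule ballI, rule ccontr)
      fix \<alpha> assume al: "\<alpha> \<in> Poly_Mapping.keys (A $$ (i, j))" "\<not> bad \<alpha>"
      have p: "av i j (Rr x) > 0" by (rule av_good_pos[of x i j \<alpha>]) (use xpos ij al in auto)
      have "0 < av i j (Rr x) * cmod (w j)" using p wp[OF ij(2)] by simp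
      also have "\<dots> \<le> (\<Sum>j\<in>S. av i j (Rr x) * cmod (w j))"
        using ij finS X.C0[OF ij(1)] by (intro member_le_sum[of j S "\<lambda>j. av i j (Rr x) * cmod (w j)"]) auto
      finally show False using we[OF ij(1)] r by simp
    qed
    then have "Q (R y) = 0" for y
    proof -
      obtain w i where "i \<in> S" "w i \<noteq> 0" "\<And>i. i \<in> S \<Longrightarrow> (\<Sum>j\<in>S. av i j (R y) * w j) = Q (R y) * w i"
        using zero[of y] stratum_det_eq_0_iff[OF S(1)] by blast
      then show ?thesis using \<open>\<And>y j i. i \<in> S \<Longrightarrow> j \<in> S \<Longrightarrow> av i j (R y) = 0\<close> by (metis (no_types, lifting) mult_eq_0_iff mult_zero_left sum.neutral)
    qed
    then show False using Qne by blast
  qed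
  define lm where "lm = Q (R z) / of_real r"
  have "cmod lm = 1" using Qr rpos by (simp add: lm_def norm_divide)
  then have l0: "lm \<noteq> 0" by auto
  \<comment> \<open>The phases of the eigenvector at \<open>z\<close>, as opposed to
    \<open>t\<close>, the phases of \<open>z\<close> itself.\<close>
  define d where "d i = w i / of_real (cmod (w i))" for i
  have d0: "d i \<noteq> 0" if "i \<in> S" for i using wp[OF that] by (auto simp: d_def)
  \<comment> \<open>Row i of the eigenvalue equation at \<open>z\<close>, expanded over all pairs of
    an index and a monomial, is an equality case of the triangle inequality, so each summand has the
    phase of the right-hand side.\<close>
  have align: "monomial_value \<alpha> t * d j = lm * d i" if ij: "i \<in> S" "j \<in> S" and al: "\<alpha> \<in> Poly_Mapping.keys (A $$ (i, j))" "\<not> bad \<alpha>" for i j \<alpha>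
  proof -
    define f where "f p = of_nat (Poly_Mapping.lookup (A $$ (i, fst p)) (snd p)) * monomial_value (snd p) (R z) * w (fst p)" for p
    define P where "P = (SIGMA j:S. Poly_Mapping.keys (A $$ (i, j)))"
    have finP: "finite P" using finS by (simp add: P_def)
    have sumf: "(\<Sum>p\<in>P. f p) = Q (R z) * w i"
    proof -
      have "(\<Sum>p\<in>P. f p) = (\<Sum>j\<in>S. \<Sum>\<alpha>\<in>Poly_Mapping.keys (A $$ (i, j)). f (j, \<alpha>))"
        unfolding P_def using finS by (subst sum.Sigma) auto
      also have "\<dots> = (\<Sum>j\<in>S. av i j (R z) * w j)" by (simp add: f_def av_def poly_value_alt sum_distrib_right)
      finally show ?thesis using w[OF ij(1)] by simp
    qed
    have sumn: "(\<Sum>p\<in>P. cmod (f p)) = r * cmod (w i)"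
    proof -
      have "(\<Sum>p\<in>P. cmod (f p)) = (\<Sum>j\<in>S. \<Sum>\<alpha>\<in>Poly_Mapping.keys (A $$ (i, j)). cmod (f (j, \<alpha>)))"
        unfolding P_def using finS by (subst sum.Sigma) auto
      also have "\<dots> = (\<Sum>j\<in>S. av i j (Rr x) * cmod (w j))"
        by (simp add: f_def av_def poly_value_alt sum_distrib_right norm_mult cmod_monomial_value nR)
      finally show ?thesis using we[OF ij(1)] by simp
    qed
    have jP: "(j, \<alpha>) \<in> P" using ij al by (simp add: P_def)
    have "f (j, \<alpha>) * of_real (cmod (\<Sum>p\<in>P. f p)) = of_real (cmod (f (j, \<alpha>))) * (\<Sum>p\<in>P. f p)"
      by (rule sum_norm_eq_imp_aligned[OF finP _ jP]) (simp add: sumn, simp add: sumf norm_mult Qr)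
    then have eq: "f (j, \<alpha>) * of_real (r * cmod (w i)) = of_real (cmod (f (j, \<alpha>))) * (Q (R z) * w i)"
      by (simp add: sumf norm_mult Qr)
    have ka: "v \<in> V \<and> v \<notin> \<tau>" if "v \<in> Poly_Mapping.keys \<alpha>" for v
      using AV[OF lt[OF ij(1)] lt[OF ij(2)]] al that by (auto simp: bad_def polys_over_def)
    define X where "X = real (Poly_Mapping.lookup (A $$ (i, j)) \<alpha>) * monomial_value \<alpha> x"
    have Xp: "X > 0"
      unfolding X_def monomial_value_def using al ka xpos by (intro mult_pos_pos prod_pos) (auto simp: in_keys_iff)
    have mz: "monomial_value \<alpha> (R z) = monomial_value \<alpha> t * of_real (monomial_value \<alpha> x)"
    proof -
      have "monomial_value \<alpha> z = (\<Prod>v\<in>Poly_Mapping.keys \<alpha>. (t v * of_real (x v)) ^ Poly_Mapping.lookup \<alpha> v)"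
        unfolding monomial_value_def using ka zne by (intro prod.cong refl) (simp add: t_def x_def)
      then show ?thesis unfolding mv_good[OF al(2)] by (simp add: monomial_value_def power_mult_distrib prod.distrib)
    qed
    have nt: "cmod (monomial_value \<alpha> t) = 1"
      unfolding cmod_monomial_value
      by (simp only: monomial_value_def) (intro prod.neutral ballI, use ka zne in \<open>simp add: t_def norm_divide\<close>)
    have fX: "f (j, \<alpha>) = of_real X * (monomial_value \<alpha> t * w j)" by (simp add: f_def X_def mz)
    have nfX: "cmod (f (j, \<alpha>)) = X * cmod (w j)" using Xp by (simp add: fX norm_mult nt)
    have "of_real X * (monomial_value \<alpha> t * w j * of_real (r * cmod (w i))) = of_real X * (of_real (cmod (w j)) * (Q (R z) * w i))"
      using eq unfolding fX nfX[unfolded fX] by (simp add: mult_ac)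
    then have "monomial_value \<alpha> t * w j * of_real (r * cmod (w i)) = of_real (cmod (w j)) * (Q (R z) * w i)"
      using Xp by simp
    then show ?thesis using wp[OF ij(1)] wp[OF ij(2)] rpos by (simp add: d_def lm_def field_simps)
  qed
  \<comment> \<open>The block at t y is \<open>lm\<close> times the conjugate by the diagonal matrix
    \<open>d\<close> of the block at y.\<close>
  have conj: "av i j (R (\<lambda>v. t v * y v)) * d j = lm * d i * av i j (R y)" if ij: "i \<in> S" "j \<in> S" for i j y
  proof -
    have "monomial_value \<alpha> (R (\<lambda>v. t v * y v)) * d j = lm * d i * monomial_value \<alpha> (R y)" if al: "\<alpha> \<in> Poly_Mapping.keys (A $$ (i, j))" for \<alpha>
    proof (cases "bad \<alpha>")
      case True then show ?thesis by (simp add: mv_bad)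
    next
      case False
      have "monomial_value \<alpha> (\<lambda>v. t v * y v) = monomial_value \<alpha> t * monomial_value \<alpha> y"
        by (simp add: monomial_value_def power_mult_distrib prod.distrib)
      then show ?thesis using align[OF ij al False] by (simp add: mv_good[OF False])
    qed
    then have "(\<Sum>\<alpha>\<in>Poly_Mapping.keys (A $$ (i, j)). of_nat (Poly_Mapping.lookup (A $$ (i, j)) \<alpha>) * (monomial_value \<alpha> (R (\<lambda>v. t v * y v)) * d j)) =
      (\<Sum>\<alpha>\<in>Poly_Mapping.keys (A $$ (i, j)). of_nat (Poly_Mapping.lookup (A $$ (i, j)) \<alpha>) * (lm * d i * monomial_value \<alpha> (R y)))" by simp
    then show ?thesis unfolding av_def poly_value_alt by (simp add: sum_distrib_left sum_distrib_right mult_ac)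
  qed
  \<comment> \<open>By \<open>conj\<close>, Q (t y) / lm is an eigenvalue of the block at y, and at
    y = x it equals Q x. If \<open>D\<close> did not vanish, it would differ from Q y at points
    tending to x, which \<open>no_branching\<close> forbids.\<close>
  define D where "D y = Q (R (\<lambda>v. t v * y v)) - lm * Q (R y)" for y
  have D_line: "line_poly D"
    unfolding D_def Q_def by (intro line_poly_diff line_poly_mult line_poly_const line_poly_value R_line Rt_line)
  have tx: "(\<lambda>v. t v * of_real (x v)) = z" by (auto simp: t_def x_def)
  have "D y = 0" for y
  proof (rule line_poly_zero_of_positive[where F = D, OF D_line finV])
    fix b :: "'v \<Rightarrow> real" assume b: "\<And>v. v \<in> V \<Longrightarrow> b v > 0"
    show "D (\<lambda>v. of_real (b v)) = 0"
    proof (rule ccontr)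
      assume Db: "D (\<lambda>v. of_real (b v)) \<noteq> 0"
      obtain P where P: "\<And>s. D (\<lambda>v. of_real (x v) + s * of_real (b v - x v)) = poly P s"
        using D_line[unfolded line_poly_def, rule_format, of "\<lambda>v. of_real (x v)" "\<lambda>v. of_real (b v - x v)"] by blast
      have "P \<noteq> 0" using P[of 1] Db by auto
      then have "finite {s. poly P s = 0}" by (rule poly_roots_finite)
      then have "finite ((\<lambda>m. complex_of_real (inverse (real (Suc m)))) -` {s. poly P s = 0} \<inter> UNIV)"
        by (rule finite_vimage_IntI) (auto simp: inj_on_def)
      \<comment> \<open>Shifted by \<open>N\<close>, the parameters 1 / (m + 1) avoid the finitely
        many zeros of \<open>P\<close>.\<close>
      then obtain N where N: "\<And>m. poly P (of_real (inverse (real (Suc m)))) = 0 \<Longrightarrow> m < N"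
        using finite_nat_set_iff_bounded[of "(\<lambda>m. complex_of_real (inverse (real (Suc m)))) -` {s. poly P s = 0} \<inter> UNIV"] by auto
      define s where "s m = inverse (real (Suc (m + N)))" for m
      have s0: "0 < s m" "s m \<le> 1" for m by (auto simp: s_def field_simps)
      have sl: "s \<longlonglongrightarrow> 0" unfolding s_def using LIMSEQ_ignore_initial_segment[OF LIMSEQ_inverse_real_of_nat, of N] by simp
      define ym where "ym m v = x v + s m * (b v - x v)" for m v
      have ympos: "ym m v > 0" if "v \<in> V" "v \<notin> \<tau>" for m v
      proof -
        have "ym m v = (1 - s m) * x v + s m * b v" by (simp add: ym_def algebra_simps)
        moreover have "(1 - s m) * x v \<ge> 0" "s m * b v > 0" using s0[of m] xpos[OF that] b[OF that(1)] by auto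
        ultimately show ?thesis by linarith
      qed
      have yl: "(\<lambda>m. ym m v) \<longlonglongrightarrow> x v" for v
        unfolding ym_def using tendsto_add[OF tendsto_const[of "x v"] tendsto_mult_right[OF sl, of "b v - x v"]] by simp
      have Rl: "(\<lambda>m. Rr (ym m) v) \<longlonglongrightarrow> Rr x v" for v using yl by (auto simp: Rr_def)
      have Dne: "D (\<lambda>v. of_real (ym m v)) \<noteq> 0" for m
        using P[of "of_real (s m)"] N[of "m + N"] by (auto simp: ym_def s_def)
      define \<mu> where "\<mu> m = Q (R (\<lambda>v. t v * of_real (ym m v))) / lm" for m
      have "\<forall>m. \<exists>v u. (\<forall>i\<in>S. v i > 0 \<and> (\<Sum>j\<in>S. av i j (Rr (ym m)) * v j) = Q (Rr (ym m)) * v i) \<and>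
        (\<forall>i\<in>S. u i > 0 \<and> (\<Sum>j\<in>S. av j i (Rr (ym m)) * u j) = Q (Rr (ym m)) * u i)"
        by (intro allI vecs) (rule ympos)
      then obtain u where u: "\<And>m i. i \<in> S \<Longrightarrow> u m i > 0" "\<And>m i. i \<in> S \<Longrightarrow> (\<Sum>j\<in>S. av j i (Rr (ym m)) * u m j) = Q (Rr (ym m)) * u m i"
        by metis
      have "\<forall>m. \<exists>w'. (\<exists>i\<in>S. w' i \<noteq> 0) \<and> (\<forall>i\<in>S. (\<Sum>j\<in>S. av i j (R (\<lambda>v. t v * of_real (ym m v))) * w' j) = Q (R (\<lambda>v. t v * of_real (ym m v))) * w' i)"
        by (intro allI stratum_det_eq_0_iff[OF S(1), THEN iffD1] zero)
      from choice[OF this] obtain w' where w'ne: "\<And>m. \<exists>i\<in>S. w' m i \<noteq> 0" and w': "\<And>m i. i \<in> S \<Longrightarrow> (\<Sum>j\<in>S. av i j (R (\<lambda>v. t v * of_real (ym m v))) * w' m j) = Q (R (\<lambda>v. t v * of_real (ym m v))) * w' m i"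
        by blast
      define vx where "vx i = cmod (w i)" for i
      have vx: "vx i > 0" "(\<Sum>j\<in>S. av i j (Rr x) * vx j) = Q (Rr x) * vx i" if "i \<in> S" for i
        using we[OF that] wp[OF that] by (auto simp: r_def vx_def)
      show False
      proof (rule X.no_branching[where Cn = "\<lambda>m i j. av i j (Rr (ym m))" and rn = "\<lambda>m. Q (Rr (ym m))" and \<mu> = \<mu> and w = "\<lambda>m i. w' m i / d i" and u = u and v = vx])
        show "(\<lambda>m. av i j (Rr (ym m))) \<longlonglongrightarrow> av i j (Rr x)" if "i \<in> S" "j \<in> S" for i j
          unfolding av_def by (rule tendsto_poly_value[OF AV[OF lt[OF that(1)] lt[OF that(2)]]]) (rule Rl)
        show "(\<lambda>m. Q (Rr (ym m))) \<longlonglongrightarrow> Q (Rr x)" unfolding Q_def by (rule tendsto_poly_value[OF qV]) (rule Rl)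
        have "(\<lambda>m. R (\<lambda>v. t v * of_real (ym m v)) v) \<longlonglongrightarrow> R z v" for v
        proof -
          have "(\<lambda>m. t v * of_real (ym m v)) \<longlonglongrightarrow> t v * of_real (x v)" by (intro tendsto_intros yl)
          then show ?thesis using fun_cong[OF tx, of v] by (simp add: R_def)
        qed
        then have "(\<lambda>m. Q (R (\<lambda>v. t v * of_real (ym m v)))) \<longlonglongrightarrow> Q (R z)"
          unfolding Q_def by (intro tendsto_poly_value[OF qV])
        then have "\<mu> \<longlonglongrightarrow> Q (R z) / lm" unfolding \<mu>_def using l0 by (intro tendsto_intros)
        moreover have "Q (R z) / lm = of_real (Q (Rr x))"
        proof -
          have "Q (R z) \<noteq> 0" using Qr rpos by auto
          then show ?thesis by (simp add: lm_def r_def)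
        qed
        ultimately show "\<mu> \<longlonglongrightarrow> of_real (Q (Rr x))" by simp
        show "\<mu> m \<noteq> of_real (Q (Rr (ym m)))" for m
        proof
          assume "\<mu> m = of_real (Q (Rr (ym m)))"
          then have "Q (R (\<lambda>v. t v * of_real (ym m v))) = lm * Q (R (\<lambda>v. of_real (ym m v)))"
            unfolding Rreal Q_real using l0 by (simp add: \<mu>_def field_simps)
          then show False using Dne[of m] by (simp add: D_def)
        qed
        show "\<exists>i\<in>S. w' m i / d i \<noteq> 0" for m using w'ne[of m] d0 by auto
        show "(\<Sum>j\<in>S. of_real (av i j (Rr (ym m))) * (w' m j / d j)) = \<mu> m * (w' m i / d i)" if i: "i \<in> S" for m i
        proof -
          have "of_real (av i j (Rr (ym m))) * (w' m j / d j) = (av i j (R (\<lambda>v. t v * of_real (ym m v))) * w' m j) / (lm * d i)" if j: "j \<in> S" for j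
          proof -
            have "av i j (R (\<lambda>v. t v * of_real (ym m v))) * d j = lm * d i * of_real (av i j (Rr (ym m)))"
              using conj[OF i j, of "\<lambda>v. of_real (ym m v)"] unfolding Rreal av_real .
            then have "of_real (av i j (Rr (ym m))) = av i j (R (\<lambda>v. t v * of_real (ym m v))) * d j / (lm * d i)"
              using l0 d0[OF i] by simp
            then show ?thesis using d0[OF j] by simp
          qed
          then have "(\<Sum>j\<in>S. of_real (av i j (Rr (ym m))) * (w' m j / d j)) = (\<Sum>j\<in>S. av i j (R (\<lambda>v. t v * of_real (ym m v))) * w' m j) / (lm * d i)"
            by (simp add: sum_divide_distrib)
          then show ?thesis unfolding w'[OF i] \<mu>_def by simp
        qed
      qed (use u vx in auto)
    qed
  qed
  then show ?thesis using l0 by (intro exI[of _ lm]) (simp add: D_def)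
qed

end

section \<open>From aligned phases to the twisted orthant\<close>

context fan_data begin

lemma P3_of_beta_matrix:
  assumes P1 P2 and bm: "beta_matrix V qq A n"
  shows P3
  unfolding P3_def
proof (intro allI impI, rule ccontr)
  fix z :: "'v \<Rightarrow> complex"
  assume "nd z" and ntw: "\<not> tw z" and "\<not> cmod (poly_value of_int qq z) < poly_value of_int qq (\<lambda>\<rho>. cmod (z \<rho>))"
  then have ge: "poly_value of_int qq (\<lambda>\<rho>. cmod (z \<rho>)) \<le> cmod (poly_value of_int qq z)" by simp
  interpret B: beta_matrix V qq A n by (rule bm)
  obtain v where v: "v \<in> verts" and vz: "\<And>\<rho>. \<rho> \<in> V - sg v \<Longrightarrow> z \<rho> \<noteq> 0" using \<open>nd z\<close> unfolding nd_def by blast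
  define \<tau> where "\<tau> = {\<rho>\<in>V. z \<rho> = 0}"
  have tsg: "\<tau> \<subseteq> sg v" using vz by (auto simp: \<tau>_def)
  define t where "t \<rho> = z \<rho> / of_real (cmod (z \<rho>))" for \<rho>
  have Rz: "(\<lambda>\<rho>. if \<rho> \<in> \<tau> then 0 else z \<rho>) = z" by (auto simp: \<tau>_def)
  have Rx: "(\<lambda>\<rho>. if \<rho> \<in> \<tau> then 0 else cmod (z \<rho>)) = (\<lambda>\<rho>. cmod (z \<rho>))" by (auto simp: \<tau>_def)
  \<comment> \<open>The 0-1 point of the cone of \<open>v\<close>; it lies on the closure of the
    stratum of \<open>z\<close>, and by (Pos1) the polynomial is nonzero there.\<close>
  define cp where "cp = (\<lambda>\<rho>. if \<rho> \<in> sg v then 0 else 1 :: real)"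
  have "\<exists>y. B.Q (\<lambda>\<rho>. if \<rho> \<in> \<tau> then 0 else y \<rho>) \<noteq> (0::complex)"
  proof (intro exI[of _ "\<lambda>\<rho>. of_real (cp \<rho>)"])
    have "(\<lambda>\<rho>. if \<rho> \<in> \<tau> then 0 else complex_of_real (cp \<rho>)) = (\<lambda>\<rho>. of_real (cp \<rho>))" by (rule ext) (use tsg in \<open>auto simp: cp_def\<close>)
    moreover have "B.Q cp > 0" using \<open>P1\<close> v unfolding P1_def B.Q_def cp_def by blast
    ultimately show "B.Q (\<lambda>\<rho>. if \<rho> \<in> \<tau> then 0 else complex_of_real (cp \<rho>)) \<noteq> 0" by (simp add: B.Q_real)
  qed
  moreover have "B.Q (\<lambda>\<rho>. if \<rho> \<in> \<tau> then 0 else cmod (z \<rho>)) \<le> cmod (B.Q (\<lambda>\<rho>. if \<rho> \<in> \<tau> then 0 else z \<rho>))"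
    unfolding Rz Rx B.Q_def by (rule ge)
  moreover have "z \<rho> \<noteq> 0" if "\<rho> \<in> V" "\<rho> \<notin> \<tau>" for \<rho> using that by (simp add: \<tau>_def)
  ultimately obtain lm where lm: "lm \<noteq> 0" "\<And>y. B.Q (\<lambda>\<rho>. if \<rho> \<in> \<tau> then 0 else t \<rho> * y \<rho>) = lm * B.Q (\<lambda>\<rho>. if \<rho> \<in> \<tau> then 0 else y \<rho>)"
    using B.stratum_alignment[of \<tau> z] unfolding t_def by blast
  define tt where "tt \<rho> = (if \<rho> \<in> V - \<tau> then t \<rho> else 1)" for \<rho>
  have ntt: "cmod (tt \<rho>) = 1" for \<rho> by (simp add: tt_def t_def \<tau>_def norm_divide)
  then have tt0: "tt \<rho> \<noteq> 0" for \<rho> by (metis norm_zero zero_neq_one)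
  define T where "T m = (\<Prod>\<rho>\<in>V. tt \<rho> ^ xp m \<rho>)" for m
  \<comment> \<open>Set the coordinate \<rho>0 to s, the other coordinates of the cone to 0 and
    those off the cone to 1. Only monomials v + d * eb v \<rho>0 survive; those with d = 0 and d = 1
    occur by (Pos1) and (Pos2), and both have phase \<open>lm\<close>. Their quotient is the group
    equation for this edge vector.\<close>
  have edge: "(\<Prod>\<rho>\<in>V. tt \<rho> powi lattice_pairing (eb v \<rho>0) (u \<rho>)) = 1" if r0: "\<rho>0 \<in> sg v" "\<rho>0 \<notin> \<tau>" for \<rho>0
  proof -
    have r0V: "\<rho>0 \<in> V" using r0 sgV[OF v] by blast
    \<comment> \<open>Since 0 ^ 0 = 1, this is 1 if the exponents of \<open>m\<close> at the other
      rays of the cone are 0, and 0 otherwise.\<close>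
    define W where "W m = (\<Prod>\<rho>\<in>V - {\<rho>0}. cp \<rho> ^ xp m \<rho>)" for m
    have uniq: "m = v + int (xp m \<rho>0) *s eb v \<rho>0" if m: "m \<in> ks" "W m \<noteq> 0" for m
    proof -
      have x0: "xp m \<rho> = 0" if "\<rho> \<in> sg v" "\<rho> \<noteq> \<rho>0" for \<rho>
      proof (rule ccontr)
        assume "xp m \<rho> \<noteq> 0"
        then have "W m = 0" unfolding W_def using that sgV[OF v] finV by (auto simp: cp_def intro!: bexI[of _ \<rho>])
        then show False using m by simp
      qed
      have "m - v = (\<Sum>\<rho>\<in>sg v. lattice_pairing (m - v) (u \<rho>) *s eb v \<rho>)" by (rule expand[OF v])
      also have "\<dots> = (\<Sum>\<rho>\<in>sg v. int (xp m \<rho>) *s eb v \<rho>)"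
      proof (intro sum.cong refl)
        fix \<rho> assume \<rho>: "\<rho> \<in> sg v"
        then have "int (xp m \<rho>) = lattice_pairing (m - v) (u \<rho>)"
          using xp_int[OF m(1), of \<rho>] vert0[OF v \<rho>] sgV[OF v] by (auto simp: lattice_pairing_diff)
        then show "lattice_pairing (m - v) (u \<rho>) *s eb v \<rho> = int (xp m \<rho>) *s eb v \<rho>" by simp
      qed
      also have "\<dots> = (\<Sum>\<rho>\<in>{\<rho>0}. int (xp m \<rho>) *s eb v \<rho>)"
        using x0 r0 fin_sg[OF v] by (intro sum.mono_neutral_right) auto
      finally show ?thesis by (simp add: algebra_simps)
    qed
    define y where "y s = (\<lambda>\<rho>. if \<rho> = \<rho>0 then s else complex_of_real (cp \<rho>))" for s
    have Qy: "B.Q (y s) = (\<Sum>m\<in>ks. of_int (cf m) * of_real (W m) * s ^ xp m \<rho>0)" for s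
      unfolding B.Q_def value_qq W_def y_def using finV r0V
      by (intro sum.cong refl) (subst prod.remove[of V \<rho>0], auto simp: mult_ac intro!: prod.cong)
    have Qty: "B.Q (\<lambda>\<rho>. tt \<rho> * y s \<rho>) = (\<Sum>m\<in>ks. of_int (cf m) * of_real (W m) * T m * s ^ xp m \<rho>0)" for s
    proof -
      have "(\<Prod>\<rho>\<in>V. (tt \<rho> * y s \<rho>) ^ xp m \<rho>) = T m * (\<Prod>\<rho>\<in>V. y s \<rho> ^ xp m \<rho>)" for m
        by (simp add: T_def power_mult_distrib prod.distrib)
      moreover have "(\<Prod>\<rho>\<in>V. y s \<rho> ^ xp m \<rho>) = of_real (W m) * s ^ xp m \<rho>0" for m
        unfolding W_def y_def using finV r0V by (subst prod.remove[of V \<rho>0]) (auto simp: mult_ac intro!: prod.cong)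
      ultimately show ?thesis unfolding B.Q_def value_qq by (simp add: mult_ac)
    qed
    have Ry: "(\<lambda>\<rho>. if \<rho> \<in> \<tau> then 0 else y s \<rho>) = y s" for s by (rule ext) (use tsg r0 in \<open>auto simp: y_def cp_def\<close>)
    have Rty: "B.Q (\<lambda>\<rho>. if \<rho> \<in> \<tau> then 0 else t \<rho> * y s \<rho>) = B.Q (\<lambda>\<rho>. tt \<rho> * y s \<rho>)" for s
      unfolding B.Q_def by (rule poly_value_cong[OF qq_over]) (use tsg r0 in \<open>auto simp: tt_def y_def cp_def\<close>)
    have ident: "(\<Sum>m\<in>ks. of_int (cf m) * of_real (W m) * (T m - lm) * s ^ xp m \<rho>0) = 0" for s
    proof -
      have "(\<Sum>m\<in>ks. of_int (cf m) * of_real (W m) * (T m - lm) * s ^ xp m \<rho>0) =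
        (\<Sum>m\<in>ks. of_int (cf m) * of_real (W m) * T m * s ^ xp m \<rho>0) - lm * (\<Sum>m\<in>ks. of_int (cf m) * of_real (W m) * s ^ xp m \<rho>0)"
        by (simp add: sum_distrib_left sum_subtractf[symmetric] algebra_simps)
      also have "\<dots> = 0" using lm(2)[of "y s"] unfolding Rty Ry Qy Qty by simp
      finally show ?thesis .
    qed
    have coeff: "(\<Sum>m | m \<in> ks \<and> xp m \<rho>0 = d. of_int (cf m) * of_real (W m) * (T m - lm)) = 0" for d
    proof -
      define P where "P = (\<Sum>m\<in>ks. Polynomial.monom (of_int (cf m) * of_real (W m) * (T m - lm)) (xp m \<rho>0))"
      have "poly P s = 0" for s using ident[of s] by (simp add: P_def poly_sum poly_monom)
      then have "P = 0" using poly_all_0_iff_0 by blast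
      then have "coeff P d = 0" by simp
      moreover have "coeff P d = (\<Sum>m | m \<in> ks \<and> xp m \<rho>0 = d. of_int (cf m) * of_real (W m) * (T m - lm))"
        unfolding P_def coeff_sum by (intro sum.mono_neutral_cong_right) auto
      ultimately show ?thesis by simp
    qed
    have vertex: "v + int d *s eb v \<rho>0 \<in> ks \<and> T (v + int d *s eb v \<rho>0) = lm" if nz: "(\<Sum>m | m \<in> ks \<and> xp m \<rho>0 = d. real_of_int (cf m) * W m) \<noteq> 0" for d
    proof -
      obtain m where m: "m \<in> ks" "xp m \<rho>0 = d" "W m \<noteq> 0"
        using nz by (metis (mono_tags, lifting) mem_Collect_eq mult_eq_0_iff sum.neutral)
      have me: "m = v + int d *s eb v \<rho>0" using uniq[OF m(1,3)] m(2) by simp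
      have "(\<Sum>m | m \<in> ks \<and> xp m \<rho>0 = d. of_int (cf m) * of_real (W m) * (T m - lm)) = (\<Sum>m\<in>{m}. of_int (cf m) * of_real (W m) * (T m - lm))"
      proof (rule sum.mono_neutral_right)
        show "\<forall>i\<in>{m \<in> ks. xp m \<rho>0 = d} - {m}. of_int (cf i) * of_real (W i) * (T i - lm) = 0"
        proof
          fix i assume i: "i \<in> {m \<in> ks. xp m \<rho>0 = d} - {m}"
          then have "W i = 0" using uniq[of i] me by auto
          then show "of_int (cf i) * of_real (W i) * (T i - lm) = 0" by simp
        qed
      qed (use m in auto)
      then have "of_int (cf m) * of_real (W m) * (T m - lm) = 0" using coeff[of d] by simp
      then have "T m = lm" using m by (simp add: in_keys_iff)
      then show ?thesis using m(1) me by simp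
    qed
    have "(\<Sum>m | m \<in> ks \<and> xp m \<rho>0 = 0. real_of_int (cf m) * W m) = poly_value of_int qq cp"
    proof -
      have "(\<Prod>\<rho>\<in>V. cp \<rho> ^ xp m \<rho>) = 0 ^ xp m \<rho>0 * W m" for m
        unfolding W_def using finV r0V r0 by (subst prod.remove[of V \<rho>0]) (auto simp: cp_def)
      then show ?thesis unfolding value_qq by (intro sum.mono_neutral_cong_left) (auto simp: power_0_left)
    qed
    also have "\<dots> > 0" using \<open>P1\<close> v unfolding P1_def cp_def by blast
    finally have v0: "v \<in> ks" "T v = lm" using vertex[of 0] by auto
    have "nd cp" unfolding nd_def cp_def using v by auto
    moreover have "cp \<rho>0 = 0" "\<forall>\<rho>'\<in>V. 0 \<le> cp \<rho>'" using r0 by (auto simp: cp_def)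
    ultimately have "deriv (\<lambda>s. poly_value of_int qq (cp(\<rho>0 := s))) 0 > 0" using \<open>P2\<close> r0V unfolding P2_def by blast
    then have "(\<Sum>m | m \<in> ks \<and> xp m \<rho>0 = 1. real_of_int (cf m) * W m) > 0"
      using DERIV_imp_deriv[OF deriv_qq[OF r0V, of cp]] by (simp add: W_def)
    then have v1: "v + eb v \<rho>0 \<in> ks" "T (v + eb v \<rho>0) = lm" using vertex[of 1] by auto
    have "T (v + eb v \<rho>0) = T v * (\<Prod>\<rho>\<in>V. tt \<rho> powi lattice_pairing (eb v \<rho>0) (u \<rho>))"
      unfolding T_def prod.distrib[symmetric]
    proof (intro prod.cong refl)
      fix \<rho> assume \<rho>: "\<rho> \<in> V"
      have "int (xp (v + eb v \<rho>0) \<rho>) = int (xp v \<rho>) + lattice_pairing (eb v \<rho>0) (u \<rho>)"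
        using xp_int[OF v0(1) \<rho>] xp_int[OF v1(1) \<rho>] by (simp add: lattice_pairing_add)
      then have "tt \<rho> powi int (xp (v + eb v \<rho>0) \<rho>) = tt \<rho> powi int (xp v \<rho>) * tt \<rho> powi lattice_pairing (eb v \<rho>0) (u \<rho>)"
        using tt0[of \<rho>] by (simp add: power_int_add)
      then show "tt \<rho> ^ xp (v + eb v \<rho>0) \<rho> = tt \<rho> ^ xp v \<rho> * tt \<rho> powi lattice_pairing (eb v \<rho>0) (u \<rho>)" by simp
    qed
    then show ?thesis using v0(2) v1(2) lm(1) by simp
  qed
  \<comment> \<open>Where \<open>z\<close> vanishes its phase is free; it is chosen to solve the
    group equation of the edge vector dual to that ray.\<close>
  define t' where "t' \<rho> = (if \<rho> \<in> \<tau> then inverse (\<Prod>\<rho>'\<in>V - sg v. tt \<rho>' powi lattice_pairing (eb v \<rho>) (u \<rho>')) else tt \<rho>)" for \<rho>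
  have nt': "cmod (t' \<rho>) = 1" for \<rho>
  proof -
    have "cmod (tt \<rho>' powi k) = 1" for \<rho>' k by (simp add: norm_power_int ntt)
    then have "cmod (\<Prod>\<rho>'\<in>V - sg v. tt \<rho>' powi lattice_pairing (eb v \<rho>) (u \<rho>')) = 1" by (simp flip: prod_norm)
    then show ?thesis by (simp add: t'_def ntt norm_inverse)
  qed
  then have t'0: "t' \<rho> \<noteq> 0" for \<rho> by (metis norm_zero zero_neq_one)
  have split: "(\<Prod>\<rho>\<in>V. f \<rho> powi lattice_pairing (eb v \<rho>0) (u \<rho>)) = f \<rho>0 * (\<Prod>\<rho>\<in>V - sg v. f \<rho> powi lattice_pairing (eb v \<rho>0) (u \<rho>))"
    if r0: "\<rho>0 \<in> sg v" for f :: "'v \<Rightarrow> complex" and \<rho>0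
  proof -
    have "(\<Prod>\<rho>\<in>V. f \<rho> powi lattice_pairing (eb v \<rho>0) (u \<rho>)) = (\<Prod>\<rho>\<in>V - sg v. f \<rho> powi lattice_pairing (eb v \<rho>0) (u \<rho>)) * (\<Prod>\<rho>\<in>sg v. f \<rho> powi lattice_pairing (eb v \<rho>0) (u \<rho>))"
      by (rule prod.subset_diff[OF sgV[OF v] finV])
    also have "(\<Prod>\<rho>\<in>sg v. f \<rho> powi lattice_pairing (eb v \<rho>0) (u \<rho>)) = (\<Prod>\<rho>\<in>sg v. if \<rho> = \<rho>0 then f \<rho> else 1)"
      using dual[OF v r0] by (intro prod.cong refl) auto
    also have "\<dots> = f \<rho>0" using r0 fin_sg[OF v] by simp
    finally show ?thesis by simp
  qed
  have e1: "(\<Prod>\<rho>\<in>V. t' \<rho> powi lattice_pairing (eb v \<rho>0) (u \<rho>)) = 1" if r0: "\<rho>0 \<in> sg v" for \<rho>0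
  proof -
    have same: "(\<Prod>\<rho>\<in>V - sg v. t' \<rho> powi lattice_pairing (eb v \<rho>0) (u \<rho>)) = (\<Prod>\<rho>\<in>V - sg v. tt \<rho> powi lattice_pairing (eb v \<rho>0) (u \<rho>))"
      using tsg by (intro prod.cong refl) (auto simp: t'_def)
    show ?thesis
    proof (cases "\<rho>0 \<in> \<tau>")
      case True
      have "(\<Prod>\<rho>\<in>V - sg v. tt \<rho> powi lattice_pairing (eb v \<rho>0) (u \<rho>)) \<noteq> 0" using tt0 finV by (simp add: power_int_eq_0_iff)
      then show ?thesis unfolding split[OF r0] same using True by (simp add: t'_def)
    next
      case False
      then show ?thesis using edge[OF r0 False] unfolding split[OF r0] same by (simp add: t'_def)
    qed
  qed
  \<comment> \<open>The edge vectors at \<open>v\<close> generate the lattice, so their group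
    equations imply all others.\<close>
  have "(\<Prod>\<rho>\<in>V. t' \<rho> powi lattice_pairing m (u \<rho>)) = 1" for m
  proof -
    have LP: "lattice_pairing m (u \<rho>) = (\<Sum>\<rho>0\<in>sg v. lattice_pairing m (u \<rho>0) * lattice_pairing (eb v \<rho>0) (u \<rho>))" for \<rho>
    proof -
      have lsum: "lattice_pairing (sum f A) w = (\<Sum>a\<in>A. lattice_pairing (f a) w)" for f :: "'v \<Rightarrow> int ^ 'n" and A w
        by (induction A rule: infinite_finite_induct) (auto simp: lattice_pairing_add)
      show ?thesis by (subst expand[OF v, of m]) (simp add: lsum lattice_pairing_scale)
    qed
    have psum: "c powi (\<Sum>a\<in>A. f a) = (\<Prod>a\<in>A. c powi f a)" if "c \<noteq> 0" for c :: complex and f :: "'v \<Rightarrow> int" and A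
      using that by (induction A rule: infinite_finite_induct) (auto simp: power_int_add)
    have "(\<Prod>\<rho>\<in>V. t' \<rho> powi lattice_pairing m (u \<rho>)) = (\<Prod>\<rho>\<in>V. \<Prod>\<rho>0\<in>sg v. t' \<rho> powi (lattice_pairing (eb v \<rho>0) (u \<rho>) * lattice_pairing m (u \<rho>0)))"
    proof (intro prod.cong refl)
      fix \<rho>
      have "t' \<rho> powi lattice_pairing m (u \<rho>) = t' \<rho> powi (\<Sum>\<rho>0\<in>sg v. lattice_pairing m (u \<rho>0) * lattice_pairing (eb v \<rho>0) (u \<rho>))"
        by (rule arg_cong[OF LP])
      also have "\<dots> = (\<Prod>\<rho>0\<in>sg v. t' \<rho> powi (lattice_pairing m (u \<rho>0) * lattice_pairing (eb v \<rho>0) (u \<rho>)))"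
        by (rule psum[OF t'0])
      finally show "t' \<rho> powi lattice_pairing m (u \<rho>) = (\<Prod>\<rho>0\<in>sg v. t' \<rho> powi (lattice_pairing (eb v \<rho>0) (u \<rho>) * lattice_pairing m (u \<rho>0)))"
        by (simp only: mult.commute)
    qed
    also have "\<dots> = (\<Prod>\<rho>0\<in>sg v. \<Prod>\<rho>\<in>V. (t' \<rho> powi lattice_pairing (eb v \<rho>0) (u \<rho>)) powi lattice_pairing m (u \<rho>0))"
      by (subst prod.swap) (simp add: power_int_mult)
    also have "\<dots> = (\<Prod>\<rho>0\<in>sg v. (\<Prod>\<rho>\<in>V. t' \<rho> powi lattice_pairing (eb v \<rho>0) (u \<rho>)) powi lattice_pairing m (u \<rho>0))"
    proof (intro prod.cong refl)
      fix \<rho>0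
      show "(\<Prod>\<rho>\<in>V. (t' \<rho> powi lattice_pairing (eb v \<rho>0) (u \<rho>)) powi lattice_pairing m (u \<rho>0)) = (\<Prod>\<rho>\<in>V. t' \<rho> powi lattice_pairing (eb v \<rho>0) (u \<rho>)) powi lattice_pairing m (u \<rho>0)"
        using finV by (induction V rule: finite_induct) (auto simp: power_int_mult_distrib)
    qed
    also have "\<dots> = 1" using e1 by (intro prod.neutral) simp
    finally show ?thesis .
  qed
  moreover have "z \<rho> = t' \<rho> * complex_of_real (cmod (z \<rho>))" if "\<rho> \<in> V" for \<rho>
    using that by (cases "\<rho> \<in> \<tau>") (auto simp: t'_def tt_def t_def \<tau>_def)
  ultimately have "tw z" unfolding tw_def using nt' by (intro exI[of _ t'] exI[of _ "\<lambda>\<rho>. cmod (z \<rho>)"]) auto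
  then show False using ntw by blast
qed

end

section \<open>Polytopes at a vertex\<close>

text \<open>The intersection of all faces through \<open>y\<close>; a point of its relative boundary
  would lie in a smaller face.\<close>

lemma polytope_minimal_face:
  fixes S :: "'a::euclidean_space set"
  assumes S: "polytope S" and y: "y \<in> S"
  obtains E where "E face_of S" "y \<in> rel_interior E"
proof -
  define E where "E = \<Inter>{F. F face_of S \<and> y \<in> F}"
  have E: "E face_of S" unfolding E_def
    using y S by (intro face_of_Inter) (auto intro: face_of_refl polytope_imp_convex)
  have yE: "y \<in> E" by (simp add: E_def)
  have poly: "polyhedron E" using face_of_polytope_polytope[OF S E] polytope_imp_polyhedron by blast
  have "y \<in> rel_interior E"
  proof (rule ccontr)
    assume "y \<notin> rel_interior E"
    then have "y \<in> rel_frontier E" using yE closure_subset by (auto simp: rel_frontier_def)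
    then obtain F where F: "F facet_of E" "y \<in> F" using rel_frontier_of_polyhedron[OF poly] by auto
    then have "F face_of S" using E face_of_trans facet_of_imp_face_of by blast
    then have "E \<subseteq> F" using F by (auto simp: E_def)
    then have "F = E" using facet_of_imp_subset[OF F(1)] by auto
    then show False using F(1) by simp
  qed
  with E show thesis by (rule that)
qed

text \<open>The hyperplane meets the affine hull of \<open>E\<close> in dimension at least 1, so
  \<open>y\<close> can be moved both ways inside the slice.\<close>

lemma rel_interior_not_extreme_in_slice:
  fixes E :: "'a::euclidean_space set"
  assumes y: "y \<in> rel_interior E" "a \<bullet> y = b" and d: "aff_dim E \<ge> 2"
  shows "\<not> y extreme_point_of (E \<inter> {x. a \<bullet> x = b})"
proof
  assume ext: "y extreme_point_of (E \<inter> {x. a \<bullet> x = b})"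
  let ?A = "affine hull E \<inter> {x. a \<bullet> x = b}"
  have "y \<in> E" using y rel_interior_subset by blast
  then have yA: "y \<in> ?A" using y hull_inc[of y E affine] by auto
  have "aff_dim ?A \<ge> 1"
    using aff_dim_affine_Int_hyperplane[of "affine hull E" a b] yA d by (auto split: if_splits)
  moreover have "aff_dim {y} = 0" by simp
  ultimately have "?A \<noteq> {y}" by (metis not_one_le_zero)
  then obtain z where z: "z \<in> ?A" "z \<noteq> y" using yA by blast
  have aff: "affine ?A" by (intro affine_Int affine_affine_hull affine_hyperplane)
  obtain e where e: "e > 0" "cball y e \<inter> affine hull E \<subseteq> E"
    using y(1) by (auto simp: mem_rel_interior_cball)
  define t where "t = e / norm (z - y)"
  have t: "t > 0" using e z by (simp add: t_def)
  have mem: "y + s *\<^sub>R (z - y) \<in> E \<inter> {x. a \<bullet> x = b}" if "\<bar>s\<bar> = t" for s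
  proof -
    have "y + s *\<^sub>R (z - y) = (1 - s) *\<^sub>R y + s *\<^sub>R z" by (simp add: algebra_simps)
    then have 1: "y + s *\<^sub>R (z - y) \<in> ?A" using mem_affine[OF aff yA z(1), of "1 - s" s] by simp
    have "norm (s *\<^sub>R (z - y)) = e" using that z by (simp add: t_def)
    then have "y + s *\<^sub>R (z - y) \<in> cball y e" by (simp add: dist_norm norm_minus_commute)
    then show ?thesis using 1 e(2) by auto
  qed
  define d where "d = t *\<^sub>R (z - y)"
  have "y - d \<noteq> y + d"
  proof
    assume "y - d = y + d"
    then have "2 *\<^sub>R d = 0" by (simp add: scaleR_2 algebra_simps)
    then show False using t z by (simp add: d_def)
  qed
  moreover have "(1 - 1/2) *\<^sub>R (y - d) + (1/2) *\<^sub>R (y + d) = y"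
    by (simp add: scaleR_half_double flip: scaleR_add_right)
  ultimately have "y \<in> open_segment (y - d) (y + d)"
    unfolding in_segment by (intro conjI exI[of _ "1/2"]) simp_all
  then show False using ext mem[of "-t"] mem[of t] t by (auto simp: extreme_point_of_def d_def)
qed

lemma polytope_extreme_points:
  fixes S :: "'a::euclidean_space set"
  assumes "polytope S"
  shows "finite {v. v extreme_point_of S}" "S = convex hull {v. v extreme_point_of S}"
  using assms by (simp_all add: finite_polyhedron_extreme_points polytope_imp_polyhedron
      Krein_Milman_Minkowski polytope_imp_compact polytope_imp_convex)

lemma extreme_point_exposed:
  fixes S :: "'a::euclidean_space set"
  assumes "polytope S" "v extreme_point_of S"
  obtains a where "\<And>x. x \<in> S \<Longrightarrow> x \<noteq> v \<Longrightarrow> a \<bullet> x < a \<bullet> v"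
proof -
  have "{v} exposed_face_of S"
    using assms by (simp add: exposed_face_of_polyhedron polytope_imp_polyhedron face_of_singleton)
  then obtain a b where "S \<subseteq> {x. a \<bullet> x \<le> b}" "{v} = S \<inter> {x. a \<bullet> x = b}"
    unfolding exposed_face_of_def by auto
  then have "a \<bullet> v = b" "\<And>x. x \<in> S \<Longrightarrow> x \<noteq> v \<Longrightarrow> a \<bullet> x \<le> b \<and> a \<bullet> x \<noteq> b" by blast+
  then have "a \<bullet> x < a \<bullet> v" if "x \<in> S" "x \<noteq> v" for x using that by force
  then show thesis by (rule that)
qed

text \<open>The slice of the polytope by a hyperplane close to the vertex is spanned by its extreme points,
  which lie on edges through the vertex.\<close>

lemma vertex_cone:
  fixes S :: "'a::euclidean_space set"
  assumes S: "polytope S" and v: "v extreme_point_of S"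
    and c: "\<And>E y. E edge_of S \<Longrightarrow> v \<in> E \<Longrightarrow> y \<in> E \<Longrightarrow> 0 \<le> c \<bullet> (y - v)"
    and w: "w \<in> S"
  shows "0 \<le> c \<bullet> (w - v)"
proof -
  obtain a where a: "\<And>x. x \<in> S \<Longrightarrow> x \<noteq> v \<Longrightarrow> a \<bullet> x < a \<bullet> v" using extreme_point_exposed[OF S v] by blast
  let ?X = "{x. x extreme_point_of S}"
  note X = polytope_extreme_points[OF S]
  have XS: "?X \<subseteq> S" by (auto simp: extreme_point_of_def)
  \<comment> \<open>Halfway between the value of \<open>a\<close> at \<open>v\<close> and its
    largest value at the other vertices; the inserted number keeps the maximum meaningful if there
    are none.\<close>
  define b where "b = (Max (insert (a \<bullet> v - 1) ((\<bullet>) a ` (?X - {v}))) + a \<bullet> v) / 2"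
  have "Max (insert (a \<bullet> v - 1) ((\<bullet>) a ` (?X - {v}))) < a \<bullet> v"
    using X(1) XS a by (subst Max_less_iff) auto
  moreover have "a \<bullet> x \<le> Max (insert (a \<bullet> v - 1) ((\<bullet>) a ` (?X - {v})))" if "x \<in> ?X - {v}" for x
    using X(1) that by (intro Max_ge) auto
  ultimately have b: "b < a \<bullet> v" "\<And>x. x \<in> ?X - {v} \<Longrightarrow> a \<bullet> x < b" unfolding b_def by (fastforce simp: field_simps)+
  let ?T = "S \<inter> {x. a \<bullet> x = b}"
  have T: "polytope ?T" by (rule polytope_Int_polyhedron[OF S polyhedron_hyperplane])
  \<comment> \<open>The minimal face through an extreme point of the slice has dimension 1: from
    dimension 2 on there is room to move inside the slice, and a vertex never has the value
    \<open>b\<close>.\<close>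
  have half: "0 \<le> c \<bullet> (y - v)" if yT: "y extreme_point_of ?T" for y
  proof -
    have y: "y \<in> S" "a \<bullet> y = b" using yT by (auto simp: extreme_point_of_def)
    obtain E where E: "E face_of S" "y \<in> rel_interior E" using polytope_minimal_face[OF S y(1)] .
    have yE: "y \<in> E" using E rel_interior_subset by blast
    have ES: "E \<subseteq> S" using E face_of_imp_subset by blast
    have extE: "x extreme_point_of S" if "x extreme_point_of E" for x using that E extreme_point_of_face by blast
    have "y extreme_point_of (E \<inter> {x. a \<bullet> x = b})"
      using yT yE y ES unfolding extreme_point_of_def by blast
    then have "aff_dim E < 2" using rel_interior_not_extreme_in_slice[OF E(2) y(2)] by (meson not_le)
    moreover have "aff_dim E \<noteq> 0"
    proof
      assume "aff_dim E = 0"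
      then have "E = {y}" using yE aff_dim_eq_0 by (metis singletonD)
      then have "y \<in> ?X" using E by (simp add: face_of_singleton)
      then show False using b y by (cases "y = v") auto
    qed
    moreover have "aff_dim E \<ge> 0" using yE aff_dim_geq[of E] aff_dim_empty[of E] by auto
    ultimately have edge: "E edge_of S" using E by (simp add: edge_of_def)
    \<comment> \<open>Otherwise all vertices of this edge, and with them the edge, would lie
      strictly below the slice.\<close>
    have "v \<in> E"
    proof (rule ccontr)
      assume nv: "v \<notin> E"
      have "{x. x extreme_point_of E} \<subseteq> {x. a \<bullet> x < b}"
      proof safe
        fix x assume x: "x extreme_point_of E"
        then have "x \<noteq> v" using nv by (auto simp: extreme_point_of_def)
        then show "a \<bullet> x < b" using b(2)[of x] extE[OF x] by auto
      qed
      then have "convex hull {x. x extreme_point_of E} \<subseteq> {x. a \<bullet> x < b}" by (rule hull_minimal) (rule convex_halfspace_lt)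
      then have "E \<subseteq> {x. a \<bullet> x < b}"
        using polytope_extreme_points(2)[OF face_of_polytope_polytope[OF S E(1)]] by simp
      then show False using yE y by auto
    qed
    then show ?thesis using c edge yE by blast
  qed
  have "convex hull {y. y extreme_point_of ?T} \<subseteq> {y. c \<bullet> y \<ge> c \<bullet> v}"
    using half by (intro hull_minimal convex_halfspace_ge) (auto simp: inner_diff_right)
  then have Tc: "c \<bullet> y \<ge> c \<bullet> v" if "y \<in> ?T" for y using polytope_extreme_points(2)[OF T] that by blast
  have "?X \<subseteq> {x. c \<bullet> x \<ge> c \<bullet> v}"
  proof safe
    fix x assume x: "x extreme_point_of S"
    show "c \<bullet> v \<le> c \<bullet> x"
    proof (cases "x = v")
      case False
      then have ax: "a \<bullet> x < b" using b(2)[of x] x by auto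
      define t where "t = (a \<bullet> v - b) / (a \<bullet> v - a \<bullet> x)"
      have t: "0 < t" "t \<le> 1" using ax b(1) by (simp_all add: t_def)
      let ?y = "(1 - t) *\<^sub>R v + t *\<^sub>R x"
      have "?y \<in> S" using t x v polytope_imp_convex[OF S] by (intro convexD) (auto simp: extreme_point_of_def)
      moreover have "a \<bullet> ?y = a \<bullet> v - t * (a \<bullet> v - a \<bullet> x)" by (simp add: inner_add_right algebra_simps)
      moreover have "t * (a \<bullet> v - a \<bullet> x) = a \<bullet> v - b" using ax b(1) by (simp add: t_def)
      ultimately have "c \<bullet> v \<le> c \<bullet> ?y" by (intro Tc) auto
      also have "c \<bullet> ?y = c \<bullet> v + t * (c \<bullet> x - c \<bullet> v)" by (simp add: inner_add_right algebra_simps)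
      finally show ?thesis using t by (simp add: zero_le_mult_iff)
    qed simp
  qed
  then have "convex hull ?X \<subseteq> {x. c \<bullet> x \<ge> c \<bullet> v}" by (rule hull_minimal) (rule convex_halfspace_ge)
  then show ?thesis using X(2) w by (auto simp: inner_diff_right)
qed

lemma extreme_point_lattice:
  assumes "lattice_polytope S" "x extreme_point_of S"
  shows "x \<in> range real_vec"
  using assms extreme_point_of_convex_hull unfolding lattice_polytope_def by blast

lemma lattice_polytope_imp_polytope: "lattice_polytope S \<Longrightarrow> polytope S"
  unfolding lattice_polytope_def polytope_def by auto

lemma edge_segment:
  fixes S :: "'a::euclidean_space set"
  assumes S: "polytope S" and E: "E edge_of S" and v: "v extreme_point_of S" "v \<in> E"
  obtains w where "w extreme_point_of S" "w \<noteq> v" "E = closed_segment v w"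
proof -
  have EF: "E face_of S" and d: "aff_dim E = 1" using E by (auto simp: edge_of_def)
  note X = polytope_extreme_points[OF face_of_polytope_polytope[OF S EF]]
  have vE: "v extreme_point_of E" using v EF extreme_point_of_face by blast
  have "{x. x extreme_point_of E} \<noteq> {v}"
    using X(2) d by (metis aff_dim_sing convex_hull_singleton zero_neq_one)
  then obtain w where w: "w extreme_point_of E" "w \<noteq> v" using vE by blast
  have wE: "w \<in> E" using w by (auto simp: extreme_point_of_def)
  have cvx: "convex E" using EF face_of_imp_convex by blast
  have "collinear E" using d by (simp add: collinear_aff_dim)
  have "E \<subseteq> closed_segment v w"
  proof
    fix z assume z: "z \<in> E"
    have "collinear {v, w, z}" using \<open>collinear E\<close> v wE z by (meson collinear_subset empty_subsetI insert_subset)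
    then have "between (v, w) z \<or> between (w, z) v \<or> between (z, v) w"
      using collinear_between_cases by (metis between_commute)
    then show "z \<in> closed_segment v w"
    proof (elim disjE)
      assume "between (w, z) v"
      then have "v \<in> closed_segment w z" by (simp add: between_mem_segment)
      then have "v = w \<or> v = z" using vE w z wE unfolding extreme_point_of_def open_segment_def by blast
      then show ?thesis using w by auto
    next
      assume "between (z, v) w"
      then have "w \<in> closed_segment z v" by (simp add: between_mem_segment)
      then have "w = z \<or> w = v" using w v z unfolding extreme_point_of_def open_segment_def by blast
      then show ?thesis using w by auto
    qed (simp add: between_mem_segment)
  qed
  moreover have "closed_segment v w \<subseteq> E" using cvx v wE by (simp add: closed_segment_subset)
  ultimately show thesis using that w EF extreme_point_of_face by blast
qed

text \<open>Take the lattice point of the edge nearest to \<open>v\<close> in the l1 distance; a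
  lattice point in the open segment would be nearer.\<close>

lemma edge_vector_of_edge:
  fixes S :: "(real ^ 'n) set"
  assumes S: "lattice_polytope S" and E: "E edge_of S" and v: "real_vec v extreme_point_of S" "real_vec v \<in> E"
  obtains e where "e \<in> edge_vectors S v" "\<And>y. y \<in> E \<Longrightarrow> \<exists>s\<ge>0. y - real_vec v = s *\<^sub>R real_vec e"
proof -
  obtain w' where w': "w' extreme_point_of S" "w' \<noteq> real_vec v" "E = closed_segment (real_vec v) w'"
    using edge_segment[OF lattice_polytope_imp_polytope[OF S] E v] .
  obtain w0 where w0: "w' = real_vec w0" using extreme_point_lattice[OF S w'(1)] by auto
  define P where "P w \<longleftrightarrow> w \<noteq> v \<and> real_vec w \<in> E" for w
  define f where "f w = nat (\<Sum>i\<in>UNIV. \<bar>w $ i - v $ i\<bar>)" for w :: "int ^ 'n"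
  have "P w0" using w' w0 by (auto simp: P_def)
  define w where "w = arg_min f P"
  have Pw: "P w" and min: "\<And>w1. P w1 \<Longrightarrow> f w \<le> f w1"
    using arg_min_nat_lemma[of P w0 f, OF \<open>P w0\<close>] by (auto simp: w_def)
  have comb: "real_vec w1 \<in> open_segment (real_vec v) (real_vec w) \<Longrightarrow> P w1 \<and> f w1 < f w" for w1
  proof -
    assume o: "real_vec w1 \<in> open_segment (real_vec v) (real_vec w)"
    have "closed_segment (real_vec v) (real_vec w) \<subseteq> E"
      using Pw v E unfolding P_def edge_of_def by (intro closed_segment_subset) (auto intro: face_of_imp_convex)
    then have 1: "P w1" using o by (auto simp: P_def open_segment_def)
    obtain s where s: "0 < s" "s < 1" "real_vec w1 = (1 - s) *\<^sub>R real_vec v + s *\<^sub>R real_vec w"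
      using o by (auto simp: in_segment)
    have co: "real_of_int (w1 $ i) - v $ i = s * (w $ i - v $ i)" for i
      using arg_cong[OF s(3), of "\<lambda>x. x $ i"] by (simp add: real_vec_def algebra_simps)
    have "real_of_int (\<Sum>i\<in>UNIV. \<bar>w1 $ i - v $ i\<bar>) = (\<Sum>i\<in>UNIV. \<bar>real_of_int (w1 $ i) - v $ i\<bar>)" by simp
    also have "\<dots> = s * real_of_int (\<Sum>i\<in>UNIV. \<bar>w $ i - v $ i\<bar>)"
      unfolding co abs_mult using s by (simp add: sum_distrib_left)
    finally have eq: "real_of_int (\<Sum>i\<in>UNIV. \<bar>w1 $ i - v $ i\<bar>) = s * real_of_int (\<Sum>i\<in>UNIV. \<bar>w $ i - v $ i\<bar>)" .
    have "\<exists>i. w $ i \<noteq> v $ i" using Pw by (auto simp: P_def Finite_Cartesian_Product.vec_eq_iff)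
    then have pos: "(\<Sum>i\<in>UNIV. \<bar>w $ i - v $ i\<bar>) > 0"
      by (simp add: less_le sum_nonneg sum_nonneg_eq_0_iff)
    then have "s * real_of_int (\<Sum>i\<in>UNIV. \<bar>w $ i - v $ i\<bar>) < 1 * real_of_int (\<Sum>i\<in>UNIV. \<bar>w $ i - v $ i\<bar>)"
      using s by (intro mult_strict_right_mono) (simp_all only: of_int_0_less_iff)
    then have "(\<Sum>i\<in>UNIV. \<bar>w1 $ i - v $ i\<bar>) < (\<Sum>i\<in>UNIV. \<bar>w $ i - v $ i\<bar>)" using eq by linarith
    then show ?thesis using 1 pos by (simp add: f_def)
  qed
  have "open_segment (real_vec v) (real_vec w) \<inter> range real_vec = {}" using comb min by force
  then have "w - v \<in> edge_vectors S v" using Pw E v unfolding edge_vectors_def P_def by blast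
  moreover have "\<exists>s\<ge>0. y - real_vec v = s *\<^sub>R real_vec (w - v)" if y: "y \<in> E" for y
  proof -
    obtain r where r: "0 \<le> r" "real_vec w = (1 - r) *\<^sub>R real_vec v + r *\<^sub>R w'" using Pw w' by (auto simp: P_def in_segment)
    obtain s where s: "0 \<le> s" "y = (1 - s) *\<^sub>R real_vec v + s *\<^sub>R w'" using y w' by (auto simp: in_segment)
    have "r \<noteq> 0" using r Pw by (auto simp: P_def)
    have "real_vec w - real_vec v = r *\<^sub>R (w' - real_vec v)" using r by (simp add: algebra_simps)
    moreover have "y - real_vec v = s *\<^sub>R (w' - real_vec v)" using s by (simp add: algebra_simps)
    ultimately have "y - real_vec v = (s / r) *\<^sub>R real_vec (w - v)" using \<open>r \<noteq> 0\<close> by (simp add: real_vec_diff)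
    then show ?thesis using r s by (intro exI[of _ "s / r"]) simp
  qed
  ultimately show thesis by (rule that)
qed

lemma edge_vector_mem:
  assumes "e \<in> edge_vectors S v" shows "real_vec (v + e) \<in> S" "e \<noteq> 0"
  using assms edge_of_imp_subset unfolding edge_vectors_def by fastforce+

section \<open>Lattice bases\<close>

text \<open>The functional of the dual basis belonging to \<open>e\<close>, given by its values on
  the standard basis.\<close>

definition dual_vec :: "(int ^ 'n) set \<Rightarrow> int ^ 'n \<Rightarrow> int ^ 'n" where
  "dual_vec B e = (\<chi> i. int_lattice.representation B (axis i 1) e)"

lemma real_vec_axis: "real_vec (axis i 1) = axis i 1"
  by (simp add: real_vec_def axis_def Finite_Cartesian_Product.vec_eq_iff)

text \<open>The gcd of the entries of \<open>u\<close> divides every pairing with \<open>u\<close>,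
  in particular 1.\<close>

lemma primitive_vecI:
  assumes "lattice_pairing e u = 1" shows "primitive_vec u"
proof -
  have "(GCD i. u $ i) dvd u $ i" for i by (intro Gcd_dvd) auto
  then have "(GCD i. u $ i) dvd lattice_pairing e u"
    unfolding lattice_pairing_def by (intro dvd_sum) auto
  then have "is_unit (GCD i. u $ i)" using assms by simp
  then show ?thesis unfolding primitive_vec_def by (metis Gcd_int_greater_eq_0 abs_of_nonneg zdvd1_eq)
qed

text \<open>Pairing with \<open>e\<close> shows that the factor is an integer, and as it divides all
  entries of a primitive vector it is 1.\<close>

lemma primitive_vec_unique:
  assumes w: "primitive_vec w" and e: "lattice_pairing e u = 1"
    and c: "real_vec w = c *\<^sub>R real_vec u" "c > 0"
  shows "w = u"
proof -
  have "of_int (lattice_pairing e w) = real_vec e \<bullet> real_vec w" by (simp add: inner_real_vec)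
  also have "\<dots> = c * of_int (lattice_pairing e u)" unfolding c by (simp add: inner_real_vec)
  finally have ck: "c = of_int (lattice_pairing e w)" using e by simp
  let ?k = "lattice_pairing e w"
  have "real_vec w = real_vec (?k *s u)" using c ck by (simp add: real_vec_scale)
  then have wk: "w = ?k *s u" by (simp only: real_vec_eq_iff)
  have "?k dvd w $ i" for i by (subst wk) simp
  then have "?k dvd (GCD i. w $ i)" by (intro Gcd_greatest) auto
  then have "?k dvd 1" using w by (simp add: primitive_vec_def)
  moreover have "?k > 0" using c ck by simp
  ultimately have "?k = 1" by simp
  then show ?thesis using wk by simp
qed

context
  fixes B :: "(int ^ 'n) set"
  assumes B: "lattice_basis B"
begin

text \<open>The standard basis vectors involve only finitely many elements of \<open>B\<close>, and
  each element of \<open>B\<close>, being a combination of them, must occur in one.\<close>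

lemma finite_lattice_basis: "finite B"
proof -
  let ?S = "\<Union>i\<in>UNIV. {e. int_lattice.representation B (axis i 1) e \<noteq> 0}"
  have fin: "finite ?S" by (intro finite_UN_I finite int_lattice.finite_representation)
  have "B \<subseteq> ?S"
  proof
    fix e assume e: "e \<in> B"
    have e_sum: "e = (\<Sum>i\<in>UNIV. e $ i *s axis i 1)" by (simp add: basis_expansion)
    have "int_lattice.representation B e e = (\<Sum>i\<in>UNIV. e $ i * int_lattice.representation B (axis i 1) e)"
      using B by (subst e_sum) (simp add: lattice_basis_def int_lattice.representation_sum int_lattice.representation_scale)
    moreover have "int_lattice.representation B e e = 1"
      using B e by (simp add: lattice_basis_def int_lattice.representation_basis)
    ultimately show "e \<in> ?S" using sum.neutral[of UNIV "\<lambda>i. e $ i * int_lattice.representation B (axis i 1) e"] by fastforce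
  qed
  then show ?thesis using fin finite_subset by blast
qed

lemma pairing_dual_vec: "lattice_pairing m (dual_vec B e) = int_lattice.representation B m e"
proof -
  have "m = (\<Sum>i\<in>UNIV. m $ i *s axis i 1)" by (simp add: basis_expansion)
  then have "int_lattice.representation B m e = int_lattice.representation B (\<Sum>i\<in>UNIV. m $ i *s axis i 1) e" by simp
  also have "\<dots> = lattice_pairing m (dual_vec B e)"
    using B by (simp add: lattice_basis_def int_lattice.representation_sum int_lattice.representation_scale lattice_pairing_def dual_vec_def)
  finally show ?thesis ..
qed

lemma pairing_basis_dual: "e \<in> B \<Longrightarrow> e' \<in> B \<Longrightarrow> lattice_pairing e' (dual_vec B e) = (if e = e' then 1 else 0)"
  using B by (auto simp: pairing_dual_vec lattice_basis_def int_lattice.representation_basis)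

lemma lattice_expansion: "m = (\<Sum>e\<in>B. lattice_pairing m (dual_vec B e) *s e)"
proof -
  have "(\<Sum>e | int_lattice.representation B m e \<noteq> 0. int_lattice.representation B m e *s e) = m"
    using B by (intro int_lattice.sum_nonzero_representation_eq) (auto simp: lattice_basis_def)
  moreover have "{e. int_lattice.representation B m e \<noteq> 0} \<subseteq> B"
    using int_lattice.representation_ne_zero by blast
  then have "(\<Sum>e | int_lattice.representation B m e \<noteq> 0. int_lattice.representation B m e *s e) =
     (\<Sum>e\<in>B. int_lattice.representation B m e *s e)"
    using finite_lattice_basis by (intro sum.mono_neutral_left) auto
  ultimately show ?thesis by (simp add: pairing_dual_vec)
qed

lemma basis_inner_dual: "e \<in> B \<Longrightarrow> e' \<in> B \<Longrightarrow> real_vec e' \<bullet> real_vec (dual_vec B e) = (if e = e' then 1 else 0)"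
  by (simp add: inner_real_vec pairing_basis_dual)

lemma vector_expansion: "x = (\<Sum>e\<in>B. (x \<bullet> real_vec (dual_vec B e)) *\<^sub>R real_vec e)"
proof -
  have ax: "axis i 1 = (\<Sum>e\<in>B. (axis i 1 \<bullet> real_vec (dual_vec B e)) *\<^sub>R real_vec e)" for i
  proof -
    have "axis i 1 = real_vec (axis i 1)" by (simp add: real_vec_axis)
    also have "\<dots> = real_vec (\<Sum>e\<in>B. lattice_pairing (axis i 1) (dual_vec B e) *s e)"
      by (rule arg_cong[OF lattice_expansion])
    also have "\<dots> = (\<Sum>e\<in>B. (axis i 1 \<bullet> real_vec (dual_vec B e)) *\<^sub>R real_vec e)"
      by (simp add: real_vec_sum real_vec_scale inner_real_vec[symmetric] real_vec_axis)
    finally show ?thesis .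
  qed
  have x: "x = (\<Sum>i\<in>UNIV. x $ i *\<^sub>R axis i 1)" by (simp add: basis_expansion flip: scalar_mult_eq_scaleR)
  have "(\<Sum>e\<in>B. (x \<bullet> real_vec (dual_vec B e)) *\<^sub>R real_vec e) =
    (\<Sum>e\<in>B. \<Sum>i\<in>UNIV. (x $ i * (axis i 1 \<bullet> real_vec (dual_vec B e))) *\<^sub>R real_vec e)"
    by (subst x) (simp add: inner_sum_left scaleR_sum_left)
  also have "\<dots> = (\<Sum>i\<in>UNIV. x $ i *\<^sub>R (\<Sum>e\<in>B. (axis i 1 \<bullet> real_vec (dual_vec B e)) *\<^sub>R real_vec e))"
    by (subst sum.swap) (simp add: scaleR_sum_right)
  also have "\<dots> = x" unfolding ax[symmetric] by (rule x[symmetric])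
  finally show ?thesis ..
qed

lemma inner_expansion: "x \<bullet> y = (\<Sum>e\<in>B. (x \<bullet> real_vec (dual_vec B e)) * (y \<bullet> real_vec e))"
proof -
  have "x \<bullet> y = (\<Sum>e\<in>B. (x \<bullet> real_vec (dual_vec B e)) *\<^sub>R real_vec e) \<bullet> y"
    by (rule arg_cong[OF vector_expansion])
  also have "\<dots> = (\<Sum>e\<in>B. (x \<bullet> real_vec (dual_vec B e)) * (real_vec e \<bullet> y))" by (simp add: inner_sum_left)
  finally show ?thesis by (simp only: inner_commute[of y])
qed

lemma dual_expansion: "y = (\<Sum>e\<in>B. (y \<bullet> real_vec e) *\<^sub>R real_vec (dual_vec B e))"
proof -
  have "\<forall>x. x \<bullet> y = x \<bullet> (\<Sum>e\<in>B. (y \<bullet> real_vec e) *\<^sub>R real_vec (dual_vec B e))"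
    by (subst inner_expansion) (simp add: inner_sum_right mult.commute)
  then show ?thesis by (simp only: vector_eq_ldot)
qed

lemma dual_vec_nonzero: "e \<in> B \<Longrightarrow> real_vec (dual_vec B e) \<noteq> 0"
  using basis_inner_dual[of e e] by force

lemma inj_on_dual_vec: "inj_on (\<lambda>e. real_vec (dual_vec B e)) B"
proof (rule inj_onI)
  fix e e' assume e: "e \<in> B" "e' \<in> B" "real_vec (dual_vec B e) = real_vec (dual_vec B e')"
  then show "e = e'" using basis_inner_dual[of e e] basis_inner_dual[of e' e] by (metis zero_neq_one)
qed

lemma independent_dual: "independent ((\<lambda>e. real_vec (dual_vec B e)) ` B)"
proof (rule independent_if_scalars_zero)
  show "finite ((\<lambda>e. real_vec (dual_vec B e)) ` B)" using finite_lattice_basis by simp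
  fix f x assume s: "(\<Sum>x\<in>(\<lambda>e. real_vec (dual_vec B e)) ` B. f x *\<^sub>R x) = 0" and "x \<in> (\<lambda>e. real_vec (dual_vec B e)) ` B"
  then obtain e where e: "e \<in> B" "x = real_vec (dual_vec B e)" by auto
  have "0 = real_vec e \<bullet> (\<Sum>e'\<in>B. f (real_vec (dual_vec B e')) *\<^sub>R real_vec (dual_vec B e'))"
    using s by (simp add: sum.reindex[OF inj_on_dual_vec])
  also have "\<dots> = (\<Sum>e'\<in>B. if e' = e then f (real_vec (dual_vec B e')) else 0)"
    unfolding inner_sum_right by (intro sum.cong refl) (simp add: basis_inner_dual e)
  also have "\<dots> = f x" using e finite_lattice_basis by simp
  finally show "f x = 0" ..
qed

lemma card_lattice_basis: "card B = CARD('n)"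
proof -
  let ?D = "(\<lambda>e. real_vec (dual_vec B e)) ` B"
  have "y \<in> span ?D" for y
    by (subst dual_expansion) (intro span_sum span_scale span_base imageI)
  then have "span ?D = UNIV" by blast
  then have "dim ?D = dim (UNIV :: (real ^ 'n) set)" by (metis dim_span)
  then have "dim ?D = CARD('n)" by simp
  then show ?thesis using dim_eq_card_independent[OF independent_dual] card_image[OF inj_on_dual_vec] by simp
qed

lemma span_convex_cone_hull: "span (convex_cone hull S) = span S" for S :: "'a::euclidean_space set"
proof -
  have "convex_cone hull S \<subseteq> span S"
    by (intro hull_minimal span_superset) (auto simp: convex_cone_iff span_add span_scale span_zero)
  then show ?thesis by (metis hull_subset span_mono span_span subset_antisym)
qed

lemma dim_dual_cone:
  assumes "I \<subseteq> B" shows "dim (convex_cone hull ((\<lambda>e. real_vec (dual_vec B e)) ` I)) = card I"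
proof -
  have "independent ((\<lambda>e. real_vec (dual_vec B e)) ` I)"
    using independent_dual assms by (meson image_mono independent_mono)
  then have "dim ((\<lambda>e. real_vec (dual_vec B e)) ` I) = card I"
    using dim_eq_card_independent inj_on_subset[OF inj_on_dual_vec assms] card_image by metis
  then show ?thesis by (metis dim_span span_convex_cone_hull)
qed

text \<open>The coordinates of y in the dual basis are its inner products with \<open>B\<close>, by
  \<open>dual_expansion\<close>.\<close>

lemma dual_cone_eq: "convex_cone hull ((\<lambda>e. real_vec (dual_vec B e)) ` B) = {y. \<forall>e\<in>B. 0 \<le> y \<bullet> real_vec e}"
proof
  show "convex_cone hull ((\<lambda>e. real_vec (dual_vec B e)) ` B) \<subseteq> {y. \<forall>e\<in>B. 0 \<le> y \<bullet> real_vec e}"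
  proof (rule hull_minimal)
    show "(\<lambda>e. real_vec (dual_vec B e)) ` B \<subseteq> {y. \<forall>e\<in>B. 0 \<le> y \<bullet> real_vec e}"
      using basis_inner_dual by (auto simp: inner_commute)
    show "convex_cone {y. \<forall>e\<in>B. 0 \<le> y \<bullet> real_vec e}" by (auto simp: convex_cone_iff inner_add_left)
  qed
  show "{y. \<forall>e\<in>B. 0 \<le> y \<bullet> real_vec e} \<subseteq> convex_cone hull ((\<lambda>e. real_vec (dual_vec B e)) ` B)"
  proof
    fix y assume y: "y \<in> {y. \<forall>e\<in>B. 0 \<le> y \<bullet> real_vec e}"
    have "(\<Sum>e\<in>I. (y \<bullet> real_vec e) *\<^sub>R real_vec (dual_vec B e)) \<in> convex_cone hull ((\<lambda>e. real_vec (dual_vec B e)) ` B)"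
      if "finite I" "I \<subseteq> B" for I
      using that
    proof (induction I)
      case (insert e I)
      then have "(y \<bullet> real_vec e) *\<^sub>R real_vec (dual_vec B e) \<in> convex_cone hull ((\<lambda>e. real_vec (dual_vec B e)) ` B)"
        using y by (intro convex_cone_hull_mul hull_inc) auto
      then show ?case using insert by (simp add: convex_cone_hull_add)
    qed (simp add: convex_cone_hull_contains_0)
    then show "y \<in> convex_cone hull ((\<lambda>e. real_vec (dual_vec B e)) ` B)"
      using finite_lattice_basis by (subst dual_expansion) blast
  qed
qed

end

lemma convex_cone_hull_sing: "convex_cone hull {x :: 'a::euclidean_space} = {c *\<^sub>R x | c. 0 \<le> c}"
  by (auto simp: convex_cone_hull_convex_hull_nonempty)

text \<open>The sum of the other basis vectors is nonnegative on the cone and vanishes there exactly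
  on the ray.\<close>

lemma dual_ray_face:
  assumes B: "lattice_basis B" and e: "e \<in> B"
  shows "convex_cone hull {real_vec (dual_vec B e)} face_of convex_cone hull ((\<lambda>e. real_vec (dual_vec B e)) ` B)"
proof -
  let ?C = "convex_cone hull ((\<lambda>e. real_vec (dual_vec B e)) ` B)"
  let ?s = "\<Sum>e'\<in>B - {e}. real_vec e'"
  note fin = finite_lattice_basis[OF B]
  have s: "?s \<bullet> y = (\<Sum>e'\<in>B - {e}. y \<bullet> real_vec e')" for y
    by (subst inner_sum_left) (simp only: inner_commute[of y])
  have "convex_cone hull {real_vec (dual_vec B e)} = ?C \<inter> {y. ?s \<bullet> y = 0}"
  proof (intro equalityI subsetI)
    fix y assume "y \<in> convex_cone hull {real_vec (dual_vec B e)}"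
    then obtain c where c: "0 \<le> c" "y = c *\<^sub>R real_vec (dual_vec B e)" by (auto simp: convex_cone_hull_sing)
    then have "y \<bullet> real_vec e' = (if e = e' then c else 0)" if "e' \<in> B" for e'
      using basis_inner_dual[OF B e that] by (simp add: inner_commute)
    moreover from this have "?s \<bullet> y = 0" unfolding s by (intro sum.neutral) auto
    ultimately show "y \<in> ?C \<inter> {y. ?s \<bullet> y = 0}" using c by (auto simp: dual_cone_eq[OF B])
  next
    fix y assume y: "y \<in> ?C \<inter> {y. ?s \<bullet> y = 0}"
    then have nn: "0 \<le> y \<bullet> real_vec e'" if "e' \<in> B" for e' using that by (auto simp: dual_cone_eq[OF B])
    have 0: "y \<bullet> real_vec e' = 0" if "e' \<in> B - {e}" for e'
      using y fin nn that sum_nonneg_eq_0_iff[of "B - {e}" "\<lambda>e'. y \<bullet> real_vec e'"] by (auto simp: s)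
    have "y = (y \<bullet> real_vec e) *\<^sub>R real_vec (dual_vec B e) + (\<Sum>e'\<in>B - {e}. (y \<bullet> real_vec e') *\<^sub>R real_vec (dual_vec B e'))"
      by (subst dual_expansion[OF B, of y]) (rule sum.remove[OF fin e])
    also have "(\<Sum>e'\<in>B - {e}. (y \<bullet> real_vec e') *\<^sub>R real_vec (dual_vec B e')) = 0" by (intro sum.neutral) (simp add: 0)
    finally show "y \<in> convex_cone hull {real_vec (dual_vec B e)}" using nn[OF e] by (auto simp: convex_cone_hull_sing)
  qed
  moreover have "?C \<inter> {y. ?s \<bullet> y = 0} face_of ?C"
    by (intro face_of_Int_supporting_hyperplane_ge convex_convex_cone_hull) (auto simp: s dual_cone_eq[OF B] intro: sum_nonneg)
  ultimately show ?thesis by simp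
qed

text \<open>Split off a nonzero dual coordinate, y = y1 + y2. Then \<open>y\<close> is the midpoint
  of 2 y1 and 2 y2, which lie in the cone, so the face property puts y1 on the ray of
  \<open>y\<close>.\<close>

lemma dual_cone_ray:
  assumes B: "lattice_basis B" and y: "y \<noteq> 0"
    and face: "convex_cone hull {y} face_of convex_cone hull ((\<lambda>e. real_vec (dual_vec B e)) ` B)"
  obtains e c where "e \<in> B" "0 < c" "y = c *\<^sub>R real_vec (dual_vec B e)"
proof -
  let ?C = "convex_cone hull ((\<lambda>e. real_vec (dual_vec B e)) ` B)"
  note fin = finite_lattice_basis[OF B]
  have yR: "y \<in> convex_cone hull {y}" by (intro hull_inc) simp
  then have "y \<in> ?C" using face face_of_imp_subset by blast
  then have nn: "0 \<le> y \<bullet> real_vec e" if "e \<in> B" for e using that by (auto simp: dual_cone_eq[OF B])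
  obtain e where e: "e \<in> B" "y \<bullet> real_vec e \<noteq> 0"
    using dual_expansion[OF B, of y] y by (metis (mono_tags, lifting) scaleR_zero_left sum.neutral)
  define y1 where "y1 = (y \<bullet> real_vec e) *\<^sub>R real_vec (dual_vec B e)"
  define y2 where "y2 = y - y1"
  have i1: "y1 \<bullet> real_vec e' = (if e = e' then y \<bullet> real_vec e else 0)" if "e' \<in> B" for e'
    using basis_inner_dual[OF B e(1) that] by (simp add: y1_def inner_commute)
  have C: "2 *\<^sub>R y1 \<in> ?C" "2 *\<^sub>R y2 \<in> ?C"
    using nn by (auto simp: dual_cone_eq[OF B] i1 y2_def inner_diff_left)
  have "2 *\<^sub>R y1 \<in> convex_cone hull {y}"
  proof (cases "2 *\<^sub>R y1 = 2 *\<^sub>R y2")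
    case True
    then have "y1 = y2" by simp
    moreover have "y = y1 + y2" by (simp add: y2_def)
    ultimately show ?thesis using yR by (simp add: scaleR_2)
  next
    case False
    have "y = (1 - 1/2) *\<^sub>R (2 *\<^sub>R y1) + (1/2) *\<^sub>R (2 *\<^sub>R y2)" by (simp add: y2_def)
    then have "y \<in> open_segment (2 *\<^sub>R y1) (2 *\<^sub>R y2)"
      using False unfolding in_segment by (intro conjI exI[of _ "1/2"]) auto
    then show ?thesis using face C yR unfolding face_of_def by blast
  qed
  then obtain c where c: "0 \<le> c" "2 *\<^sub>R y1 = c *\<^sub>R y" by (auto simp: convex_cone_hull_sing)
  have "y1 \<noteq> 0" using e dual_vec_nonzero[OF B e(1)] by (simp add: y1_def)
  then have "c \<noteq> 0" using c by auto
  have "y = (2 / c) *\<^sub>R y1"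
    using arg_cong[OF c(2), of "\<lambda>x. (1 / c) *\<^sub>R x"] \<open>c \<noteq> 0\<close> by (simp add: field_simps)
  also have "\<dots> = (2 / c * (y \<bullet> real_vec e)) *\<^sub>R real_vec (dual_vec B e)" by (simp add: y1_def)
  finally show thesis using that[of e "2 / c * (y \<bullet> real_vec e)"] e nn[OF e(1)] c \<open>c \<noteq> 0\<close> by auto
qed

section \<open>Facets and rays of a smooth polytope\<close>

locale smooth_polytope =
  fixes \<Phi> :: "(real ^ 'n) set"
  assumes smooth: "smooth_lattice_polytope \<Phi>"
begin

definition verts :: "(int ^ 'n) set" where "verts = {v. real_vec v extreme_point_of \<Phi>}"
abbreviation eds :: "int ^ 'n \<Rightarrow> (int ^ 'n) set" where "eds v \<equiv> edge_vectors \<Phi> v"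
abbreviation nu :: "int ^ 'n \<Rightarrow> int ^ 'n \<Rightarrow> int ^ 'n" where "nu v e \<equiv> dual_vec (eds v) e"
text \<open>The facet through \<open>v\<close> that contains every edge at \<open>v\<close> except
  the one along \<open>e\<close>; \<open>nu v e\<close> is its inward normal.\<close>

definition fct :: "int ^ 'n \<Rightarrow> int ^ 'n \<Rightarrow> (real ^ 'n) set" where
  "fct v e = \<Phi> \<inter> {x. real_vec (nu v e) \<bullet> x = real_vec (nu v e) \<bullet> real_vec v}"

lemma lattice: "lattice_polytope \<Phi>" and full_dim: "aff_dim \<Phi> = int CARD('n)"
  using smooth by (auto simp: smooth_lattice_polytope_def)

lemma poly: "polytope \<Phi>" using lattice by (rule lattice_polytope_imp_polytope)

lemma basis: "v \<in> verts \<Longrightarrow> lattice_basis (eds v)"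
  using smooth by (simp add: smooth_lattice_polytope_def verts_def)

lemma vert_mem: "v \<in> verts \<Longrightarrow> real_vec v \<in> \<Phi>"
  by (simp add: verts_def extreme_point_of_def)

lemma finite_verts: "finite verts"
  using finite_vimageI[OF polytope_extreme_points(1)[OF poly], of real_vec]
  by (simp add: verts_def vimage_def inj_on_def)

lemma face_has_vertex:
  assumes Q: "Q face_of \<Phi>" "Q \<noteq> {}"
  obtains v where "v \<in> verts" "real_vec v \<in> Q"
proof -
  have "polytope Q" using Q face_of_polytope_polytope poly by blast
  then have "Q = convex hull {x. x extreme_point_of Q}" by (rule polytope_extreme_points)
  then obtain x where x: "x extreme_point_of Q" using Q by fastforce
  then have "x extreme_point_of \<Phi>" using Q extreme_point_of_face by blast
  moreover from this obtain v where "x = real_vec v" using extreme_point_lattice[OF lattice] by blast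
  ultimately show thesis using that[of v] x by (auto simp: verts_def extreme_point_of_def)
qed

text \<open>\<open>vertex_cone\<close> reduces this to the edges at \<open>v\<close>, where it is
  duality of bases.\<close>

lemma edge_coord_nonneg:
  assumes v: "v \<in> verts" and e: "e \<in> eds v" and w: "w \<in> \<Phi>"
  shows "0 \<le> real_vec (nu v e) \<bullet> (w - real_vec v)"
proof (rule vertex_cone[OF poly _ _ w])
  show x: "real_vec v extreme_point_of \<Phi>" using v by (simp add: verts_def)
  fix E y assume E: "E edge_of \<Phi>" "real_vec v \<in> E" "y \<in> E"
  obtain e' where e': "e' \<in> eds v" "\<exists>s\<ge>0. y - real_vec v = s *\<^sub>R real_vec e'"
    using edge_vector_of_edge[OF lattice E(1) x E(2)] E(3) by metis
  then show "0 \<le> real_vec (nu v e) \<bullet> (y - real_vec v)"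
    using basis_inner_dual[OF basis[OF v] e e'(1)] by (auto simp: inner_commute)
qed

lemma edge_end_mem: "e \<in> eds v \<Longrightarrow> real_vec v + real_vec e \<in> \<Phi>"
  using edge_vector_mem(1) by (fastforce simp: real_vec_add)

lemma vert_fct: "v \<in> verts \<Longrightarrow> real_vec v \<in> fct v e"
  using vert_mem by (simp add: fct_def)

lemma edge_end_fct:
  assumes "v \<in> verts" "e \<in> eds v" "e' \<in> eds v"
  shows "real_vec v + real_vec e' \<in> fct v e \<longleftrightarrow> e \<noteq> e'"
  using basis_inner_dual[OF basis[OF assms(1)] assms(2,3)] edge_end_mem[OF assms(3)]
  by (auto simp: fct_def inner_add_left inner_add_right inner_commute)

lemma fct_face:
  assumes v: "v \<in> verts" and e: "e \<in> eds v" shows "fct v e face_of \<Phi>"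
  unfolding fct_def
  using edge_coord_nonneg[OF v e] polytope_imp_convex[OF poly]
  by (intro face_of_Int_supporting_hyperplane_ge) (auto simp: inner_diff_right)

text \<open>The edges at \<open>v\<close> other than \<open>e\<close> start in the facet and already
  span the direction of the hyperplane.\<close>

lemma affine_hull_fct:
  assumes v: "v \<in> verts" and e: "e \<in> eds v"
  shows "affine hull (fct v e) = {x. real_vec (nu v e) \<bullet> x = real_vec (nu v e) \<bullet> real_vec v}" (is "_ = ?H")
proof
  show "affine hull (fct v e) \<subseteq> ?H" by (intro hull_minimal affine_hyperplane) (auto simp: fct_def)
  show "?H \<subseteq> affine hull (fct v e)"
  proof
    fix x assume x: "x \<in> ?H"
    let ?D = "{y - real_vec v | y. y \<in> fct v e - {real_vec v}}"
    have "x - real_vec v = (\<Sum>e'\<in>eds v. ((x - real_vec v) \<bullet> real_vec (nu v e')) *\<^sub>R real_vec e')"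
      by (rule vector_expansion[OF basis[OF v]])
    also have "\<dots> \<in> span ?D"
    proof (rule span_sum)
      fix e' assume e': "e' \<in> eds v"
      show "((x - real_vec v) \<bullet> real_vec (nu v e')) *\<^sub>R real_vec e' \<in> span ?D"
      proof (cases "e' = e")
        case True
        then have "(x - real_vec v) \<bullet> real_vec (nu v e') = 0" using x by (simp add: inner_diff_left inner_commute)
        then show ?thesis by (simp add: span_zero)
      next
        case False
        then have m: "real_vec v + real_vec e' \<in> fct v e" using edge_end_fct[OF v e e'] by simp
        have "real_vec e' \<noteq> 0" using edge_vector_mem(2)[OF e'] real_vec_eq_iff[of e' 0] by simp
        then have "real_vec e' \<in> ?D" using m by (intro CollectI exI[of _ "real_vec v + real_vec e'"]) auto
        then show ?thesis by (intro span_scale span_base)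
      qed
    qed
    finally have "x - real_vec v \<in> span ?D" .
    then show "x \<in> affine hull (fct v e)"
      unfolding affine_hull_span[OF vert_fct[OF v]]
      by (intro CollectI exI[of _ "x - real_vec v"]) simp
  qed
qed

lemma fct_facet:
  assumes v: "v \<in> verts" and e: "e \<in> eds v" shows "fct v e facet_of \<Phi>"
proof -
  have "aff_dim (fct v e) = int CARD('n) - 1"
    using aff_dim_affine_hull[of "fct v e"] affine_hull_fct[OF v e] dual_vec_nonzero[OF basis[OF v] e]
    by (simp add: aff_dim_hyperplane)
  then show ?thesis using fct_face[OF v e] vert_fct[OF v, of e] full_dim by (auto simp: facet_of_def)
qed

lemma fct_inj: "v \<in> verts \<Longrightarrow> e \<in> eds v \<Longrightarrow> e' \<in> eds v \<Longrightarrow> fct v e = fct v e' \<Longrightarrow> e = e'"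
  using edge_end_fct by metis

lemma facet_subset_eq:
  assumes "F facet_of \<Phi>" "G facet_of \<Phi>" "F \<subseteq> G" shows "F = G"
proof (rule ccontr)
  assume ne: "F \<noteq> G"
  have "F face_of G" using assms by (meson face_of_subset facet_of_imp_face_of facet_of_imp_subset)
  then have "aff_dim F < aff_dim G"
    using ne assms by (intro face_of_aff_dim_lt) (auto intro: face_of_imp_convex facet_of_imp_face_of)
  then show False using assms by (simp add: facet_of_def)
qed

text \<open>A functional supporting \<open>G\<close> is nonpositive on the edge vectors at
  \<open>v\<close> and negative on some \<open>e\<close>. On \<open>G\<close> the coordinate along
  \<open>e\<close> must then vanish, so \<open>G\<close> lies in \<open>fct v e\<close>, and
  distinct facets are never nested.\<close>

lemma facet_at_vertex:
  assumes G: "G facet_of \<Phi>" and v: "v \<in> verts" "real_vec v \<in> G"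
  obtains e where "e \<in> eds v" "G = fct v e"
proof -
  have "G exposed_face_of \<Phi>"
    using G poly by (simp add: exposed_face_of_polyhedron polytope_imp_polyhedron facet_of_imp_face_of)
  then obtain a b where ab: "\<Phi> \<subseteq> {x. a \<bullet> x \<le> b}" "G = \<Phi> \<inter> {x. a \<bullet> x = b}"
    unfolding exposed_face_of_def by auto
  have b: "b = a \<bullet> real_vec v" using ab v by auto
  have le: "a \<bullet> real_vec e \<le> 0" if "e \<in> eds v" for e
    using edge_end_mem[OF that] ab(1) b by (auto simp: inner_add_right)
  have "\<exists>e\<in>eds v. a \<bullet> real_vec e \<noteq> 0"
  proof (rule ccontr)
    assume "\<not> ?thesis"
    then have "a = 0" using dual_expansion[OF basis[OF v(1)], of a] by simp
    then have "G = \<Phi>" using ab b by auto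
    then show False using G by simp
  qed
  then obtain e where e: "e \<in> eds v" "a \<bullet> real_vec e < 0" using le by fastforce
  have "G \<subseteq> fct v e"
  proof
    fix w assume w: "w \<in> G"
    let ?f = "\<lambda>e'. ((w - real_vec v) \<bullet> real_vec (nu v e')) * (a \<bullet> real_vec e')"
    have wP: "w \<in> \<Phi>" using w ab by auto
    have "?f e' \<le> 0" if "e' \<in> eds v" for e'
      using edge_coord_nonneg[OF v(1) that wP] le[OF that] by (auto simp: inner_commute mult_le_0_iff)
    moreover have "(w - real_vec v) \<bullet> a = (\<Sum>e'\<in>eds v. ?f e')"
      by (rule inner_expansion[OF basis[OF v(1)]])
    moreover have "(w - real_vec v) \<bullet> a = 0" using w ab b by (auto simp: inner_diff_left inner_diff_right inner_commute)
    ultimately have "?f e = 0"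
      using sum_nonneg_eq_0_iff[of "eds v" "\<lambda>e. - ?f e"] finite_lattice_basis[OF basis[OF v(1)]] e by (auto simp: sum_negf)
    then show "w \<in> fct v e" using e wP by (auto simp: fct_def inner_diff_left inner_commute)
  qed
  then show thesis using that[OF e(1)] facet_subset_eq[OF G fct_facet[OF v(1) e(1)]] by blast
qed

lemma facet_cases:
  assumes G: "G facet_of \<Phi>"
  obtains v e where "v \<in> verts" "e \<in> eds v" "G = fct v e"
  using face_has_vertex[of G] facet_at_vertex[OF G] G by (metis facet_of_def)

lemma pairing_nu: "v \<in> verts \<Longrightarrow> e \<in> eds v \<Longrightarrow> lattice_pairing e (nu v e) = 1"
  using pairing_basis_dual[OF basis] by simp

text \<open>Any candidate vanishes on the edge vectors inside the facet, so it is a positive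
  multiple of the dual vector, and primitivity fixes the multiple.\<close>

lemma facet_normal_fct:
  assumes v: "v \<in> verts" and e: "e \<in> eds v" shows "facet_normal \<Phi> (fct v e) = nu v e"
  unfolding facet_normal_def
proof (rule the_equality)
  show "primitive_vec (nu v e) \<and> (\<exists>b. \<Phi> \<subseteq> {x. b \<le> x \<bullet> real_vec (nu v e)} \<and> fct v e = \<Phi> \<inter> {x. x \<bullet> real_vec (nu v e) = b})"
    using primitive_vecI[OF pairing_nu[OF v e]] edge_coord_nonneg[OF v e]
    by (intro conjI exI[of _ "real_vec (nu v e) \<bullet> real_vec v"]) (auto simp: fct_def inner_diff_left inner_diff_right inner_commute)
next
  fix w assume w: "primitive_vec w \<and> (\<exists>b. \<Phi> \<subseteq> {x. b \<le> x \<bullet> real_vec w} \<and> fct v e = \<Phi> \<inter> {x. x \<bullet> real_vec w = b})"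
  then obtain b where b: "\<Phi> \<subseteq> {x. b \<le> x \<bullet> real_vec w}" "fct v e = \<Phi> \<inter> {x. x \<bullet> real_vec w = b}" by blast
  have bv: "real_vec v \<bullet> real_vec w = b" using vert_fct[OF v, of e] b by auto
  have 0: "real_vec w \<bullet> real_vec e' = 0" if "e' \<in> eds v" "e' \<noteq> e" for e'
    using edge_end_fct[OF v e that(1)] that bv b(2) by (auto simp: inner_add_left inner_add_right inner_commute)
  have "real_vec w \<bullet> real_vec e \<noteq> 0" "real_vec w \<bullet> real_vec e \<ge> 0"
    using edge_end_fct[OF v e e] edge_end_mem[OF e] bv b by (auto simp: inner_add_left inner_add_right inner_commute)
  moreover have "real_vec w = (real_vec w \<bullet> real_vec e) *\<^sub>R real_vec (nu v e)"
  proof -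
    have "real_vec w = (\<Sum>e'\<in>eds v. (real_vec w \<bullet> real_vec e') *\<^sub>R real_vec (nu v e'))"
      by (rule dual_expansion[OF basis[OF v]])
    also have "\<dots> = (real_vec w \<bullet> real_vec e) *\<^sub>R real_vec (nu v e) + (\<Sum>e'\<in>eds v - {e}. (real_vec w \<bullet> real_vec e') *\<^sub>R real_vec (nu v e'))"
      by (rule sum.remove[OF finite_lattice_basis[OF basis[OF v]] e])
    also have "(\<Sum>e'\<in>eds v - {e}. (real_vec w \<bullet> real_vec e') *\<^sub>R real_vec (nu v e')) = 0"
      by (intro sum.neutral) (simp add: 0)
    finally show ?thesis by simp
  qed
  ultimately show "w = nu v e" using w pairing_nu[OF v e] by (intro primitive_vec_unique[where c = "real_vec w \<bullet> real_vec e"]) auto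
qed

lemma facet_offset_fct:
  assumes v: "v \<in> verts" and e: "e \<in> eds v"
  shows "facet_offset \<Phi> (fct v e) = - lattice_pairing v (nu v e)"
  unfolding facet_offset_def facet_normal_fct[OF v e] affine_hull_fct[OF v e]
proof (rule the_equality)
  show "{x. real_vec (nu v e) \<bullet> x = real_vec (nu v e) \<bullet> real_vec v} =
    {x. x \<bullet> real_vec (nu v e) = - real_of_int (- lattice_pairing v (nu v e))}"
    by (auto simp: inner_commute inner_real_vec lattice_pairing_commute)
next
  fix a assume "{x. real_vec (nu v e) \<bullet> x = real_vec (nu v e) \<bullet> real_vec v} =
    {x. x \<bullet> real_vec (nu v e) = - real_of_int a}"
  then have "real_vec v \<bullet> real_vec (nu v e) = - real_of_int a" by blast
  then show "a = - lattice_pairing v (nu v e)" unfolding inner_real_vec by linarith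
qed

definition rayof :: "(real ^ 'n) set \<Rightarrow> (real ^ 'n) set" where
  "rayof F = convex_cone hull {real_vec (facet_normal \<Phi> F)}"

text \<open>Facets containing \<open>Q\<close> pass through each of its vertices. So the normal cone
  is spanned by part of a dual basis, and its dimension is a count of facets.\<close>

lemma normal_cone_vertex:
  assumes v: "v \<in> verts" "real_vec v \<in> Q"
  shows "normal_cone \<Phi> Q = convex_cone hull ((\<lambda>e. real_vec (nu v e)) ` {e \<in> eds v. Q \<subseteq> fct v e})"
proof -
  have "{real_vec (facet_normal \<Phi> F) | F. F facet_of \<Phi> \<and> Q \<subseteq> F} = (\<lambda>e. real_vec (nu v e)) ` {e \<in> eds v. Q \<subseteq> fct v e}"
  proof safe
    fix F assume F: "F facet_of \<Phi>" "Q \<subseteq> F"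
    then obtain e where e: "e \<in> eds v" "F = fct v e" using facet_at_vertex[OF F(1) v(1)] v by blast
    then show "real_vec (facet_normal \<Phi> F) \<in> (\<lambda>e. real_vec (nu v e)) ` {e \<in> eds v. Q \<subseteq> fct v e}"
      using F facet_normal_fct[OF v(1) e(1)] by auto
  next
    fix e assume e: "e \<in> eds v" "Q \<subseteq> fct v e"
    then show "\<exists>F. real_vec (nu v e) = real_vec (facet_normal \<Phi> F) \<and> F facet_of \<Phi> \<and> Q \<subseteq> F"
      using facet_normal_fct[OF v(1) e(1)] fct_facet[OF v(1) e(1)] by metis
  qed
  then show ?thesis by (simp add: normal_cone_def)
qed

lemma dim_normal_cone:
  assumes v: "v \<in> verts" "real_vec v \<in> Q"
  shows "dim (normal_cone \<Phi> Q) = card {e \<in> eds v. Q \<subseteq> fct v e}"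
  unfolding normal_cone_vertex[OF v] by (rule dim_dual_cone[OF basis[OF v(1)]]) auto

lemma rayof_fct: "v \<in> verts \<Longrightarrow> e \<in> eds v \<Longrightarrow> rayof (fct v e) = convex_cone hull {real_vec (nu v e)}"
  by (simp add: rayof_def facet_normal_fct)

lemma rays_eq: "rays \<Phi> = rayof ` {F. F facet_of \<Phi>}"
proof safe
  fix \<rho> assume "\<rho> \<in> rays \<Phi>"
  then obtain Q where Q: "Q face_of \<Phi>" "Q \<noteq> {}" "\<rho> = normal_cone \<Phi> Q" "dim \<rho> = 1"
    by (auto simp: fan_cones_def normal_fan_def)
  obtain v where v: "v \<in> verts" "real_vec v \<in> Q" using face_has_vertex[OF Q(1,2)] .
  obtain e where e: "{e \<in> eds v. Q \<subseteq> fct v e} = {e}" using Q dim_normal_cone[OF v] by (metis card_1_singletonE)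
  then have "\<rho> = rayof (fct v e)" "e \<in> eds v" using Q normal_cone_vertex[OF v] rayof_fct[OF v(1), of e] by auto
  then show "\<rho> \<in> rayof ` {F. F facet_of \<Phi>}" using fct_facet[OF v(1)] by blast
next
  fix F assume F: "F facet_of \<Phi>"
  then obtain v e where v: "v \<in> verts" and e: "e \<in> eds v" "F = fct v e" using facet_cases by blast
  have "{e' \<in> eds v. fct v e \<subseteq> fct v e'} = {e}"
    using e facet_subset_eq[OF fct_facet[OF v] fct_facet[OF v]] fct_inj[OF v] by blast
  then have "normal_cone \<Phi> F = rayof F" "dim (normal_cone \<Phi> F) = 1"
    using normal_cone_vertex[OF v vert_fct[OF v], of e] dim_normal_cone[OF v vert_fct[OF v], of e] e rayof_fct[OF v e(1)] by simp_all
  moreover have "F face_of \<Phi>" "F \<noteq> {}" using F by (auto simp: facet_of_def)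
  ultimately show "rayof F \<in> rays \<Phi>" unfolding fan_cones_def normal_fan_def by (metis (mono_tags, lifting) mem_Collect_eq)
qed

text \<open>Primitive normals on one ray coincide, and both facets are then the set where the same
  functional is minimal on the polytope.\<close>

lemma parallel_nu:
  assumes v: "v \<in> verts" "e \<in> eds v" and v': "v' \<in> verts" "e' \<in> eds v'"
    and c: "real_vec (nu v' e') = c *\<^sub>R real_vec (nu v e)" "0 \<le> c"
  shows "fct v' e' = fct v e"
proof -
  have "c \<noteq> 0" using dual_vec_nonzero[OF basis[OF v'(1)] v'(2)] c by auto
  then have eq: "nu v' e' = nu v e"
    using primitive_vec_unique[OF primitive_vecI[OF pairing_nu[OF v']] pairing_nu[OF v] c(1)] c by simp
  have "real_vec (nu v e) \<bullet> real_vec v = real_vec (nu v e) \<bullet> real_vec v'"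
    using edge_coord_nonneg[OF v vert_mem[OF v'(1)]] edge_coord_nonneg[OF v' vert_mem[OF v(1)]] eq
    by (simp add: inner_diff_right)
  then show ?thesis by (simp add: fct_def eq)
qed

lemma rayof_inj:
  assumes F: "F facet_of \<Phi>" and G: "G facet_of \<Phi>" and eq: "rayof F = rayof G" shows "F = G"
proof -
  obtain v e where v: "v \<in> verts" "e \<in> eds v" "F = fct v e" using facet_cases[OF F] .
  obtain v' e' where v': "v' \<in> verts" "e' \<in> eds v'" "G = fct v' e'" using facet_cases[OF G] .
  have "real_vec (nu v' e') \<in> rayof F" using eq v' rayof_fct[OF v'(1,2)] by (simp add: hull_inc)
  then obtain c where c: "0 \<le> c" "real_vec (nu v' e') = c *\<^sub>R real_vec (nu v e)"
    using v rayof_fct[OF v(1,2)] by (auto simp: convex_cone_hull_sing)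
  then show ?thesis using parallel_nu[OF v(1,2) v'(1,2) c(2,1)] v v' by simp
qed

lemma ray_facet_rayof: "F facet_of \<Phi> \<Longrightarrow> ray_facet \<Phi> (rayof F) = F"
  unfolding ray_facet_def rayof_def[symmetric] by (rule the_equality) (auto dest: rayof_inj)

definition ray_at :: "int ^ 'n \<Rightarrow> int ^ 'n \<Rightarrow> (real ^ 'n) set" where "ray_at v e = rayof (fct v e)"

lemma ray_normal_at: "v \<in> verts \<Longrightarrow> e \<in> eds v \<Longrightarrow> ray_normal \<Phi> (ray_at v e) = nu v e"
  and ray_offset_at: "v \<in> verts \<Longrightarrow> e \<in> eds v \<Longrightarrow> ray_offset \<Phi> (ray_at v e) = - lattice_pairing v (nu v e)"
  by (simp_all add: ray_normal_def ray_offset_def ray_at_def ray_facet_rayof fct_facet facet_normal_fct facet_offset_fct)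

lemma ray_cases:
  assumes "\<rho> \<in> rays \<Phi>" obtains v e where "v \<in> verts" "e \<in> eds v" "\<rho> = ray_at v e"
  using assms facet_cases unfolding rays_eq ray_at_def by blast

lemma inj_ray_at: "v \<in> verts \<Longrightarrow> inj_on (ray_at v) (eds v)"
  unfolding ray_at_def by (intro inj_onI) (meson fct_facet fct_inj rayof_inj)

lemma ray_at_mem: "v \<in> verts \<Longrightarrow> e \<in> eds v \<Longrightarrow> ray_at v e \<in> rays \<Phi>"
  unfolding rays_eq ray_at_def using fct_facet by blast

definition vcone :: "int ^ 'n \<Rightarrow> (real ^ 'n) set" where "vcone v = normal_cone \<Phi> {real_vec v}"

lemma vcone_eq: "v \<in> verts \<Longrightarrow> vcone v = convex_cone hull ((\<lambda>e. real_vec (nu v e)) ` eds v)"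
proof -
  assume v: "v \<in> verts"
  have "{e \<in> eds v. {real_vec v} \<subseteq> fct v e} = eds v" using vert_fct[OF v] by auto
  then show ?thesis using normal_cone_vertex[OF v, of "{real_vec v}"] by (simp add: vcone_def)
qed

text \<open>Full dimension means that all facets through a vertex of \<open>Q\<close> contain
  \<open>Q\<close>, and these facets meet only in that vertex.\<close>

lemma maximal_cones_eq: "maximal_cones \<Phi> = vcone ` verts"
proof safe
  fix \<sigma> assume "\<sigma> \<in> maximal_cones \<Phi>"
  then obtain Q where Q: "Q face_of \<Phi>" "Q \<noteq> {}" "\<sigma> = normal_cone \<Phi> Q" "dim \<sigma> = CARD('n)"
    by (auto simp: fan_cones_def normal_fan_def)
  obtain v where v: "v \<in> verts" "real_vec v \<in> Q" using face_has_vertex[OF Q(1,2)] .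
  have "card {e \<in> eds v. Q \<subseteq> fct v e} = card (eds v)"
    using Q dim_normal_cone[OF v] card_lattice_basis[OF basis[OF v(1)]] by simp
  then have "{e \<in> eds v. Q \<subseteq> fct v e} = eds v"
    by (intro card_subset_eq finite_lattice_basis[OF basis[OF v(1)]]) auto
  then have sub: "Q \<subseteq> fct v e" if "e \<in> eds v" for e using that by blast
  have "w = real_vec v" if w: "w \<in> Q" for w
  proof -
    have "(w - real_vec v) \<bullet> real_vec (nu v e) = 0" if "e \<in> eds v" for e
      using sub[OF that] w by (auto simp: fct_def inner_diff_left inner_commute)
    then have "w - real_vec v = 0" using vector_expansion[OF basis[OF v(1)], of "w - real_vec v"] by simp
    then show ?thesis by simp
  qed
  then have "Q = {real_vec v}" using v by blast
  then show "\<sigma> \<in> vcone ` verts" using Q v by (auto simp: vcone_def)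
next
  fix v assume v: "v \<in> verts"
  then have "{real_vec v} face_of \<Phi>" by (simp add: verts_def face_of_singleton)
  moreover have "dim (vcone v) = CARD('n)"
    using dim_dual_cone[OF basis[OF v], of "eds v"] card_lattice_basis[OF basis[OF v]] vcone_eq[OF v] by simp
  ultimately show "vcone v \<in> maximal_cones \<Phi>" unfolding fan_cones_def normal_fan_def vcone_def by blast
qed

text \<open>The extreme rays of the simplicial cone at \<open>v\<close> are spanned by the dual
  vectors; \<open>parallel_nu\<close> identifies the facets that span the same ray.\<close>

lemma cone_rays_eq:
  assumes v: "v \<in> verts" shows "cone_rays \<Phi> (vcone v) = ray_at v ` eds v"
proof safe
  fix \<rho> assume \<rho>: "\<rho> \<in> cone_rays \<Phi> (vcone v)"
  then have "\<rho> \<in> rays \<Phi>" by (simp add: cone_rays_def)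
  then obtain v' e' where v': "v' \<in> verts" "e' \<in> eds v'" and \<rho>': "\<rho> = ray_at v' e'" by (rule ray_cases)
  have "convex_cone hull {real_vec (nu v' e')} face_of convex_cone hull ((\<lambda>e. real_vec (nu v e)) ` eds v)"
    using \<rho> \<rho>' rayof_fct[OF v'] vcone_eq[OF v] by (simp add: cone_rays_def ray_at_def)
  then obtain e c where e: "e \<in> eds v" "0 < c" "real_vec (nu v' e') = c *\<^sub>R real_vec (nu v e)"
    using dual_cone_ray[OF basis[OF v] dual_vec_nonzero[OF basis[OF v'(1)] v'(2)]] by blast
  then have "fct v' e' = fct v e" using parallel_nu[OF v e(1) v' e(3)] e by simp
  then show "\<rho> \<in> ray_at v ` eds v" using e \<rho>' by (simp add: ray_at_def)
next
  fix e assume e: "e \<in> eds v"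
  show "ray_at v e \<in> cone_rays \<Phi> (vcone v)"
    using dual_ray_face[OF basis[OF v] e] ray_at_mem[OF v e] rayof_fct[OF v e] vcone_eq[OF v]
    by (simp add: cone_rays_def ray_at_def)
qed

lemma finite_rays: "finite (rays \<Phi>)"
  unfolding rays_eq by (intro finite_imageI finite_polytope_facets[OF poly])

lemma ray_coord_nonneg:
  assumes m: "real_vec m \<in> \<Phi>" and \<rho>: "\<rho> \<in> rays \<Phi>"
  shows "0 \<le> lattice_pairing m (ray_normal \<Phi> \<rho>) + ray_offset \<Phi> \<rho>"
proof -
  obtain v e where v: "v \<in> verts" "e \<in> eds v" "\<rho> = ray_at v e" using ray_cases[OF \<rho>] .
  have "0 \<le> real_vec (nu v e) \<bullet> real_vec (m - v)"
    using edge_coord_nonneg[OF v(1,2) m] by (simp add: real_vec_diff)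
  then show ?thesis
    using v by (simp add: inner_real_vec ray_normal_at ray_offset_at lattice_pairing_commute[of "nu v e"] lattice_pairing_diff)
qed

text \<open>Take a vertex of the face on which \<open>s\<close> is maximal. This is completeness of
  the normal fan and provides \<open>max_vert\<close>.\<close>

lemma maximal_vertex: "\<exists>v\<in>verts. \<forall>e\<in>eds v. s \<bullet> real_vec e \<le> 0"
proof -
  have "\<Phi> \<noteq> {}" using full_dim aff_dim_empty[of \<Phi>] by auto
  then obtain x where x: "x \<in> \<Phi>" "\<And>y. y \<in> \<Phi> \<Longrightarrow> s \<bullet> y \<le> s \<bullet> x"
    using continuous_attains_sup[OF polytope_imp_compact[OF poly], of "\<lambda>x. s \<bullet> x"] by (force intro: continuous_intros)
  have "\<Phi> \<inter> {y. s \<bullet> y = s \<bullet> x} face_of \<Phi>"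
    using x polytope_imp_convex[OF poly] by (intro face_of_Int_supporting_hyperplane_le) auto
  then obtain v where v: "v \<in> verts" "real_vec v \<in> \<Phi> \<inter> {y. s \<bullet> y = s \<bullet> x}"
    using face_has_vertex x by blast
  have "s \<bullet> real_vec e \<le> 0" if "e \<in> eds v" for e
    using x(2)[OF edge_end_mem[OF that]] v by (auto simp: inner_add_right)
  then show ?thesis using v by blast
qed

end

section \<open>The two implications in terms of fan data\<close>

context fan_data begin

text \<open>A sign change in a single coordinate is not the phase of a group element, as the
  equation for the dual edge vector fails. This yields positivity on the open orthant and the two
  distinct terms needed for the companion matrix.\<close>

lemma value_sign_flip:
  assumes P3 and v: "v \<in> verts" and i: "i \<in> sg v" and x: "\<And>\<rho>. \<rho> \<in> V \<Longrightarrow> 0 < x \<rho>"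
  defines "z \<equiv> \<lambda>\<rho>. complex_of_real (x \<rho>) * (if \<rho> = i then -1 else 1)"
  shows "cmod (poly_value of_int qq z) < poly_value of_int qq x"
proof -
  have iV: "i \<in> V" using i sgV[OF v] by blast
  have "z \<rho> \<noteq> 0" if "\<rho> \<in> V" for \<rho> using x[OF that] by (simp add: z_def)
  then have "nd z" using v unfolding nd_def by blast
  moreover have "\<not> tw z"
  proof
    assume "tw z"
    then obtain t y where ty: "\<And>\<rho>. \<rho> \<in> V \<Longrightarrow> cmod (t \<rho>) = 1 \<and> 0 \<le> y \<rho> \<and> z \<rho> = t \<rho> * complex_of_real (y \<rho>)"
      and g: "\<And>m. (\<Prod>\<rho>\<in>V. t \<rho> powi lattice_pairing m (u \<rho>)) = 1" unfolding tw_def by blast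
    have t: "t \<rho> = (if \<rho> = i then -1 else 1)" if "\<rho> \<in> V" for \<rho>
    proof -
      have "cmod (z \<rho>) = y \<rho>" using ty[OF that] by (auto simp: norm_mult)
      moreover have "cmod (z \<rho>) = x \<rho>" using x[OF that] by (simp add: z_def norm_mult)
      ultimately have "complex_of_real (x \<rho>) * (if \<rho> = i then -1 else 1) = complex_of_real (x \<rho>) * t \<rho>"
        using ty[OF that] by (simp add: z_def mult.commute)
      then show ?thesis using x[OF that] by (metis less_irrefl mult_cancel_left of_real_eq_0_iff)
    qed
    have "(\<Prod>\<rho>\<in>V. t \<rho> powi lattice_pairing (eb v i) (u \<rho>)) = (\<Prod>\<rho>\<in>{i}. t \<rho> powi lattice_pairing (eb v i) (u \<rho>))"
      using t iV finV by (intro prod.mono_neutral_right) auto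
    then have "t i = 1" using g[of "eb v i"] dual[OF v i i] by simp
    then show False using t[OF iV] by simp
  qed
  ultimately have "cmod (poly_value of_int qq z) < poly_value of_int qq (\<lambda>\<rho>. cmod (z \<rho>))"
    using \<open>P3\<close> unfolding P3_def by blast
  also have "poly_value of_int qq (\<lambda>\<rho>. cmod (z \<rho>)) = poly_value of_int qq x"
    using x by (intro poly_value_cong[OF qq_over]) (auto simp: z_def norm_mult abs_of_pos)
  finally show ?thesis .
qed

theorem aperiodic_matrix_of_P3:
  assumes P1 P2 P3
  shows "\<exists>A. square_matrix_over V A \<and> aperiodic_matrix A \<and> is_spectral_radius_fun V qq A"
proof -
  obtain k0 where k0: "\<And>k \<beta>. k \<ge> k0 \<Longrightarrow> \<beta> \<in> Poly_Mapping.keys (qq ^ k) \<Longrightarrow> Poly_Mapping.lookup (qq ^ k) \<beta> > 0"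
    using eventually_positive_coefficients[OF assms] by blast
  define k where "k = Suc k0"
  have nn: "Poly_Mapping.lookup (qq ^ l) \<alpha> \<ge> 0" if "l \<ge> k0" for l \<alpha>
    using k0[OF that, of \<alpha>] by (cases "\<alpha> \<in> Poly_Mapping.keys (qq ^ l)") (auto simp: in_keys_iff)
  obtain v i where v: "v \<in> verts" and i: "i \<in> sg v" using verts_ne sg_ne by blast
  have pos: "poly_value of_int qq x > (0::real)" if "\<And>\<rho>. \<rho> \<in> V \<Longrightarrow> 0 < x \<rho>" for x
    by (rule order_le_less_trans[OF norm_ge_zero value_sign_flip[OF \<open>P3\<close> v i]]) (rule that)
  have one: "poly_value of_int (qq ^ l) (\<lambda>_. 1 :: real) > 0" for l
    using pos[of "\<lambda>_. 1"] by (simp add: of_int_coeff.poly_value_power)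
  have ne: "qq ^ l \<noteq> 0" for l using one[of l] by auto
  \<comment> \<open>A single term would have the same modulus at the sign-flipped point as at the
    point with all coordinates 1.\<close>
  have "\<exists>\<beta> \<gamma>. \<beta> \<in> Poly_Mapping.keys (qq ^ k) \<and> \<gamma> \<in> Poly_Mapping.keys (qq ^ k) \<and> \<beta> \<noteq> \<gamma>"
  proof (rule ccontr)
    assume "\<not> ?thesis"
    moreover obtain \<beta> where "\<beta> \<in> Poly_Mapping.keys (qq ^ k)" using ne[of k] by (metis all_not_in_conv keys_eq_empty)
    ultimately have keys: "Poly_Mapping.keys (qq ^ k) = {\<beta>}" by blast
    define z where "z = (\<lambda>\<rho>. complex_of_real 1 * (if \<rho> = i then -1 else 1))"
    have z1: "cmod (z \<rho>) = 1" for \<rho> by (simp add: z_def)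
    have "cmod (poly_value of_int qq z) < poly_value of_int qq (\<lambda>_. 1 :: real)"
      using value_sign_flip[OF \<open>P3\<close> v i, of "\<lambda>_. 1"] by (simp add: z_def)
    then have "cmod (poly_value of_int qq z) ^ k < poly_value of_int qq (\<lambda>_. 1 :: real) ^ k"
      by (intro power_strict_mono) (auto simp: k_def)
    then have "cmod (poly_value of_int (qq ^ k) z) < poly_value of_int (qq ^ k) (\<lambda>_. 1 :: real)"
      by (simp add: of_int_coeff.poly_value_power norm_power)
    moreover have "cmod (poly_value of_int (qq ^ k) z) = \<bar>poly_value of_int (qq ^ k) (\<lambda>_. 1 :: real)\<bar>"
      unfolding poly_value_def keys by (simp add: norm_mult norm_power z1 flip: prod_norm)
    ultimately show False by simp
  qed
  then obtain \<beta> \<gamma> where two: "\<beta> \<in> Poly_Mapping.keys (qq ^ k)" "\<gamma> \<in> Poly_Mapping.keys (qq ^ k)" "\<beta> \<noteq> \<gamma>" by blast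
  show ?thesis
  proof (rule aperiodic_companion_matrix[OF qq_over _ _ _ _ two ne])
    show "poly_value of_int qq x > 0" if "x \<in> V \<rightarrow>\<^sub>E {0<..}" for x :: "'v \<Rightarrow> real" using that by (intro pos) auto
    show "k \<ge> 1" by (simp add: k_def)
    show "Poly_Mapping.lookup (qq ^ k) \<alpha> \<ge> 0" for \<alpha> by (rule nn) (simp add: k_def)
    show "Poly_Mapping.lookup (qq ^ Suc k) \<alpha> \<ge> 0" for \<alpha> by (rule nn) (simp add: k_def)
  qed
qed

theorem P3_of_irreducible_matrix:
  assumes P1 P2 and A: "square_matrix_over V A" "irreducible_matrix A" "is_spectral_radius_fun V qq A"
  shows P3
proof (rule P3_of_beta_matrix[OF \<open>P1\<close> \<open>P2\<close>])
  have "square_mat A" and el: "elements_mat A \<subseteq> polys_over V" and pos: "dim_row A > 0"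
    using A by (auto simp: square_matrix_over_def)
  then have dim: "A \<in> carrier_mat (dim_row A) (dim_row A)" by auto
  show "beta_matrix V qq A (dim_row A)"
  proof
    show "A $$ (i, j) \<in> polys_over V" if "i < dim_row A" "j < dim_row A" for i j
      using that dim el elements_matI[of A "dim_row A" "dim_row A" i j] by blast
  qed (fact A dim pos finV qq_over)+
qed

end

section \<open>The equivalence\<close>

lemma aperiodic_imp_irreducible: "aperiodic_matrix A \<Longrightarrow> irreducible_matrix A"
  by (auto simp: aperiodic_matrix_def irreducible_matrix_def)

lemma unit_circle_iff: "t \<in> unit_circle \<longleftrightarrow> cmod t = 1"
proof
  assume "cmod t = 1"
  then have "t = exp (\<i> * of_real (Arg t))" using Arg_eq[of t] by fastforce
  then show "t \<in> unit_circle" by (auto simp: unit_circle_def)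
qed (auto simp: unit_circle_def)

lemma finite_lattice_points:
  fixes S :: "(real ^ 'n) set"
  assumes "bounded S" shows "finite {m. real_vec m \<in> S}"
proof -
  obtain b where b: "\<And>x. x \<in> S \<Longrightarrow> norm x \<le> b" using assms by (auto simp: bounded_iff)
  define K where "K = \<lceil>b\<rceil>"
  have "{m. real_vec m \<in> S} \<subseteq> (\<lambda>f. \<chi> i. f i) ` (UNIV \<rightarrow>\<^sub>E {-K..K})"
  proof
    fix m :: "int ^ 'n" assume "m \<in> {m. real_vec m \<in> S}"
    then have m: "real_vec m \<in> S" by simp
    have "m $ i \<in> {-K..K}" for i
    proof -
      have "\<bar>real_vec m $ i\<bar> \<le> b" using component_le_norm_cart[of "real_vec m" i] b[OF m] by linarith
      then have "real_of_int \<bar>m $ i\<bar> \<le> b" by (simp add: real_vec_def)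
      then have "\<bar>m $ i\<bar> \<le> K" unfolding K_def by linarith
      then show ?thesis by auto
    qed
    then show "m \<in> (\<lambda>f. \<chi> i. f i) ` (UNIV \<rightarrow>\<^sub>E {-K..K})"
      by (intro image_eqI[of _ _ "\<lambda>i. m $ i"]) auto
  qed
  then show ?thesis by (rule finite_subset) (intro finite_imageI finite_PiE, auto)
qed

locale smooth_newton = smooth_polytope \<Phi> for \<Phi> :: "(real ^ 'n) set" +
  fixes p :: "(int ^ 'n) \<Rightarrow>\<^sub>0 int"
  assumes newton: "\<Phi> = newton_polytope p"
begin

text \<open>\<open>rays\<close> abbreviates \<open>fan_cones\<close> at the index 1, a form that has
  to be kept during simplification.\<close>

declare One_nat_def [simp del]

abbreviation "sgm v \<equiv> cone_rays \<Phi> (vcone v)"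
abbreviation "ebm v \<equiv> inv_into (eds v) (ray_at v)"

lemma support_mem: "m \<in> Poly_Mapping.keys p \<Longrightarrow> real_vec m \<in> \<Phi>"
  by (auto simp: newton newton_polytope_def intro: hull_inc)

text \<open>Edge vectors at a vertex are relabelled by the rays of its cone:
  \<open>ebm v \<rho>\<close> is the edge vector dual to the normal of \<rho>.\<close>

sublocale fan_data "rays \<Phi>" "ray_normal \<Phi>" "ray_offset \<Phi>" p verts sgm ebm
proof
  show "verts \<noteq> {}" using maximal_vertex by blast
  fix v assume v: "v \<in> verts"
  note sg = cone_rays_eq[OF v] and inj = inj_ray_at[OF v] and B = basis[OF v]
  show "sgm v \<subseteq> rays \<Phi>" by (auto simp: cone_rays_def)
  have "eds v \<noteq> {}" using card_lattice_basis[OF B] by (metis card.empty zero_less_card_finite less_irrefl)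
  then show "sgm v \<noteq> {}" using sg by blast
  show "lattice_pairing (ebm v \<rho>) (ray_normal \<Phi> \<rho>') = (if \<rho> = \<rho>' then 1 else 0)" if \<rho>: "\<rho> \<in> sgm v" "\<rho>' \<in> sgm v" for \<rho> \<rho>'
  proof -
    obtain e where e1: "\<rho> = ray_at v e" "e \<in> eds v" using \<rho>(1) unfolding sg by (rule imageE)
    obtain e' where e2: "\<rho>' = ray_at v e'" "e' \<in> eds v" using \<rho>(2) unfolding sg by (rule imageE)
    note e = e1(2,1) e2(2,1)
    then show ?thesis using pairing_basis_dual[OF B e(3,1)] inj_on_eq_iff[OF inj e(1,3)] inj by (auto simp: ray_normal_at[OF v])
  qed
  show "m = (\<Sum>\<rho>\<in>sgm v. lattice_pairing m (ray_normal \<Phi> \<rho>) *s ebm v \<rho>)" for m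
    unfolding sg sum.reindex[OF inj] using lattice_expansion[OF B, of m] by (simp add: inj ray_normal_at[OF v])
  show "lattice_pairing v (ray_normal \<Phi> \<rho>) + ray_offset \<Phi> \<rho> = 0" if "\<rho> \<in> sgm v" for \<rho>
    using that by (auto simp: sg ray_normal_at[OF v] ray_offset_at[OF v])
next
  fix s :: "real ^ 'n"
  obtain v where v: "v \<in> verts" "\<forall>e\<in>eds v. s \<bullet> real_vec e \<le> 0" using maximal_vertex by blast
  then show "\<exists>v\<in>verts. \<forall>\<rho>\<in>sgm v. s \<bullet> real_vec (ebm v \<rho>) \<le> 0"
    by (intro bexI[of _ v]) (auto simp: cone_rays_eq inj_ray_at)
qed (use finite_rays finite_verts ray_coord_nonneg support_mem in auto)

lemma homogenization_eq: "homogenization \<Phi> p = qq"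
  unfolding homogenization_def qq_def hx_def xp_def
  using support_mem finite_lattice_points[OF polytope_imp_bounded[OF poly]]
  by (intro sum.mono_neutral_right) (auto simp: in_keys_iff)

lemma irrelevant_iff: "z \<in> rays \<Phi> \<rightarrow>\<^sub>E UNIV \<Longrightarrow> z \<notin> irrelevant_set \<Phi> \<longleftrightarrow> nd z"
  using finV by (auto simp: irrelevant_set_def nd_def maximal_cones_eq)

lemma P1_iff: "P1 \<longleftrightarrow> Pos1 \<Phi> qq"
proof -
  have "poly_value of_int qq (cone_point \<Phi> \<sigma>) = poly_value of_int qq (\<lambda>\<rho>. if \<rho> \<in> cone_rays \<Phi> \<sigma> then 0 else 1)" for \<sigma>
    by (rule poly_value_cong[OF qq_over]) (simp add: cone_point_def)
  then show ?thesis by (simp add: P1_def Pos1_def maximal_cones_eq)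
qed

lemma P2_of_Pos2: assumes "Pos2 \<Phi> qq" shows P2
  unfolding P2_def
proof (intro ballI allI impI)
  fix \<rho> and x :: "(real ^ 'n) set \<Rightarrow> real"
  assume \<rho>: "\<rho> \<in> rays \<Phi>" and x: "\<forall>\<rho>'\<in>rays \<Phi>. 0 \<le> x \<rho>'" "x \<rho> = 0" "nd x"
  define y where "y = restrict x (rays \<Phi>)"
  have "complex_point (rays \<Phi>) y \<notin> irrelevant_set \<Phi>"
    using x(3) by (subst irrelevant_iff) (auto simp: complex_point_def nd_def y_def)
  moreover have "y \<in> orthant_face \<Phi> \<rho>" using x \<rho> by (auto simp: orthant_face_def y_def)
  ultimately have "deriv (\<lambda>s. poly_value of_int qq (y(\<rho> := s))) (y \<rho>) > 0"
    using assms \<rho> unfolding Pos2_def by blast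
  moreover have "y \<rho> = 0" using x \<rho> by (simp add: y_def)
  moreover have "poly_value of_int qq (y(\<rho> := s)) = poly_value of_int qq (x(\<rho> := s))" for s
    by (rule poly_value_cong[OF qq_over]) (auto simp: y_def)
  ultimately show "deriv (\<lambda>s. poly_value of_int qq (x(\<rho> := s))) 0 > 0" by simp
qed

lemma twisted_iff:
  assumes z: "z \<in> rays \<Phi> \<rightarrow>\<^sub>E UNIV" shows "z \<in> twisted_orthant \<Phi> \<longleftrightarrow> tw z"
proof
  assume "z \<in> twisted_orthant \<Phi>"
  then obtain t x where zt: "z = (\<lambda>\<rho>\<in>rays \<Phi>. t \<rho> * complex_of_real (x \<rho>))" and t: "t \<in> cox_group \<Phi>" "t \<in> rays \<Phi> \<rightarrow>\<^sub>E unit_circle"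
    and x: "x \<in> rays \<Phi> \<rightarrow>\<^sub>E {0..}" by (auto simp: twisted_orthant_def)
  have "cmod (t \<rho>) = 1 \<and> 0 \<le> x \<rho> \<and> z \<rho> = t \<rho> * complex_of_real (x \<rho>)" if "\<rho> \<in> rays \<Phi>" for \<rho>
    using PiE_mem[OF t(2) that] PiE_mem[OF x that] zt that by (simp add: unit_circle_iff)
  then show "tw z" using t(1) unfolding tw_def cox_group_def by blast
next
  assume "tw z"
  then obtain t x where tx: "\<And>\<rho>. \<rho> \<in> rays \<Phi> \<Longrightarrow> cmod (t \<rho>) = 1 \<and> 0 \<le> x \<rho> \<and> z \<rho> = t \<rho> * complex_of_real (x \<rho>)"
    and g: "\<And>m. (\<Prod>\<rho>\<in>rays \<Phi>. t \<rho> powi lattice_pairing m (ray_normal \<Phi> \<rho>)) = 1" unfolding tw_def by blast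
  let ?t = "restrict t (rays \<Phi>)" and ?x = "restrict x (rays \<Phi>)"
  have "?t \<in> rays \<Phi> \<rightarrow>\<^sub>E unit_circle" using tx by (auto simp: unit_circle_iff)
  moreover have "t \<rho> \<noteq> 0" if "\<rho> \<in> rays \<Phi>" for \<rho> using tx[OF that] by auto
  then have "?t \<in> cox_group \<Phi>" using g by (auto simp: cox_group_def cong: prod.cong)
  moreover have "?x \<in> rays \<Phi> \<rightarrow>\<^sub>E {0..}" using tx by auto
  moreover have "z = (\<lambda>\<rho>\<in>rays \<Phi>. ?t \<rho> * complex_of_real (?x \<rho>))"
  proof
    fix \<rho> show "z \<rho> = (\<lambda>\<rho>\<in>rays \<Phi>. ?t \<rho> * complex_of_real (?x \<rho>)) \<rho>"
      using PiE_arb[OF z, of \<rho>] tx[of \<rho>] by (cases "\<rho> \<in> rays \<Phi>") simp_all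
  qed
  ultimately show "z \<in> twisted_orthant \<Phi>" unfolding twisted_orthant_def by blast
qed

lemma P3_iff: "P3 \<longleftrightarrow> Pos3 \<Phi> qq"
proof
  assume P3
  show "Pos3 \<Phi> qq" unfolding Pos3_def
  proof
    fix z assume z: "z \<in> (rays \<Phi> \<rightarrow>\<^sub>E UNIV) - (irrelevant_set \<Phi> \<union> twisted_orthant \<Phi>)"
    then have "cmod (poly_value of_int qq z) < poly_value of_int qq (\<lambda>\<rho>. cmod (z \<rho>))"
      using \<open>P3\<close> irrelevant_iff twisted_iff unfolding P3_def by blast
    also have "poly_value of_int qq (\<lambda>\<rho>. cmod (z \<rho>)) = poly_value of_int qq (\<lambda>\<rho>\<in>rays \<Phi>. cmod (z \<rho>))"
      by (rule poly_value_cong[OF qq_over]) simp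
    finally show "cmod (poly_value of_int qq z) < poly_value of_int qq (\<lambda>\<rho>\<in>rays \<Phi>. cmod (z \<rho>))" .
  qed
next
  assume pos: "Pos3 \<Phi> qq"
  show P3 unfolding P3_def
  proof (intro allI impI)
    fix z :: "(real ^ 'n) set \<Rightarrow> complex" assume z: "nd z" "\<not> tw z"
    define y where "y = restrict z (rays \<Phi>)"
    have y: "y \<in> rays \<Phi> \<rightarrow>\<^sub>E UNIV" by (simp add: y_def)
    have "nd y" using z(1) by (auto simp: nd_def y_def)
    moreover have "\<not> tw y" using z(2) by (simp add: tw_def y_def)
    ultimately have "cmod (poly_value of_int qq y) < poly_value of_int qq (\<lambda>\<rho>\<in>rays \<Phi>. cmod (y \<rho>))"
      using pos y irrelevant_iff[OF y] twisted_iff[OF y] unfolding Pos3_def by blast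
    moreover have "poly_value of_int qq y = poly_value of_int qq z"
      by (rule poly_value_cong[OF qq_over]) (simp add: y_def)
    moreover have "poly_value of_int qq (\<lambda>\<rho>\<in>rays \<Phi>. cmod (y \<rho>)) = poly_value of_int qq (\<lambda>\<rho>. cmod (z \<rho>))"
      by (rule poly_value_cong[OF qq_over]) (simp add: y_def)
    ultimately show "cmod (poly_value of_int qq z) < poly_value of_int qq (\<lambda>\<rho>. cmod (z \<rho>))" by simp
  qed
qed

end

theorem corollary1p2:
  fixes p :: "(int ^ 'n) \<Rightarrow>\<^sub>0 int"
    and \<Phi> :: "(real ^ 'n) set"
    and q :: "((real ^ 'n) set, int) multipoly"
  defines "\<Phi> \<equiv> newton_polytope p"
    and "q \<equiv> homogenization \<Phi> p"
  assumes "smooth_lattice_polytope \<Phi>"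
    and "Pos1 \<Phi> q"
    and "Pos2 \<Phi> q"
  shows "(Pos3 \<Phi> q \<longleftrightarrow>
            (\<exists>A. square_matrix_over (rays \<Phi>) A \<and> irreducible_matrix A \<and>
                 is_spectral_radius_fun (rays \<Phi>) q A)) \<and>
         (Pos3 \<Phi> q \<longleftrightarrow>
            (\<exists>A. square_matrix_over (rays \<Phi>) A \<and> aperiodic_matrix A \<and>
                 is_spectral_radius_fun (rays \<Phi>) q A))"
proof -
  interpret smooth_newton \<Phi> p by unfold_locales (use assms in auto)
  have q: "q = qq" by (simp add: q_def homogenization_eq)
  have P1 P2 using assms P1_iff P2_of_Pos2 by (auto simp: q)
  then show ?thesis
    using aperiodic_matrix_of_P3 P3_of_irreducible_matrix aperiodic_imp_irreducible
    unfolding q P3_iff[symmetric] by blast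
qed

end
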